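(* Suppose the eigengap, bounded eigenvalue, and sparsity assumptions hold, that $\max_{1\le j\le p+q}\|\eta_j^0\|_0=O(s)$, and that the preliminary estimators $\hat\alpha_n,\hat\beta_n$ satisfy the preliminary estimator condition with exponent $\kappa\in[1/2,1]$ (all stated in the context). Suppose further that $$\|\eta_j^0\|_1\le B_j\le C_Ts^{1/2}\qquad(j=1,\ldots,p+q)$$ for some $C_T>0$. Then there exists an absolute constant $C>0$, depending on $C_T$, such that for $\lambda_j^{nl}=C\lambda$ $(j=1,\ldots,p+q)$, the estimator $\hat\Phi_n$ obtained by feeding $\hat H_n(\hat x_n,\hat y_n)$ to the nodewise Lasso algorithm (described in the context) satisfies $$\max_{1\le j\le p+q}\|(\hat\Phi_n)_j-\Phi_j^0\|_1=O_p(s^{\kappa+1/2}\lambda)\quad\text{and}\quad \max_{1\le j\le p+q}\|(\hat\Phi_n)_j-\Phi_j^0\|_2=O_p(s^\kappa\lambda),$$ where $A_j$ denotes the $j$th column of a matrix $A$.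
   Context: **Model.** $(X_i,Y_i)_{i=1}^n$ are i.i.d. copies of $(X,Y)$, where $X\in\mathbb{R}^p$, $Y\in\mathbb{R}^q$ are centered sub-Gaussian random vectors (sub-Gaussian norms bounded by a fixed constant); $p,q$ may vary with $n$ and asymptotics are as $n\to\infty$. The joint covariance is $\Sigma=\begin{bmatrix}\Sigma_x&\Sigma_{xy}\\ \Sigma_{yx}&\Sigma_y\end{bmatrix}$. $\Sigma_{xy}$ has fixed rank $r\ge1$ and $\Sigma_{xy}=\Sigma_xU\Lambda V^T\Sigma_y$ with $U=[u_1\ldots u_r]$, $V=[v_1\ldots v_r]$, $U^T\Sigma_xU=V^T\Sigma_yV=I_r$, $\Lambda=\mathrm{diag}(\Lambda_1\ge\cdots\ge\Lambda_r>0)$. Put $\rho_0=\Lambda_1$, $\alpha_0=u_1$, $\beta_0=v_1$; $\Lambda_2=0$ if $r=1$. $s_U,s_V$ are the numbers of nonzero rows of $U,V$; $s=s_U+s_V$; $\lambda=(\log(p\vee q)/n)^{1/2}$. $\hat\Sigma_x,\hat\Sigma_y,\hat\Sigma_{xy}=\hat\Sigma_{yx}^T$ are the empirical covariance matrices. **Assumptions.** *Eigengap:* there is $\epsilon_0\in(0,1)$ with $\rho_0-\Lambda_2>\epsilon_0$ for all $n$. *Bounded eigenvalues:* there is $M>0$ such that all eigenvalues of $\Sigma_x,\Sigma_y$ lie in $[M^{-1},M]$. *Sparsity:* $s_U=o(p)$, $s_V=o(q)$, $s^{2\kappa}\lambda^2=o(n^{-1/2})$. *Preliminary estimator condition:*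 for some $\kappa\in[1/2,1]$, $\inf_{w\in\{\pm1\}}\|w\hat\alpha_n-\alpha_0\|_2+\inf_{w\in\{\pm1\}}\|w\hat\beta_n-\beta_0\|_2=O_p(s^\kappa\lambda)$ and $\inf_{w\in\{\pm1\}}\|w\hat\alpha_n-\alpha_0\|_1+\inf_{w\in\{\pm1\}}\|w\hat\beta_n-\beta_0\|_1=O_p(s^{\kappa+1/2}\lambda)$. **Hessian and its estimate.** $\Phi^0=(H^0)^{-1}$ with $$H^0=2\rho_0\begin{bmatrix}\Sigma_x+2\Sigma_x\alpha_0\alpha_0^T\Sigma_x & -\Sigma_{xy}/\rho_0\\ -\Sigma_{yx}/\rho_0 & \Sigma_y+2\Sigma_y\beta_0\beta_0^T\Sigma_y\end{bmatrix}.$$ For a square matrix $A$, $A_{-j,-j}$ is $A$ with $j$th row and column deleted and $A_{-j,j}$ is the $j$th column of $A$ with its $j$th entry deleted. $\eta_j^0=(H^0_{-j,-j})^{-1}H^0_{-j,j}\in\mathbb{R}^{p+q-1}$; $\|\cdot\|_0$ counts nonzero entries. Let $\hat\rho_n=\hat\alpha_n^T\hat\Sigma_{xy}\hat\beta_n/\{(\hat\alpha_n^T\hat\Sigma_x\hat\alpha_n)^{1/2}(\hat\beta_n^T\hat\Sigma_y\hat\beta_n)^{1/2}\}$, $\hat x_n=|\hat\rho_n|^{1/2}\hat\alpha_n$, $\hat y_n=|\hat\rho_n|^{1/2}\hat\beta_n$, and $$\hat H_n(x,y)=2\begin{bmatrix}(x^T\hat\Sigma_xx)\hat\Sigma_x+2\hat\Sigma_xxx^T\hat\Sigma_x&-\hat\Sigma_{xy}\\-\hat\Sigma_{yx}&(y^T\hat\Sigma_yy)\hat\Sigma_y+2\hat\Sigma_yyy^T\hat\Sigma_y\end{bmatrix}.$$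 **Nodewise Lasso algorithm.** Input: $A\in\mathbb{R}^{m\times m}$ and positive parameters $(\lambda_j^{nl},B_j)$, $j=1,\ldots,m$ (here $m=p+q$). For each $j$: let $\hat\eta_j$ be any stationary point of the problem of minimizing $\eta^TA_{-j,-j}\eta-2A_{-j,j}^T\eta+\lambda_j^{nl}\|\eta\|_1$ over $\eta\in\mathbb{R}^{m-1}$ with $\|\eta\|_1\le B_j$; let $\hat\Gamma_j\in\mathbb{R}^m$ be the vector with $j$th entry $1$ and remaining entries (in order) $-\hat\eta_j$; let $\hat\tau_j^2=\hat\Gamma_j^TA\hat\Gamma_j+\frac12\lambda_j^{nl}\|\hat\eta_j\|_1$. Output: the matrix $[\hat\Gamma_1/\hat\tau_1^2,\ldots,\hat\Gamma_m/\hat\tau_m^2]$. *)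

theory Defs
  imports
    "HOL-Probability.Probability"
    "HOL-Library.Landau_Symbols"
    "Jordan_Normal_Form.Determinant"
    "Jordan_Normal_Form.Char_Poly"
    "Jordan_Normal_Form.Gauss_Jordan_Elimination"
    "Jordan_Normal_Form.DL_Rank"
begin

unbundle no vec_syntax
unbundle no inner_syntax

text \<open>
  The dimensions vary with the sample size, so vectors and matrices are those of
  Jordan_Normal_Form.  All indices start at 0.
\<close>

type_synonym rvector = "real Matrix.vec"
type_synonym rmatrix = "real Matrix.mat"


section \<open>Vectors and matrices\<close>

definition vec_l0 :: "rvector \<Rightarrow> nat" where
  "vec_l0 v = card {i. i < dim_vec v \<and> v $ i \<noteq> 0}"

definition vec_l1 :: "rvector \<Rightarrow> real" where
  "vec_l1 v = (\<Sum>i<dim_vec v. \<bar>v $ i\<bar>)"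

definition vec_l2 :: "rvector \<Rightarrow> real" where
  "vec_l2 v = sqrt (v \<bullet> v)"

definition outer_prod :: "rvector \<Rightarrow> rvector \<Rightarrow> rmatrix" where
  "outer_prod u v = Matrix.mat (dim_vec u) (dim_vec v) (\<lambda>(i, j). u $ i * v $ j)"

definition quad_form :: "rmatrix \<Rightarrow> rvector \<Rightarrow> real" where
  "quad_form A v = v \<bullet> (A *\<^sub>v v)"

text \<open>Unspecified when \<open>A\<close> is singular.\<close>

definition mat_inv :: "rmatrix \<Rightarrow> rmatrix" where
  "mat_inv A = the (mat_inverse A)"

text \<open>
  The \<open>j\<close>th column without its \<open>j\<close>th entry; the matching principal submatrix is
  \<open>mat_delete A j j\<close>.
\<close>

definition col_delete :: "rmatrix \<Rightarrow> nat \<Rightarrow> rvector" where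
  "col_delete A j = Matrix.vec (dim_row A - 1) (\<lambda>i. A $$ (insert_index j i, j))"

definition nonzero_rows :: "rmatrix \<Rightarrow> nat" where
  "nonzero_rows A = card {i. i < dim_row A \<and> Matrix.row A i \<noteq> 0\<^sub>v (dim_col A)}"


section \<open>Random vectors\<close>

definition random_vec :: "'w measure \<Rightarrow> nat \<Rightarrow> ('w \<Rightarrow> rvector) \<Rightarrow> bool" where
  "random_vec P d X \<longleftrightarrow>
     (\<forall>\<omega>\<in>space P. X \<omega> \<in> carrier_vec d) \<and>
     (\<forall>k<d. (\<lambda>\<omega>. X \<omega> $ k) \<in> borel_measurable P)"

definition centered :: "'w measure \<Rightarrow> nat \<Rightarrow> ('w \<Rightarrow> rvector) \<Rightarrow> bool" where
  "centered P d X \<longleftrightarrow> (\<forall>k<d. (\<integral>\<omega>. X \<omega> $ k \<partial>P) = 0)"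

definition cov_mat ::
  "'w measure \<Rightarrow> nat \<Rightarrow> nat \<Rightarrow> ('w \<Rightarrow> rvector) \<Rightarrow> ('w \<Rightarrow> rvector) \<Rightarrow> rmatrix" where
  "cov_mat P d e X Y = Matrix.mat d e (\<lambda>(k, l).
     \<integral>\<omega>. (X \<omega> $ k - (\<integral>\<omega>'. X \<omega>' $ k \<partial>P)) * (Y \<omega> $ l - (\<integral>\<omega>'. Y \<omega>' $ l \<partial>P)) \<partial>P)"

text \<open>
  The sub-Gaussian (Orlicz) norm, with value \<open>\<infinity>\<close> for variables that are not
  sub-Gaussian; for vectors, the supremum over all one-dimensional marginals.
\<close>

definition psi2_norm :: "'w measure \<Rightarrow> ('w \<Rightarrow> real) \<Rightarrow> ennreal" where
  "psi2_norm P Z =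
     Inf {ennreal t | t. t > 0 \<and> (\<integral>\<^sup>+\<omega>. ennreal (exp ((Z \<omega> / t)\<^sup>2)) \<partial>P) \<le> 2}"

definition vec_psi2_norm :: "'w measure \<Rightarrow> nat \<Rightarrow> ('w \<Rightarrow> rvector) \<Rightarrow> ennreal" where
  "vec_psi2_norm P d X =
     (SUP u\<in>{u \<in> carrier_vec d. vec_l2 u = 1}. psi2_norm P (\<lambda>\<omega>. u \<bullet> X \<omega>))"

text \<open>
  Vectors of length \<open>d\<close> as points of the product space \<open>\<real>\<^sup>d\<close>, where laws and
  independence are available.
\<close>

definition coords :: "nat \<Rightarrow> rvector \<Rightarrow> nat \<Rightarrow> real" where
  "coords d v = (\<lambda>k\<in>{..<d}. v $ k)"

definition coord_space :: "nat \<Rightarrow> (nat \<Rightarrow> real) measure" where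
  "coord_space d = PiM {..<d} (\<lambda>_. borel)"

text \<open>
  \<open>Z\<^sub>n = O\<^sub>p(a\<^sub>n)\<close>.  The exceptional set is only required to be contained in a
  small event, so that the notion also makes sense (and is not vacuous) when \<open>Z\<^sub>n\<close> is
  not measurable, as for an arbitrary choice of stationary points.  For random variables
  it is the usual notion, as the next lemma shows.
\<close>

definition bounded_in_prob ::
  "(nat \<Rightarrow> 'w measure) \<Rightarrow> (nat \<Rightarrow> 'w \<Rightarrow> real) \<Rightarrow> (nat \<Rightarrow> real) \<Rightarrow> bool" where
  "bounded_in_prob P Z a \<longleftrightarrow>
     (\<forall>\<epsilon>>0. \<exists>C>0. \<forall>\<^sub>F n in sequentially. \<exists>E\<in>sets (P n).
        {\<omega> \<in> space (P n). \<bar>Z n \<omega>\<bar> > C * a n} \<subseteq> E \<and> measure (P n) E < \<epsilon>)"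

lemma bounded_in_prob_measurable:
  assumes "\<forall>\<^sub>F n in sequentially. prob_space (P n) \<and> Z n \<in> borel_measurable (P n)"
  shows "bounded_in_prob P Z a \<longleftrightarrow>
     (\<forall>\<epsilon>>0. \<exists>C>0. \<forall>\<^sub>F n in sequentially.
        measure (P n) {\<omega> \<in> space (P n). \<bar>Z n \<omega>\<bar> > C * a n} < \<epsilon>)"
proof -
  have *: "(\<exists>E\<in>sets Q. {\<omega> \<in> space Q. \<bar>z \<omega>\<bar> > c} \<subseteq> E \<and> measure Q E < \<epsilon>) \<longleftrightarrow>
      measure Q {\<omega> \<in> space Q. \<bar>z \<omega>\<bar> > c} < \<epsilon>"
    if "prob_space Q \<and> z \<in> borel_measurable Q" for Q :: "'a measure" and z :: "'a \<Rightarrow> real" and c \<epsilon> :: real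
  proof -
    interpret prob_space Q using that by simp
    have z[measurable]: "z \<in> borel_measurable Q" using that by simp
    have m: "{\<omega> \<in> space Q. \<bar>z \<omega>\<bar> > c} \<in> sets Q" by measurable
    show ?thesis
      using m finite_measure_mono[of "{\<omega> \<in> space Q. \<bar>z \<omega>\<bar> > c}"]
      by (meson order.refl order.strict_trans1)
  qed
  have "(\<forall>\<^sub>F n in sequentially. \<exists>E\<in>sets (P n).
          {\<omega> \<in> space (P n). \<bar>Z n \<omega>\<bar> > C * a n} \<subseteq> E \<and> measure (P n) E < \<epsilon>) \<longleftrightarrow>
        (\<forall>\<^sub>F n in sequentially.
          measure (P n) {\<omega> \<in> space (P n). \<bar>Z n \<omega>\<bar> > C * a n} < \<epsilon>)" for C \<epsilon>
    by (rule eventually_subst, rule eventually_mono[OF assms], rule *)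
  then show ?thesis unfolding bounded_in_prob_def by simp
qed


section \<open>The sparse CCA model\<close>

text \<open>
  One element of the triangular array: the probability space, the dimensions \<open>p\<close> and
  \<open>q\<close>, the population pair \<open>(X, Y)\<close>, the sample \<open>(X\<^sub>i, Y\<^sub>i)\<close>, and the canonical
  decomposition \<open>\<Sigma>\<^sub>x\<^sub>y = \<Sigma>\<^sub>x U \<Lambda> V\<^sup>T \<Sigma>\<^sub>y\<close> with \<open>\<Lambda> = diag (canL 0, canL 1, \<dots>)\<close>.
\<close>

record 'w cca =
  pspace :: "'w measure"
  dimX :: nat
  dimY :: nat
  popX :: "'w \<Rightarrow> rvector"
  popY :: "'w \<Rightarrow> rvector"
  smpX :: "nat \<Rightarrow> 'w \<Rightarrow> rvector"
  smpY :: "nat \<Rightarrow> 'w \<Rightarrow> rvector"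
  canU :: rmatrix
  canV :: rmatrix
  canL :: "nat \<Rightarrow> real"

definition Sigma_x :: "'w cca \<Rightarrow> rmatrix" where
  "Sigma_x S = cov_mat (pspace S) (dimX S) (dimX S) (popX S) (popX S)"

definition Sigma_y :: "'w cca \<Rightarrow> rmatrix" where
  "Sigma_y S = cov_mat (pspace S) (dimY S) (dimY S) (popY S) (popY S)"

definition Sigma_xy :: "'w cca \<Rightarrow> rmatrix" where
  "Sigma_xy S = cov_mat (pspace S) (dimX S) (dimY S) (popX S) (popY S)"

definition iid_sample :: "nat \<Rightarrow> 'w cca \<Rightarrow> bool" where
  "iid_sample n S \<longleftrightarrow>
     (let P = pspace S; d = dimX S + dimY S;
          Z = (\<lambda>i \<omega>. coords d (smpX S i \<omega> @\<^sub>v smpY S i \<omega>));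
          Z0 = (\<lambda>\<omega>. coords d (popX S \<omega> @\<^sub>v popY S \<omega>))
      in prob_space.indep_vars P (\<lambda>_. coord_space d) Z {..<n} \<and>
         (\<forall>i<n. distr P (coord_space d) (Z i) = distr P (coord_space d) Z0))"

text \<open>\<open>K\<close> bounds the sub-Gaussian norms, \<open>r\<close> is the rank and \<open>n\<close> the sample size.\<close>

definition cca_model :: "real \<Rightarrow> nat \<Rightarrow> nat \<Rightarrow> 'w cca \<Rightarrow> bool" where
  "cca_model K r n S \<longleftrightarrow>
     (let P = pspace S; p = dimX S; q = dimY S; U = canU S; V = canV S; L = canL S in
      prob_space P \<and>
      random_vec P p (popX S) \<and> random_vec P q (popY S) \<and>
      (\<forall>i<n. random_vec P p (smpX S i) \<and> random_vec P q (smpY S i)) \<and>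
      iid_sample n S \<and>
      centered P p (popX S) \<and> centered P q (popY S) \<and>
      vec_psi2_norm P p (popX S) \<le> ennreal K \<and>
      vec_psi2_norm P q (popY S) \<le> ennreal K \<and>
      vec_space.rank p (Sigma_xy S) = r \<and>
      U \<in> carrier_mat p r \<and> V \<in> carrier_mat q r \<and>
      Sigma_xy S = Sigma_x S * U * mat_diag r L * V\<^sup>T * Sigma_y S \<and>
      U\<^sup>T * Sigma_x S * U = 1\<^sub>m r \<and> V\<^sup>T * Sigma_y S * V = 1\<^sub>m r \<and>
      (\<forall>i j. i \<le> j \<longrightarrow> j < r \<longrightarrow> L j \<le> L i) \<and> (\<forall>i<r. L i > 0))"

definition rho0 :: "'w cca \<Rightarrow> real" where
  "rho0 S = canL S 0"

definition Lambda2 :: "nat \<Rightarrow> 'w cca \<Rightarrow> real" where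
  "Lambda2 r S = (if r = 1 then 0 else canL S 1)"

definition alpha0 :: "'w cca \<Rightarrow> rvector" where
  "alpha0 S = Matrix.col (canU S) 0"

definition beta0 :: "'w cca \<Rightarrow> rvector" where
  "beta0 S = Matrix.col (canV S) 0"

definition sparsity :: "'w cca \<Rightarrow> nat" where
  "sparsity S = nonzero_rows (canU S) + nonzero_rows (canV S)"

definition base_rate :: "nat \<Rightarrow> 'w cca \<Rightarrow> real" where
  "base_rate n S = sqrt (ln (real (max (dimX S) (dimY S))) / real n)"

text \<open>The empirical covariances are not recentred, since the population is centered.\<close>

definition emp_cov ::
  "nat \<Rightarrow> nat \<Rightarrow> nat \<Rightarrow> (nat \<Rightarrow> 'w \<Rightarrow> rvector) \<Rightarrow> (nat \<Rightarrow> 'w \<Rightarrow> rvector) \<Rightarrow> 'w \<Rightarrow> rmatrix" where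
  "emp_cov n d e X Y \<omega> =
     Matrix.mat d e (\<lambda>(k, l). (\<Sum>i<n. X i \<omega> $ k * Y i \<omega> $ l) / real n)"

definition hat_Sigma_x :: "nat \<Rightarrow> 'w cca \<Rightarrow> 'w \<Rightarrow> rmatrix" where
  "hat_Sigma_x n S = emp_cov n (dimX S) (dimX S) (smpX S) (smpX S)"

definition hat_Sigma_y :: "nat \<Rightarrow> 'w cca \<Rightarrow> 'w \<Rightarrow> rmatrix" where
  "hat_Sigma_y n S = emp_cov n (dimY S) (dimY S) (smpY S) (smpY S)"

definition hat_Sigma_xy :: "nat \<Rightarrow> 'w cca \<Rightarrow> 'w \<Rightarrow> rmatrix" where
  "hat_Sigma_xy n S = emp_cov n (dimX S) (dimY S) (smpX S) (smpY S)"


section \<open>Assumptions\<close>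

definition eigengap :: "real \<Rightarrow> nat \<Rightarrow> 'w cca \<Rightarrow> bool" where
  "eigengap \<epsilon>\<^sub>0 r S \<longleftrightarrow> rho0 S - Lambda2 r S > \<epsilon>\<^sub>0"

definition bounded_eigenvalues :: "real \<Rightarrow> 'w cca \<Rightarrow> bool" where
  "bounded_eigenvalues M S \<longleftrightarrow>
     (\<forall>k. eigenvalue (Sigma_x S) k \<or> eigenvalue (Sigma_y S) k \<longrightarrow> inverse M \<le> k \<and> k \<le> M)"

definition sparsity_assumption :: "real \<Rightarrow> (nat \<Rightarrow> 'w cca) \<Rightarrow> bool" where
  "sparsity_assumption \<kappa> S \<longleftrightarrow>
     (\<lambda>n. real (nonzero_rows (canU (S n)))) \<in> o(\<lambda>n. real (dimX (S n))) \<and>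
     (\<lambda>n. real (nonzero_rows (canV (S n)))) \<in> o(\<lambda>n. real (dimY (S n))) \<and>
     (\<lambda>n. real (sparsity (S n)) powr (2 * \<kappa>) * (base_rate n (S n))\<^sup>2)
       \<in> o(\<lambda>n. real n powr (- 1 / 2))"

definition preliminary_estimators ::
  "real \<Rightarrow> (nat \<Rightarrow> 'w cca) \<Rightarrow> (nat \<Rightarrow> 'w \<Rightarrow> rvector) \<Rightarrow> (nat \<Rightarrow> 'w \<Rightarrow> rvector) \<Rightarrow> bool" where
  "preliminary_estimators \<kappa> S a b \<longleftrightarrow>
     (\<forall>n\<ge>1. random_vec (pspace (S n)) (dimX (S n)) (a n) \<and>
            random_vec (pspace (S n)) (dimY (S n)) (b n)) \<and>
     bounded_in_prob (\<lambda>n. pspace (S n))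
       (\<lambda>n \<omega>. (INF w\<in>{1, - 1}. vec_l2 (w \<cdot>\<^sub>v a n \<omega> - alpha0 (S n))) +
              (INF w\<in>{1, - 1}. vec_l2 (w \<cdot>\<^sub>v b n \<omega> - beta0 (S n))))
       (\<lambda>n. real (sparsity (S n)) powr \<kappa> * base_rate n (S n)) \<and>
     bounded_in_prob (\<lambda>n. pspace (S n))
       (\<lambda>n \<omega>. (INF w\<in>{1, - 1}. vec_l1 (w \<cdot>\<^sub>v a n \<omega> - alpha0 (S n))) +
              (INF w\<in>{1, - 1}. vec_l1 (w \<cdot>\<^sub>v b n \<omega> - beta0 (S n))))
       (\<lambda>n. real (sparsity (S n)) powr (\<kappa> + 1 / 2) * base_rate n (S n))"


section \<open>The Hessian and its estimate\<close>

definition H0 :: "'w cca \<Rightarrow> rmatrix" where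
  "H0 S = (let Sx = Sigma_x S; Sy = Sigma_y S; Sxy = Sigma_xy S; \<rho> = rho0 S;
               a = alpha0 S; b = beta0 S in
     (2 * \<rho>) \<cdot>\<^sub>m four_block_mat
       (Sx + 2 \<cdot>\<^sub>m (Sx * outer_prod a a * Sx)) (- (inverse \<rho> \<cdot>\<^sub>m Sxy))
       (- (inverse \<rho> \<cdot>\<^sub>m Sxy\<^sup>T)) (Sy + 2 \<cdot>\<^sub>m (Sy * outer_prod b b * Sy)))"

definition Phi0 :: "'w cca \<Rightarrow> rmatrix" where
  "Phi0 S = mat_inv (H0 S)"

definition eta0 :: "'w cca \<Rightarrow> nat \<Rightarrow> rvector" where
  "eta0 S j = mat_inv (mat_delete (H0 S) j j) *\<^sub>v col_delete (H0 S) j"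

definition hat_H :: "nat \<Rightarrow> 'w cca \<Rightarrow> 'w \<Rightarrow> rvector \<Rightarrow> rvector \<Rightarrow> rmatrix" where
  "hat_H n S \<omega> x y =
     (let Sx = hat_Sigma_x n S \<omega>; Sy = hat_Sigma_y n S \<omega>; Sxy = hat_Sigma_xy n S \<omega> in
      2 \<cdot>\<^sub>m four_block_mat
        (quad_form Sx x \<cdot>\<^sub>m Sx + 2 \<cdot>\<^sub>m (Sx * outer_prod x x * Sx)) (- Sxy)
        (- (Sxy\<^sup>T)) (quad_form Sy y \<cdot>\<^sub>m Sy + 2 \<cdot>\<^sub>m (Sy * outer_prod y y * Sy)))"

definition hat_rho :: "nat \<Rightarrow> 'w cca \<Rightarrow> 'w \<Rightarrow> rvector \<Rightarrow> rvector \<Rightarrow> real" where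
  "hat_rho n S \<omega> a b =
     a \<bullet> (hat_Sigma_xy n S \<omega> *\<^sub>v b) /
     (sqrt (quad_form (hat_Sigma_x n S \<omega>) a) * sqrt (quad_form (hat_Sigma_y n S \<omega>) b))"

text \<open>The matrix \<open>hat_H\<close> at the scaled preliminary estimators.\<close>

definition plugin_H :: "nat \<Rightarrow> 'w cca \<Rightarrow> 'w \<Rightarrow> rvector \<Rightarrow> rvector \<Rightarrow> rmatrix" where
  "plugin_H n S \<omega> a b =
     (let c = sqrt \<bar>hat_rho n S \<omega> a b\<bar> in hat_H n S \<omega> (c \<cdot>\<^sub>v a) (c \<cdot>\<^sub>v b))"


section \<open>Nodewise Lasso\<close>

definition l1_subgradient :: "rvector \<Rightarrow> rvector \<Rightarrow> bool" where
  "l1_subgradient \<eta> z \<longleftrightarrow>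
     z \<in> carrier_vec (dim_vec \<eta>) \<and>
     (\<forall>w \<in> carrier_vec (dim_vec \<eta>). vec_l1 w \<ge> vec_l1 \<eta> + z \<bullet> (w - \<eta>))"

text \<open>
  First-order stationarity for minimizing \<open>\<eta>\<^sup>T A \<eta> - 2 a\<^sup>T \<eta> + l * vec_l1 \<eta>\<close> subject to
  \<open>vec_l1 \<eta> \<le> B\<close>.  The smooth part need not be convex; its gradient is
  \<open>(A + A\<^sup>T) \<eta> - 2 a\<close>.
\<close>

definition lasso_stationary :: "rmatrix \<Rightarrow> rvector \<Rightarrow> real \<Rightarrow> real \<Rightarrow> rvector \<Rightarrow> bool" where
  "lasso_stationary A a l B \<eta> \<longleftrightarrow>
     \<eta> \<in> carrier_vec (dim_vec a) \<and> vec_l1 \<eta> \<le> B \<and>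
     (\<exists>z. l1_subgradient \<eta> z \<and>
        (\<forall>\<theta> \<in> carrier_vec (dim_vec a). vec_l1 \<theta> \<le> B \<longrightarrow>
           ((A + A\<^sup>T) *\<^sub>v \<eta> - 2 \<cdot>\<^sub>v a + l \<cdot>\<^sub>v z) \<bullet> (\<theta> - \<eta>) \<ge> 0))"

definition node_Gamma :: "nat \<Rightarrow> nat \<Rightarrow> rvector \<Rightarrow> rvector" where
  "node_Gamma m j \<eta> = Matrix.vec m (\<lambda>i. if i = j then 1 else - (\<eta> $ delete_index j i))"

definition node_tau2 :: "rmatrix \<Rightarrow> real \<Rightarrow> nat \<Rightarrow> rvector \<Rightarrow> real" where
  "node_tau2 A l j \<eta> = quad_form A (node_Gamma (dim_row A) j \<eta>) + l * vec_l1 \<eta> / 2"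

text \<open>\<open>\<Phi>\<close> is a possible output on input \<open>A\<close>, for some choice of stationary points.\<close>

definition nodewise_lasso_output ::
  "rmatrix \<Rightarrow> (nat \<Rightarrow> real) \<Rightarrow> (nat \<Rightarrow> real) \<Rightarrow> rmatrix \<Rightarrow> bool" where
  "nodewise_lasso_output A l B \<Phi> \<longleftrightarrow>
     (\<exists>\<eta>. (\<forall>j<dim_row A. lasso_stationary (mat_delete A j j) (col_delete A j) (l j) (B j) (\<eta> j)) \<and>
          \<Phi> = mat_of_cols (dim_row A)
                (map (\<lambda>j. inverse (node_tau2 A (l j) j (\<eta> j)) \<cdot>\<^sub>v node_Gamma (dim_row A) j (\<eta> j))
                     [0..<dim_row A]))"

end

theory Submission
  imports Defs "HOL-Library.Function_Algebras"
begin

text \<open>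
  All matrices are read as bilinear forms on coordinate functions.  The eigengap and Bessel's
  inequality make the population Hessian form \<open>H\<close> uniformly positive definite, and the canonical
  decomposition inverts \<open>H\<close> explicitly on the sparse directions that occur.

  The plug-in Hessian minus \<open>H\<close>, applied to \<open>\<Gamma>\<^sub>j = (1, - \<eta>\<^sub>j\<^sup>0)\<close>, splits into \<open>H h\<close> with
  \<open>h\<close> of the order of the preliminary rate \<open>e = s\<^sup>\<kappa> \<lambda>\<close>, and a part bounded entrywise by a multiple of
  \<open>\<lambda>\<close>.  The entrywise part is absorbed by the penalty.  Comparing the stationary point with
  \<open>\<eta>\<^sub>j\<^sup>0\<close>, or with \<open>\<eta>\<^sub>j\<^sup>0 + h\<close> when that point is feasible, removes \<open>h\<close> as well, so the penalty
  level need not see \<open>e\<close>, and \<open>C\<close> does not depend on the constants hidden in the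
  preliminary rates.

  The random input is a deviation bound for the joint covariance: entrywise at rate \<open>\<lambda>\<close> by
  Chernoff bounds, and for all quadratic forms up to \<open>\<lambda>\<^sup>2\<close> times the squared \<open>\<ell>\<^sub>1\<close> norm, which
  follows from the sums of about \<open>1 / \<lambda>\<^sup>2\<close> signed coordinate vectors by Maurey's method.
\<close>

section \<open>Semidefinite bilinear forms\<close>

text \<open>Three obstacles shape the argument. First, comparing the stationary point with
  \<open>\<eta>\<^sub>0\<close> alone leaves a term of order \<open>e\<close> times the Euclidean
  error; absorbing it in the curvature and dividing by the penalty level costs
  \<open>e\<^sup>2 / \<delta>\<close> in l1 norm, that is s^(2 kappa) lambda, more than the claimed
  s^(kappa + 1/2) lambda if kappa > 1/2. The shifted point leaves a term with
  \<open>e\<^sup>2\<close> in place of \<open>e\<close>. Second, inverting \<open>H\<close> through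
  the l1 norms of the columns of its inverse would cost a factor \<open>\<sigma>\<close>, the root
  of s; the explicit inverse only adds multiples of sparse canonical vectors. Third, the estimated
  Hessian need not be semidefinite; the l1 constraint of radius \<open>C\<^sub>T * \<sigma>\<close>
  makes its defect linear in \<open>\<delta>\<close> times the l1 norm, so the penalty absorbs it.
  The sparsity assumption enters as \<open>e\<^sup>2 \<le> \<delta>\<close> and as
  \<open>\<sigma> * e\<close> tending to 0. Deviations are also controlled along the vectors
  \<open>\<Gamma> j\<close> and the leading canonical pair, since an entrywise bound alone would
  lose their l1 norms, again of order \<open>\<sigma>\<close>.\<close>

lemma abs_add_bound: "\<bar>a\<bar> \<le> x \<Longrightarrow> \<bar>b\<bar> \<le> y \<Longrightarrow> \<bar>a + b\<bar> \<le> x + (y::real)" by linarith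
lemma abs_diff_bound: "\<bar>a\<bar> \<le> x \<Longrightarrow> \<bar>b\<bar> \<le> y \<Longrightarrow> \<bar>a - b\<bar> \<le> x + (y::real)" by linarith
lemma abs_mult_bound: "\<bar>a\<bar> \<le> x \<Longrightarrow> \<bar>b\<bar> \<le> y \<Longrightarrow> \<bar>a * b\<bar> \<le> x * (y::real)"
  unfolding abs_mult by (rule mult_mono) linarith+
lemma abs_numeral_mult_bound: "\<bar>a\<bar> \<le> x \<Longrightarrow> \<bar>numeral k * a\<bar> \<le> numeral k * (x::real)"
  by (simp add: abs_mult)

lemmas abs_bounds = abs_numeral_mult_bound abs_add_bound abs_diff_bound

text \<open>Semidefinite, not definite: the joint covariance degenerates when the leading canonical
  correlation is 1, and forms on functions ignore all coordinates beyond the dimension.\<close>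

locale psd_form =
  fixes G :: "'a::real_vector \<Rightarrow> 'a \<Rightarrow> real"
  assumes bil: "bilinear G" and sym: "G u v = G v u" and psd: "G u u \<ge> 0"
begin

lemmas bsimps = bilinear_ladd[OF bil] bilinear_radd[OF bil] bilinear_lmul[OF bil]
  bilinear_rmul[OF bil] bilinear_lsub[OF bil] bilinear_rsub[OF bil] bilinear_lneg[OF bil]
  bilinear_rneg[OF bil] bilinear_lzero[OF bil] bilinear_rzero[OF bil]

lemma sum_left: "G (\<Sum>k\<in>A. f k) v = (\<Sum>k\<in>A. G (f k) v)"
  using linear_sum[of "\<lambda>x. G x v" f A] bil unfolding bilinear_def by simp

lemma sum_right: "G u (\<Sum>k\<in>A. f k) = (\<Sum>k\<in>A. G u (f k))"
  using linear_sum[of "G u" f A] bil unfolding bilinear_def by simp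

lemma cauchy_schwarz_sq: "(G u v)\<^sup>2 \<le> G u u * G v v"
proof -
  \<comment> \<open>The form along a line is a nonnegative polynomial in \<open>t\<close>. Below,
    \<open>t\<close> is its minimiser or, if \<open>G v v = 0\<close>, the point where the remaining
    affine function equals -1.\<close>
  have q: "0 \<le> G u u + 2 * t * G u v + t\<^sup>2 * G v v" for t
    using psd[of "u + t *\<^sub>R v"] sym[of v u]
    by (simp add: bsimps power2_eq_square algebra_simps)
  show ?thesis
  proof (cases "G v v = 0")
    case True
    have "G u v = 0"
    proof (rule ccontr)
      assume n: "G u v \<noteq> 0"
      show False using q[of "- (G u u + 1) / (2 * G u v)"] True n psd[of u] by (simp add: field_simps)
    qed
    then show ?thesis using True by simp
  next
    case False
    then have p: "G v v > 0" using psd[of v] by simp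
    have "0 \<le> G u u - (G u v)\<^sup>2 / G v v"
      using q[of "- (G u v / G v v)"] p by (simp add: field_simps power2_eq_square)
    then show ?thesis using p by (simp add: field_simps)
  qed
qed

lemma cauchy_schwarz: "\<bar>G u v\<bar> \<le> sqrt (G u u) * sqrt (G v v)"
  using cauchy_schwarz_sq[of u v] real_sqrt_le_mono[of "(G u v)\<^sup>2" "G u u * G v v"]
  by (simp add: real_sqrt_mult)

lemma cauchy_schwarz_bound:
  assumes "G u u \<le> x\<^sup>2" "G v v \<le> y\<^sup>2" "x \<ge> 0" "y \<ge> 0"
  shows "\<bar>G u v\<bar> \<le> x * y"
proof -
  have "sqrt (G u u) * sqrt (G v v) \<le> x * y"
    using assms by (intro mult_mono real_le_lsqrt) (auto simp: psd)
  then show ?thesis using cauchy_schwarz[of u v] by linarith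
qed

text \<open>\<open>w\<close> is the orthogonal projection of \<open>u\<close> onto the span of the
  orthonormal family; the claim is nonnegativity of the form at \<open>u - w\<close>.\<close>

lemma bessel:
  fixes r :: nat
  assumes on: "\<And>k l. k < r \<Longrightarrow> l < r \<Longrightarrow> G (U k) (U l) = (if k = l then 1 else 0)"
  shows "(\<Sum>k<r. (G u (U k))\<^sup>2) \<le> G u u"
proof -
  define w where "w = (\<Sum>k<r. G u (U k) *\<^sub>R U k)"
  have uw: "G u w = (\<Sum>k<r. (G u (U k))\<^sup>2)"
    by (simp add: w_def sum_right bsimps power2_eq_square)
  have Uw: "G (U k) w = G u (U k)" if "k < r" for k
    proof -
    have "G (U k) w = (\<Sum>l<r. G u (U l) * (if k = l then 1 else 0))"
      using that by (auto simp: w_def sum_right bsimps on intro!: sum.cong)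
    also have "\<dots> = (\<Sum>l<r. if k = l then G u (U l) else 0)" by (intro sum.cong) auto
    also have "\<dots> = G u (U k)" using that by simp
    finally show ?thesis .
  qed
  have "G w w = (\<Sum>k<r. G u (U k) * G (U k) w)"
    by (subst (1) w_def) (simp add: sum_left bsimps)
  also have "\<dots> = (\<Sum>k<r. (G u (U k))\<^sup>2)"
    by (intro sum.cong) (auto simp: Uw power2_eq_square)
  finally have ww: "G w w = (\<Sum>k<r. (G u (U k))\<^sup>2)" .
  show ?thesis using psd[of "u - w"] uw ww sym[of w u] by (simp add: bsimps)
qed

end

text \<open>Both vector norms sum finitely many coordinates of functions on all natural numbers,
  hence vanish on functions supported beyond the dimension. The locale also lets a single argument
  bound a vector in l1 and in l2 norm.\<close>

locale seminorm =
  fixes N :: "'a::real_vector \<Rightarrow> real"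
  assumes triangle: "N (u + v) \<le> N u + N v" and scale: "N (c *\<^sub>R u) = \<bar>c\<bar> * N u"
begin

lemma zero [simp]: "N 0 = 0" using scale[of 0 0] by simp

lemma minus [simp]: "N (- u) = N u" using scale[of "-1" u] by simp

lemma triangle_diff: "N (u - v) \<le> N u + N v" using triangle[of u "- v"] by simp

lemma diff_ge: "N u - N v \<le> N (u - v)" using triangle[of "u - v" v] by simp

lemma nonneg [simp]: "N u \<ge> 0" using triangle[of u "- u"] by simp

lemma sum: "N (\<Sum>k\<in>A. f k) \<le> (\<Sum>k\<in>A. N (f k))"
proof (cases "finite A")
  case True
  then show ?thesis
    by (induction A) (auto intro: order_trans[OF triangle])
qed simp

end

text \<open>
  The space splits as a direct sum of an \<open>X\<close>-part and a \<open>Y\<close>-part; \<open>N\<^sub>1\<close> and \<open>N\<^sub>2\<close> play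
  the roles of the two vector norms.
\<close>

locale split_space =
  n1: seminorm N\<^sub>1 + n2: seminorm N\<^sub>2
  for N\<^sub>1 N\<^sub>2 :: "'a::real_vector \<Rightarrow> real" +
  fixes PX PY :: "'a \<Rightarrow> 'a"
  assumes lin_X: "linear PX" and lin_Y: "linear PY"
    and XX [simp]: "PX (PX u) = PX u" and YY [simp]: "PY (PY u) = PY u"
    and XY [simp]: "PX (PY u) = 0" and YX [simp]: "PY (PX u) = 0"
    and XplusY: "PX u + PY u = u"
    and n1_X: "N\<^sub>1 (PX u) \<le> N\<^sub>1 u" and n1_Y: "N\<^sub>1 (PY u) \<le> N\<^sub>1 u"
    and n2_split: "(N\<^sub>2 u)\<^sup>2 = (N\<^sub>2 (PX u))\<^sup>2 + (N\<^sub>2 (PY u))\<^sup>2"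
begin

lemma n2_X: "N\<^sub>2 (PX u) \<le> N\<^sub>2 u"
  by (rule power2_le_imp_le) (auto simp: n2_split[of u])

lemma n2_Y: "N\<^sub>2 (PY u) \<le> N\<^sub>2 u"
  by (rule power2_le_imp_le) (auto simp: n2_split[of u])

lemmas psimps = linear_add[OF lin_X] linear_add[OF lin_Y] linear_cmul[OF lin_X] linear_cmul[OF lin_Y]
  linear_diff[OF lin_X] linear_diff[OF lin_Y] linear_neg[OF lin_X] linear_neg[OF lin_Y]
  linear_0[OF lin_X] linear_0[OF lin_Y] linear_sum[OF lin_X] linear_sum[OF lin_Y]

text \<open>
  Twice the block form built from \<open>F\<close>, with weights \<open>\<rho>\<^sub>1\<close>, \<open>\<rho>\<^sub>2\<close> on the diagonal blocks
  and \<open>\<rho>\<^sub>3\<close> on the rank-one terms; both \<open>H\<^sup>0\<close> and \<open>\<hat>H\<close> are of this shape.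
\<close>

definition block_form ::
  "real \<Rightarrow> real \<Rightarrow> real \<Rightarrow> ('a \<Rightarrow> 'a \<Rightarrow> real) \<Rightarrow> 'a \<Rightarrow> 'a \<Rightarrow> 'a \<Rightarrow> 'a \<Rightarrow> real" where
  "block_form \<rho>\<^sub>1 \<rho>\<^sub>2 \<rho>\<^sub>3 F a b u v = 2 *
     (\<rho>\<^sub>1 * F (PX u) (PX v) + 2 * \<rho>\<^sub>3 * F (PX u) a * F a (PX v) +
      \<rho>\<^sub>2 * F (PY u) (PY v) + 2 * \<rho>\<^sub>3 * F (PY u) b * F b (PY v) -
      F (PX u) (PY v) - F (PY u) (PX v))"

lemma bilinear_block_form:
  assumes "bilinear F"
  shows "bilinear (block_form \<rho>\<^sub>1 \<rho>\<^sub>2 \<rho>\<^sub>3 F a b)"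
  unfolding bilinear_def block_form_def using assms
  by (auto intro!: linearI simp: psimps algebra_simps bilinear_ladd bilinear_radd bilinear_lmul bilinear_rmul)

lemma block_form_sym:
  assumes "\<And>u v. F u v = F v u"
  shows "block_form \<rho>\<^sub>1 \<rho>\<^sub>2 \<rho>\<^sub>3 F a b u v = block_form \<rho>\<^sub>1 \<rho>\<^sub>2 \<rho>\<^sub>3 F a b v u"
  unfolding block_form_def
  using assms[of "PX u" "PX v"] assms[of "PY u" "PY v"] assms[of "PX u" "PY v"] assms[of "PY u" "PX v"]
    assms[of "PX u" a] assms[of "PX v" a] assms[of "PY u" b] assms[of "PY v" b]
  by (simp add: algebra_simps)

end


section \<open>The population Hessian\<close>

text \<open>\<open>G\<close> is the joint covariance, \<open>U\<close> and \<open>V\<close> are the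
  canonical vectors with correlations \<open>\<Lambda>\<close>, and \<open>\<sigma>\<close> is the
  square root of the sparsity, so that \<open>n1_U\<close> and \<open>n1_V\<close> are
  Cauchy-Schwarz on the support. Eigenvalues are bounded on the two diagonal blocks only.
  \<open>gap0\<close> also covers rank one, where the second correlation counts as 0.\<close>

locale canonical_form =
  split_space N\<^sub>1 N\<^sub>2 PX PY + psd_form G
  for N\<^sub>1 N\<^sub>2 :: "'a::real_vector \<Rightarrow> real" and PX PY and G +
  fixes M \<epsilon> \<sigma> :: real and r :: nat and U V :: "nat \<Rightarrow> 'a" and \<Lambda> :: "nat \<Rightarrow> real"
  assumes M1: "M \<ge> 1" and eps: "0 < \<epsilon>" "\<epsilon> < 1" and r1: "r \<ge> 1" and sig: "\<sigma> \<ge> 1"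
    and lower_X: "(N\<^sub>2 (PX u))\<^sup>2 \<le> M * G (PX u) (PX u)"
    and lower_Y: "(N\<^sub>2 (PY u))\<^sup>2 \<le> M * G (PY u) (PY u)"
    and upper_X: "G (PX u) (PX u) \<le> M * (N\<^sub>2 (PX u))\<^sup>2"
    and upper_Y: "G (PY u) (PY u) \<le> M * (N\<^sub>2 (PY u))\<^sup>2"
    and UX [simp]: "k < r \<Longrightarrow> PX (U k) = U k" and VY [simp]: "k < r \<Longrightarrow> PY (V k) = V k"
    and UU: "k < r \<Longrightarrow> l < r \<Longrightarrow> G (U k) (U l) = (if k = l then 1 else 0)"
    and VV: "k < r \<Longrightarrow> l < r \<Longrightarrow> G (V k) (V l) = (if k = l then 1 else 0)"
    and cross: "G (PX u) (PY v) = (\<Sum>k<r. \<Lambda> k * G (PX u) (U k) * G (V k) (PY v))"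
    and gap: "\<And>k. 1 \<le> k \<Longrightarrow> k < r \<Longrightarrow> 0 \<le> \<Lambda> k \<and> \<Lambda> k \<le> \<Lambda> 0 - \<epsilon>" and gap0: "\<epsilon> \<le> \<Lambda> 0"
    and n1_U: "k < r \<Longrightarrow> N\<^sub>1 (U k) \<le> \<sigma> * N\<^sub>2 (U k)"
    and n1_V: "k < r \<Longrightarrow> N\<^sub>1 (V k) \<le> \<sigma> * N\<^sub>2 (V k)"
begin

abbreviation "\<alpha> \<equiv> U 0"
abbreviation "\<beta> \<equiv> V 0"
abbreviation "\<rho> \<equiv> \<Lambda> 0"

definition "H \<equiv> block_form \<rho> \<rho> \<rho> G \<alpha> \<beta>"

lemma UY [simp]: "k < r \<Longrightarrow> PY (U k) = 0" using UX[of k] YX by metis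
lemma VX [simp]: "k < r \<Longrightarrow> PX (V k) = 0" using VY[of k] XY by metis
lemma r0 [simp]: "0 < r" using r1 by simp

lemma bil_H: "bilinear H" unfolding H_def by (rule bilinear_block_form[OF bil])
lemma sym_H: "H u v = H v u" unfolding H_def by (rule block_form_sym[OF sym])

lemmas hsimps = bilinear_ladd[OF bil_H] bilinear_radd[OF bil_H] bilinear_lmul[OF bil_H]
  bilinear_rmul[OF bil_H] bilinear_lsub[OF bil_H] bilinear_rsub[OF bil_H] bilinear_lneg[OF bil_H]
  bilinear_rneg[OF bil_H] bilinear_lzero[OF bil_H] bilinear_rzero[OF bil_H]

lemma rho_pos: "\<rho> > 0" using gap0 eps by simp

text \<open>\<open>\<rho>\<close> is the covariance of two directions of unit variance, so
  Cauchy-Schwarz applies.\<close>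

lemma rho_le1: "\<rho> \<le> 1"
proof -
  have "G \<alpha> \<beta> = (\<Sum>k<r. \<Lambda> k * G \<alpha> (U k) * G (V k) \<beta>)"
    using cross[of \<alpha> \<beta>] by simp
  also have "\<dots> = (\<Sum>k<r. if k = 0 then \<rho> else 0)"
    by (intro sum.cong) (auto simp: UU VV)
  also have "\<dots> = \<rho>" by simp
  finally show ?thesis
    using cauchy_schwarz_bound[of \<alpha> 1 \<beta> 1] by (simp add: UU VV)
qed

lemma cross_sym: "G (PY u) (PX v) = (\<Sum>k<r. \<Lambda> k * G (PX v) (U k) * G (V k) (PY u))"
  by (subst sym) (rule cross)

lemma G_ab: "G \<alpha> \<beta> = \<rho>"
proof -
  have "G \<alpha> \<beta> = (\<Sum>k<r. \<Lambda> k * G \<alpha> (U k) * G (V k) \<beta>)"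
    using cross[of \<alpha> \<beta>] by simp
  also have "\<dots> = (\<Sum>k<r. if k = 0 then \<rho> else 0)"
    by (intro sum.cong) (auto simp: UU VV)
  finally show ?thesis by simp
qed

lemma sqrtM: "sqrt M \<le> M" "sqrt M \<ge> 1" "sqrt M * sqrt M = M"
  using M1 by (auto simp: real_le_lsqrt power2_eq_square)

lemma G_X_le: "G (PX u) (PX u) \<le> (sqrt M * N\<^sub>2 (PX u))\<^sup>2"
  using upper_X[of u] M1 by (simp add: power_mult_distrib)
lemma G_Y_le: "G (PY u) (PY u) \<le> (sqrt M * N\<^sub>2 (PY u))\<^sup>2"
  using upper_Y[of u] M1 by (simp add: power_mult_distrib)

lemma G_XX: "\<bar>G (PX u) (PX v)\<bar> \<le> M * (N\<^sub>2 u * N\<^sub>2 v)"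
proof -
  have "\<bar>G (PX u) (PX v)\<bar> \<le> (sqrt M * N\<^sub>2 (PX u)) * (sqrt M * N\<^sub>2 (PX v))"
    by (rule cauchy_schwarz_bound[OF G_X_le G_X_le]) (use M1 in auto)
  also have "\<dots> = M * (N\<^sub>2 (PX u) * N\<^sub>2 (PX v))" using sqrtM(3) by (simp add: mult_ac)
  also have "\<dots> \<le> M * (N\<^sub>2 u * N\<^sub>2 v)"
    using M1 by (intro mult_left_mono mult_mono n2_X) auto
  finally show ?thesis .
qed

lemma G_YY: "\<bar>G (PY u) (PY v)\<bar> \<le> M * (N\<^sub>2 u * N\<^sub>2 v)"
proof -
  have "\<bar>G (PY u) (PY v)\<bar> \<le> (sqrt M * N\<^sub>2 (PY u)) * (sqrt M * N\<^sub>2 (PY v))"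
    by (rule cauchy_schwarz_bound[OF G_Y_le G_Y_le]) (use M1 in auto)
  also have "\<dots> = M * (N\<^sub>2 (PY u) * N\<^sub>2 (PY v))" using sqrtM(3) by (simp add: mult_ac)
  also have "\<dots> \<le> M * (N\<^sub>2 u * N\<^sub>2 v)"
    using M1 by (intro mult_left_mono mult_mono n2_Y) auto
  finally show ?thesis .
qed

lemma G_XY: "\<bar>G (PX u) (PY v)\<bar> \<le> M * (N\<^sub>2 u * N\<^sub>2 v)"
proof -
  have "\<bar>G (PX u) (PY v)\<bar> \<le> (sqrt M * N\<^sub>2 (PX u)) * (sqrt M * N\<^sub>2 (PY v))"
    by (rule cauchy_schwarz_bound[OF G_X_le G_Y_le]) (use M1 in auto)
  also have "\<dots> = M * (N\<^sub>2 (PX u) * N\<^sub>2 (PY v))" using sqrtM(3) by (simp add: mult_ac)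
  also have "\<dots> \<le> M * (N\<^sub>2 u * N\<^sub>2 v)"
    using M1 by (intro mult_left_mono mult_mono n2_X n2_Y) auto
  finally show ?thesis .
qed

lemma G_YX: "\<bar>G (PY u) (PX v)\<bar> \<le> M * (N\<^sub>2 u * N\<^sub>2 v)"
  using G_XY[of v u] by (subst sym) (simp add: mult_ac)

lemma G_XU: "\<bar>G (PX u) (U k)\<bar> \<le> M * N\<^sub>2 u" if "k < r"
proof -
  have "\<bar>G (PX u) (U k)\<bar> \<le> (sqrt M * N\<^sub>2 (PX u)) * 1"
    by (rule cauchy_schwarz_bound[OF G_X_le]) (use that M1 in \<open>auto simp: UU\<close>)
  also have "\<dots> \<le> M * N\<^sub>2 u" using sqrtM n2_X[of u] M1 by (auto intro!: mult_mono)
  finally show ?thesis .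
qed

lemma G_YV: "\<bar>G (PY u) (V k)\<bar> \<le> M * N\<^sub>2 u" if "k < r"
proof -
  have "\<bar>G (PY u) (V k)\<bar> \<le> (sqrt M * N\<^sub>2 (PY u)) * 1"
    by (rule cauchy_schwarz_bound[OF G_Y_le]) (use that M1 in \<open>auto simp: VV\<close>)
  also have "\<dots> \<le> M * N\<^sub>2 u" using sqrtM n2_Y[of u] M1 by (auto intro!: mult_mono)
  finally show ?thesis .
qed

lemma n2_U: "N\<^sub>2 (U k) \<le> M" if "k < r"
proof (rule power2_le_imp_le)
  have "(N\<^sub>2 (U k))\<^sup>2 \<le> M" using lower_X[of "U k"] that by (simp add: UU)
  also have "M \<le> M\<^sup>2" using M1 by (simp add: power2_eq_square)
  finally show "(N\<^sub>2 (U k))\<^sup>2 \<le> M\<^sup>2" .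
qed (use M1 in auto)

lemma n2_V: "N\<^sub>2 (V k) \<le> M" if "k < r"
proof (rule power2_le_imp_le)
  have "(N\<^sub>2 (V k))\<^sup>2 \<le> M" using lower_Y[of "V k"] that by (simp add: VV)
  also have "M \<le> M\<^sup>2" using M1 by (simp add: power2_eq_square)
  finally show "(N\<^sub>2 (V k))\<^sup>2 \<le> M\<^sup>2" .
qed (use M1 in auto)

lemma n1_UM: "N\<^sub>1 (U k) \<le> \<sigma> * M" "N\<^sub>1 (V k) \<le> \<sigma> * M" if "k < r"
proof -
  have "\<sigma> * N\<^sub>2 (U k) \<le> \<sigma> * M" "\<sigma> * N\<^sub>2 (V k) \<le> \<sigma> * M"
    using n2_U[OF that] n2_V[OF that] sig by (auto intro!: mult_left_mono)
  then show "N\<^sub>1 (U k) \<le> \<sigma> * M" "N\<^sub>1 (V k) \<le> \<sigma> * M"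
    using n1_U[OF that] n1_V[OF that] by linarith+
qed

text \<open>The rank-one terms of the Hessian pay for the leading canonical pair, where the gap
  gives nothing. Every other pair costs at most \<open>\<rho> - \<epsilon>\<close> times its squared
  coefficients, and Bessel's inequality sums these costs to at most
  \<open>\<rho> - \<epsilon>\<close> times the diagonal part. What survives is
  \<open>\<epsilon>\<close> times the diagonal part.\<close>

lemma H_lower: "2 * \<epsilon> / M * (N\<^sub>2 u)\<^sup>2 \<le> H u u"
proof -
  define a where "a k = G (PX u) (U k)" for k
  define b where "b k = G (PY u) (V k)" for k
  define x where "x = G (PX u) (PX u)"
  define y where "y = G (PY u) (PY u)"
  have ba: "(\<Sum>k<r. (a k)\<^sup>2) \<le> x" unfolding a_def x_def by (rule bessel) (rule UU)
  have bb: "(\<Sum>k<r. (b k)\<^sup>2) \<le> y" unfolding b_def y_def by (rule bessel) (rule VV)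
  have sb: "G (V k) (PY u) = b k" "G \<alpha> (PX u) = a 0" "G \<beta> (PY u) = b 0" for k
    unfolding a_def b_def by (rule sym)+
  have c: "G (PX u) (PY u) = (\<Sum>k<r. \<Lambda> k * a k * b k)" "G (PY u) (PX u) = (\<Sum>k<r. \<Lambda> k * a k * b k)"
    unfolding cross cross_sym sb by (simp_all add: a_def)
  have H: "H u u = 2 * (\<rho> * x + 2 * \<rho> * (a 0)\<^sup>2 + \<rho> * y + 2 * \<rho> * (b 0)\<^sup>2 - 2 * (\<Sum>k<r. \<Lambda> k * a k * b k))"
    unfolding H_def block_form_def c sb
    by (simp add: x_def y_def a_def b_def power2_eq_square algebra_simps)
  have "2 * (\<Sum>k<r. \<Lambda> k * a k * b k) = (\<Sum>k<r. \<Lambda> k * (2 * a k * b k))"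
    by (simp add: sum_distrib_left mult_ac)
  also have "\<dots> \<le> (\<Sum>k<r. (\<rho> - \<epsilon>) * ((a k)\<^sup>2 + (b k)\<^sup>2) + (if k = 0 then 2 * \<rho> * ((a 0)\<^sup>2 + (b 0)\<^sup>2) else 0))"
  proof (intro sum_mono)
    fix k assume "k \<in> {..<r}"
    then have k: "k < r" by simp
    have ab: "2 * a k * b k \<le> (a k)\<^sup>2 + (b k)\<^sup>2"
      using sum_squares_bound[of "a k" "b k"] by simp
    show "\<Lambda> k * (2 * a k * b k) \<le> (\<rho> - \<epsilon>) * ((a k)\<^sup>2 + (b k)\<^sup>2) + (if k = 0 then 2 * \<rho> * ((a 0)\<^sup>2 + (b 0)\<^sup>2) else 0)"
    proof (cases "k = 0")
      case True
      have "\<rho> * (2 * a 0 * b 0) \<le> \<rho> * ((a 0)\<^sup>2 + (b 0)\<^sup>2)"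
        using ab rho_pos True by (intro mult_left_mono) auto
      also have "\<dots> \<le> 2 * \<rho> * ((a 0)\<^sup>2 + (b 0)\<^sup>2)" using rho_pos by (intro mult_right_mono) auto
      moreover have "0 \<le> (\<rho> - \<epsilon>) * ((a 0)\<^sup>2 + (b 0)\<^sup>2)" using gap0 by simp
      ultimately show ?thesis using True by simp
    next
      case False
      then have g: "0 \<le> \<Lambda> k" "\<Lambda> k \<le> \<rho> - \<epsilon>" using gap[of k] k by auto
      have "\<Lambda> k * (2 * a k * b k) \<le> \<Lambda> k * ((a k)\<^sup>2 + (b k)\<^sup>2)" using ab g by (intro mult_left_mono)
      also have "\<dots> \<le> (\<rho> - \<epsilon>) * ((a k)\<^sup>2 + (b k)\<^sup>2)" using g by (intro mult_right_mono) auto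
      finally show ?thesis using False by simp
    qed
  qed
  also have "\<dots> = (\<rho> - \<epsilon>) * ((\<Sum>k<r. (a k)\<^sup>2) + (\<Sum>k<r. (b k)\<^sup>2)) + 2 * \<rho> * ((a 0)\<^sup>2 + (b 0)\<^sup>2)"
    by (simp add: sum.distrib sum_distrib_left distrib_left)
  also have "\<dots> \<le> (\<rho> - \<epsilon>) * (x + y) + 2 * \<rho> * ((a 0)\<^sup>2 + (b 0)\<^sup>2)"
    using ba bb gap0 by (intro add_right_mono mult_left_mono) auto
  finally have "2 * (\<epsilon> * (x + y)) \<le> H u u" unfolding H by (simp add: algebra_simps)
  moreover have "(N\<^sub>2 u)\<^sup>2 / M \<le> x + y"
    using lower_X[of u] lower_Y[of u] M1 n2_split[of u] unfolding x_def y_def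
    by (simp add: field_simps)
  then have "2 * (\<epsilon> * ((N\<^sub>2 u)\<^sup>2 / M)) \<le> 2 * (\<epsilon> * (x + y))" using eps by (intro mult_left_mono) auto
  ultimately show ?thesis by simp
qed

lemma H_psd: "H u u \<ge> 0"
  by (rule order_trans[OF _ H_lower]) (use eps M1 in simp)

text \<open>The factor 16 is twice 1 + 2 + 1 + 2 + 1 + 1, the multiplicities of the six terms of the
  block form, each of which is at most \<open>B\<close>.\<close>

lemma H_upper: "\<bar>H u v\<bar> \<le> 16 * M\<^sup>2 * (N\<^sub>2 u * N\<^sub>2 v)"
proof -
  define B where "B = M\<^sup>2 * (N\<^sub>2 u * N\<^sub>2 v)"
  have MM: "M * (N\<^sub>2 u * N\<^sub>2 v) \<le> B" unfolding B_def
    using M1 by (intro mult_right_mono) (auto simp: power2_eq_square)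
  have "\<bar>\<rho> * z\<bar> \<le> B" if "\<bar>z\<bar> \<le> B" for z
  proof -
    have "\<rho> * \<bar>z\<bar> \<le> 1 * \<bar>z\<bar>" using rho_le1 by (intro mult_right_mono) auto
    then show ?thesis using that rho_pos by (simp add: abs_mult)
  qed
  note R = this
  have 1: "\<bar>\<rho> * G (PX u) (PX v)\<bar> \<le> B" "\<bar>\<rho> * G (PY u) (PY v)\<bar> \<le> B"
    using G_XX[of u v] G_YY[of u v] MM by (auto intro!: R)
  have "\<bar>G (PX u) \<alpha> * G \<alpha> (PX v)\<bar> \<le> (M * N\<^sub>2 u) * (M * N\<^sub>2 v)" unfolding abs_mult
    using G_XU[of 0 u] G_XU[of 0 v] sym[of \<alpha> "PX v"] M1 by (intro mult_mono) auto
  then have 2: "\<bar>\<rho> * (G (PX u) \<alpha> * G \<alpha> (PX v))\<bar> \<le> B"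
    by (intro R) (simp add: B_def power2_eq_square mult_ac)
  have "\<bar>G (PY u) \<beta> * G \<beta> (PY v)\<bar> \<le> (M * N\<^sub>2 u) * (M * N\<^sub>2 v)" unfolding abs_mult
    using G_YV[of 0 u] G_YV[of 0 v] sym[of \<beta> "PY v"] M1 by (intro mult_mono) auto
  then have 3: "\<bar>\<rho> * (G (PY u) \<beta> * G \<beta> (PY v))\<bar> \<le> B"
    by (intro R) (simp add: B_def power2_eq_square mult_ac)
  have H: "H u v = 2 * (\<rho> * G (PX u) (PX v) + 2 * (\<rho> * (G (PX u) \<alpha> * G \<alpha> (PX v))) +
     \<rho> * G (PY u) (PY v) + 2 * (\<rho> * (G (PY u) \<beta> * G \<beta> (PY v))) - G (PX u) (PY v) - G (PY u) (PX v))"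
    unfolding H_def block_form_def by (simp add: mult_ac)
  have "\<bar>H u v\<bar> \<le> 2 * (B + 2 * B + B + 2 * B + B + B)" unfolding H
    by (intro abs_bounds 1 2 3 order_trans[OF G_XY MM] order_trans[OF G_YX MM])
  then show ?thesis by (simp add: B_def mult_ac)
qed

end

section \<open>Explicit inversion of the population Hessian\<close>

context canonical_form
begin

text \<open>Seeking \<open>h\<close> as \<open>1 / \<rho>\<close> times \<open>g\<close> plus a
  combination of canonical vectors decouples the equation into one system with two unknowns per
  canonical pair. The right-hand side is the shape in which a perturbation of the Hessian appears.
  The l1 norm grows only by a multiple of \<open>\<sigma> * N\<^sub>2 g\<close> because the
  \<open>2 * r\<close> added vectors are sparse.\<close>

lemma solve:
  obtains h where "\<And>v. H h v = 2 * (G (PX g) (PX v) + G (PY g) (PY v))"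
    and "N\<^sub>2 h \<le> (1 + 4 * r * M\<^sup>2 / \<epsilon>) / \<epsilon> * N\<^sub>2 g"
    and "N\<^sub>1 h \<le> (1 + 4 * r * M\<^sup>2 / \<epsilon>) / \<epsilon> * (N\<^sub>1 g + \<sigma> * N\<^sub>2 g)"
proof -
  define a' where "a' k = G (PX g) (U k)" for k
  define b' where "b' k = G (PY g) (V k)" for k
  define \<mu> where "\<mu> k = \<Lambda> k / \<rho>" for k
  \<comment> \<open>For \<open>k \<ge> 1\<close> the system is c = \<mu> (b' + d), d = \<mu> (a' +
    c), solvable since \<mu> < 1. For \<open>k = 0\<close>, where \<mu> = 1, it would be singular;
    the rank-one terms turn it into 3 c + 2 a' = b' + d and 3 d + 2 b' = a' + c, whose solution has
    the denominator 8.\<close>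
  define c where "c k = (if k = 0 then (b' k - 5 * a' k) / 8 else (\<mu> k * b' k + (\<mu> k)\<^sup>2 * a' k) / (1 - (\<mu> k)\<^sup>2))" for k
  define d where "d k = (if k = 0 then (a' k - 5 * b' k) / 8 else (\<mu> k * a' k + (\<mu> k)\<^sup>2 * b' k) / (1 - (\<mu> k)\<^sup>2))" for k
  define h where "h = (1 / \<rho>) *\<^sub>R (g + (\<Sum>k<r. c k *\<^sub>R U k) + (\<Sum>k<r. d k *\<^sub>R V k))"
  have mu: "0 \<le> \<mu> k" "\<mu> k \<le> 1 - \<epsilon>" "\<epsilon> \<le> 1 - (\<mu> k)\<^sup>2" if "1 \<le> k" "k < r" for k
  proof -
    have "\<Lambda> k \<le> \<rho> - \<epsilon>" "0 \<le> \<Lambda> k" using gap[OF that] by auto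
    \<comment> \<open>\<open>\<rho> \<le> 1\<close> converts the absolute gap
      \<open>\<epsilon>\<close> into a relative gap:
      \<open>\<Lambda> k / \<rho> \<le> 1 - \<epsilon>\<close>.\<close>
    moreover have "\<rho> * \<epsilon> \<le> 1 * \<epsilon>" using rho_le1 eps by (intro mult_right_mono) auto
    ultimately have "\<Lambda> k \<le> (1 - \<epsilon>) * \<rho>" by (simp add: algebra_simps)
    then show m: "0 \<le> \<mu> k" "\<mu> k \<le> 1 - \<epsilon>"
      unfolding \<mu>_def using rho_pos \<open>0 \<le> \<Lambda> k\<close> by (auto simp: field_simps)
    have "(\<mu> k)\<^sup>2 \<le> \<mu> k * 1" unfolding power2_eq_square using m eps by (intro mult_left_mono) auto
    then show "\<epsilon> \<le> 1 - (\<mu> k)\<^sup>2" using m by simp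
  qed
  have PXh: "PX h = (1 / \<rho>) *\<^sub>R (PX g + (\<Sum>k<r. c k *\<^sub>R U k))"
    and PYh: "PY h = (1 / \<rho>) *\<^sub>R (PY g + (\<Sum>k<r. d k *\<^sub>R V k))"
    by (simp_all add: h_def psimps)
  have hU: "G (PX h) (U k) = (a' k + c k) / \<rho>" if "k < r" for k
  proof -
    have "(\<Sum>l<r. c l * G (U l) (U k)) = (\<Sum>l<r. if l = k then c l else 0)"
      using that by (intro sum.cong) (auto simp: UU)
    then show ?thesis using that by (simp add: PXh bsimps sum_left a'_def)
  qed
  have hV: "G (PY h) (V k) = (b' k + d k) / \<rho>" if "k < r" for k
  proof -
    have "(\<Sum>l<r. d l * G (V l) (V k)) = (\<Sum>l<r. if l = k then d l else 0)"
      using that by (intro sum.cong) (auto simp: VV)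
    then show ?thesis using that by (simp add: PYh bsimps sum_left b'_def)
  qed
  have Hh: "H h v = 2 * (G (PX g) (PX v) + G (PY g) (PY v))" for v
  proof -
    define p where "p k = G (U k) (PX v)" for k
    define q where "q k = G (V k) (PY v)" for k
    have pq: "G (PX v) (U k) = p k" "G (V k) (PY h) = G (PY h) (V k)" for k
      unfolding p_def by (rule sym)+
    have 1: "\<rho> * G (PX h) (PX v) = G (PX g) (PX v) + (\<Sum>k<r. c k * p k)"
      and 2: "\<rho> * G (PY h) (PY v) = G (PY g) (PY v) + (\<Sum>k<r. d k * q k)"
      using rho_pos by (simp_all add: PXh PYh bsimps sum_left p_def q_def)
    have 3: "G (PX h) (PY v) = (\<Sum>k<r. \<Lambda> k * ((a' k + c k) / \<rho>) * q k)"
      unfolding cross by (intro sum.cong) (auto simp: hU q_def)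
    have 4: "G (PY h) (PX v) = (\<Sum>k<r. \<Lambda> k * ((b' k + d k) / \<rho>) * p k)"
      unfolding cross_sym pq by (intro sum.cong) (auto simp: hV)
    have 5: "2 * \<rho> * G (PX h) \<alpha> * G \<alpha> (PX v) = (\<Sum>k<r. if k = 0 then 2 * (a' k + c k) * p k else 0)"
      using rho_pos by (simp add: hU p_def)
    have 6: "2 * \<rho> * G (PY h) \<beta> * G \<beta> (PY v) = (\<Sum>k<r. if k = 0 then 2 * (b' k + d k) * q k else 0)"
      using rho_pos by (simp add: hV q_def)
    \<comment> \<open>The system that defines \<open>c\<close> and \<open>d\<close>: the left-hand
      sides are the coefficients of \<open>p k\<close> and \<open>q k\<close> in the defect of the
      equation for \<open>h\<close>.\<close>
    have eq: "c k + (if k = 0 then 2 * (a' k + c k) else 0) - \<Lambda> k * ((b' k + d k) / \<rho>) = 0"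
      "d k + (if k = 0 then 2 * (b' k + d k) else 0) - \<Lambda> k * ((a' k + c k) / \<rho>) = 0" if "k < r" for k
    proof -
      have L: "\<Lambda> k * (z / \<rho>) = \<mu> k * z" for z by (simp add: \<mu>_def)
      have "c k + (if k = 0 then 2 * (a' k + c k) else 0) - \<Lambda> k * ((b' k + d k) / \<rho>) = 0 \<and>
        d k + (if k = 0 then 2 * (b' k + d k) else 0) - \<Lambda> k * ((a' k + c k) / \<rho>) = 0"
      proof (cases "k = 0")
        case True
        then show ?thesis using rho_pos by (simp add: c_def d_def field_simps)
      next
        case False
        have "1 - (\<mu> k)\<^sup>2 > 0" using mu[of k] False that eps by simp
        then show ?thesis using False unfolding L by (simp add: c_def d_def field_simps power2_eq_square)
      qed
      then show "c k + (if k = 0 then 2 * (a' k + c k) else 0) - \<Lambda> k * ((b' k + d k) / \<rho>) = 0"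
        "d k + (if k = 0 then 2 * (b' k + d k) else 0) - \<Lambda> k * ((a' k + c k) / \<rho>) = 0" by auto
    qed
    have "(\<Sum>k<r. c k * p k) + (\<Sum>k<r. if k = 0 then 2 * (a' k + c k) * p k else 0)
        - (\<Sum>k<r. \<Lambda> k * ((b' k + d k) / \<rho>) * p k)
      = (\<Sum>k<r. (c k + (if k = 0 then 2 * (a' k + c k) else 0) - \<Lambda> k * ((b' k + d k) / \<rho>)) * p k)"
      unfolding sum.distrib[symmetric] sum_subtractf[symmetric]
      by (intro sum.cong) (auto simp: algebra_simps)
    also have "\<dots> = 0" by (intro sum.neutral) (use eq in auto)
    finally have 7: "(\<Sum>k<r. c k * p k) + (\<Sum>k<r. if k = 0 then 2 * (a' k + c k) * p k else 0)
        - (\<Sum>k<r. \<Lambda> k * ((b' k + d k) / \<rho>) * p k) = 0" .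
    have "(\<Sum>k<r. d k * q k) + (\<Sum>k<r. if k = 0 then 2 * (b' k + d k) * q k else 0)
        - (\<Sum>k<r. \<Lambda> k * ((a' k + c k) / \<rho>) * q k)
      = (\<Sum>k<r. (d k + (if k = 0 then 2 * (b' k + d k) else 0) - \<Lambda> k * ((a' k + c k) / \<rho>)) * q k)"
      unfolding sum.distrib[symmetric] sum_subtractf[symmetric]
      by (intro sum.cong) (auto simp: algebra_simps)
    also have "\<dots> = 0" by (intro sum.neutral) (use eq in auto)
    finally have 8: "(\<Sum>k<r. d k * q k) + (\<Sum>k<r. if k = 0 then 2 * (b' k + d k) * q k else 0)
        - (\<Sum>k<r. \<Lambda> k * ((a' k + c k) / \<rho>) * q k) = 0" .
    show ?thesis unfolding H_def block_form_def 1 2 3 4 5 6 using 7 8 by simp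
  qed
  have cd: "\<bar>c k\<bar> \<le> 2 * M * N\<^sub>2 g / \<epsilon>" "\<bar>d k\<bar> \<le> 2 * M * N\<^sub>2 g / \<epsilon>" if "k < r" for k
  proof -
    have ab: "\<bar>a' k\<bar> \<le> M * N\<^sub>2 g" "\<bar>b' k\<bar> \<le> M * N\<^sub>2 g"
      unfolding a'_def b'_def using G_XU[OF that] G_YV[OF that] by auto
    have MN: "0 \<le> M * N\<^sub>2 g" using M1 by simp
    have e1: "2 * M * N\<^sub>2 g \<le> 2 * M * N\<^sub>2 g / \<epsilon>"
      using mult_left_mono[of \<epsilon> 1 "2 * (M * N\<^sub>2 g)"] eps MN by (simp add: field_simps)
    have "\<bar>c k\<bar> \<le> 2 * M * N\<^sub>2 g / \<epsilon> \<and> \<bar>d k\<bar> \<le> 2 * M * N\<^sub>2 g / \<epsilon>"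
    proof (cases "k = 0")
      case True
      then show ?thesis using ab e1 by (auto simp: c_def d_def)
    next
      case False
      then have m: "0 \<le> \<mu> k" "\<mu> k \<le> 1" "\<epsilon> \<le> 1 - (\<mu> k)\<^sup>2" "(\<mu> k)\<^sup>2 \<le> 1" using mu[of k] that eps by auto
      have *: "\<bar>(\<mu> k * x + (\<mu> k)\<^sup>2 * y) / (1 - (\<mu> k)\<^sup>2)\<bar> \<le> 2 * M * N\<^sub>2 g / \<epsilon>"
        if "\<bar>x\<bar> \<le> M * N\<^sub>2 g" "\<bar>y\<bar> \<le> M * N\<^sub>2 g" for x y
      proof -
        have "\<bar>\<mu> k * x + (\<mu> k)\<^sup>2 * y\<bar> \<le> 1 * (M * N\<^sub>2 g) + 1 * (M * N\<^sub>2 g)"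
          using that m by (intro abs_add_bound abs_mult_bound) auto
        then show ?thesis unfolding abs_divide using m eps by (intro frac_le) auto
      qed
      show ?thesis using False *[OF ab(2,1)] *[OF ab] by (simp add: c_def d_def)
    qed
    then show "\<bar>c k\<bar> \<le> 2 * M * N\<^sub>2 g / \<epsilon>" "\<bar>d k\<bar> \<le> 2 * M * N\<^sub>2 g / \<epsilon>" by auto
  qed
  \<comment> \<open>Stated for any seminorm that is at most \<open>y\<close> on the canonical
    vectors; used with \<open>y = M\<close> for \<open>N\<^sub>2\<close> and with
    \<open>y = \<sigma> * M\<close> for \<open>N\<^sub>1\<close>.\<close>
  have bound: "N h \<le> 1 / \<epsilon> * (N g + 2 * (real r * (2 * M * N\<^sub>2 g / \<epsilon> * y)))"
    if N: "seminorm N" and UV: "\<And>k. k < r \<Longrightarrow> N (U k) \<le> y" "\<And>k. k < r \<Longrightarrow> N (V k) \<le> y" and "0 \<le> y"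
    for N :: "'a \<Rightarrow> real" and y
  proof -
    interpret N: seminorm N by (rule N)
    have nn: "0 \<le> 2 * M * N\<^sub>2 g / \<epsilon>" using M1 eps by simp
    have cU: "N (c k *\<^sub>R U k) \<le> 2 * M * N\<^sub>2 g / \<epsilon> * y" "N (d k *\<^sub>R V k) \<le> 2 * M * N\<^sub>2 g / \<epsilon> * y" if "k < r" for k
      unfolding N.scale using cd[OF that] UV[OF that] nn by (intro mult_mono; simp)+
    define z where "z = 2 * M * N\<^sub>2 g / \<epsilon> * y"
    have "N (\<Sum>k<r. c k *\<^sub>R U k) \<le> (\<Sum>k<r. z)"
      by (intro order_trans[OF N.sum] sum_mono) (use cU z_def in auto)
    moreover have "N (\<Sum>k<r. d k *\<^sub>R V k) \<le> (\<Sum>k<r. z)"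
      by (intro order_trans[OF N.sum] sum_mono) (use cU z_def in auto)
    ultimately have "N (g + (\<Sum>k<r. c k *\<^sub>R U k) + (\<Sum>k<r. d k *\<^sub>R V k)) \<le> N g + 2 * (real r * z)"
      using N.triangle[of "g + (\<Sum>k<r. c k *\<^sub>R U k)" "\<Sum>k<r. d k *\<^sub>R V k"]
        N.triangle[of g "\<Sum>k<r. c k *\<^sub>R U k"] by simp
    then have *: "N (g + (\<Sum>k<r. c k *\<^sub>R U k) + (\<Sum>k<r. d k *\<^sub>R V k))
        \<le> N g + 2 * (real r * (2 * M * N\<^sub>2 g / \<epsilon> * y))" by (simp only: z_def)
    have "N h = 1 / \<rho> * N (g + (\<Sum>k<r. c k *\<^sub>R U k) + (\<Sum>k<r. d k *\<^sub>R V k))"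
      unfolding h_def N.scale using rho_pos by simp
    also have "\<dots> \<le> 1 / \<epsilon> * (N g + 2 * (real r * (2 * M * N\<^sub>2 g / \<epsilon> * y)))"
      using * gap0 eps rho_pos by (intro mult_mono) (auto simp: field_simps)
    finally show ?thesis .
  qed
  have "N\<^sub>2 h \<le> 1 / \<epsilon> * (N\<^sub>2 g + 2 * (real r * (2 * M * N\<^sub>2 g / \<epsilon> * M)))"
    by (rule bound[OF n2.seminorm_axioms]) (use n2_U n2_V M1 in auto)
  then have n2h: "N\<^sub>2 h \<le> (1 + 4 * r * M\<^sup>2 / \<epsilon>) / \<epsilon> * N\<^sub>2 g"
    using eps by (simp add: field_simps power2_eq_square)
  have "N\<^sub>1 h \<le> 1 / \<epsilon> * (N\<^sub>1 g + 2 * (real r * (2 * M * N\<^sub>2 g / \<epsilon> * (\<sigma> * M))))"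
    by (rule bound[OF n1.seminorm_axioms]) (use n1_UM M1 sig in auto)
  also have "\<dots> = 1 / \<epsilon> * (1 * N\<^sub>1 g + (4 * r * M\<^sup>2 / \<epsilon>) * (\<sigma> * N\<^sub>2 g))"
    using eps by (simp add: field_simps power2_eq_square)
  also have "\<dots> \<le> 1 / \<epsilon> * ((1 + 4 * r * M\<^sup>2 / \<epsilon>) * N\<^sub>1 g + (1 + 4 * r * M\<^sup>2 / \<epsilon>) * (\<sigma> * N\<^sub>2 g))"
    using eps sig by (intro mult_left_mono add_mono mult_right_mono) auto
  also have "\<dots> = (1 + 4 * r * M\<^sup>2 / \<epsilon>) / \<epsilon> * (N\<^sub>1 g + \<sigma> * N\<^sub>2 g)"
    using eps by (simp add: field_simps)
  finally have n1h: "N\<^sub>1 h \<le> (1 + 4 * r * M\<^sup>2 / \<epsilon>) / \<epsilon> * (N\<^sub>1 g + \<sigma> * N\<^sub>2 g)" .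
  show ?thesis by (rule that[OF Hh n2h n1h])
qed

end


section \<open>The estimated Hessian\<close>

text \<open>\<open>E\<close> is the deviation of the empirical from the population covariance,
  \<open>\<delta>\<close> the base rate, \<open>e\<close> the Euclidean rate of the preliminary
  estimators \<open>a\<close> and \<open>b\<close>, and \<open>D\<close> the constant hidden in it.
  \<open>E_\<alpha>\<close> and \<open>E_\<beta>\<close> carry no factor for the l1 norm of the
  canonical vectors. The constants are parameters tied by equations so that they can be chosen
  before the sample size; the smallness conditions then hold for large samples.\<close>

locale perturbed_form = canonical_form N\<^sub>1 N\<^sub>2 PX PY G M \<epsilon> \<sigma> r U V \<Lambda>
  for N\<^sub>1 N\<^sub>2 :: "'a::real_vector \<Rightarrow> real" and PX PY G M \<epsilon> \<sigma> r U V \<Lambda> +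
  fixes E :: "'a \<Rightarrow> 'a \<Rightarrow> real" and a b :: 'a
    and \<rho>\<^sub>1 \<rho>\<^sub>2 \<rho>\<^sub>3 A D k e \<delta> k\<^sub>c k\<^sub>g A\<^sub>2 :: real
  assumes bil_E: "bilinear E" and sym_E: "E u v = E v u"
    and A1: "A \<ge> 1" and D1: "D \<ge> 1" and k1: "k \<ge> 1" and lam: "\<delta> > 0"
    and sl: "\<sigma> * \<delta> \<le> e" and e2: "e\<^sup>2 \<le> \<delta>"
    and E_inf: "\<bar>E u v\<bar> \<le> A * \<delta> * (N\<^sub>1 u * N\<^sub>1 v)"
    and E_\<alpha>: "\<bar>E (U 0) v\<bar> \<le> A * \<delta> * N\<^sub>1 v" and E_\<beta>: "\<bar>E (V 0) v\<bar> \<le> A * \<delta> * N\<^sub>1 v"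
    and E_rsc: "\<bar>E u u\<bar> \<le> \<epsilon> / (20 * M) * (N\<^sub>2 u)\<^sup>2 + A * \<delta>\<^sup>2 * (N\<^sub>1 u)\<^sup>2"
    and Xa: "PX a = a" and Yb: "PY b = b"
    and a2: "N\<^sub>2 (a - U 0) \<le> D * e" and a1: "N\<^sub>1 (a - U 0) \<le> D * (\<sigma> * e)"
    and b2: "N\<^sub>2 (b - V 0) \<le> D * e" and b1: "N\<^sub>1 (b - V 0) \<le> D * (\<sigma> * e)"
    and rho1: "\<bar>\<rho>\<^sub>1 - \<Lambda> 0\<bar> \<le> k * e" and rho2: "\<bar>\<rho>\<^sub>2 - \<Lambda> 0\<bar> \<le> k * e" and rho3: "\<bar>\<rho>\<^sub>3 - \<Lambda> 0\<bar> \<le> k * e"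
    and rho3_nonneg: "\<rho>\<^sub>3 \<ge> 0"
    and kc_def: "k\<^sub>c = k * M + 2 * M * D + 4"
    and kg_def: "k\<^sub>g = 2 * (k + 2 * M * k\<^sub>c + 2 * M * D + 2)"
    and A2_def: "A\<^sub>2 = 2 * (7 * A + 5120 * A\<^sup>2 * M ^ 3 / \<epsilon>)"
    and small_kc: "k\<^sub>c * D * (\<sigma> * e) \<le> 1"
    and small_rsc: "(6 * k * M\<^sup>2 + 16 * M\<^sup>2 * D) * (4 * M / \<epsilon>) * (\<sigma> * e) \<le> 1"
begin

abbreviation "Gh \<equiv> \<lambda>u v. G u v + E u v"

definition "Hh \<equiv> block_form \<rho>\<^sub>1 \<rho>\<^sub>2 \<rho>\<^sub>3 Gh a b"

lemmas esimps = bilinear_ladd[OF bil_E] bilinear_radd[OF bil_E] bilinear_lmul[OF bil_E]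
  bilinear_rmul[OF bil_E] bilinear_lsub[OF bil_E] bilinear_rsub[OF bil_E] bilinear_lneg[OF bil_E]
  bilinear_rneg[OF bil_E] bilinear_lzero[OF bil_E] bilinear_rzero[OF bil_E]

lemma bil_Gh: "bilinear Gh"
  unfolding bilinear_def by (auto intro!: linearI simp: bsimps esimps algebra_simps)

lemma bil_Hh: "bilinear Hh" unfolding Hh_def by (rule bilinear_block_form[OF bil_Gh])

lemma sym_Hh: "Hh u v = Hh v u"
  unfolding Hh_def by (rule block_form_sym) (metis sym sym_E)

lemmas hhsimps = bilinear_ladd[OF bil_Hh] bilinear_radd[OF bil_Hh] bilinear_lmul[OF bil_Hh]
  bilinear_rmul[OF bil_Hh] bilinear_lsub[OF bil_Hh] bilinear_rsub[OF bil_Hh] bilinear_lneg[OF bil_Hh]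
  bilinear_rneg[OF bil_Hh] bilinear_lzero[OF bil_Hh] bilinear_rzero[OF bil_Hh]

lemma small_intro: "c * (\<sigma> * e) \<le> 1 \<Longrightarrow> 0 \<le> c' \<Longrightarrow> c' \<le> c \<Longrightarrow> c' * (\<sigma> * e) \<le> 1"
  apply (rule order_trans[of _ "c * (\<sigma> * e)"])
  subgoal using order_trans[OF _ sl, of 0] sig lam by (intro mult_right_mono) auto
  by assumption

lemma le_e: "\<delta> \<le> e" "0 < e" "e \<le> \<sigma> * e" "\<sigma> * e \<le> 1" "e \<le> 1"
proof -
  have "1 * \<delta> \<le> \<sigma> * \<delta>" using sig lam by (intro mult_right_mono) auto
  then show *: "\<delta> \<le> e" "0 < e" using sl lam by linarith+
  have "1 * e \<le> \<sigma> * e" using sig * by (intro mult_right_mono) auto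
  then show "e \<le> \<sigma> * e" by simp
  have "1 * (\<sigma> * e) \<le> k\<^sub>c * D * (\<sigma> * e)"
  proof (intro mult_right_mono)
    have "k\<^sub>c \<ge> 1" unfolding kc_def using k1 M1 D1 by simp
    then show "1 \<le> k\<^sub>c * D" using D1 mult_mono[of 1 k\<^sub>c 1 D] by simp
  qed (use sig * in auto)
  then show "\<sigma> * e \<le> 1" using small_kc by simp
  with \<open>e \<le> \<sigma> * e\<close> show "e \<le> 1" by linarith
qed


lemma kc_ge: "k\<^sub>c \<ge> 4" "k\<^sub>c \<ge> M * D" "k\<^sub>c \<ge> k" "k\<^sub>c \<ge> D"
proof -
  have *: "0 \<le> k * M" "0 \<le> M * D" "k * 1 \<le> k * M" "1 * D \<le> M * D"
    using k1 M1 D1 by (auto intro!: mult_left_mono mult_right_mono)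
  then show "k\<^sub>c \<ge> 4" "k\<^sub>c \<ge> M * D" "k\<^sub>c \<ge> k" "k\<^sub>c \<ge> D" unfolding kc_def using M1 by linarith+
qed

lemma small_D: "D * (\<sigma> * e) \<le> 1" "k * e \<le> 1" "k\<^sub>c * (D * e) \<le> 1"
proof -
  have D: "1 * D \<le> k\<^sub>c * D" "k\<^sub>c * 1 \<le> k\<^sub>c * D" using kc_ge D1 by (intro mult_mono; simp)+
  show "D * (\<sigma> * e) \<le> 1" using small_intro[OF small_kc, of D] D D1 by simp
  have "k * (\<sigma> * e) \<le> 1" using small_intro[OF small_kc, of k] D kc_ge k1 by simp
  moreover have "k * e \<le> k * (\<sigma> * e)" using le_e k1 by (intro mult_left_mono) auto
  ultimately show "k * e \<le> 1" by simp
  have "k\<^sub>c * D * e \<le> k\<^sub>c * D * (\<sigma> * e)" using le_e kc_ge D1 by (intro mult_left_mono) auto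
  then show "k\<^sub>c * (D * e) \<le> 1" using small_kc by (simp add: mult.assoc)
qed

lemma rho_le2: "\<bar>\<rho>\<^sub>1\<bar> \<le> 2" "\<bar>\<rho>\<^sub>2\<bar> \<le> 2" "\<bar>\<rho>\<^sub>3\<bar> \<le> 2"
  using rho1 rho2 rho3 small_D(2) rho_le1 rho_pos by linarith+

text \<open>The perturbation of one diagonal block, applied to \<open>u\<close>, up to the part absorbed by \<open>g\<close>.\<close>

lemma block_perturbation:
  fixes \<rho>' L F :: real and u x y :: 'a
  assumes rho: "\<bar>\<rho>' - \<rho>\<bar> \<le> k * e" and L: "0 \<le> L" and F: "0 \<le> F"
    and Gx: "\<bar>G u x\<bar> \<le> M * L" and Gy: "\<bar>G u (y - x)\<bar> \<le> M * (L * (D * e))"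
    and Ex: "\<bar>E u x\<bar> \<le> F * \<delta>" and Eu: "\<And>v. \<bar>E u v\<bar> \<le> F * \<delta> * N\<^sub>1 v"
    and Exv: "\<And>v. \<bar>E x v\<bar> \<le> A * \<delta> * N\<^sub>1 v"
    and y2: "N\<^sub>2 (y - x) \<le> D * e" and y1: "N\<^sub>1 (y - x) \<le> D * (\<sigma> * e)"
    and u2: "N\<^sub>2 u \<le> L" and u1: "N\<^sub>1 u \<le> \<sigma> * L" and x2: "N\<^sub>2 x \<le> M" and x1: "N\<^sub>1 x \<le> \<sigma> * M"
  defines "g \<equiv> (\<rho>' - \<rho>) *\<^sub>R u + (2 * (\<rho>\<^sub>3 * Gh u y - \<rho> * G u x)) *\<^sub>R x + (2 * (\<rho>\<^sub>3 * Gh u y)) *\<^sub>R (y - x)"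
  shows "N\<^sub>2 g \<le> k\<^sub>g / 2 * (e * L + \<delta> * F)" and "N\<^sub>1 g \<le> k\<^sub>g / 2 * (\<sigma> * (e * L + \<delta> * F))"
    and "\<bar>(\<rho>' * Gh u v + 2 * \<rho>\<^sub>3 * Gh u y * Gh y v) - (\<rho> * G u v + 2 * \<rho> * G u x * G x v) - G g v\<bar>
      \<le> (2 * F + 4 * A * (2 * M * L + F)) * \<delta> * N\<^sub>1 v"
proof -
  define S where "S = e * L + \<delta> * F"
  have S: "0 \<le> S" "e * L \<le> S" "\<delta> * F \<le> S" unfolding S_def using le_e L F lam by auto
  define c where "c = \<rho>\<^sub>3 * Gh u y"
  define c0 where "c0 = \<rho> * G u x"
  have Dse: "N\<^sub>1 (y - x) \<le> 1" using y1 small_D(1) by linarith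
  have Fd: "0 \<le> F * \<delta>" using F lam by simp
  have Eyx: "\<bar>E u (y - x)\<bar> \<le> F * \<delta>"
    using Eu[of "y - x"] mult_left_mono[OF Dse Fd] by simp
  \<comment> \<open>The change of the coefficient of the rank-one direction \<open>x\<close> comes
    from the weight, from \<open>y - x\<close> and from the noise. Each part is of order
    \<open>e * L + \<delta> * F\<close>, which is \<open>S\<close>.\<close>
  have "c - c0 = (\<rho>\<^sub>3 - \<rho>) * G u x + \<rho>\<^sub>3 * (G u (y - x) + (E u x + E u (y - x)))"
    unfolding c_def c0_def by (simp add: bsimps esimps algebra_simps)
  also have "\<bar>\<dots>\<bar> \<le> (k * e) * (M * L) + 2 * (M * (L * (D * e)) + (F * \<delta> + F * \<delta>))"
    by (intro abs_bounds abs_mult_bound rho3 rho_le2 Gx Gy Ex Eyx)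
  also have "\<dots> = (k * M + 2 * M * D) * (e * L) + 4 * (\<delta> * F)" by (simp add: algebra_simps)
  also have "\<dots> \<le> (k * M + 2 * M * D) * S + 4 * S"
    using S k1 M1 D1 by (intro add_mono mult_left_mono) auto
  also have "\<dots> = k\<^sub>c * S" by (simp add: kc_def algebra_simps)
  finally have cc: "\<bar>c - c0\<bar> \<le> k\<^sub>c * S" .
  have c0: "\<bar>c0\<bar> \<le> M * L"
    unfolding c0_def using abs_mult_bound[OF _ Gx, of \<rho> 1] rho_le1 rho_pos by simp
  have cb: "\<bar>c\<bar> \<le> M * L + k\<^sub>c * S" using cc c0 by linarith
  have kS: "k\<^sub>c * S * (D * e) \<le> S"
    using mult_right_mono[OF small_D(3) S(1)] by (simp add: mult_ac)
  have cN: "\<bar>c\<bar> * (D * e) \<le> (M * D + 1) * S"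
  proof -
    have "\<bar>c\<bar> * (D * e) \<le> (M * L + k\<^sub>c * S) * (D * e)" using cb D1 le_e by (intro mult_right_mono) auto
    also have "\<dots> = M * D * (e * L) + k\<^sub>c * S * (D * e)" by (simp add: algebra_simps)
    also have "\<dots> \<le> M * D * S + S" using kS S M1 D1 by (intro add_mono mult_left_mono) auto
    finally show ?thesis by (simp add: algebra_simps)
  qed
  have keL: "k * e * L \<le> k * S" using S k1 mult_left_mono[of "e * L" S k] by (simp add: mult_ac)
  have kgS: "k * S + 2 * (k\<^sub>c * S * M) + 2 * ((M * D + 1) * S) = k\<^sub>g / 2 * S"
    by (simp add: kg_def algebra_simps)
  define d where "d = c - c0"
  note cc = cc[folded d_def]
  have geq: "g = (\<rho>' - \<rho>) *\<^sub>R u + (2 * d) *\<^sub>R x + (2 * c) *\<^sub>R (y - x)"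
    by (simp add: g_def d_def c_def c0_def)
  have "N\<^sub>2 g \<le> \<bar>\<rho>' - \<rho>\<bar> * N\<^sub>2 u + 2 * (\<bar>d\<bar> * N\<^sub>2 x) + 2 * (\<bar>c\<bar> * N\<^sub>2 (y - x))"
    unfolding geq
    using n2.triangle[of "(\<rho>' - \<rho>) *\<^sub>R u + (2 * d) *\<^sub>R x" "(2 * c) *\<^sub>R (y - x)"]
      n2.triangle[of "(\<rho>' - \<rho>) *\<^sub>R u" "(2 * d) *\<^sub>R x"]
    by (simp add: n2.scale abs_mult)
  also have "\<dots> \<le> k * e * L + 2 * (k\<^sub>c * S * M) + 2 * (\<bar>c\<bar> * (D * e))"
    using rho u2 cc x2 y2 k1 le_e kc_ge S by (intro add_mono mult_left_mono mult_mono) auto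
  also have "\<dots> \<le> k\<^sub>g / 2 * S" using keL cN kgS by linarith
  finally show "N\<^sub>2 g \<le> k\<^sub>g / 2 * (e * L + \<delta> * F)" by (simp add: S_def)
  have "N\<^sub>1 g \<le> \<bar>\<rho>' - \<rho>\<bar> * N\<^sub>1 u + 2 * (\<bar>d\<bar> * N\<^sub>1 x) + 2 * (\<bar>c\<bar> * N\<^sub>1 (y - x))"
    unfolding geq
    using n1.triangle[of "(\<rho>' - \<rho>) *\<^sub>R u + (2 * d) *\<^sub>R x" "(2 * c) *\<^sub>R (y - x)"]
      n1.triangle[of "(\<rho>' - \<rho>) *\<^sub>R u" "(2 * d) *\<^sub>R x"]
    by (simp add: n1.scale abs_mult)
  also have "\<dots> \<le> k * e * (\<sigma> * L) + 2 * (k\<^sub>c * S * (\<sigma> * M)) + 2 * (\<bar>c\<bar> * (D * (\<sigma> * e)))"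
    using rho u1 cc x1 y1 k1 le_e kc_ge S sig by (intro add_mono mult_left_mono mult_mono) auto
  also have "\<dots> = \<sigma> * (k * e * L + 2 * (k\<^sub>c * S * M) + 2 * (\<bar>c\<bar> * (D * e)))" by (simp add: algebra_simps)
  also have "\<dots> \<le> \<sigma> * (k\<^sub>g / 2 * S)"
    using keL cN kgS sig by (intro mult_left_mono) linarith+
  finally show "N\<^sub>1 g \<le> k\<^sub>g / 2 * (\<sigma> * (e * L + \<delta> * F))" by (simp add: S_def mult_ac)
  have cb2: "\<bar>c\<bar> \<le> 2 * M * L + F"
  proof -
    have "k\<^sub>c * e \<le> 1"
    proof -
      have "k\<^sub>c * (1 * e) \<le> k\<^sub>c * (D * e)" using D1 le_e kc_ge by (intro mult_left_mono mult_right_mono) auto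
      then show ?thesis using small_D(3) by simp
    qed
    moreover have "k\<^sub>c * \<delta> \<le> k\<^sub>c * e" using le_e kc_ge by (intro mult_left_mono) auto
    ultimately have "k\<^sub>c * e * L \<le> 1 * L" "k\<^sub>c * \<delta> * F \<le> 1 * F"
      using L F by (intro mult_right_mono; linarith)+
    then have "k\<^sub>c * S \<le> L + F" unfolding S_def by (simp add: algebra_simps)
    moreover have "1 * L \<le> M * L" using M1 L by (intro mult_right_mono) auto
    ultimately show ?thesis using cb by linarith
  qed
  have Eyv: "\<bar>E (y - x) v\<bar> \<le> A * \<delta> * N\<^sub>1 v"
  proof -
    have "A * \<delta> * (N\<^sub>1 (y - x) * N\<^sub>1 v) \<le> A * \<delta> * (1 * N\<^sub>1 v)"
      using Dse A1 lam by (intro mult_left_mono mult_right_mono) auto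
    then show ?thesis using E_inf[of "y - x" v] by simp
  qed
  \<comment> \<open>\<open>g\<close> is chosen so that all terms pairing \<open>v\<close> through
    \<open>G\<close> cancel. What is left pairs \<open>v\<close> through \<open>E\<close> and is of
    size \<open>\<delta>\<close> times its l1 norm.\<close>
  have "(\<rho>' * Gh u v + 2 * \<rho>\<^sub>3 * Gh u y * Gh y v) - (\<rho> * G u v + 2 * \<rho> * G u x * G x v) - G g v
     = \<rho>' * E u v + 2 * (c * (E x v + E (y - x) v))"
  proof -
    have "Gh y v = G x v + G (y - x) v + E x v + E (y - x) v" by (simp add: bsimps esimps)
    then have 1: "2 * \<rho>\<^sub>3 * Gh u y * Gh y v = 2 * c * (G x v + G (y - x) v + E x v + E (y - x) v)"
      unfolding c_def by (simp only: mult.assoc)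
    have 2: "G g v = (\<rho>' - \<rho>) * G u v + 2 * (c - c0) * G x v + 2 * c * G (y - x) v"
      unfolding geq d_def by (simp add: bsimps)
    have 3: "2 * \<rho> * G u x * G x v = 2 * c0 * G x v" by (simp add: c0_def)
    show ?thesis unfolding 1 2 3 by (simp add: algebra_simps)
  qed
  also have "\<bar>\<dots>\<bar> \<le> 2 * (F * \<delta> * N\<^sub>1 v) + 2 * ((2 * M * L + F) * (A * \<delta> * N\<^sub>1 v + A * \<delta> * N\<^sub>1 v))"
    using rho small_D(2) rho_le1 rho_pos
    by (intro abs_bounds abs_mult_bound Eu Exv Eyv cb2) linarith
  also have "\<dots> = (2 * F + 4 * A * (2 * M * L + F)) * \<delta> * N\<^sub>1 v" by (simp add: algebra_simps)
  finally show "\<bar>(\<rho>' * Gh u v + 2 * \<rho>\<^sub>3 * Gh u y * Gh y v) - (\<rho> * G u v + 2 * \<rho> * G u x * G x v) - G g v\<bar>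
      \<le> (2 * F + 4 * A * (2 * M * L + F)) * \<delta> * N\<^sub>1 v" .
qed

text \<open>The part through \<open>g\<close> is too large for the penalty but has the shape that
  \<open>solve\<close> inverts; the remainder is what the penalty is made for. Used twice: for the
  node vector, with \<open>F = A\<close>, and for the correction \<open>h\<close>, where
  \<open>L\<close> and \<open>F\<close> are themselves of the order of the rates.\<close>

lemma perturbation:
  assumes L: "0 \<le> L" and F: "0 \<le> F" and u2: "N\<^sub>2 u \<le> L" and u1: "N\<^sub>1 u \<le> \<sigma> * L"
    and EX: "\<And>v. \<bar>E (PX u) v\<bar> \<le> F * \<delta> * N\<^sub>1 v" and EY: "\<And>v. \<bar>E (PY u) v\<bar> \<le> F * \<delta> * N\<^sub>1 v"
    and E\<alpha>: "\<bar>E (PX u) \<alpha>\<bar> \<le> F * \<delta>" and E\<beta>: "\<bar>E (PY u) \<beta>\<bar> \<le> F * \<delta>"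
  obtains g where "N\<^sub>2 g \<le> k\<^sub>g * (e * L + \<delta> * F)" "N\<^sub>1 g \<le> k\<^sub>g * (\<sigma> * (e * L + \<delta> * F))"
    "\<And>v. \<bar>Hh u v - H u v - 2 * (G (PX g) (PX v) + G (PY g) (PY v))\<bar>
       \<le> (28 * A * F + 32 * A * M * L) * \<delta> * N\<^sub>1 v"
proof -
  define gx where "gx = (\<rho>\<^sub>1 - \<rho>) *\<^sub>R PX u + (2 * (\<rho>\<^sub>3 * Gh (PX u) a - \<rho> * G (PX u) \<alpha>)) *\<^sub>R \<alpha> + (2 * (\<rho>\<^sub>3 * Gh (PX u) a)) *\<^sub>R (a - \<alpha>)"
  define gy where "gy = (\<rho>\<^sub>2 - \<rho>) *\<^sub>R PY u + (2 * (\<rho>\<^sub>3 * Gh (PY u) b - \<rho> * G (PY u) \<beta>)) *\<^sub>R \<beta> + (2 * (\<rho>\<^sub>3 * Gh (PY u) b)) *\<^sub>R (b - \<beta>)"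
  have Xd: "PX (a - \<alpha>) = a - \<alpha>" and Yd: "PY (b - \<beta>) = b - \<beta>" by (simp_all add: psimps Xa Yb)
  have gx: "PX gx = gx" "PY gx = 0" "PY gy = gy" "PX gy = 0"
  proof -
    show "PX gx = gx" "PY gy = gy" unfolding gx_def gy_def by (simp_all add: psimps Xa Yb)
    then show "PY gx = 0" "PX gy = 0" using YX[of gx] XY[of gy] by simp_all
  qed
  have uL: "M * N\<^sub>2 u \<le> M * L" using u2 M1 by (intro mult_left_mono) auto
  have G1: "\<bar>G (PX u) \<alpha>\<bar> \<le> M * L" "\<bar>G (PY u) \<beta>\<bar> \<le> M * L"
    using G_XU[of 0 u] G_YV[of 0 u] uL by auto
  have uD: "M * (N\<^sub>2 u * N\<^sub>2 w) \<le> M * (L * (D * e))" if "N\<^sub>2 w \<le> D * e" for w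
    using that u2 M1 L by (intro mult_left_mono mult_mono) auto
  have G2: "\<bar>G (PX u) (a - \<alpha>)\<bar> \<le> M * (L * (D * e))" "\<bar>G (PY u) (b - \<beta>)\<bar> \<le> M * (L * (D * e))"
    using G_XX[of u "a - \<alpha>"] G_YY[of u "b - \<beta>"] uD[OF a2] uD[OF b2] unfolding Xd Yd by linarith+
  have Pu: "N\<^sub>2 (PX u) \<le> L" "N\<^sub>2 (PY u) \<le> L" "N\<^sub>1 (PX u) \<le> \<sigma> * L" "N\<^sub>1 (PY u) \<le> \<sigma> * L"
    using n2_X[of u] n2_Y[of u] n1_X[of u] n1_Y[of u] u1 u2 by linarith+
  note X = block_perturbation[OF rho1 L F G1(1) G2(1) E\<alpha> EX E_\<alpha> a2 a1 Pu(1,3) n2_U[OF r0] n1_UM(1)[OF r0], folded gx_def]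
  note Y = block_perturbation[OF rho2 L F G1(2) G2(2) E\<beta> EY E_\<beta> b2 b1 Pu(2,4) n2_V[OF r0] n1_UM(2)[OF r0], folded gy_def]
  have "\<bar>Hh u v - H u v - 2 * (G (PX (gx + gy)) (PX v) + G (PY (gx + gy)) (PY v))\<bar>
       \<le> (28 * A * F + 32 * A * M * L) * \<delta> * N\<^sub>1 v" for v
  proof -
    define m where "m = \<delta> * N\<^sub>1 v"
    have m: "0 \<le> m" using lam by (simp add: m_def)
    have mX: "\<delta> * N\<^sub>1 (PX v) \<le> m" "\<delta> * N\<^sub>1 (PY v) \<le> m"
      unfolding m_def using n1_X n1_Y lam by (auto intro!: mult_left_mono)
    define w where "w = 2 * F + 4 * A * (2 * M * L + F)"
    have w: "0 \<le> w" unfolding w_def using A1 F M1 L by (intro add_nonneg_nonneg mult_nonneg_nonneg) auto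
    have "\<bar>(\<rho>\<^sub>1 * Gh (PX u) (PX v) + 2 * \<rho>\<^sub>3 * Gh (PX u) a * Gh a (PX v)) - (\<rho> * G (PX u) (PX v) + 2 * \<rho> * G (PX u) \<alpha> * G \<alpha> (PX v)) - G gx (PX v)\<bar> \<le> w * m"
      using X(3)[of "PX v"] mult_left_mono[OF mX(1) w] unfolding w_def by (simp add: mult_ac)
    note 1 = this
    have "\<bar>(\<rho>\<^sub>2 * Gh (PY u) (PY v) + 2 * \<rho>\<^sub>3 * Gh (PY u) b * Gh b (PY v)) - (\<rho> * G (PY u) (PY v) + 2 * \<rho> * G (PY u) \<beta> * G \<beta> (PY v)) - G gy (PY v)\<bar> \<le> w * m"
      using Y(3)[of "PY v"] mult_left_mono[OF mX(2) w] unfolding w_def by (simp add: mult_ac)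
    note 2 = this
    have 3: "\<bar>E (PX u) (PY v)\<bar> \<le> F * m" "\<bar>E (PY u) (PX v)\<bar> \<le> F * m"
      using EX[of "PY v"] EY[of "PX v"] mult_left_mono[OF mX(1) F] mult_left_mono[OF mX(2) F]
      by (simp_all add: mult_ac)
    have "Hh u v - H u v - 2 * (G (PX (gx + gy)) (PX v) + G (PY (gx + gy)) (PY v)) =
      2 * (((\<rho>\<^sub>1 * Gh (PX u) (PX v) + 2 * \<rho>\<^sub>3 * Gh (PX u) a * Gh a (PX v)) - (\<rho> * G (PX u) (PX v) + 2 * \<rho> * G (PX u) \<alpha> * G \<alpha> (PX v)) - G gx (PX v))
        + ((\<rho>\<^sub>2 * Gh (PY u) (PY v) + 2 * \<rho>\<^sub>3 * Gh (PY u) b * Gh b (PY v)) - (\<rho> * G (PY u) (PY v) + 2 * \<rho> * G (PY u) \<beta> * G \<beta> (PY v)) - G gy (PY v))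
        - E (PX u) (PY v) - E (PY u) (PX v))"
      unfolding Hh_def H_def block_form_def by (simp add: psimps gx algebra_simps)
    also have "\<bar>\<dots>\<bar> \<le> 2 * (w * m + w * m + F * m + F * m)"
      by (intro abs_bounds 1 2 3)
    also have "\<dots> = (12 * F + 16 * (A * F) + 32 * A * M * L) * m" by (simp add: w_def algebra_simps)
    also have "\<dots> \<le> (28 * A * F + 32 * A * M * L) * m"
      using mult_right_mono[OF A1 F] m by (intro mult_right_mono) auto
    finally show ?thesis by (simp add: m_def mult_ac)
  qed
  moreover have "N\<^sub>2 (gx + gy) \<le> k\<^sub>g * (e * L + \<delta> * F)" "N\<^sub>1 (gx + gy) \<le> k\<^sub>g * (\<sigma> * (e * L + \<delta> * F))"
    using X(1,2) Y(1,2) n2.triangle[of gx gy] n1.triangle[of gx gy] by simp_all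
  ultimately show ?thesis using that by blast
qed

end

lemma quadratic_le:
  fixes x a c :: real
  assumes "c > 0"
  shows "- (a\<^sup>2 / (2 * c)) \<le> 2 * (c * x\<^sup>2) - 2 * (a * x)"
proof -
  have "0 \<le> (2 * c * x - a)\<^sup>2 / (2 * c)" using assms by simp
  also have "\<dots> = 2 * (c * x\<^sup>2) - 2 * (a * x) + a\<^sup>2 / (2 * c)"
    using assms by (simp add: power2_eq_square field_simps)
  finally show ?thesis by simp
qed

lemma abs_shift: "\<bar>x - 2 * z\<bar> \<le> p \<Longrightarrow> \<bar>z\<bar> \<le> q \<Longrightarrow> \<bar>x\<bar> \<le> 2 * q + (p :: real)"
  by linarith

section \<open>Restricted convexity of the estimated Hessian\<close>

context perturbed_form
begin

text \<open>Only a lower bound is wanted, so the square of \<open>y\<close> is dropped, being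
  nonnegative by \<open>\<rho>\<^sub>3 \<ge> 0\<close>; the rest is linear in
  \<open>y\<close>.\<close>

lemma square_perturbation:
  fixes x y :: real
  shows "- (k * e * x\<^sup>2) - 4 * (\<bar>x\<bar> * \<bar>y\<bar>) \<le> \<rho>\<^sub>3 * (x + y)\<^sup>2 - \<rho> * x\<^sup>2"
proof -
  have "\<rho>\<^sub>3 * (x + y)\<^sup>2 - \<rho> * x\<^sup>2 = (\<rho>\<^sub>3 - \<rho>) * x\<^sup>2 + 2 * (\<rho>\<^sub>3 * (x * y)) + \<rho>\<^sub>3 * y\<^sup>2"
    by (simp add: power2_eq_square algebra_simps)
  moreover have "\<bar>(\<rho>\<^sub>3 - \<rho>) * x\<^sup>2\<bar> \<le> k * e * x\<^sup>2" by (intro abs_mult_bound rho3) simp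
  moreover have "\<bar>\<rho>\<^sub>3 * (x * y)\<bar> \<le> 2 * (\<bar>x\<bar> * \<bar>y\<bar>)"
    by (intro abs_mult_bound rho_le2) (simp_all add: abs_mult)
  moreover have "0 \<le> \<rho>\<^sub>3 * y\<^sup>2" using rho3_nonneg by simp
  ultimately show ?thesis by linarith
qed

text \<open>The perturbation \<open>z\<close> of \<open>G u x\<close> has a part of order
  \<open>e * N\<^sub>2 v\<close> from \<open>y - x\<close> and a noise part of order
  \<open>\<delta> * N\<^sub>1 v\<close>. Multiplied by \<open>G u x\<close>, of order
  \<open>N\<^sub>2 v\<close>, the first becomes a small multiple of the squared Euclidean norm and
  the second a mixed product, left to Young's inequality.\<close>

lemma rank_one_perturbation:
  assumes Gx: "\<bar>G u x\<bar> \<le> M * N\<^sub>2 v" and Gy: "\<bar>G u (y - x)\<bar> \<le> M * (N\<^sub>2 v * (D * e))"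
    and Ex: "\<And>w. \<bar>E x w\<bar> \<le> A * \<delta> * N\<^sub>1 w" and y1: "N\<^sub>1 (y - x) \<le> D * (\<sigma> * e)"
    and u: "N\<^sub>1 u \<le> N\<^sub>1 v"
  shows "- ((k * M\<^sup>2 + 4 * M\<^sup>2 * D) * e * (N\<^sub>2 v)\<^sup>2) - 8 * A * M * (N\<^sub>2 v * (\<delta> * N\<^sub>1 v))
     \<le> \<rho>\<^sub>3 * (Gh u y)\<^sup>2 - \<rho> * (G u x)\<^sup>2"
proof -
  define n where "n = N\<^sub>2 v"
  define m where "m = \<delta> * N\<^sub>1 v"
  have nm: "0 \<le> n" "0 \<le> m" using lam by (auto simp: n_def m_def)
  define z where "z = G u (y - x) + (E u x + E u (y - x))"
  have s: "Gh u y = G u x + z" by (simp add: z_def bsimps esimps)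
  have um: "\<delta> * N\<^sub>1 u \<le> m" unfolding m_def using u lam by (intro mult_left_mono) auto
  have "A * (\<delta> * N\<^sub>1 u) \<le> A * m" using um A1 by (intro mult_left_mono) auto
  then have e1: "\<bar>E u x\<bar> \<le> A * m"
    using Ex[of u] sym_E[of u x] by (simp add: mult.assoc)
  have "N\<^sub>1 (y - x) \<le> 1" using y1 small_D(1) by linarith
  then have "A * (\<delta> * N\<^sub>1 u * N\<^sub>1 (y - x)) \<le> A * (m * 1)"
    using um A1 nm by (intro mult_left_mono mult_mono) auto
  then have e2: "\<bar>E u (y - x)\<bar> \<le> A * m" using E_inf[of u "y - x"] by (simp add: mult_ac)
  have z: "\<bar>z\<bar> \<le> M * (n * (D * e)) + (A * m + A * m)"
    unfolding z_def n_def by (intro abs_bounds Gy e1 e2)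
  have "\<bar>G u x\<bar> * \<bar>z\<bar> \<le> (M * n) * (M * (n * (D * e)) + (A * m + A * m))"
    using Gx z nm M1 by (intro mult_mono) (auto simp: n_def)
  also have "\<dots> = M\<^sup>2 * D * e * n\<^sup>2 + 2 * A * M * (n * m)" by (simp add: power2_eq_square algebra_simps)
  finally have 1: "\<bar>G u x\<bar> * \<bar>z\<bar> \<le> M\<^sup>2 * D * e * n\<^sup>2 + 2 * A * M * (n * m)" .
  have "(G u x)\<^sup>2 \<le> (M * n)\<^sup>2" using Gx nm M1 by (intro abs_le_square_iff[THEN iffD1]) (auto simp: n_def)
  then have 2: "k * e * (G u x)\<^sup>2 \<le> k * e * (M * n)\<^sup>2"
    using k1 le_e by (intro mult_left_mono) auto
  have "- ((k * M\<^sup>2 + 4 * M\<^sup>2 * D) * e * n\<^sup>2) - 8 * A * M * (n * m)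
      = - (k * e * (M * n)\<^sup>2) - 4 * (M\<^sup>2 * D * e * n\<^sup>2 + 2 * A * M * (n * m))"
    by (simp add: power_mult_distrib algebra_simps)
  also have "\<dots> \<le> - (k * e * (G u x)\<^sup>2) - 4 * (\<bar>G u x\<bar> * \<bar>z\<bar>)"
    by (intro diff_mono le_imp_neg_le mult_left_mono 1 2) simp
  also have "\<dots> \<le> \<rho>\<^sub>3 * (Gh u y)\<^sup>2 - \<rho> * (G u x)\<^sup>2" unfolding s by (rule square_perturbation)
  finally show ?thesis unfolding n_def m_def .
qed

text \<open>Half of the curvature \<open>2 * \<epsilon> / M\<close> of \<open>H\<close> is kept. The
  other half pays, in equal shares, for the errors of weights and directions, small together with
  \<open>\<sigma> * e\<close>, and for ten times \<open>t\<close>, spent on \<open>E_rsc\<close> and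
  on Young's inequality. The l1 terms of these two add up to \<open>A\<^sub>2\<close>.\<close>

lemma restricted_convexity: "\<epsilon> / M * (N\<^sub>2 v)\<^sup>2 - A\<^sub>2 * (\<delta> * N\<^sub>1 v)\<^sup>2 \<le> Hh v v"
proof -
  define t where "t = \<epsilon> / (20 * M)"
  have t: "t > 0" using eps M1 by (simp add: t_def)
  define n where "n = N\<^sub>2 v"
  define m where "m = \<delta> * N\<^sub>1 v"
  have nm: "0 \<le> n" "0 \<le> m" using lam by (auto simp: n_def m_def)
  have Eq: "\<bar>E u u\<bar> \<le> t * (N\<^sub>2 u)\<^sup>2 + A * m\<^sup>2" if "N\<^sub>1 u \<le> N\<^sub>1 v" for u
  proof -
    have "(\<delta> * N\<^sub>1 u)\<^sup>2 \<le> m\<^sup>2"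
      unfolding m_def using that lam by (intro power_mono mult_left_mono) auto
    then have "A * (\<delta> * N\<^sub>1 u)\<^sup>2 \<le> A * m\<^sup>2" using A1 by (intro mult_left_mono) auto
    then show ?thesis using E_rsc[of u] by (simp add: t_def power_mult_distrib mult.assoc)
  qed
  have E1: "\<bar>E (PX v) (PX v)\<bar> \<le> t * (N\<^sub>2 (PX v))\<^sup>2 + A * m\<^sup>2"
    and E2: "\<bar>E (PY v) (PY v)\<bar> \<le> t * (N\<^sub>2 (PY v))\<^sup>2 + A * m\<^sup>2"
    and E0: "\<bar>E v v\<bar> \<le> t * n\<^sup>2 + A * m\<^sup>2"
    using Eq[of "PX v"] Eq[of "PY v"] Eq[of v] n1_X n1_Y by (auto simp: n_def)
  have n12: "t * (N\<^sub>2 (PX v))\<^sup>2 + t * (N\<^sub>2 (PY v))\<^sup>2 = t * n\<^sup>2"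
    by (simp add: n_def n2_split[of v] algebra_simps)
  \<comment> \<open>The deviation bound is available for quadratic forms only; the off-diagonal
    block is recovered from \<open>E v v\<close> and the two diagonal blocks.\<close>
  have E12: "E v v = E (PX v) (PX v) + E (PY v) (PY v) + 2 * E (PX v) (PY v)"
  proof -
    have "E v v = E (PX v + PY v) (PX v + PY v)" by (simp add: XplusY)
    then show ?thesis by (simp only: esimps) (simp add: sym_E[of "PY v" "PX v"])
  qed
  have r1: "\<bar>\<rho>\<^sub>1 * E (PX v) (PX v)\<bar> \<le> 2 * (t * (N\<^sub>2 (PX v))\<^sup>2 + A * m\<^sup>2)"
    and r2: "\<bar>\<rho>\<^sub>2 * E (PY v) (PY v)\<bar> \<le> 2 * (t * (N\<^sub>2 (PY v))\<^sup>2 + A * m\<^sup>2)"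
    by (intro abs_mult_bound rho_le2 E1 E2)+
  have g1: "\<bar>(\<rho>\<^sub>1 - \<rho>) * G (PX v) (PX v)\<bar> \<le> k * e * (M * n\<^sup>2)"
    and g2: "\<bar>(\<rho>\<^sub>2 - \<rho>) * G (PY v) (PY v)\<bar> \<le> k * e * (M * n\<^sup>2)"
    using abs_mult_bound[OF rho1 G_XX[of v v]] abs_mult_bound[OF rho2 G_YY[of v v]]
    by (simp_all add: n_def power2_eq_square)
  have X: "PX (a - \<alpha>) = a - \<alpha>" and Y: "PY (b - \<beta>) = b - \<beta>" by (simp_all add: psimps Xa Yb)
  have ne: "M * (N\<^sub>2 v * N\<^sub>2 w) \<le> M * (N\<^sub>2 v * (D * e))" if "N\<^sub>2 w \<le> D * e" for w
    using that M1 by (intro mult_left_mono) auto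
  have qx: "- ((k * M\<^sup>2 + 4 * M\<^sup>2 * D) * e * n\<^sup>2) - 8 * A * M * (n * m)
     \<le> \<rho>\<^sub>3 * (Gh (PX v) a)\<^sup>2 - \<rho> * (G (PX v) \<alpha>)\<^sup>2"
    unfolding n_def m_def
  proof (rule rank_one_perturbation)
    show "\<bar>G (PX v) (a - \<alpha>)\<bar> \<le> M * (N\<^sub>2 v * (D * e))"
      using G_XX[of v "a - \<alpha>"] ne[OF a2] unfolding X by linarith
  qed (use G_XU[of 0 v] E_\<alpha> a1 n1_X in auto)
  have qy: "- ((k * M\<^sup>2 + 4 * M\<^sup>2 * D) * e * n\<^sup>2) - 8 * A * M * (n * m)
     \<le> \<rho>\<^sub>3 * (Gh (PY v) b)\<^sup>2 - \<rho> * (G (PY v) \<beta>)\<^sup>2"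
    unfolding n_def m_def
  proof (rule rank_one_perturbation)
    show "\<bar>G (PY v) (b - \<beta>)\<bar> \<le> M * (N\<^sub>2 v * (D * e))"
      using G_YY[of v "b - \<beta>"] ne[OF b2] unfolding Y by linarith
  qed (use G_YV[of 0 v] E_\<beta> b1 n1_Y in auto)
  have young: "32 * A * M * (n * m) \<le> t * n\<^sup>2 + 5120 * A\<^sup>2 * M ^ 3 / \<epsilon> * m\<^sup>2"
  proof -
    have "0 \<le> (t * n - 16 * A * M * m)\<^sup>2 / t" using t by simp
    also have "\<dots> = t * n\<^sup>2 - 32 * A * M * (n * m) + 256 * A\<^sup>2 * M\<^sup>2 / t * m\<^sup>2"
      using t by (simp add: power2_eq_square field_simps)
    also have "256 * A\<^sup>2 * M\<^sup>2 / t = 5120 * A\<^sup>2 * M ^ 3 / \<epsilon>"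
      using eps M1 by (simp add: t_def field_simps power3_eq_cube power2_eq_square)
    finally show ?thesis by simp
  qed
  have sm: "(2 * k * M + 4 * k * M\<^sup>2 + 16 * M\<^sup>2 * D) * e * n\<^sup>2 \<le> \<epsilon> / (4 * M) * n\<^sup>2"
  proof (rule mult_right_mono)
    have "k * M * 1 \<le> k * M * M" using k1 M1 by (intro mult_left_mono) auto
    then have "(2 * k * M + 4 * k * M\<^sup>2 + 16 * M\<^sup>2 * D) * e \<le> (6 * k * M\<^sup>2 + 16 * M\<^sup>2 * D) * e"
      using le_e by (intro mult_right_mono) (auto simp: power2_eq_square mult_ac)
    also have "\<dots> \<le> (6 * k * M\<^sup>2 + 16 * M\<^sup>2 * D) * (\<sigma> * e)"
      using le_e k1 M1 D1 by (intro mult_left_mono) auto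
    also have "\<dots> \<le> \<epsilon> / (4 * M)"
      using small_rsc eps M1 by (simp add: field_simps)
    finally show "(2 * k * M + 4 * k * M\<^sup>2 + 16 * M\<^sup>2 * D) * e \<le> \<epsilon> / (4 * M)" .
  qed simp
  have diff: "Hh v v - H v v = 2 * ((\<rho>\<^sub>1 - \<rho>) * G (PX v) (PX v) + \<rho>\<^sub>1 * E (PX v) (PX v)
      + ((\<rho>\<^sub>2 - \<rho>) * G (PY v) (PY v) + \<rho>\<^sub>2 * E (PY v) (PY v))
      + 2 * (\<rho>\<^sub>3 * (Gh (PX v) a)\<^sup>2 - \<rho> * (G (PX v) \<alpha>)\<^sup>2)
      + 2 * (\<rho>\<^sub>3 * (Gh (PY v) b)\<^sup>2 - \<rho> * (G (PY v) \<beta>)\<^sup>2) - 2 * E (PX v) (PY v))"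
    unfolding Hh_def H_def block_form_def
    by (simp add: sym[of a] sym_E[of a] sym[of b] sym_E[of b] sym[of \<alpha>] sym[of \<beta>] sym_E[of "PY v" "PX v"]
        sym[of "PY v" "PX v"] power2_eq_square algebra_simps)
  have total: "\<epsilon> / M * n\<^sup>2 + A\<^sub>2 * m\<^sup>2 =
      2 * (\<epsilon> / (4 * M) * n\<^sup>2) + 10 * (t * n\<^sup>2) + 14 * (A * m\<^sup>2) + 2 * (5120 * A\<^sup>2 * M ^ 3 / \<epsilon> * m\<^sup>2)"
    unfolding A2_def t_def using M1 by (simp add: field_simps)
  have sm': "2 * (k * e * (M * n\<^sup>2)) + 4 * ((k * M\<^sup>2 + 4 * M\<^sup>2 * D) * e * n\<^sup>2) \<le> \<epsilon> / (4 * M) * n\<^sup>2"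
    using sm by (simp add: algebra_simps)
  have young': "4 * (8 * A * M * (n * m)) \<le> t * n\<^sup>2 + 5120 * A\<^sup>2 * M ^ 3 / \<epsilon> * m\<^sup>2"
    using young by simp
  \<comment> \<open>The bookkeeping with every product replaced by a variable, which leaves linear
    arithmetic.\<close>
  have lin: "h0 - z \<le> h1"
    if "h1 - h0 = 2 * (g1 + r1 + (g2 + r2) + 2 * q1 + 2 * q2 - 2 * e12)" "\<bar>g1\<bar> \<le> gb" "\<bar>g2\<bar> \<le> gb"
      "\<bar>r1\<bar> \<le> 2 * (t1 + am)" "\<bar>r2\<bar> \<le> 2 * (t2 + am)" "- kk - w \<le> q1" "- kk - w \<le> q2" "4 * w \<le> tn + y"
      "2 * gb + 4 * kk \<le> s" "e0 = e1 + e2 + 2 * e12" "\<bar>e0\<bar> \<le> tn + am" "\<bar>e1\<bar> \<le> t1 + am" "\<bar>e2\<bar> \<le> t2 + am"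
      "t1 + t2 = tn" "z = 2 * s + 10 * tn + 14 * am + 2 * y"
    for h0 h1 z g1 g2 r1 r2 q1 q2 e12 gb t1 t2 am kk w tn y s e0 e1 e2 :: real
  proof -
    have "- gb \<le> g1" "- gb \<le> g2" "- (2 * (t1 + am)) \<le> r1" "- (2 * (t2 + am)) \<le> r2"
      "e0 \<le> tn + am" "- (t1 + am) \<le> e1" "- (t2 + am) \<le> e2"
      using that(2-5,11-13) by (simp_all only: abs_le_iff minus_le_iff)
    with that(1,6-10,14,15) show ?thesis by argo
  qed
  have "H v v - (\<epsilon> / M * n\<^sup>2 + A\<^sub>2 * m\<^sup>2) \<le> Hh v v"
    by (rule lin[OF diff g1 g2 r1 r2 qx qy young' sm' E12 E0 E1 E2 n12 total])
  moreover have "2 * \<epsilon> / M * n\<^sup>2 = 2 * (\<epsilon> / M * n\<^sup>2)" by simp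
  ultimately show ?thesis using H_lower[of v] unfolding n_def[symmetric] m_def[symmetric] by linarith
qed

end


section \<open>Stationary points of the nodewise Lasso\<close>

text \<open>
  \<open>J\<close> reads off the coordinate of the node, \<open>\<eta>\<close> and \<open>\<eta>\<^sub>0\<close> are the stationary point and its
  target, and \<open>\<Gamma>\<close> has node coordinate 1 and remaining coordinates \<open>- \<eta>\<^sub>0\<close>.
\<close>

locale nodewise = perturbed_form N\<^sub>1 N\<^sub>2 PX PY G M \<epsilon> \<sigma> r U V \<Lambda> E a b \<rho>\<^sub>1 \<rho>\<^sub>2 \<rho>\<^sub>3 A D k e \<delta> k\<^sub>c k\<^sub>g A\<^sub>2
  for N\<^sub>1 N\<^sub>2 :: "'a::real_vector \<Rightarrow> real" and PX PY G M \<epsilon> \<sigma> r U V \<Lambda> E a b \<rho>\<^sub>1 \<rho>\<^sub>2 \<rho>\<^sub>3 A D k e \<delta> k\<^sub>c k\<^sub>g A\<^sub>2 +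
  fixes J :: "'a \<Rightarrow> real" and \<Gamma> \<eta> \<eta>\<^sub>0 :: 'a
    and L B C\<^sub>T \<nu> C \<chi> h\<^sub>c k\<^sub>3 k\<^sub>4 k\<^sub>5 k\<^sub>6 k\<^sub>7 k\<^sub>8 :: real
  assumes lin_J: "linear J" and J_le: "\<bar>J u\<bar> \<le> N\<^sub>2 u"
    and J\<Gamma>: "J \<Gamma> = 1" and J\<eta>: "J \<eta> = 0" and J\<eta>0: "J \<eta>\<^sub>0 = 0"
    and orth: "J w = 0 \<Longrightarrow> H \<Gamma> w = 0"
    and L1: "L \<ge> 1" and \<Gamma>2: "N\<^sub>2 \<Gamma> \<le> L" and \<Gamma>1: "N\<^sub>1 \<Gamma> \<le> \<sigma> * L"
    and E\<Gamma>X: "\<bar>E (PX \<Gamma>) v\<bar> \<le> A * \<delta> * N\<^sub>1 v" and E\<Gamma>Y: "\<bar>E (PY \<Gamma>) v\<bar> \<le> A * \<delta> * N\<^sub>1 v"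
    and E\<Gamma>\<alpha>: "\<bar>E (PX \<Gamma>) (U 0)\<bar> \<le> A * \<delta>" and E\<Gamma>\<beta>: "\<bar>E (PY \<Gamma>) (V 0)\<bar> \<le> A * \<delta>"
    and CT: "C\<^sub>T > 0" and \<eta>0B: "N\<^sub>1 \<eta>\<^sub>0 \<le> B" and \<eta>B: "N\<^sub>1 \<eta> \<le> B" and B_le: "B \<le> C\<^sub>T * \<sigma>"
    and stationary: "J \<theta> = 0 \<Longrightarrow> N\<^sub>1 \<theta> \<le> B \<Longrightarrow>
      2 * Hh (\<Gamma> - (\<eta> - \<eta>\<^sub>0)) (\<theta> - \<eta>) \<le> C * \<delta> * (N\<^sub>1 \<theta> - N\<^sub>1 \<eta>)"
    and chi: "\<chi> \<ge> 0"
    and sparse: "N\<^sub>1 (\<eta> - \<eta>\<^sub>0) \<le> N\<^sub>1 \<eta> - N\<^sub>1 \<eta>\<^sub>0 + 2 * \<chi> * \<sigma> * N\<^sub>2 (\<eta> - \<eta>\<^sub>0)"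
    and \<nu>_def: "\<nu> = 28 * A\<^sup>2 + 32 * A * M * L"
    and C_def: "C = 8 + 4 * \<nu>"
    and hc_def: "h\<^sub>c = 2 * ((1 + 4 * r * M\<^sup>2 / \<epsilon>) / \<epsilon>) * k\<^sub>g * (L + A) * (1 + L)"
    and k3_def: "k\<^sub>3 = 4 * M * k\<^sub>g * h\<^sub>c * (1 + A)"
    and k4_def: "k\<^sub>4 = k\<^sub>3\<^sup>2 * M / (2 * \<epsilon>)"
    and k5_def: "k\<^sub>5 = 3 * h\<^sub>c + 2 * k\<^sub>4"
    and k6_def: "k\<^sub>6 = 1 + M / \<epsilon> * (16 * M\<^sup>2 * h\<^sub>c + 4 * C * \<chi> + C * k\<^sub>5)"
    and k7_def: "k\<^sub>7 = 4 * \<chi> * k\<^sub>6 + k\<^sub>5"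
    and k8_def: "k\<^sub>8 = 4 * M * k\<^sub>g * (L + A) * L + \<nu> * L + 2 * (16 * M\<^sup>2 * h\<^sub>c * k\<^sub>6 + \<nu> * k\<^sub>7)
       + (16 * M\<^sup>2 * h\<^sub>c * k\<^sub>6 + C * k\<^sub>7) + C * C\<^sub>T"
    and small_h: "(28 * A\<^sup>2 * h\<^sub>c + 32 * A * M * h\<^sub>c) * (\<sigma> * e) \<le> 1" and small_hc: "h\<^sub>c * (\<sigma> * e) \<le> 1"
    and small_A2: "A\<^sub>2 * (2 * C\<^sub>T + 1) * (\<sigma> * e) \<le> 1"
    and small_k8: "k\<^sub>8 * M / \<epsilon> * (\<sigma> * e) \<le> 1"
begin

definition "v \<equiv> \<eta> - \<eta>\<^sub>0"

lemma Jv: "J v = 0" unfolding v_def using J\<eta> J\<eta>0 by (simp add: linear_diff[OF lin_J])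

lemma kg_nonneg: "k\<^sub>g \<ge> 0"
  unfolding kg_def using k1 M1 D1 kc_ge by (intro mult_nonneg_nonneg add_nonneg_nonneg) auto

lemma nu_nonneg: "\<nu> \<ge> 0" unfolding \<nu>_def using A1 M1 L1 by simp

lemma hc_nonneg: "h\<^sub>c \<ge> 0"
  unfolding hc_def using kg_nonneg L1 A1 eps by (intro mult_nonneg_nonneg) auto

text \<open>The non-sparse part of the noise is \<open>H h\<close> for a vector \<open>h\<close> of the order of the rate.\<close>

lemma noise:
  obtains h where "J h = 0" "N\<^sub>2 h \<le> h\<^sub>c * e" "N\<^sub>1 h \<le> h\<^sub>c * (\<sigma> * e)"
    "\<And>w. J w = 0 \<Longrightarrow> \<bar>Hh \<Gamma> w - H h w\<bar> \<le> \<nu> * \<delta> * N\<^sub>1 w"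
    "\<bar>Hh \<Gamma> \<Gamma> - H \<Gamma> \<Gamma>\<bar> \<le> 4 * M * k\<^sub>g * (L + A) * L * e + \<nu> * \<delta> * N\<^sub>1 \<Gamma>"
proof -
  define c where "c = (1 + 4 * r * M\<^sup>2 / \<epsilon>) / \<epsilon>"
  have c: "c \<ge> 0" unfolding c_def using eps by simp
  obtain g where g: "N\<^sub>2 g \<le> k\<^sub>g * (e * L + \<delta> * A)" "N\<^sub>1 g \<le> k\<^sub>g * (\<sigma> * (e * L + \<delta> * A))"
    "\<And>v. \<bar>Hh \<Gamma> v - H \<Gamma> v - 2 * (G (PX g) (PX v) + G (PY g) (PY v))\<bar>
       \<le> (28 * A * A + 32 * A * M * L) * \<delta> * N\<^sub>1 v"
    by (rule perturbation[of L A \<Gamma>]) (use L1 A1 \<Gamma>2 \<Gamma>1 E\<Gamma>X E\<Gamma>Y E\<Gamma>\<alpha> E\<Gamma>\<beta> in auto)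
  have nu: "28 * A * A + 32 * A * M * L = \<nu>" by (simp add: \<nu>_def power2_eq_square)
  have le: "e * L + \<delta> * A \<le> (L + A) * e"
    using mult_right_mono[OF le_e(1), of A] A1 by (simp add: algebra_simps)
  have g2: "N\<^sub>2 g \<le> k\<^sub>g * (L + A) * e"
    using g(1) mult_left_mono[OF le kg_nonneg] by (simp add: mult_ac)
  have g1: "N\<^sub>1 g \<le> k\<^sub>g * (L + A) * (\<sigma> * e)"
  proof -
    have "k\<^sub>g * (\<sigma> * (e * L + \<delta> * A)) \<le> k\<^sub>g * (\<sigma> * ((L + A) * e))"
      using le kg_nonneg sig by (intro mult_left_mono) auto
    then show ?thesis using g(2) by (simp add: mult_ac)
  qed
  obtain h0 where h0: "\<And>v. H h0 v = 2 * (G (PX g) (PX v) + G (PY g) (PY v))"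
    "N\<^sub>2 h0 \<le> c * N\<^sub>2 g" "N\<^sub>1 h0 \<le> c * (N\<^sub>1 g + \<sigma> * N\<^sub>2 g)"
    unfolding c_def by (rule solve[of g]) blast
  define q where "q = c * (k\<^sub>g * (L + A))"
  have q: "0 \<le> q" unfolding q_def using c kg_nonneg L1 A1 by (intro mult_nonneg_nonneg) auto
  have h2: "N\<^sub>2 h0 \<le> q * e" using h0(2) mult_left_mono[OF g2 c] by (simp add: q_def mult_ac)
  have h1: "N\<^sub>1 h0 \<le> 2 * q * (\<sigma> * e)"
  proof -
    have "\<sigma> * N\<^sub>2 g \<le> \<sigma> * (k\<^sub>g * (L + A) * e)" using g2 sig by (intro mult_left_mono) auto
    then have "\<sigma> * N\<^sub>2 g \<le> k\<^sub>g * (L + A) * (\<sigma> * e)" by (simp add: mult_ac)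
    then have "N\<^sub>1 g + \<sigma> * N\<^sub>2 g \<le> 2 * (k\<^sub>g * (L + A) * (\<sigma> * e))" using g1 by linarith
    then show ?thesis using h0(3) mult_left_mono[OF _ c] by (force simp: q_def mult_ac)
  qed
  \<comment> \<open>A multiple of \<open>\<Gamma>\<close> brings the node coordinate of
    \<open>h\<close> to 0, so that \<open>\<eta>\<^sub>0 + h\<close> can serve as a regression
    vector. By \<open>orth\<close> it does not change \<open>H h w\<close> for any \<open>w\<close>
    with node coordinate 0.\<close>
  define h where "h = h0 - J h0 *\<^sub>R \<Gamma>"
  have hq: "h\<^sub>c = 2 * q * (1 + L)" unfolding hc_def q_def c_def by (simp add: mult_ac)
  have Jq: "\<bar>J h0\<bar> \<le> q * e" using J_le[of h0] h2 by linarith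
  have se: "0 \<le> \<sigma> * e" "0 \<le> e" using le_e sig by auto
  have "N\<^sub>2 h \<le> N\<^sub>2 h0 + \<bar>J h0\<bar> * N\<^sub>2 \<Gamma>" unfolding h_def
    by (rule order_trans[OF n2.triangle_diff]) (simp add: n2.scale)
  also have "\<dots> \<le> q * e + (q * e) * L"
    using h2 Jq \<Gamma>2 q se by (intro add_mono mult_mono) auto
  also have "\<dots> = (1 + L) * (q * e)" by (simp add: algebra_simps)
  also have "\<dots> \<le> 2 * ((1 + L) * (q * e))" using L1 q se by (simp add: mult_nonneg_nonneg)
  finally have n2h: "N\<^sub>2 h \<le> h\<^sub>c * e" unfolding hq by (simp add: mult_ac)
  have "N\<^sub>1 h \<le> N\<^sub>1 h0 + \<bar>J h0\<bar> * N\<^sub>1 \<Gamma>" unfolding h_def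
    by (rule order_trans[OF n1.triangle_diff]) (simp add: n1.scale)
  also have "\<dots> \<le> 2 * q * (\<sigma> * e) + (q * e) * (\<sigma> * L)"
    using h1 Jq \<Gamma>1 q se by (intro add_mono mult_mono) auto
  also have "\<dots> = (2 + L) * (q * (\<sigma> * e))" by (simp add: algebra_simps)
  also have "\<dots> \<le> (2 * (1 + L)) * (q * (\<sigma> * e))" using L1 q se by (intro mult_right_mono) auto
  finally have n1h: "N\<^sub>1 h \<le> h\<^sub>c * (\<sigma> * e)" unfolding hq by (simp add: mult_ac)
  have Jh: "J h = 0" unfolding h_def using J\<Gamma> by (simp add: linear_diff[OF lin_J] linear_cmul[OF lin_J])
  have Hh: "\<bar>Hh \<Gamma> w - H h w\<bar> \<le> \<nu> * \<delta> * N\<^sub>1 w" if "J w = 0" for w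
  proof -
    have "H h w = H h0 w" unfolding h_def using orth[OF that] by (simp add: hsimps)
    then show ?thesis using g(3)[of w] orth[OF that] unfolding nu h0(1) by simp
  qed
  have "\<bar>G (PX g) (PX \<Gamma>) + G (PY g) (PY \<Gamma>)\<bar> \<le> 2 * M * k\<^sub>g * (L + A) * L * e"
  proof -
    have "M * (N\<^sub>2 g * N\<^sub>2 \<Gamma>) \<le> M * ((k\<^sub>g * (L + A) * e) * L)"
      using g2 \<Gamma>2 M1 kg_nonneg L1 A1 se by (intro mult_left_mono mult_mono) auto
    then have "\<bar>G (PX g) (PX \<Gamma>) + G (PY g) (PY \<Gamma>)\<bar> \<le> 2 * (M * ((k\<^sub>g * (L + A) * e) * L))"
      using G_XX[of g \<Gamma>] G_YY[of g \<Gamma>] by linarith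
    then show ?thesis by (simp add: mult_ac)
  qed
  then have "\<bar>Hh \<Gamma> \<Gamma> - H \<Gamma> \<Gamma>\<bar> \<le> 2 * (2 * M * k\<^sub>g * (L + A) * L * e) + \<nu> * \<delta> * N\<^sub>1 \<Gamma>"
    by (rule abs_shift[OF g(3)[of \<Gamma>, unfolded nu]])
  then show ?thesis using that[OF Jh n2h n1h Hh] by simp
qed

text \<open>Replacing the population by the estimated Hessian at \<open>h\<close> is a second-order
  error since \<open>h\<close> is already of order \<open>e\<close>. Hence \<open>h\<close> cancels
  in the comparison with \<open>\<eta>\<^sub>0 + h\<close> up to terms of order
  \<open>e\<^sup>2\<close>, which \<open>e\<^sup>2 \<le> \<delta>\<close> puts within reach of the
  penalty.\<close>

lemma h_perturbation:
  assumes "N\<^sub>2 h \<le> h\<^sub>c * e" "N\<^sub>1 h \<le> h\<^sub>c * (\<sigma> * e)"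
  shows "\<bar>Hh h w - H h w\<bar> \<le> k\<^sub>3 * e\<^sup>2 * N\<^sub>2 w + \<delta> * N\<^sub>1 w"
proof -
  \<comment> \<open>The entrywise noise level times the l1 norm of \<open>h\<close>. A sharper
    deviation bound along \<open>h\<close> is not at hand because \<open>h\<close> depends on the
    sample; \<open>small_h\<close> makes up for the lost factor \<open>\<sigma>\<close>.\<close>
  define F where "F = A * (h\<^sub>c * (\<sigma> * e))"
  have se: "0 \<le> \<sigma> * e" "0 \<le> e" using le_e sig by auto
  have F: "0 \<le> F" unfolding F_def using A1 hc_nonneg se by simp
  have En: "\<bar>E u x\<bar> \<le> F * \<delta> * N\<^sub>1 x" if "N\<^sub>1 u \<le> h\<^sub>c * (\<sigma> * e)" for u x
  proof -
    have "A * \<delta> * (N\<^sub>1 u * N\<^sub>1 x) \<le> A * \<delta> * ((h\<^sub>c * (\<sigma> * e)) * N\<^sub>1 x)"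
      using that A1 lam by (intro mult_left_mono mult_right_mono) auto
    then show ?thesis using E_inf[of u x] by (simp add: F_def mult_ac)
  qed
  have En0: "\<bar>E u \<alpha>\<bar> \<le> F * \<delta>" "\<bar>E u \<beta>\<bar> \<le> F * \<delta>" if "N\<^sub>1 u \<le> h\<^sub>c * (\<sigma> * e)" for u
  proof -
    have "A * \<delta> * N\<^sub>1 u \<le> A * \<delta> * (h\<^sub>c * (\<sigma> * e))"
      using that A1 lam by (intro mult_left_mono) auto
    then show "\<bar>E u \<alpha>\<bar> \<le> F * \<delta>" "\<bar>E u \<beta>\<bar> \<le> F * \<delta>"
      using E_\<alpha>[of u] E_\<beta>[of u] unfolding sym_E[of u] by (simp_all add: F_def mult_ac)
  qed
  have PX: "N\<^sub>1 (PX h) \<le> h\<^sub>c * (\<sigma> * e)" and PY: "N\<^sub>1 (PY h) \<le> h\<^sub>c * (\<sigma> * e)"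
    using n1_X[of h] n1_Y[of h] assms(2) by linarith+
  obtain g where g: "N\<^sub>2 g \<le> k\<^sub>g * (e * (h\<^sub>c * e) + \<delta> * F)"
    "\<And>v. \<bar>Hh h v - H h v - 2 * (G (PX g) (PX v) + G (PY g) (PY v))\<bar>
       \<le> (28 * A * F + 32 * A * M * (h\<^sub>c * e)) * \<delta> * N\<^sub>1 v"
    by (rule perturbation[of "h\<^sub>c * e" F h])
       (use hc_nonneg se F assms En[OF PX] En[OF PY] En0[OF PX] En0[OF PY] in \<open>auto simp: mult_ac\<close>)
  have "\<delta> * F \<le> A * h\<^sub>c * e\<^sup>2"
    unfolding F_def using mult_left_mono[OF sl, of "A * h\<^sub>c * e"] A1 hc_nonneg se
    by (simp add: power2_eq_square mult_ac)
  then have "e * (h\<^sub>c * e) + \<delta> * F \<le> h\<^sub>c * (1 + A) * e\<^sup>2" by (simp add: power2_eq_square algebra_simps)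
  from mult_left_mono[OF this kg_nonneg] have g2: "N\<^sub>2 g \<le> k\<^sub>g * h\<^sub>c * (1 + A) * e\<^sup>2"
    using g(1) by (simp add: mult_ac)
  have *: "M * (N\<^sub>2 g * N\<^sub>2 w) \<le> M * (k\<^sub>g * h\<^sub>c * (1 + A) * e\<^sup>2 * N\<^sub>2 w)"
    using g2 M1 by (intro mult_left_mono mult_right_mono) auto
  have G: "\<bar>2 * (G (PX g) (PX w) + G (PY g) (PY w))\<bar> \<le> k\<^sub>3 * e\<^sup>2 * N\<^sub>2 w"
  proof -
    have "\<bar>2 * (G (PX g) (PX w) + G (PY g) (PY w))\<bar> \<le> 2 * (M * (N\<^sub>2 g * N\<^sub>2 w) + M * (N\<^sub>2 g * N\<^sub>2 w))"
      by (intro abs_bounds G_XX G_YY)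
    also have "\<dots> = 4 * (M * (N\<^sub>2 g * N\<^sub>2 w))" by simp
    also have "\<dots> \<le> 4 * (M * (k\<^sub>g * h\<^sub>c * (1 + A) * e\<^sup>2 * N\<^sub>2 w))" by (intro mult_left_mono *) simp
    also have "\<dots> = k\<^sub>3 * e\<^sup>2 * N\<^sub>2 w" by (simp add: k3_def)
    finally show ?thesis .
  qed
  have "28 * A * F + 32 * A * M * (h\<^sub>c * e) \<le> 1"
  proof -
    have "32 * A * M * h\<^sub>c * e \<le> 32 * A * M * h\<^sub>c * (\<sigma> * e)"
      using A1 M1 hc_nonneg le_e by (intro mult_left_mono) auto
    then show ?thesis using small_h unfolding F_def by (simp add: algebra_simps power2_eq_square)
  qed
  from mult_right_mono[OF this, of "\<delta> * N\<^sub>1 w"]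
  have "(28 * A * F + 32 * A * M * (h\<^sub>c * e)) * \<delta> * N\<^sub>1 w \<le> \<delta> * N\<^sub>1 w"
    using lam by (simp add: mult.assoc)
  then show ?thesis using g(2)[of w] G by linarith
qed


lemma A2_nonneg: "A\<^sub>2 \<ge> 0" unfolding A2_def using A1 M1 eps by simp

text \<open>On an l1 ball of radius of order \<open>\<sigma>\<close> the product
  \<open>A\<^sub>2 * (\<delta> * N\<^sub>1 w)\<close> is at most 1, so the quadratic defect of
  \<open>restricted_convexity\<close> becomes linear. The radius covers
  \<open>\<eta> - \<eta>\<^sub>0\<close>, at most \<open>2 * C\<^sub>T * \<sigma>\<close>, together
  with \<open>h\<close>, at most 1.\<close>

lemma convexity_on_bounded:
  assumes "N\<^sub>1 w \<le> (2 * C\<^sub>T + 1) * \<sigma>"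
  shows "\<epsilon> / M * (N\<^sub>2 w)\<^sup>2 - \<delta> * N\<^sub>1 w \<le> Hh w w"
proof -
  have "A\<^sub>2 * (\<delta> * N\<^sub>1 w) \<le> A\<^sub>2 * (\<delta> * ((2 * C\<^sub>T + 1) * \<sigma>))"
    using assms A2_nonneg lam by (intro mult_left_mono) auto
  also have "\<dots> = A\<^sub>2 * (2 * C\<^sub>T + 1) * (\<sigma> * \<delta>)" by (simp add: mult_ac)
  also have "\<dots> \<le> A\<^sub>2 * (2 * C\<^sub>T + 1) * (\<sigma> * e)"
    using sl le_e A2_nonneg CT by (intro mult_left_mono) auto
  also have "\<dots> \<le> 1" by (rule small_A2)
  finally have "A\<^sub>2 * (\<delta> * N\<^sub>1 w) * (\<delta> * N\<^sub>1 w) \<le> 1 * (\<delta> * N\<^sub>1 w)"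
    using lam by (intro mult_right_mono) auto
  then show ?thesis using restricted_convexity[of w] by (simp add: power2_eq_square mult.assoc)
qed

lemma n1_v: "N\<^sub>1 v \<le> 2 * C\<^sub>T * \<sigma>"
  using n1.triangle_diff[of \<eta> \<eta>\<^sub>0] \<eta>B \<eta>0B B_le unfolding v_def by simp

text \<open>If the l1 norm of \<open>\<eta>\<close> exceeds that of \<open>\<eta>\<^sub>0\<close> by
  at most \<open>N\<^sub>1 h\<close>, then \<open>sparse\<close> suffices. Otherwise
  \<open>\<eta>\<^sub>0 + h\<close> has l1 norm below \<open>N\<^sub>1 \<eta> \<le> B\<close>, so it
  is feasible and stationarity applies to it: the case distinction itself supplies
  feasibility.\<close>

lemma cone: "N\<^sub>1 v \<le> 4 * \<chi> * \<sigma> * N\<^sub>2 v + k\<^sub>5 * (\<sigma> * e)"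
proof -
  obtain h where h: "J h = 0" "N\<^sub>2 h \<le> h\<^sub>c * e" "N\<^sub>1 h \<le> h\<^sub>c * (\<sigma> * e)"
    "\<And>w. J w = 0 \<Longrightarrow> \<bar>Hh \<Gamma> w - H h w\<bar> \<le> \<nu> * \<delta> * N\<^sub>1 w"
    using noise by blast
  have se: "0 \<le> \<sigma> * e" "0 \<le> e" using le_e sig by auto
  have sv: "N\<^sub>1 v \<le> N\<^sub>1 \<eta> - N\<^sub>1 \<eta>\<^sub>0 + 2 * (\<chi> * \<sigma> * N\<^sub>2 v)" using sparse unfolding v_def by (simp add: mult_ac)
  have nn: "0 \<le> \<chi> * \<sigma> * N\<^sub>2 v" using chi sig by simp
  have k4: "0 \<le> k\<^sub>4 * (\<sigma> * e)" unfolding k4_def using M1 eps se by simp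
  have k5: "k\<^sub>5 * (\<sigma> * e) = 3 * (h\<^sub>c * (\<sigma> * e)) + 2 * (k\<^sub>4 * (\<sigma> * e))" by (simp add: k5_def algebra_simps)
  have hcse: "0 \<le> h\<^sub>c * (\<sigma> * e)" using hc_nonneg se by simp
  have eqn: "4 * \<chi> * \<sigma> * N\<^sub>2 v = 4 * (\<chi> * \<sigma> * N\<^sub>2 v)" by simp
  show ?thesis
  proof (cases "N\<^sub>1 \<eta> \<le> N\<^sub>1 \<eta>\<^sub>0 + N\<^sub>1 h")
    case True
    then show ?thesis using sv nn h(3) k5 k4 hcse eqn by linarith
  next
    case False
    define w where "w = v - h"
    define \<theta> where "\<theta> = \<eta>\<^sub>0 + h"
    have Jw: "J w = 0" unfolding w_def using Jv h(1) by (simp add: linear_diff[OF lin_J])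
    have \<theta>1: "N\<^sub>1 \<theta> \<le> N\<^sub>1 \<eta>\<^sub>0 + N\<^sub>1 h" unfolding \<theta>_def by (rule n1.triangle)
    have st: "2 * Hh (\<Gamma> - (\<eta> - \<eta>\<^sub>0)) (\<theta> - \<eta>) \<le> C * \<delta> * (N\<^sub>1 \<theta> - N\<^sub>1 \<eta>)"
    proof (rule stationary)
      show "J \<theta> = 0" unfolding \<theta>_def using J\<eta>0 h(1) by (simp add: linear_add[OF lin_J])
      show "N\<^sub>1 \<theta> \<le> B" using \<theta>1 False \<eta>B by linarith
    qed
    \<comment> \<open>In these terms stationarity bounds
      \<open>Hh w w + Hh h w - Hh \<Gamma> w\<close>. Both \<open>Hh h w\<close> and
      \<open>Hh \<Gamma> w\<close> are close to \<open>H h w\<close>, so the noise of order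
      \<open>e\<close> cancels.\<close>
    have "\<theta> - \<eta> = - w" "\<eta> - \<eta>\<^sub>0 = w + h" by (simp_all add: \<theta>_def w_def v_def)
    then have "Hh (\<Gamma> - (\<eta> - \<eta>\<^sub>0)) (\<theta> - \<eta>) = Hh w w + Hh h w - Hh \<Gamma> w"
      by (simp only: hhsimps)
    with st have st': "2 * (Hh w w + Hh h w - Hh \<Gamma> w) \<le> C * \<delta> * (N\<^sub>1 \<theta> - N\<^sub>1 \<eta>)" by simp
    have w1: "N\<^sub>1 w \<le> N\<^sub>1 v + h\<^sub>c * (\<sigma> * e)" unfolding w_def using n1.triangle_diff[of v h] h(3) by linarith
    have w2: "N\<^sub>1 w \<le> (2 * C\<^sub>T + 1) * \<sigma>"
      using w1 n1_v small_hc sig by (simp add: distrib_right)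
    have conv: "\<epsilon> / M * (N\<^sub>2 w)\<^sup>2 - \<delta> * N\<^sub>1 w \<le> Hh w w" by (rule convexity_on_bounded[OF w2])
    have n1: "H h w - \<nu> * \<delta> * N\<^sub>1 w \<le> Hh \<Gamma> w \<and> Hh \<Gamma> w \<le> H h w + \<nu> * \<delta> * N\<^sub>1 w"
      using h(4)[OF Jw] by linarith
    have n2: "H h w - (k\<^sub>3 * e\<^sup>2 * N\<^sub>2 w + \<delta> * N\<^sub>1 w) \<le> Hh h w"
      using h_perturbation[OF h(2,3), of w] by linarith
    \<comment> \<open>The curvature absorbs \<open>k\<^sub>3 * e\<^sup>2 * N\<^sub>2 w\<close> at a
      price of order e^4. As e^2 is at most both \<open>\<delta>\<close> and
      \<open>\<sigma> * e\<close>, this is at most a multiple of \<open>\<delta>\<close> times the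
      l1 rate.\<close>
    have quad: "- ((k\<^sub>3 * e\<^sup>2)\<^sup>2 / (2 * (\<epsilon> / M))) \<le> 2 * (\<epsilon> / M * (N\<^sub>2 w)\<^sup>2) - 2 * (k\<^sub>3 * e\<^sup>2 * N\<^sub>2 w)"
      using quadratic_le[of "\<epsilon> / M" "k\<^sub>3 * e\<^sup>2" "N\<^sub>2 w"] eps M1 by simp
    have "(k\<^sub>3 * e\<^sup>2)\<^sup>2 / (2 * (\<epsilon> / M)) = k\<^sub>4 * (e\<^sup>2 * e\<^sup>2)"
      using M1 eps by (simp add: k4_def field_simps power2_eq_square)
    also have "\<dots> \<le> k\<^sub>4 * (\<delta> * (\<sigma> * e))"
    proof -
      have "e\<^sup>2 \<le> \<sigma> * e" unfolding power2_eq_square using le_e sig by (intro mult_right_mono) auto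
      then have "e\<^sup>2 * e\<^sup>2 \<le> \<delta> * (\<sigma> * e)" using e2 lam by (intro mult_mono) auto
      then show ?thesis using k4_def M1 eps by (intro mult_left_mono) auto
    qed
    finally have q4: "(k\<^sub>3 * e\<^sup>2)\<^sup>2 / (2 * (\<epsilon> / M)) \<le> \<delta> * (k\<^sub>4 * (\<sigma> * e))" by (simp add: mult_ac)
    have "C * \<delta> * (N\<^sub>1 \<eta> - N\<^sub>1 \<theta>) \<le> \<delta> * (k\<^sub>4 * (\<sigma> * e)) + 4 * (\<delta> * N\<^sub>1 w) + 2 * (\<nu> * \<delta> * N\<^sub>1 w)"
    proof -
      have "C * \<delta> * (N\<^sub>1 \<eta> - N\<^sub>1 \<theta>) = - (C * \<delta> * (N\<^sub>1 \<theta> - N\<^sub>1 \<eta>))" by (simp add: algebra_simps)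
      then show ?thesis using st' conv n1 n2 quad q4 by argo
    qed
    \<comment> \<open>The origin of \<open>C = 8 + 4 * \<nu>\<close>: the coefficient
      \<open>4 + 2 * \<nu>\<close> of \<open>\<delta> * N\<^sub>1 w\<close> is exactly half the
      penalty, so half of the l1 error can be moved to the other side.\<close>
    also have "\<dots> = \<delta> * (k\<^sub>4 * (\<sigma> * e) + C / 2 * N\<^sub>1 w)" by (simp add: C_def field_simps)
    finally have "\<delta> * (C * (N\<^sub>1 \<eta> - N\<^sub>1 \<theta>)) \<le> \<delta> * (k\<^sub>4 * (\<sigma> * e) + C / 2 * N\<^sub>1 w)"
      by (simp only: mult.left_commute[of C] mult.assoc)
    then have "C * (N\<^sub>1 \<eta> - N\<^sub>1 \<theta>) \<le> k\<^sub>4 * (\<sigma> * e) + C / 2 * N\<^sub>1 w" using lam by simp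
    also have "\<dots> \<le> C * (k\<^sub>4 * (\<sigma> * e)) + C / 2 * N\<^sub>1 w"
      using mult_right_mono[OF _ k4, of 1 C] nu_nonneg C_def by simp
    finally have "C * (N\<^sub>1 \<eta> - N\<^sub>1 \<theta>) \<le> C * (k\<^sub>4 * (\<sigma> * e) + N\<^sub>1 w / 2)" by (simp add: algebra_simps)
    then have "N\<^sub>1 \<eta> - N\<^sub>1 \<theta> \<le> k\<^sub>4 * (\<sigma> * e) + N\<^sub>1 w / 2"
      using nu_nonneg C_def by (simp add: mult_le_cancel_left)
    then show ?thesis using \<theta>1 h(3) w1 sv k5 eqn by argo
  qed
qed

text \<open>Comparison with \<open>\<eta>\<^sub>0\<close>, which is always feasible. The term of
  order \<open>e * N\<^sub>2 v\<close> is harmless here: it yields the Euclidean rate, while the l1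
  norm is controlled by \<open>cone\<close>.\<close>

lemma basic_inequality:
  "Hh v v \<le> 16 * M\<^sup>2 * h\<^sub>c * e * N\<^sub>2 v + (\<nu> + C / 2) * (\<delta> * N\<^sub>1 v)"
  "\<bar>Hh \<Gamma> v\<bar> \<le> 16 * M\<^sup>2 * h\<^sub>c * e * N\<^sub>2 v + \<nu> * (\<delta> * N\<^sub>1 v)"
proof -
  obtain h where h: "J h = 0" "N\<^sub>2 h \<le> h\<^sub>c * e" "N\<^sub>1 h \<le> h\<^sub>c * (\<sigma> * e)"
    "\<And>w. J w = 0 \<Longrightarrow> \<bar>Hh \<Gamma> w - H h w\<bar> \<le> \<nu> * \<delta> * N\<^sub>1 w"
    using noise by blast
  have "16 * M\<^sup>2 * (N\<^sub>2 h * N\<^sub>2 v) \<le> 16 * M\<^sup>2 * ((h\<^sub>c * e) * N\<^sub>2 v)"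
    using h(2) by (intro mult_left_mono mult_right_mono) auto
  then have Hv: "\<bar>H h v\<bar> \<le> 16 * M\<^sup>2 * h\<^sub>c * e * N\<^sub>2 v" using H_upper[of h v] by (simp add: mult.assoc)
  then show *: "\<bar>Hh \<Gamma> v\<bar> \<le> 16 * M\<^sup>2 * h\<^sub>c * e * N\<^sub>2 v + \<nu> * (\<delta> * N\<^sub>1 v)"
    using h(4)[OF Jv] by (simp add: mult.assoc)
  have "2 * Hh (\<Gamma> - (\<eta> - \<eta>\<^sub>0)) (\<eta>\<^sub>0 - \<eta>) \<le> C * \<delta> * (N\<^sub>1 \<eta>\<^sub>0 - N\<^sub>1 \<eta>)"
    by (rule stationary[OF J\<eta>0 \<eta>0B])
  moreover have "\<eta>\<^sub>0 - \<eta> = - v" "\<eta> - \<eta>\<^sub>0 = v" by (simp_all add: v_def)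
  then have "Hh (\<Gamma> - (\<eta> - \<eta>\<^sub>0)) (\<eta>\<^sub>0 - \<eta>) = Hh v v - Hh \<Gamma> v" by (simp only: hhsimps)
  moreover have "N\<^sub>1 (\<eta>\<^sub>0 - \<eta>) = N\<^sub>1 v" using n1.minus[of v] by (simp add: v_def)
  then have "C * \<delta> * (N\<^sub>1 \<eta>\<^sub>0 - N\<^sub>1 \<eta>) \<le> C * \<delta> * N\<^sub>1 v"
    using n1.diff_ge[of \<eta>\<^sub>0 \<eta>] nu_nonneg lam unfolding C_def by (intro mult_left_mono) auto
  ultimately have "2 * (Hh v v - Hh \<Gamma> v) \<le> C * \<delta> * N\<^sub>1 v" by simp
  moreover have "(\<nu> + C / 2) * (\<delta> * N\<^sub>1 v) = \<nu> * (\<delta> * N\<^sub>1 v) + C * \<delta> * N\<^sub>1 v / 2" by (simp add: algebra_simps)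
  ultimately show "Hh v v \<le> 16 * M\<^sup>2 * h\<^sub>c * e * N\<^sub>2 v + (\<nu> + C / 2) * (\<delta> * N\<^sub>1 v)"
    using abs_le_D1[OF *] by argo
qed

lemma k_nonneg: "0 \<le> k\<^sub>4" "0 \<le> k\<^sub>5" "0 \<le> C" "1 \<le> k\<^sub>6" "0 \<le> k\<^sub>7"
proof -
  show k: "0 \<le> k\<^sub>4" "0 \<le> k\<^sub>5" "0 \<le> C"
    unfolding k5_def k4_def C_def using hc_nonneg M1 eps nu_nonneg by auto
  have "0 \<le> M / \<epsilon> * (16 * M\<^sup>2 * h\<^sub>c + 4 * C * \<chi> + C * k\<^sub>5)"
    using M1 eps hc_nonneg k chi by (intro mult_nonneg_nonneg add_nonneg_nonneg) auto
  then show "1 \<le> k\<^sub>6" by (simp add: k6_def)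
  then show "0 \<le> k\<^sub>7" unfolding k7_def using chi k by simp
qed

text \<open>Either the error is already at most \<open>e\<close>, or \<open>e\<close> may be
  replaced by \<open>N\<^sub>2 v\<close> in the cone bound; with
  \<open>\<sigma> * \<delta> \<le> e\<close> a factor \<open>N\<^sub>2 v\<close> then cancels from
  the basic inequality.\<close>

lemma n2_error: "N\<^sub>2 v \<le> k\<^sub>6 * e"
proof (cases "N\<^sub>2 v \<le> e")
  case True
  moreover have "1 * e \<le> k\<^sub>6 * e" using k_nonneg(4) le_e by (intro mult_right_mono) auto
  ultimately show ?thesis by linarith
next
  case False
  define n where "n = N\<^sub>2 v"
  have n: "e \<le> n" "0 < n" using False le_e by (auto simp: n_def)
  have dn: "\<delta> * N\<^sub>1 v \<le> (4 * \<chi> + k\<^sub>5) * (e * n)"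
  proof -
    have "\<delta> * N\<^sub>1 v \<le> \<delta> * (4 * \<chi> * \<sigma> * n + k\<^sub>5 * (\<sigma> * e))"
      using cone lam unfolding n_def by (intro mult_left_mono) auto
    also have "\<dots> = (\<sigma> * \<delta>) * (4 * \<chi> * n + k\<^sub>5 * e)" by (simp add: algebra_simps)
    also have "\<dots> \<le> e * (4 * \<chi> * n + k\<^sub>5 * n)"
      using sl n chi k_nonneg le_e by (intro mult_mono add_mono mult_left_mono) auto
    finally show ?thesis by (simp add: algebra_simps)
  qed
  have "\<epsilon> / M * n\<^sup>2 - \<delta> * N\<^sub>1 v \<le> Hh v v"
    unfolding n_def by (rule convexity_on_bounded) (use n1_v sig in \<open>simp add: distrib_right\<close>)
  also have "\<dots> \<le> 16 * M\<^sup>2 * h\<^sub>c * e * n + (\<nu> + C / 2) * (\<delta> * N\<^sub>1 v)"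
    unfolding n_def by (rule basic_inequality)
  finally have "\<epsilon> / M * n\<^sup>2 \<le> 16 * M\<^sup>2 * h\<^sub>c * e * n + (1 + \<nu> + C / 2) * (\<delta> * N\<^sub>1 v)" by (simp add: algebra_simps)
  also have "\<dots> \<le> 16 * M\<^sup>2 * h\<^sub>c * e * n + C * (\<delta> * N\<^sub>1 v)"
    using nu_nonneg lam by (intro add_left_mono mult_right_mono) (auto simp: C_def)
  also have "\<dots> \<le> 16 * M\<^sup>2 * h\<^sub>c * e * n + C * ((4 * \<chi> + k\<^sub>5) * (e * n))"
    using dn k_nonneg by (intro add_left_mono mult_left_mono)
  also have "\<dots> = (16 * M\<^sup>2 * h\<^sub>c + 4 * C * \<chi> + C * k\<^sub>5) * e * n" by (simp add: algebra_simps)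
  finally have "\<epsilon> / M * n * n \<le> (16 * M\<^sup>2 * h\<^sub>c + 4 * C * \<chi> + C * k\<^sub>5) * e * n"
    by (simp add: power2_eq_square mult.assoc)
  then have "\<epsilon> / M * n \<le> (16 * M\<^sup>2 * h\<^sub>c + 4 * C * \<chi> + C * k\<^sub>5) * e"
    using n(2) by (rule mult_right_le_imp_le)
  then have "n \<le> M / \<epsilon> * ((16 * M\<^sup>2 * h\<^sub>c + 4 * C * \<chi> + C * k\<^sub>5) * e)"
    using eps M1 by (simp add: field_simps)
  then show ?thesis unfolding k6_def n_def using le_e by (simp add: distrib_right mult.assoc)
qed

lemma n1_error: "N\<^sub>1 v \<le> k\<^sub>7 * (\<sigma> * e)"
proof -
  have "4 * \<chi> * \<sigma> * N\<^sub>2 v \<le> 4 * \<chi> * \<sigma> * (k\<^sub>6 * e)"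
    using n2_error chi sig by (intro mult_left_mono) auto
  then show ?thesis using cone by (simp add: k7_def algebra_simps)
qed

text \<open>The first two terms are the scale estimate \<open>\<tau>\<^sub>j\<^sup>2\<close>.\<close>

lemma scale_error:
  "\<bar>Hh (\<Gamma> - v) (\<Gamma> - v) + C * \<delta> / 2 * N\<^sub>1 \<eta> - H \<Gamma> \<Gamma>\<bar> \<le> k\<^sub>8 * e"
proof -
  obtain h where h: "\<bar>Hh \<Gamma> \<Gamma> - H \<Gamma> \<Gamma>\<bar> \<le> 4 * M * k\<^sub>g * (L + A) * L * e + \<nu> * \<delta> * N\<^sub>1 \<Gamma>"
    using noise by blast
  have se: "0 \<le> \<sigma> * e" "0 \<le> e" using le_e sig by auto
  have dl: "\<delta> * N\<^sub>1 w \<le> c * e" if "N\<^sub>1 w \<le> c * \<sigma>" "0 \<le> c" for w c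
  proof -
    have "\<delta> * N\<^sub>1 w \<le> c * (\<sigma> * \<delta>)" using mult_left_mono[OF that(1), of \<delta>] lam by (simp add: mult_ac)
    also have "\<dots> \<le> c * e" using sl that by (intro mult_left_mono)
    finally show ?thesis .
  qed
  have "k\<^sub>7 * (\<sigma> * e) \<le> k\<^sub>7 * \<sigma>" using k_nonneg sig le_e by (intro mult_left_mono) auto
  then have d: "\<delta> * N\<^sub>1 v \<le> k\<^sub>7 * e" using dl[of v k\<^sub>7] n1_error k_nonneg by simp
  have d\<Gamma>: "\<delta> * N\<^sub>1 \<Gamma> \<le> L * e" using dl[of \<Gamma> L] \<Gamma>1 L1 by (simp add: mult.commute)
  have d\<eta>: "\<delta> * N\<^sub>1 \<eta> \<le> C\<^sub>T * e" using dl[of \<eta> C\<^sub>T] \<eta>B B_le CT by simp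
  have n: "16 * M\<^sup>2 * h\<^sub>c * e * N\<^sub>2 v \<le> 16 * M\<^sup>2 * h\<^sub>c * k\<^sub>6 * e"
  proof -
    have "N\<^sub>2 v \<le> k\<^sub>6 * 1" using n2_error k_nonneg le_e mult_left_mono[of e 1 k\<^sub>6] by linarith
    then have "16 * M\<^sup>2 * h\<^sub>c * e * N\<^sub>2 v \<le> 16 * M\<^sup>2 * h\<^sub>c * e * (k\<^sub>6 * 1)"
      using hc_nonneg se by (intro mult_left_mono) auto
    then show ?thesis by (simp add: mult_ac)
  qed
  have nd: "\<nu> * (\<delta> * N\<^sub>1 v) \<le> \<nu> * (k\<^sub>7 * e)" "\<nu> * (\<delta> * N\<^sub>1 \<Gamma>) \<le> \<nu> * (L * e)" "C * (\<delta> * N\<^sub>1 \<eta>) \<le> C * (C\<^sub>T * e)"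
     "(\<nu> + C / 2) * (\<delta> * N\<^sub>1 v) \<le> C * (k\<^sub>7 * e)" "0 \<le> C * (\<delta> * N\<^sub>1 \<eta>)"
  proof -
    show "\<nu> * (\<delta> * N\<^sub>1 v) \<le> \<nu> * (k\<^sub>7 * e)" "\<nu> * (\<delta> * N\<^sub>1 \<Gamma>) \<le> \<nu> * (L * e)"
      by (intro mult_left_mono d d\<Gamma> nu_nonneg)+
    show "C * (\<delta> * N\<^sub>1 \<eta>) \<le> C * (C\<^sub>T * e)" "0 \<le> C * (\<delta> * N\<^sub>1 \<eta>)"
      using d\<eta> k_nonneg lam by (auto intro!: mult_left_mono)
    have "(\<nu> + C / 2) * (\<delta> * N\<^sub>1 v) \<le> C * (\<delta> * N\<^sub>1 v)"
      using nu_nonneg lam by (intro mult_right_mono) (auto simp: C_def)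
    also have "\<dots> \<le> C * (k\<^sub>7 * e)" by (intro mult_left_mono d k_nonneg)
    finally show "(\<nu> + C / 2) * (\<delta> * N\<^sub>1 v) \<le> C * (k\<^sub>7 * e)" .
  qed
  have \<Gamma>v: "\<bar>Hh \<Gamma> v\<bar> \<le> 16 * M\<^sup>2 * h\<^sub>c * k\<^sub>6 * e + \<nu> * (k\<^sub>7 * e)"
    using basic_inequality(2) n nd by linarith
  have vv: "Hh v v \<le> 16 * M\<^sup>2 * h\<^sub>c * k\<^sub>6 * e + C * (k\<^sub>7 * e)"
    using basic_inequality(1) n nd by linarith
  \<comment> \<open>The estimated form need not be nonnegative at \<open>v\<close>, but convexity on
    the l1 ball keeps its negative part of the order of the rate.\<close>
  have vv0: "- (C * (k\<^sub>7 * e)) \<le> Hh v v"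
  proof -
    have "\<epsilon> / M * (N\<^sub>2 v)\<^sup>2 - \<delta> * N\<^sub>1 v \<le> Hh v v"
      by (rule convexity_on_bounded) (use n1_v sig in \<open>simp add: distrib_right\<close>)
    moreover have "0 \<le> \<epsilon> / M * (N\<^sub>2 v)\<^sup>2" using eps M1 by simp
    moreover have "1 * (\<delta> * N\<^sub>1 v) \<le> C * (\<delta> * N\<^sub>1 v)"
      using nu_nonneg lam by (intro mult_right_mono) (auto simp: C_def)
    moreover have "C * (\<delta> * N\<^sub>1 v) \<le> C * (k\<^sub>7 * e)" using d k_nonneg by (intro mult_left_mono)
    ultimately show ?thesis by linarith
  qed
  have "0 \<le> 16 * M\<^sup>2 * h\<^sub>c * k\<^sub>6 * e" using hc_nonneg k_nonneg se by simp
  then have vva: "\<bar>Hh v v\<bar> \<le> 16 * M\<^sup>2 * h\<^sub>c * k\<^sub>6 * e + C * (k\<^sub>7 * e)" using vv vv0 by linarith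
  have h': "\<bar>Hh \<Gamma> \<Gamma> - H \<Gamma> \<Gamma>\<bar> \<le> 4 * M * k\<^sub>g * (L + A) * L * e + \<nu> * (L * e)"
    using h nd(2) by (simp add: mult.assoc)
  have l: "\<bar>C * (\<delta> * N\<^sub>1 \<eta>) / 2\<bar> \<le> C * (C\<^sub>T * e)" using nd(3,5) by simp
  have "Hh (\<Gamma> - v) (\<Gamma> - v) + C * \<delta> / 2 * N\<^sub>1 \<eta> - H \<Gamma> \<Gamma>
      = (Hh \<Gamma> \<Gamma> - H \<Gamma> \<Gamma>) - 2 * Hh \<Gamma> v + Hh v v + C * (\<delta> * N\<^sub>1 \<eta>) / 2"
    by (simp add: hhsimps sym_Hh[of v \<Gamma>])
  also have "\<bar>\<dots>\<bar> \<le> (4 * M * k\<^sub>g * (L + A) * L * e + \<nu> * (L * e)) + 2 * (16 * M\<^sup>2 * h\<^sub>c * k\<^sub>6 * e + \<nu> * (k\<^sub>7 * e))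
      + (16 * M\<^sup>2 * h\<^sub>c * k\<^sub>6 * e + C * (k\<^sub>7 * e)) + C * (C\<^sub>T * e)"
    by (intro abs_bounds h' \<Gamma>v vva l)
  also have "\<dots> = k\<^sub>8 * e" by (simp add: k8_def algebra_simps)
  finally show ?thesis .
qed

text \<open>The error of the direction is divided by the estimated scale, and the error of the
  inverse scale multiplies \<open>\<Gamma>\<close>. From \<open>1 \<le> N\<^sub>2 \<Gamma>\<close>
  the true scale is at least \<open>2 * \<epsilon> / M\<close>, and \<open>small_k8\<close> keeps
  the estimated one above half of that. The seminorm is left open to serve both rates.\<close>

lemma column_error:
  assumes N: "seminorm N" and \<Gamma>: "1 \<le> N\<^sub>2 \<Gamma>" and v: "N v \<le> x * e" and \<Gamma>N: "N \<Gamma> \<le> y" and x: "0 \<le> x" and y: "0 \<le> y"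
  shows "N ((1 / (Hh (\<Gamma> - v) (\<Gamma> - v) + C * \<delta> / 2 * N\<^sub>1 \<eta>)) *\<^sub>R (\<Gamma> - v) - (1 / H \<Gamma> \<Gamma>) *\<^sub>R \<Gamma>)
    \<le> (M / \<epsilon> * x + (M / \<epsilon>)\<^sup>2 * k\<^sub>8 * y) * e"
proof -
  interpret N: seminorm N by (rule N)
  define s where "s = Hh (\<Gamma> - v) (\<Gamma> - v) + C * \<delta> / 2 * N\<^sub>1 \<eta>"
  define t where "t = H \<Gamma> \<Gamma>"
  define c where "c = \<epsilon> / M"
  have c: "c > 0" using eps M1 by (simp add: c_def)
  have "1 \<le> (N\<^sub>2 \<Gamma>)\<^sup>2" using \<Gamma> by simp
  then have "2 * c * 1 \<le> 2 * c * (N\<^sub>2 \<Gamma>)\<^sup>2" using c by (intro mult_left_mono) auto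
  then have t: "2 * c \<le> t" using H_lower[of \<Gamma>] by (simp add: t_def c_def)
  have st: "\<bar>s - t\<bar> \<le> k\<^sub>8 * e" unfolding s_def t_def by (rule scale_error)
  then have k8: "0 \<le> k\<^sub>8 * e" by linarith
  then have k8': "0 \<le> k\<^sub>8" using le_e by (simp add: zero_le_mult_iff)
  have "k\<^sub>8 * e \<le> k\<^sub>8 * (\<sigma> * e)" using le_e k8' by (intro mult_left_mono) auto
  also have "\<dots> \<le> c" using small_k8 eps M1 by (simp add: c_def field_simps)
  finally have s: "c \<le> s" using st t by linarith
  have inv: "\<bar>1 / s - 1 / t\<bar> \<le> (1 / c)\<^sup>2 * (k\<^sub>8 * e)"
  proof -
    have "1 / s - 1 / t = (t - s) / (s * t)" using s t c by (simp add: field_simps)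
    moreover have "c * c \<le> s * t" using s t c by (intro mult_mono) auto
    ultimately have "\<bar>1 / s - 1 / t\<bar> \<le> (k\<^sub>8 * e) / (c * c)"
      using st s t c k8 by (simp add: abs_mult abs_minus_commute) (intro frac_le, auto)
    then show ?thesis by (simp add: power2_eq_square field_simps)
  qed
  have "(1 / s) *\<^sub>R (\<Gamma> - v) - (1 / t) *\<^sub>R \<Gamma> = (1 / s - 1 / t) *\<^sub>R \<Gamma> - (1 / s) *\<^sub>R v"
    by (simp add: algebra_simps)
  also have "N \<dots> \<le> \<bar>1 / s - 1 / t\<bar> * N \<Gamma> + \<bar>1 / s\<bar> * N v"
    by (rule order_trans[OF N.triangle_diff]) (simp add: N.scale)
  also have "\<dots> \<le> (1 / c)\<^sup>2 * (k\<^sub>8 * e) * y + (1 / c) * (x * e)"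
    using inv \<Gamma>N v s c k8 y x le_e by (intro add_mono mult_mono) (auto simp: frac_le)
  also have "\<dots> = (M / \<epsilon> * x + (M / \<epsilon>)\<^sup>2 * k\<^sub>8 * y) * e"
    using eps M1 by (simp add: c_def field_simps)
  finally show ?thesis unfolding s_def t_def .
qed

end

section \<open>Concentration of quadratic forms\<close>

text \<open>Taylor with Lagrange remainder: \<open>\<bar>\<theta>\<bar> \<le> 1 / 2\<close> leaves
  at most \<open>exp (w / 2)\<close> in the remainder, and a second factor
  \<open>exp (w / 2)\<close> swallows \<open>w\<^sup>2\<close> up to the constant 8.\<close>

lemma exp_le_quadratic:
  fixes w \<theta> :: real
  assumes w: "w \<ge> 0" and \<theta>: "\<bar>\<theta>\<bar> \<le> 1 / 2"
  shows "exp (\<theta> * w) \<le> 1 + \<theta> * w + 4 * \<theta>\<^sup>2 * exp w"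
proof -
  obtain t where t: "\<bar>t\<bar> \<le> \<bar>\<theta> * w\<bar>" "exp (\<theta> * w) = (\<Sum>m<2. (\<theta> * w) ^ m / fact m) + exp t / fact 2 * (\<theta> * w)\<^sup>2"
    using Maclaurin_exp_le[of "\<theta> * w" 2] by blast
  have "\<bar>\<theta>\<bar> * w \<le> 1 / 2 * w" using \<theta> w by (intro mult_right_mono)
  then have t2: "t \<le> w / 2" using t(1) w by (simp add: abs_mult)
  have "(w / 2)\<^sup>2 / 2 \<le> exp (w / 2)" using exp_lower_Taylor_quadratic[of "w / 2"] w by simp
  then have "exp t * w\<^sup>2 \<le> exp (w / 2) * (8 * exp (w / 2))"
    using t2 by (intro mult_mono) (auto simp: power2_eq_square)
  also have "\<dots> = 8 * exp w" by (simp add: exp_add[symmetric])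
  finally have "exp t * w\<^sup>2 * (\<theta>\<^sup>2 / 2) \<le> 8 * exp w * (\<theta>\<^sup>2 / 2)" by (intro mult_right_mono) auto
  then show ?thesis unfolding t(2) by (simp add: numeral_2_eq_2 power_mult_distrib mult_ac)
qed

context prob_space
begin

text \<open>Meant for the square \<open>W\<close> of a sub-Gaussian variable, which is
  sub-exponential: its centred moment generating function is quadratic near 0. The 8 is 4 times the
  moment bound 2.\<close>

lemma exp_moment:
  fixes W :: "'a \<Rightarrow> real"
  assumes [measurable]: "W \<in> borel_measurable M" and nn: "\<And>x. x \<in> space M \<Longrightarrow> 0 \<le> W x"
    and two: "(\<integral>\<^sup>+x. ennreal (exp (W x)) \<partial>M) \<le> 2"
  shows "integrable M W" and "\<bar>\<theta>\<bar> \<le> 1 / 2 \<Longrightarrow>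
    (\<integral>\<^sup>+x. ennreal (exp (\<theta> * (W x - expectation W))) \<partial>M) \<le> ennreal (exp (8 * \<theta>\<^sup>2))"
proof -
  have ie: "integrable M (\<lambda>x. exp (W x))"
    using two by (intro integrableI_bounded) (auto simp: order_le_less_trans[of _ "2::ennreal"] less_top)
  have Ee: "expectation (\<lambda>x. exp (W x)) \<le> 2"
    using two nn_integral_eq_integral[OF ie] by (simp add: ennreal_le_iff2 flip: ennreal_numeral)
  show iW: "integrable M W"
  proof (rule Bochner_Integration.integrable_bound[OF ie])
    show "AE x in M. norm (W x) \<le> norm (exp (W x))"
    proof (rule AE_I2)
      fix x assume "x \<in> space M"
      moreover have "W x \<le> exp (W x)" using exp_ge_add_one_self[of "W x"] by linarith
      ultimately show "norm (W x) \<le> norm (exp (W x))" using nn[of x] by simp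
    qed
  qed simp
  assume \<theta>: "\<bar>\<theta>\<bar> \<le> 1 / 2"
  define \<mu> where "\<mu> = expectation W"
  have i1: "integrable M (\<lambda>x. 1 + \<theta> * W x + 4 * \<theta>\<^sup>2 * exp (W x))" using ie iW by auto
  have pos: "0 \<le> 1 + \<theta> * W x + 4 * \<theta>\<^sup>2 * exp (W x)" if "x \<in> space M" for x
    using exp_le_quadratic[OF nn[OF that] \<theta>] by (rule order_trans[rotated]) simp
  have "(\<integral>\<^sup>+x. ennreal (exp (\<theta> * (W x - \<mu>))) \<partial>M)
      = (\<integral>\<^sup>+x. ennreal (exp (- \<theta> * \<mu>)) * ennreal (exp (\<theta> * W x)) \<partial>M)"
    by (intro nn_integral_cong) (simp add: algebra_simps flip: ennreal_mult exp_add)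
  also have "\<dots> = ennreal (exp (- \<theta> * \<mu>)) * (\<integral>\<^sup>+x. ennreal (exp (\<theta> * W x)) \<partial>M)"
    by (rule nn_integral_cmult) simp
  also have "\<dots> \<le> ennreal (exp (- \<theta> * \<mu>)) * (\<integral>\<^sup>+x. ennreal (1 + \<theta> * W x + 4 * \<theta>\<^sup>2 * exp (W x)) \<partial>M)"
    by (intro mult_left_mono nn_integral_mono ennreal_leI exp_le_quadratic nn \<theta>) auto
  also have "(\<integral>\<^sup>+x. ennreal (1 + \<theta> * W x + 4 * \<theta>\<^sup>2 * exp (W x)) \<partial>M)
      = ennreal (expectation (\<lambda>x. 1 + \<theta> * W x + 4 * \<theta>\<^sup>2 * exp (W x)))"
    using i1 pos by (intro nn_integral_eq_integral) auto
  also have "expectation (\<lambda>x. 1 + \<theta> * W x + 4 * \<theta>\<^sup>2 * exp (W x))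
      = 1 + \<theta> * \<mu> + 4 * \<theta>\<^sup>2 * expectation (\<lambda>x. exp (W x))"
    using ie iW by (simp add: \<mu>_def prob_space)
  also have "ennreal (exp (- \<theta> * \<mu>)) * ennreal (1 + \<theta> * \<mu> + 4 * \<theta>\<^sup>2 * expectation (\<lambda>x. exp (W x)))
      \<le> ennreal (exp (- \<theta> * \<mu>)) * ennreal (exp (\<theta> * \<mu> + 8 * \<theta>\<^sup>2))"
  proof (intro mult_left_mono ennreal_leI)
    have "4 * \<theta>\<^sup>2 * expectation (\<lambda>x. exp (W x)) \<le> 4 * \<theta>\<^sup>2 * 2" using Ee by (intro mult_left_mono) auto
    then show "1 + \<theta> * \<mu> + 4 * \<theta>\<^sup>2 * expectation (\<lambda>x. exp (W x)) \<le> exp (\<theta> * \<mu> + 8 * \<theta>\<^sup>2)"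
      using exp_ge_add_one_self[of "\<theta> * \<mu> + 8 * \<theta>\<^sup>2"] by linarith
  qed simp
  also have "\<dots> = ennreal (exp (8 * \<theta>\<^sup>2))" by (simp flip: ennreal_mult exp_add)
  finally show "(\<integral>\<^sup>+x. ennreal (exp (\<theta> * (W x - expectation W))) \<partial>M) \<le> ennreal (exp (8 * \<theta>\<^sup>2))"
    by (simp add: \<mu>_def)
qed

lemma sample_mean_tail_one_sided:
  fixes W :: "nat \<Rightarrow> 'a \<Rightarrow> real"
  assumes ind: "indep_vars (\<lambda>_. borel) W {..<n}" and n: "n > 0"
    and nn: "\<And>i x. i < n \<Longrightarrow> x \<in> space M \<Longrightarrow> 0 \<le> W i x"
    and two: "\<And>i. i < n \<Longrightarrow> (\<integral>\<^sup>+x. ennreal (exp (W i x)) \<partial>M) \<le> 2"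
    and mean: "\<And>i. i < n \<Longrightarrow> expectation (W i) = \<mu>"
    and s: "\<bar>s\<bar> = (1::real)" and u: "0 < u" "u \<le> 8"
  shows "prob {x \<in> space M. u \<le> s * ((\<Sum>i<n. W i x) / n - \<mu>)} \<le> exp (- real n * u\<^sup>2 / 32)"
proof -
  have [measurable]: "W i \<in> borel_measurable M" if "i < n" for i
    using ind that by (auto simp: indep_vars_def)
  \<comment> \<open>The minimiser of \<open>8 * l\<^sup>2 - l * u\<close>, with value -u^2 / 32;
    \<open>u \<le> 8\<close> keeps it in the range of the moment bound.\<close>
  define l where "l = u / 16"
  have l: "l > 0" "l \<le> 1 / 2" using u by (auto simp: l_def)
  have ss: "s\<^sup>2 = 1" using s by (metis power2_abs power_one)
  have eq: "{x \<in> space M. u \<le> s * ((\<Sum>i<n. W i x) / n - \<mu>)} = {x \<in> space M. n * u \<le> (\<Sum>i<n. s * (W i x - \<mu>))}"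
    using n by (intro Collect_cong) (auto simp: field_simps sum_distrib_left sum_subtractf)
  have "ennreal (prob {x \<in> space M. u \<le> s * ((\<Sum>i<n. W i x) / n - \<mu>)}) =
     emeasure M {x \<in> space M. n * u \<le> (\<Sum>i<n. s * (W i x - \<mu>))}"
    unfolding eq by (simp add: emeasure_eq_measure)
  also have "\<dots> \<le> ennreal (exp (- l * (n * u))) * (\<integral>\<^sup>+x\<in>space M. exp (l * (\<Sum>i<n. s * (W i x - \<mu>))) \<partial>M)"
    by (intro Chernoff_ineq_nn_integral_ge l) auto
  also have "(\<integral>\<^sup>+x\<in>space M. exp (l * (\<Sum>i<n. s * (W i x - \<mu>))) \<partial>M) =
     (\<integral>\<^sup>+x. (\<Prod>i<n. ennreal (exp (l * s * (W i x - \<mu>)))) \<partial>M)"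
    by (intro nn_integral_cong) (simp_all add: sum_distrib_left exp_sum prod_ennreal mult.assoc)
  also have "\<dots> = (\<Prod>i<n. \<integral>\<^sup>+x. ennreal (exp (l * s * (W i x - \<mu>))) \<partial>M)"
    by (intro indep_vars_nn_integral indep_vars_compose2[OF ind]) auto
  also have "ennreal (exp (- l * (n * u))) * \<dots> \<le> ennreal (exp (- l * (n * u))) * (\<Prod>i<n. ennreal (exp (8 * l\<^sup>2)))"
  proof (intro mult_left_mono prod_mono_ennreal)
    fix i assume i: "i \<in> {..<n}"
    have "(\<integral>\<^sup>+x. ennreal (exp (l * s * (W i x - expectation (W i)))) \<partial>M) \<le> ennreal (exp (8 * (l * s)\<^sup>2))"
      by (rule exp_moment(2)) (use i nn two l s in \<open>auto simp: abs_mult\<close>)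
    then show "(\<integral>\<^sup>+x. ennreal (exp (l * s * (W i x - \<mu>))) \<partial>M) \<le> ennreal (exp (8 * l\<^sup>2))"
      using mean i ss by (simp add: power_mult_distrib)
  qed auto
  also have "\<dots> = ennreal (exp (- l * (n * u)) * exp (n * (8 * l\<^sup>2)))"
    by (simp add: ennreal_power exp_of_nat_mult flip: ennreal_mult)
  also have "exp (- l * (n * u)) * exp (n * (8 * l\<^sup>2)) = exp (- real n * u\<^sup>2 / 32)"
    by (simp add: l_def power2_eq_square field_simps flip: exp_add)
  finally show ?thesis by (subst (asm) ennreal_le_iff) auto
qed

lemma sample_mean_tail:
  fixes W :: "nat \<Rightarrow> 'a \<Rightarrow> real"
  assumes ind: "indep_vars (\<lambda>_. borel) W {..<n}" and n: "n > 0"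
    and nn: "\<And>i x. i < n \<Longrightarrow> x \<in> space M \<Longrightarrow> 0 \<le> W i x"
    and two: "\<And>i. i < n \<Longrightarrow> (\<integral>\<^sup>+x. ennreal (exp (W i x)) \<partial>M) \<le> 2"
    and mean: "\<And>i. i < n \<Longrightarrow> expectation (W i) = \<mu>"
    and u: "0 < u" "u \<le> 8"
  shows "prob {x \<in> space M. u \<le> \<bar>(\<Sum>i<n. W i x) / n - \<mu>\<bar>} \<le> 2 * exp (- real n * u\<^sup>2 / 32)"
proof -
  have [measurable]: "W i \<in> borel_measurable M" if "i < n" for i
    using ind that by (auto simp: indep_vars_def)
  have eq: "{x \<in> space M. u \<le> \<bar>(\<Sum>i<n. W i x) / n - \<mu>\<bar>} =
     {x \<in> space M. u \<le> 1 * ((\<Sum>i<n. W i x) / n - \<mu>)} \<union> {x \<in> space M. u \<le> - 1 * ((\<Sum>i<n. W i x) / n - \<mu>)}"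
    by (auto simp: abs_real_def)
  have "prob {x \<in> space M. u \<le> \<bar>(\<Sum>i<n. W i x) / n - \<mu>\<bar>} \<le> prob {x \<in> space M. u \<le> 1 * ((\<Sum>i<n. W i x) / n - \<mu>)}
      + prob {x \<in> space M. u \<le> - 1 * ((\<Sum>i<n. W i x) / n - \<mu>)}"
    unfolding eq by (rule measure_Un_le) auto
  also have "\<dots> \<le> exp (- real n * u\<^sup>2 / 32) + exp (- real n * u\<^sup>2 / 32)"
  proof (rule add_mono)
    show "prob {x \<in> space M. u \<le> 1 * ((\<Sum>i<n. W i x) / n - \<mu>)} \<le> exp (- real n * u\<^sup>2 / 32)"
      by (rule sample_mean_tail_one_sided; (fact ind n nn two mean u | simp))
    show "prob {x \<in> space M. u \<le> - 1 * ((\<Sum>i<n. W i x) / n - \<mu>)} \<le> exp (- real n * u\<^sup>2 / 32)"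
      by (rule sample_mean_tail_one_sided; (fact ind n nn two mean u | simp))
  qed
  finally show ?thesis by simp
qed

end

section \<open>Empirical covariance forms along fixed vectors\<close>

definition lform :: "nat \<Rightarrow> (nat \<Rightarrow> real) \<Rightarrow> (nat \<Rightarrow> real) \<Rightarrow> real" where
  "lform d u z = (\<Sum>k<d. u k * z k)"

definition bform :: "nat \<Rightarrow> (nat \<Rightarrow> nat \<Rightarrow> real) \<Rightarrow> (nat \<Rightarrow> real) \<Rightarrow> (nat \<Rightarrow> real) \<Rightarrow> real" where
  "bform d g u v = (\<Sum>i<d. \<Sum>j<d. u i * g i j * v j)"

lemma bform_outer: "bform d (\<lambda>i j. z i * z j) u v = lform d u z * lform d v z"
  unfolding bform_def lform_def sum_product by (intro sum.cong) (auto simp: mult_ac)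

lemma bform_sum: "bform d (\<lambda>i j. \<Sum>l\<in>A. g l i j) u v = (\<Sum>l\<in>A. bform d (g l) u v)"
proof -
  have "bform d (\<lambda>i j. \<Sum>l\<in>A. g l i j) u v = (\<Sum>i<d. \<Sum>j<d. \<Sum>l\<in>A. u i * g l i j * v j)"
    by (simp add: bform_def sum_distrib_left sum_distrib_right)
  also have "\<dots> = (\<Sum>i<d. \<Sum>l\<in>A. \<Sum>j<d. u i * g l i j * v j)" by (intro sum.cong sum.swap refl)
  also have "\<dots> = (\<Sum>l\<in>A. bform d (g l) u v)" unfolding bform_def by (rule sum.swap)
  finally show ?thesis .
qed

lemma bform_diff: "bform d (\<lambda>i j. g i j - h i j) u v = bform d g u v - bform d h u v"
  by (simp add: bform_def algebra_simps sum_subtractf)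

lemma bform_divide: "bform d (\<lambda>i j. g i j / c) u v = bform d g u v / c"
  by (simp add: bform_def sum_divide_distrib)

lemma lform_scale: "lform d (\<lambda>k. c * u k) z = c * lform d u z"
  by (simp add: lform_def sum_distrib_left mult_ac)

lemma lform_zero: "(\<Sum>k<d. (u k)\<^sup>2) = 0 \<Longrightarrow> lform d u z = 0"
  by (simp add: lform_def sum_nonneg_eq_0_iff)

lemma lform_measurable: "lform d u \<in> borel_measurable (coord_space d)"
  unfolding lform_def coord_space_def by measurable

text \<open>\<open>subgauss\<close> is the exponential moment at one scale \<open>T\<close>, uniform
  over the unit ball, in place of a bound on the norm as an infimum over scales.\<close>

locale iid_vectors = prob_space P for P :: "'w measure" +
  fixes d n :: nat and Z\<^sub>0 :: "'w \<Rightarrow> nat \<Rightarrow> real" and Z :: "nat \<Rightarrow> 'w \<Rightarrow> nat \<Rightarrow> real" and T :: real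
  assumes n: "n > 0" and T: "T > 0"
    and ind: "indep_vars (\<lambda>_. coord_space d) Z {..<n}"
    and Z0: "Z\<^sub>0 \<in> measurable P (coord_space d)"
    and ident: "\<And>i. i < n \<Longrightarrow> distr P (coord_space d) (Z i) = distr P (coord_space d) Z\<^sub>0"
    and subgauss: "\<And>u. (\<Sum>k<d. (u k)\<^sup>2) \<le> 1 \<Longrightarrow> (\<integral>\<^sup>+\<omega>. ennreal (exp ((lform d u (Z\<^sub>0 \<omega>) / T)\<^sup>2)) \<partial>P) \<le> 2"
begin

text \<open>Uncentred second moments: they are covariances because the population is centred, and
  the empirical version is not recentred either.\<close>

definition "cov i j = expectation (\<lambda>\<omega>. Z\<^sub>0 \<omega> i * Z\<^sub>0 \<omega> j)"

definition "dev \<omega> i j = (\<Sum>l<n. Z l \<omega> i * Z l \<omega> j) / n - cov i j"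

lemma Zm: "i < n \<Longrightarrow> Z i \<in> measurable P (coord_space d)"
  using ind by (auto simp: indep_vars_def)

lemma lform_rv [measurable]: "(\<lambda>\<omega>. lform d u (Z\<^sub>0 \<omega>)) \<in> borel_measurable P"
  using measurable_compose[OF Z0 lform_measurable] .

lemma lform_rv' [measurable]: "i < n \<Longrightarrow> (\<lambda>\<omega>. lform d u (Z i \<omega>)) \<in> borel_measurable P"
  using measurable_compose[OF Zm lform_measurable] .

lemma integrable_lform_sq: "integrable P (\<lambda>\<omega>. (lform d u (Z\<^sub>0 \<omega>))\<^sup>2)"
proof (cases "(\<Sum>k<d. (u k)\<^sup>2) = 0")
  case True
  then show ?thesis by (simp add: lform_zero)
next
  case False
  define s where "s = sqrt (\<Sum>k<d. (u k)\<^sup>2)"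
  have s: "s > 0" using False by (simp add: s_def sum_nonneg less_le)
  have "(\<Sum>k<d. (u k / s)\<^sup>2) = (\<Sum>k<d. (u k)\<^sup>2) / s\<^sup>2" by (simp add: power_divide sum_divide_distrib)
  also have "\<dots> = 1" using s False by (simp add: s_def sum_nonneg)
  finally have 1: "(\<Sum>k<d. (u k / s)\<^sup>2) \<le> 1" by simp
  have "integrable P (\<lambda>\<omega>. (lform d (\<lambda>k. u k / s) (Z\<^sub>0 \<omega>) / T)\<^sup>2)"
    by (rule exp_moment(1)) (use subgauss[OF 1] in auto)
  then have "integrable P (\<lambda>\<omega>. (s * T)\<^sup>2 * (lform d (\<lambda>k. u k / s) (Z\<^sub>0 \<omega>) / T)\<^sup>2)" by simp
  also have "(\<lambda>\<omega>. (s * T)\<^sup>2 * (lform d (\<lambda>k. u k / s) (Z\<^sub>0 \<omega>) / T)\<^sup>2) = (\<lambda>\<omega>. (lform d u (Z\<^sub>0 \<omega>))\<^sup>2)"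
    using lform_scale[of d "1 / s" u] s T by (auto simp: power_mult_distrib power_divide)
  finally show ?thesis .
qed

lemma integrable_lform_mult: "integrable P (\<lambda>\<omega>. lform d u (Z\<^sub>0 \<omega>) * lform d v (Z\<^sub>0 \<omega>))"
proof (rule Bochner_Integration.integrable_bound)
  show "integrable P (\<lambda>\<omega>. (lform d u (Z\<^sub>0 \<omega>))\<^sup>2 + (lform d v (Z\<^sub>0 \<omega>))\<^sup>2)"
    by (intro Bochner_Integration.integrable_add integrable_lform_sq)
  show "AE \<omega> in P. norm (lform d u (Z\<^sub>0 \<omega>) * lform d v (Z\<^sub>0 \<omega>)) \<le> norm ((lform d u (Z\<^sub>0 \<omega>))\<^sup>2 + (lform d v (Z\<^sub>0 \<omega>))\<^sup>2)"
  proof (rule AE_I2)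
    fix \<omega>
    have "2 * (\<bar>x\<bar> * \<bar>y\<bar>) \<le> x\<^sup>2 + y\<^sup>2" for x y :: real
      using sum_squares_bound[of "\<bar>x\<bar>" "\<bar>y\<bar>"] by simp
    then have "\<bar>x\<bar> * \<bar>y\<bar> \<le> x\<^sup>2 + y\<^sup>2" for x y :: real
      by (rule order_trans[rotated]) simp
    then show "norm (lform d u (Z\<^sub>0 \<omega>) * lform d v (Z\<^sub>0 \<omega>)) \<le> norm ((lform d u (Z\<^sub>0 \<omega>))\<^sup>2 + (lform d v (Z\<^sub>0 \<omega>))\<^sup>2)"
      by (simp add: abs_mult)
  qed
qed simp

lemma lform_unit: "i < d \<Longrightarrow> lform d (\<lambda>k. if k = i then 1 else 0) z = z i"
  by (simp add: lform_def if_distrib[of "\<lambda>x. x * _"] cong: if_cong)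

lemma integrable_coord_mult: "i < d \<Longrightarrow> j < d \<Longrightarrow> integrable P (\<lambda>\<omega>. Z\<^sub>0 \<omega> i * Z\<^sub>0 \<omega> j)"
  using integrable_lform_mult[of "\<lambda>k. if k = i then 1 else 0" "\<lambda>k. if k = j then 1 else 0"]
  by (simp add: lform_unit)

lemma bform_cov: "bform d cov u v = expectation (\<lambda>\<omega>. lform d u (Z\<^sub>0 \<omega>) * lform d v (Z\<^sub>0 \<omega>))"
proof -
  have int: "integrable P (\<lambda>\<omega>. u i * (Z\<^sub>0 \<omega> i * Z\<^sub>0 \<omega> j) * v j)" if "i < d" "j < d" for i j
    using integrable_coord_mult[OF that] by simp
  have "bform d cov u v = (\<Sum>i<d. \<Sum>j<d. expectation (\<lambda>\<omega>. u i * (Z\<^sub>0 \<omega> i * Z\<^sub>0 \<omega> j) * v j))"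
    unfolding bform_def cov_def by simp
  also have "\<dots> = (\<Sum>i<d. expectation (\<lambda>\<omega>. \<Sum>j<d. u i * (Z\<^sub>0 \<omega> i * Z\<^sub>0 \<omega> j) * v j))"
    by (intro sum.cong refl Bochner_Integration.integral_sum[symmetric] int) auto
  also have "\<dots> = expectation (\<lambda>\<omega>. bform d (\<lambda>i j. Z\<^sub>0 \<omega> i * Z\<^sub>0 \<omega> j) u v)"
    unfolding bform_def
    by (intro Bochner_Integration.integral_sum[symmetric] Bochner_Integration.integrable_sum int) auto
  finally show ?thesis by (simp add: bform_outer)
qed

lemma bform_dev: "bform d (dev \<omega>) u v = (\<Sum>l<n. lform d u (Z l \<omega>) * lform d v (Z l \<omega>)) / n - bform d cov u v"
  unfolding dev_def by (simp add: bform_diff bform_divide bform_sum bform_outer)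

text \<open>After scaling \<open>u\<close> to length 1, the deviation form is a centred sample mean
  of squares \<open>f (Z l \<omega>)\<close>. The event is strict so that it is empty for vectors
  vanishing on the first \<open>d\<close> coordinates.\<close>

lemma quadratic_tail:
  assumes t: "0 < t" "t \<le> 8"
  shows "{\<omega> \<in> space P. t * T\<^sup>2 * (\<Sum>k<d. (u k)\<^sup>2) < \<bar>bform d (dev \<omega>) u u\<bar>} \<in> events"
    and "prob {\<omega> \<in> space P. t * T\<^sup>2 * (\<Sum>k<d. (u k)\<^sup>2) < \<bar>bform d (dev \<omega>) u u\<bar>} \<le> 2 * exp (- real n * t\<^sup>2 / 32)"
proof -
  show m: "{\<omega> \<in> space P. t * T\<^sup>2 * (\<Sum>k<d. (u k)\<^sup>2) < \<bar>bform d (dev \<omega>) u u\<bar>} \<in> events"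
    unfolding bform_dev by measurable
  show "prob {\<omega> \<in> space P. t * T\<^sup>2 * (\<Sum>k<d. (u k)\<^sup>2) < \<bar>bform d (dev \<omega>) u u\<bar>} \<le> 2 * exp (- real n * t\<^sup>2 / 32)"
  proof (cases "(\<Sum>k<d. (u k)\<^sup>2) = 0")
    case True
    then have "bform d (dev \<omega>) u u = 0" for \<omega> unfolding bform_dev bform_cov by (simp add: lform_zero)
    then show ?thesis using True by simp
  next
    case False
    define s where "s = sqrt (\<Sum>k<d. (u k)\<^sup>2)"
    have s: "s > 0" "s\<^sup>2 = (\<Sum>k<d. (u k)\<^sup>2)" using False by (simp_all add: s_def sum_nonneg less_le)
    define w where "w k = u k / s" for k
    have "(\<Sum>k<d. (w k)\<^sup>2) = (\<Sum>k<d. (u k)\<^sup>2) / s\<^sup>2" by (simp add: w_def power_divide sum_divide_distrib)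
    then have 1: "(\<Sum>k<d. (w k)\<^sup>2) \<le> 1" using s False by simp
    define f where "f z = (lform d w z / T)\<^sup>2" for z
    have f: "f \<in> borel_measurable (coord_space d)"
      unfolding f_def using lform_measurable[of d w] by measurable
    have lu: "lform d u z = s * lform d w z" for z
      using lform_scale[of d s w z] s by (simp add: w_def)
    have fs: "(lform d u z)\<^sup>2 = s\<^sup>2 * T\<^sup>2 * f z" for z
      using T by (simp add: f_def lu power_mult_distrib power_divide)
    have transfer: "(\<integral>\<^sup>+x. ennreal (exp (f (Z i x))) \<partial>P) = (\<integral>\<^sup>+x. ennreal (exp (f (Z\<^sub>0 x))) \<partial>P)"
      "expectation (\<lambda>x. f (Z i x)) = expectation (\<lambda>x. f (Z\<^sub>0 x))" if "i < n" for i
    proof -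
      have "(\<integral>\<^sup>+x. ennreal (exp (f (Z i x))) \<partial>P) = (\<integral>\<^sup>+z. ennreal (exp (f z)) \<partial>distr P (coord_space d) (Z i))"
        using Zm[OF that] f by (subst nn_integral_distr) auto
      also have "\<dots> = (\<integral>\<^sup>+x. ennreal (exp (f (Z\<^sub>0 x))) \<partial>P)"
        unfolding ident[OF that] using Z0 f by (subst nn_integral_distr) auto
      finally show "(\<integral>\<^sup>+x. ennreal (exp (f (Z i x))) \<partial>P) = (\<integral>\<^sup>+x. ennreal (exp (f (Z\<^sub>0 x))) \<partial>P)" .
      have "expectation (\<lambda>x. f (Z i x)) = (\<integral>z. f z \<partial>distr P (coord_space d) (Z i))"
        using Zm[OF that] f by (subst integral_distr) auto
      also have "\<dots> = expectation (\<lambda>x. f (Z\<^sub>0 x))"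
        unfolding ident[OF that] using Z0 f by (subst integral_distr) auto
      finally show "expectation (\<lambda>x. f (Z i x)) = expectation (\<lambda>x. f (Z\<^sub>0 x))" .
    qed
    have two: "(\<integral>\<^sup>+x. ennreal (exp (f (Z\<^sub>0 x))) \<partial>P) \<le> 2" unfolding f_def by (rule subgauss[OF 1])
    have c: "bform d cov u u = s\<^sup>2 * T\<^sup>2 * expectation (\<lambda>x. f (Z\<^sub>0 x))"
      unfolding bform_cov power2_eq_square[symmetric] fs by simp
    have d: "bform d (dev \<omega>) u u = s\<^sup>2 * T\<^sup>2 * ((\<Sum>l<n. f (Z l \<omega>)) / n - expectation (\<lambda>x. f (Z\<^sub>0 x)))" for \<omega>
      unfolding bform_dev c power2_eq_square[symmetric] fs by (simp add: sum_distrib_left algebra_simps)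
    have "prob {\<omega> \<in> space P. t * T\<^sup>2 * (\<Sum>k<d. (u k)\<^sup>2) < \<bar>bform d (dev \<omega>) u u\<bar>}
       \<le> prob {\<omega> \<in> space P. t \<le> \<bar>(\<Sum>l<n. f (Z l \<omega>)) / n - expectation (\<lambda>x. f (Z\<^sub>0 x))\<bar>}"
    proof (rule finite_measure_mono)
      have pos: "s\<^sup>2 * T\<^sup>2 > 0" using s(1) T by simp
      have "t \<le> y" if "t * T\<^sup>2 * s\<^sup>2 < \<bar>s\<^sup>2 * T\<^sup>2\<bar> * y" for y
      proof -
        have "(s\<^sup>2 * T\<^sup>2) * t < (s\<^sup>2 * T\<^sup>2) * y" using that by (simp add: mult_ac)
        then show ?thesis using pos by (simp only: mult_less_cancel_left_pos)
      qed
      then show "{\<omega> \<in> space P. t * T\<^sup>2 * (\<Sum>k<d. (u k)\<^sup>2) < \<bar>bform d (dev \<omega>) u u\<bar>}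
         \<subseteq> {\<omega> \<in> space P. t \<le> \<bar>(\<Sum>l<n. f (Z l \<omega>)) / n - expectation (\<lambda>x. f (Z\<^sub>0 x))\<bar>}"
        unfolding s(2)[symmetric] d abs_mult[of "s\<^sup>2 * T\<^sup>2"] by blast
      have [measurable]: "(\<lambda>\<omega>. f (Z l \<omega>)) \<in> borel_measurable P" if "l < n" for l
        using measurable_compose[OF Zm[OF that] f] .
      show "{\<omega> \<in> space P. t \<le> \<bar>(\<Sum>l<n. f (Z l \<omega>)) / n - expectation (\<lambda>x. f (Z\<^sub>0 x))\<bar>} \<in> events"
        by measurable
    qed
    also have "\<dots> \<le> 2 * exp (- real n * t\<^sup>2 / 32)"
      by (rule sample_mean_tail[OF indep_vars_compose2[OF ind f] n])
         (use transfer two t in \<open>auto simp: f_def\<close>)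
    finally show ?thesis .
  qed
qed

lemma quadratic_deviation:
  assumes F: "finite F" and t: "0 < t" "t \<le> 8"
  obtains X where "X \<in> events" "prob X \<le> card F * (2 * exp (- real n * t\<^sup>2 / 32))"
    "\<And>\<omega> u. \<omega> \<in> space P - X \<Longrightarrow> u \<in> F \<Longrightarrow> \<bar>bform d (dev \<omega>) u u\<bar> \<le> t * T\<^sup>2 * (\<Sum>k<d. (u k)\<^sup>2)"
proof -
  define Y where "Y u = {\<omega> \<in> space P. t * T\<^sup>2 * (\<Sum>k<d. (u k)\<^sup>2) < \<bar>bform d (dev \<omega>) u u\<bar>}" for u
  have Y: "Y u \<in> events" "prob (Y u) \<le> 2 * exp (- real n * t\<^sup>2 / 32)" for u
    unfolding Y_def using quadratic_tail[OF t] by auto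
  have "prob (\<Union>u\<in>F. Y u) \<le> (\<Sum>u\<in>F. prob (Y u))"
    using F Y by (intro finite_measure_subadditive_finite) auto
  also have "\<dots> \<le> (\<Sum>u\<in>F. 2 * exp (- real n * t\<^sup>2 / 32))" by (intro sum_mono Y)
  finally have "prob (\<Union>u\<in>F. Y u) \<le> card F * (2 * exp (- real n * t\<^sup>2 / 32))" by simp
  moreover have "(\<Union>u\<in>F. Y u) \<in> events" using F Y by auto
  ultimately show ?thesis
    by (intro that[of "\<Union>u\<in>F. Y u"]) (auto simp: Y_def not_less)
qed

end

section \<open>Vectors as functions\<close>

text \<open>Vectors of every dimension live in one type of functions on the natural numbers, since
  the dimension varies with the sample size; the abstract locales ask for a real vector
  space.\<close>

instantiation "fun" :: (type, real_vector) real_vector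
begin

definition "c *\<^sub>R f = (\<lambda>x. c *\<^sub>R f x)"

instance
  by standard (simp_all add: scaleR_fun_def fun_eq_iff scaleR_add_right scaleR_add_left)

end

lemma scaleR_fun_apply [simp]: "(c *\<^sub>R f) x = c *\<^sub>R f x"
  by (simp add: scaleR_fun_def)

lemma sum_fun_apply: "(\<Sum>k\<in>A. f k) x = (\<Sum>k\<in>A. f k x)"
  by (induction A rule: infinite_finite_induct) auto

definition n1 :: "nat \<Rightarrow> (nat \<Rightarrow> real) \<Rightarrow> real" where
  "n1 d u = (\<Sum>k<d. \<bar>u k\<bar>)"

definition n2 :: "nat \<Rightarrow> (nat \<Rightarrow> real) \<Rightarrow> real" where
  "n2 d u = L2_set u {..<d}"

lemma n2_sq: "(n2 d u)\<^sup>2 = (\<Sum>k<d. (u k)\<^sup>2)"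
  by (simp add: n2_def L2_set_def sum_nonneg)

lemma seminorm_n1: "seminorm (n1 d)"
proof
  show "n1 d (u + v) \<le> n1 d u + n1 d v" for u v
    unfolding n1_def sum.distrib[symmetric] by (intro sum_mono) simp
  show "n1 d (c *\<^sub>R u) = \<bar>c\<bar> * n1 d u" for c u
    by (simp add: n1_def abs_mult sum_distrib_left)
qed

lemma seminorm_n2: "seminorm (n2 d)"
proof
  show "n2 d (u + v) \<le> n2 d u + n2 d v" for u v
    using L2_set_triangle_ineq[of u v "{..<d}"] by (simp add: n2_def plus_fun_def)
  show "n2 d (c *\<^sub>R u) = \<bar>c\<bar> * n2 d u" for c u
  proof -
    have "n2 d (c *\<^sub>R u) = sqrt (c\<^sup>2 * (\<Sum>k<d. (u k)\<^sup>2))"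
      by (simp add: n2_def L2_set_def power_mult_distrib sum_distrib_left)
    then show ?thesis by (simp add: n2_def L2_set_def real_sqrt_mult)
  qed
qed

text \<open>Cauchy-Schwarz against the constant 1 on the support.\<close>

lemma n1_le_n2:
  assumes "S \<subseteq> {..<d}" "card S \<le> s" "\<And>k. k < d \<Longrightarrow> k \<notin> S \<Longrightarrow> u k = 0"
  shows "n1 d u \<le> sqrt s * n2 d u"
proof -
  have "n1 d u = (\<Sum>k\<in>S. \<bar>u k\<bar> * \<bar>1\<bar>)"
    unfolding n1_def using assms by (intro sum.mono_neutral_cong_right) auto
  also have "\<dots> \<le> L2_set u S * L2_set (\<lambda>_. 1) S" by (rule L2_set_mult_ineq)
  also have "\<dots> \<le> n2 d u * sqrt s"
  proof (rule mult_mono)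
    show "L2_set u S \<le> n2 d u" unfolding n2_def L2_set_def
      using assms by (intro real_sqrt_le_mono sum_mono2) auto
    show "L2_set (\<lambda>_. 1) S \<le> sqrt s" unfolding L2_set_def using assms(2) by simp
  qed (auto simp: n2_def)
  finally show ?thesis by (simp add: mult.commute)
qed

definition unit :: "nat \<Rightarrow> nat \<Rightarrow> real" where
  "unit i = (\<lambda>k. if k = i then 1 else 0)"

lemma bilinear_bform: "bilinear (bform d g)"
  unfolding bilinear_def bform_def
  by (auto intro!: linearI simp: algebra_simps sum.distrib sum_distrib_left)

lemma bform_sym: "(\<And>i j. i < d \<Longrightarrow> j < d \<Longrightarrow> g i j = g j i) \<Longrightarrow> bform d g u v = bform d g v u"
  unfolding bform_def by (subst sum.swap) (auto intro!: sum.cong)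

lemma bform_cong: "(\<And>i. i < d \<Longrightarrow> u i = u' i) \<Longrightarrow> (\<And>i. i < d \<Longrightarrow> v i = v' i) \<Longrightarrow>
   (\<And>i j. i < d \<Longrightarrow> j < d \<Longrightarrow> g i j = g' i j) \<Longrightarrow> bform d g u v = bform d g' u' v'"
  unfolding bform_def by (intro sum.cong) auto

lemma bform_unit_left: "i < d \<Longrightarrow> bform d g (unit i) v = (\<Sum>k<d. g i k * v k)"
proof -
  assume i: "i < d"
  have "bform d g (unit i) v = (\<Sum>l<d. if l = i then \<Sum>k<d. g l k * v k else 0)"
    unfolding bform_def unit_def by (intro sum.cong) auto
  then show ?thesis using i by simp
qed

lemma bform_unit_right: "j < d \<Longrightarrow> bform d g u (unit j) = (\<Sum>k<d. u k * g k j)"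
proof -
  assume j: "j < d"
  have "bform d g u (unit j) = (\<Sum>l<d. \<Sum>k<d. if k = j then u l * g l k else 0)"
    unfolding bform_def unit_def by (intro sum.cong) auto
  then show ?thesis using j by simp
qed

lemma bform_unit_unit: "i < d \<Longrightarrow> j < d \<Longrightarrow> bform d g (unit i) (unit j) = g i j"
proof -
  assume ij: "i < d" "j < d"
  have "(\<Sum>k<d. g i k * unit j k) = (\<Sum>k<d. if k = j then g i k else 0)"
    unfolding unit_def by (intro sum.cong) auto
  then show ?thesis using ij by (simp add: bform_unit_left)
qed

lemma bform_abs_le:
  assumes "\<And>i j. i < d \<Longrightarrow> j < d \<Longrightarrow> \<bar>g i j\<bar> \<le> c"
  shows "\<bar>bform d g u v\<bar> \<le> c * (n1 d u * n1 d v)"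
proof -
  have "\<bar>bform d g u v\<bar> \<le> (\<Sum>i<d. \<Sum>j<d. \<bar>u i * g i j * v j\<bar>)"
    unfolding bform_def by (intro order_trans[OF sum_abs] sum_mono order_trans[OF sum_abs]) auto
  also have "\<dots> \<le> (\<Sum>i<d. \<Sum>j<d. \<bar>u i\<bar> * c * \<bar>v j\<bar>)"
    unfolding abs_mult by (intro sum_mono mult_right_mono mult_left_mono assms) auto
  also have "\<dots> = c * (n1 d u * n1 d v)"
    unfolding n1_def sum_product by (simp add: sum_distrib_left mult_ac)
  finally show ?thesis .
qed

text \<open>Hoelder's inequality with \<open>u\<close> held fixed, so that the l1 norm of
  \<open>u\<close> does not enter. This is the gain from controlling deviations along fixed vectors
  and not just entrywise.\<close>

lemma bform_abs_le_left:
  assumes "\<And>i. i < d \<Longrightarrow> \<bar>bform d g u (unit i)\<bar> \<le> c"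
  shows "\<bar>bform d g u v\<bar> \<le> c * n1 d v"
proof -
  have "bform d g u v = (\<Sum>j<d. bform d g u (unit j) * v j)"
    unfolding bform_def[of d g u v] by (subst sum.swap) (auto simp: bform_unit_right sum_distrib_right intro!: sum.cong)
  also have "\<bar>\<dots>\<bar> \<le> (\<Sum>j<d. c * \<bar>v j\<bar>)"
    by (intro order_trans[OF sum_abs] sum_mono) (auto simp: abs_mult intro!: mult_right_mono assms)
  finally show ?thesis by (simp add: n1_def sum_distrib_left)
qed


section \<open>From sums of few coordinate vectors to all vectors\<close>

text \<open>
  The empirical method of Maurey, derandomised: the average of \<open>Q\<close> over a random next atom
  exceeds \<open>Q\<close> at the mean only by the variance term, so some atom does no worse.
\<close>

lemma maurey_step:
  fixes Q :: "'a::real_vector \<Rightarrow> 'a \<Rightarrow> real" and x :: "'i \<Rightarrow> 'a"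
  assumes Q: "bilinear Q" and sym: "\<And>u v. Q u v = Q v u"
    and I: "finite I" and p: "\<And>i. i \<in> I \<Longrightarrow> p i \<ge> 0" "(\<Sum>i\<in>I. p i) = 1"
    and \<mu>: "\<mu> = (\<Sum>i\<in>I. p i *\<^sub>R x i)"
  obtains i where "i \<in> I" "Q (y + x i) (y + x i) \<le> Q (y + \<mu>) (y + \<mu>) + ((\<Sum>i\<in>I. p i * Q (x i) (x i)) - Q \<mu> \<mu>)"
proof -
  note bs = bilinear_ladd[OF Q] bilinear_radd[OF Q] bilinear_rmul[OF Q]
  define D where "D = (\<Sum>i\<in>I. p i * Q (x i) (x i))"
  define c where "c = Q (y + \<mu>) (y + \<mu>) + (D - Q \<mu> \<mu>)"
  have "linear (Q y)" using Q by (simp add: bilinear_def)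
  then have y\<mu>: "Q y \<mu> = (\<Sum>i\<in>I. p i * Q y (x i))"
    unfolding \<mu> by (simp add: linear_sum linear_cmul)
  have e: "Q (y + z) (y + z) = Q y y + 2 * Q y z + Q z z" for z
    using sym[of z y] by (simp add: bs)
  have "(\<Sum>i\<in>I. p i * Q (y + x i) (y + x i)) = (\<Sum>i\<in>I. p i) * Q y y + 2 * (\<Sum>i\<in>I. p i * Q y (x i)) + D"
    by (simp add: e D_def sum_distrib_left sum_distrib_right algebra_simps sum.distrib)
  also have "\<dots> = c" by (simp add: c_def e p y\<mu>)
  finally have avg: "(\<Sum>i\<in>I. p i * Q (y + x i) (y + x i)) = c" .
  have "\<exists>i\<in>I. Q (y + x i) (y + x i) \<le> c"
  proof (rule ccontr)
    assume "\<not> ?thesis"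
    then have gt: "\<And>i. i \<in> I \<Longrightarrow> c < Q (y + x i) (y + x i)" by auto
    have "\<exists>i\<in>I. p i > 0"
    proof (rule ccontr)
      assume "\<not> ?thesis"
      then have "p i = 0" if "i \<in> I" for i using that p(1)[OF that] by force
      then show False using p(2) by simp
    qed
    then obtain i0 where i0: "i0 \<in> I" "p i0 > 0" by blast
    have "(\<Sum>i\<in>I. p i * c) < (\<Sum>i\<in>I. p i * Q (y + x i) (y + x i))"
    proof (rule sum_strict_mono_ex1[OF I])
      show "\<forall>i\<in>I. p i * c \<le> p i * Q (y + x i) (y + x i)"
        by (intro ballI mult_left_mono[OF less_imp_le[OF gt] p(1)])
      show "\<exists>i\<in>I. p i * c < p i * Q (y + x i) (y + x i)"
        using i0 gt by (intro bexI[of _ i0] mult_strict_left_mono)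
    qed
    then show False using avg p by (simp add: sum_distrib_right[symmetric])
  qed
  then show ?thesis using that by (auto simp: c_def D_def)
qed

text \<open>Iterates \<open>maurey_step\<close>: the shift \<open>u\<close> carries the atoms
  already chosen, the remaining steps are still taken by the mean, and the variance term is paid
  once per step.\<close>

lemma maurey:
  fixes Q :: "'a::real_vector \<Rightarrow> 'a \<Rightarrow> real" and x :: "'i \<Rightarrow> 'a"
  assumes Q: "bilinear Q" and sym: "\<And>u v. Q u v = Q v u"
    and I: "finite I" and p: "\<And>i. i \<in> I \<Longrightarrow> p i \<ge> 0" "(\<Sum>i\<in>I. p i) = 1"
    and \<mu>: "\<mu> = (\<Sum>i\<in>I. p i *\<^sub>R x i)"
  shows "\<exists>xs. set xs \<subseteq> I \<and> length xs = k \<and>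
    Q (u + sum_list (map x xs)) (u + sum_list (map x xs))
      \<le> Q (u + real k *\<^sub>R \<mu>) (u + real k *\<^sub>R \<mu>) + k * ((\<Sum>i\<in>I. p i * Q (x i) (x i)) - Q \<mu> \<mu>)"
proof (induction k arbitrary: u)
  case 0
  then show ?case by auto
next
  case (Suc k)
  define y where "y = u + real k *\<^sub>R \<mu>"
  obtain i where i: "i \<in> I" "Q (y + x i) (y + x i) \<le> Q (y + \<mu>) (y + \<mu>) + ((\<Sum>i\<in>I. p i * Q (x i) (x i)) - Q \<mu> \<mu>)"
    using maurey_step[OF assms] by blast
  obtain xs where xs: "set xs \<subseteq> I" "length xs = k"
    "Q ((u + x i) + sum_list (map x xs)) ((u + x i) + sum_list (map x xs))
      \<le> Q ((u + x i) + real k *\<^sub>R \<mu>) ((u + x i) + real k *\<^sub>R \<mu>) + k * ((\<Sum>i\<in>I. p i * Q (x i) (x i)) - Q \<mu> \<mu>)"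
    using Suc.IH[of "u + x i"] by blast
  have e1: "(u + x i) + real k *\<^sub>R \<mu> = y + x i" and e2: "u + real (Suc k) *\<^sub>R \<mu> = y + \<mu>"
    by (simp_all add: y_def algebra_simps)
  have "Q ((u + x i) + sum_list (map x xs)) ((u + x i) + sum_list (map x xs))
      \<le> Q (y + \<mu>) (y + \<mu>) + real (Suc k) * ((\<Sum>i\<in>I. p i * Q (x i) (x i)) - Q \<mu> \<mu>)"
    using xs(3) i(2) unfolding e1 by (simp add: algebra_simps)
  then show ?case unfolding e2
    by (intro exI[of _ "i # xs"]) (use xs i in \<open>auto simp: add.assoc\<close>)
qed

definition signed_unit :: "nat \<times> bool \<Rightarrow> nat \<Rightarrow> real" where
  "signed_unit = (\<lambda>(i, s). (if s then 1 else - 1) *\<^sub>R unit i)"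

text \<open>Exactly \<open>k\<close> terms with repetition, as in sampling \<open>k\<close> atoms;
  the number of these vectors is polynomial in \<open>d\<close> for fixed \<open>k\<close>.\<close>

definition unit_sums :: "nat \<Rightarrow> nat \<Rightarrow> (nat \<Rightarrow> real) set" where
  "unit_sums d k = (\<lambda>xs. sum_list (map signed_unit xs)) ` {xs. set xs \<subseteq> {..<d} \<times> UNIV \<and> length xs = k}"

lemma finite_unit_sums: "finite (unit_sums d k)"
  unfolding unit_sums_def by (intro finite_imageI finite_lists_length_eq) auto

lemma card_unit_sums: "card (unit_sums d k) \<le> (2 * d) ^ k"
proof -
  have "card (unit_sums d k) \<le> card {xs. set xs \<subseteq> {..<d} \<times> (UNIV :: bool set) \<and> length xs = k}"
    unfolding unit_sums_def by (intro card_image_le finite_lists_length_eq) auto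
  also have "\<dots> = (2 * d) ^ k" by (subst card_lists_length_eq) (auto simp: card_cartesian_product mult.commute)
  finally show ?thesis .
qed

text \<open>\<open>v\<close> is its l1 norm times a convex combination \<open>\<mu>\<close> of
  signed unit vectors. Maurey's method finds a sum of \<open>k\<close> of them whose form is at most
  \<open>k\<^sup>2 * Q \<mu> \<mu> + k * (q - Q \<mu> \<mu>)\<close>; this is nonnegative by
  hypothesis, and dividing by \<open>k\<close> bounds \<open>Q \<mu> \<mu>\<close> from
  below.\<close>

lemma unit_sums_extend:
  assumes Q: "bilinear Q" and sym: "\<And>u v. Q u v = Q v u" and k: "k \<ge> 2"
    and nonneg: "\<And>u. u \<in> unit_sums d k \<Longrightarrow> 0 \<le> Q u u"
    and diag: "\<And>i. i < d \<Longrightarrow> Q (unit i) (unit i) \<le> q"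
    and v: "\<And>i. i \<ge> d \<Longrightarrow> v i = 0"
  shows "- (q / (k - 1) * (n1 d v)\<^sup>2) \<le> Q v v"
proof (cases "n1 d v = 0")
  case True
  then have "v = 0" using v by (auto simp: n1_def sum_nonneg_eq_0_iff fun_eq_iff not_less[symmetric])
  then show ?thesis using True bilinear_lzero[OF Q] by simp
next
  case False
  define N where "N = n1 d v"
  have N: "N > 0" using False by (simp add: N_def n1_def less_le sum_nonneg)
  define p where "p i = \<bar>v i\<bar> / N" for i
  define x where "x i = signed_unit (i, v i \<ge> 0)" for i
  define \<mu> where "\<mu> = (\<Sum>i<d. p i *\<^sub>R x i)"
  have p: "p i \<ge> 0" for i using N by (simp add: p_def)
  have p1: "(\<Sum>i<d. p i) = 1" using N unfolding p_def N_def n1_def by (simp add: sum_divide_distrib[symmetric])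
  have px: "(p i *\<^sub>R x i) k = (if k = i then v i / N else 0)" for i k
    by (simp add: p_def x_def signed_unit_def unit_def)
  have v\<mu>: "v = N *\<^sub>R \<mu>"
  proof
    fix k
    have "\<mu> k = (if k < d then v k / N else 0)" unfolding \<mu>_def sum_fun_apply px by simp
    then show "v k = (N *\<^sub>R \<mu>) k" using N v[of k] by simp
  qed
  have xx: "Q (x i) (x i) = Q (unit i) (unit i)" for i
    by (simp add: x_def signed_unit_def bilinear_lneg[OF Q] bilinear_rneg[OF Q])
  have D: "(\<Sum>i<d. p i * Q (x i) (x i)) \<le> q"
  proof -
    have "(\<Sum>i<d. p i * Q (x i) (x i)) \<le> (\<Sum>i<d. p i * q)"
      unfolding xx by (intro sum_mono mult_left_mono diag p) auto
    then show ?thesis using p1 by (simp add: sum_distrib_right[symmetric])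
  qed
  obtain xs where xs: "set xs \<subseteq> {..<d}" "length xs = k"
    "Q (0 + sum_list (map x xs)) (0 + sum_list (map x xs))
      \<le> Q (0 + real k *\<^sub>R \<mu>) (0 + real k *\<^sub>R \<mu>) + k * ((\<Sum>i<d. p i * Q (x i) (x i)) - Q \<mu> \<mu>)"
    using maurey[OF Q sym finite_lessThan p p1 \<mu>_def, of k 0] by blast
  have "sum_list (map x xs) \<in> unit_sums d k"
    unfolding unit_sums_def
  proof (rule image_eqI)
    show "sum_list (map x xs) = sum_list (map signed_unit (map (\<lambda>i. (i, v i \<ge> 0)) xs))"
      by (simp only: map_map) (rule arg_cong[of _ _ sum_list], simp add: x_def)
  qed (use xs in auto)
  from nonneg[OF this] have "0 \<le> k\<^sup>2 * Q \<mu> \<mu> + k * (q - Q \<mu> \<mu>)"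
    using xs(3) mult_left_mono[OF D, of "real k"]
    by (simp add: bilinear_lmul[OF Q] bilinear_rmul[OF Q] power2_eq_square algebra_simps)
  also have "\<dots> = k * ((real k - 1) * Q \<mu> \<mu> + q)" by (simp add: power2_eq_square algebra_simps)
  finally have "0 \<le> (real k - 1) * Q \<mu> \<mu> + q" using k by (simp add: zero_le_mult_iff)
  then have "- (q / (real k - 1)) \<le> Q \<mu> \<mu>" using k by (simp add: field_simps)
  then have "N\<^sup>2 * - (q / (real k - 1)) \<le> N\<^sup>2 * Q \<mu> \<mu>" by (intro mult_left_mono) auto
  moreover have "Q v v = N\<^sup>2 * Q \<mu> \<mu>"
    by (subst (1 2) v\<mu>) (simp add: bilinear_lmul[OF Q] bilinear_rmul[OF Q] power2_eq_square)
  ultimately show ?thesis using k by (simp add: N_def of_nat_diff mult.commute)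
qed


section \<open>Symmetric matrices\<close>

lemma mat_inv_inverse:
  assumes A: "A \<in> carrier_mat d d" and "det A \<noteq> 0"
  shows "A * mat_inv A = 1\<^sub>m d" "mat_inv A * A = 1\<^sub>m d" "mat_inv A \<in> carrier_mat d d"
proof -
  have "A \<in> Units (ring_mat TYPE(real) d ())" by (rule det_non_zero_imp_unit[OF A assms(2)])
  then obtain B where B: "mat_inverse A = Some B" using mat_inverse(1)[OF A] by fastforce
  then have "mat_inv A = B" by (simp add: mat_inv_def)
  then show "A * mat_inv A = 1\<^sub>m d" "mat_inv A * A = 1\<^sub>m d" "mat_inv A \<in> carrier_mat d d"
    using mat_inverse(2)[OF A B] by auto
qed

lemma mult_mat_vec_index:
  assumes "A \<in> carrier_mat n k" "x \<in> carrier_vec k" "i < n"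
  shows "(A *\<^sub>v x) $ i = (\<Sum>l<k. A $$ (i, l) * x $ l)"
  using assms by (simp add: scalar_prod_def lessThan_atLeast0)

lemma mult_mat_index:
  assumes "A \<in> carrier_mat n k" "B \<in> carrier_mat k l" "i < n" "j < l"
  shows "(A * B) $$ (i, j) = (\<Sum>h<k. A $$ (i, h) * B $$ (h, j))"
  using assms by (simp add: scalar_prod_def lessThan_atLeast0)

lemma pd_det_nonzero:
  assumes A: "A \<in> carrier_mat d d"
    and pd: "\<And>u. n2 d u \<noteq> 0 \<Longrightarrow> bform d (\<lambda>i j. A $$ (i, j)) u u \<noteq> 0"
  shows "det A \<noteq> 0"
proof
  assume "det A = 0"
  then obtain v where v: "v \<in> carrier_vec d" "v \<noteq> 0\<^sub>v d" "A *\<^sub>v v = 0\<^sub>v d"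
    using det_0_iff_vec_prod_zero[OF A] by auto
  define u where "u i = v $ i" for i
  have "bform d (\<lambda>i j. A $$ (i, j)) u u = (\<Sum>i<d. u i * (A *\<^sub>v v) $ i)"
    unfolding bform_def u_def by (intro sum.cong) (auto simp: mult_mat_vec_index[OF A v(1)] sum_distrib_left mult.assoc)
  also have "\<dots> = 0" unfolding v(3) by simp
  finally have "n2 d u = 0" using pd by blast
  then have "\<And>i. i < d \<Longrightarrow> u i = 0"
    using n2_sq[of d u] by (simp add: sum_nonneg_eq_0_iff)
  then have "v = 0\<^sub>v d" using v(1) by (intro eq_vecI) (auto simp: u_def)
  then show False using v(2) by simp
qed

text \<open>
  The infimum \<open>\<mu>\<close> of the Rayleigh quotient is an eigenvalue: the form of \<open>A - \<mu>\<close> is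
  semidefinite, and if \<open>A - \<mu>\<close> were invertible then the Cauchy--Schwarz inequality for
  that form would keep it away from 0.
\<close>

lemma eigenvalues_lower_bound:
  fixes g :: "nat \<Rightarrow> nat \<Rightarrow> real"
  assumes sym: "\<And>i j. i < d \<Longrightarrow> j < d \<Longrightarrow> g i j = g j i"
    and ev: "\<And>k. eigenvalue (Matrix.mat d d (\<lambda>(i, j). g i j)) k \<Longrightarrow> l \<le> k"
  shows "l * (n2 d u)\<^sup>2 \<le> bform d g u u"
proof (cases "n2 d u = 0")
  case True
  then have "\<And>i. i < d \<Longrightarrow> u i = 0" using n2_sq[of d u] by (simp add: sum_nonneg_eq_0_iff)
  then show ?thesis using True by (simp add: bform_def)
next
  case False
  interpret n2: seminorm "n2 d" by (rule seminorm_n2)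
  define S where "S = {bform d g w w | w. n2 d w = 1}"
  define b where "b = (\<Sum>i<d. \<Sum>j<d. \<bar>g i j\<bar>)"
  have coord: "\<bar>w i\<bar> \<le> n2 d w" if "i < d" for w i
    unfolding n2_def using member_le_L2_set[of "{..<d}" i "\<lambda>i. \<bar>w i\<bar>"] that by (simp add: L2_set_def)
  have bound: "\<bar>bform d h w w\<bar> \<le> (\<Sum>i<d. \<Sum>j<d. \<bar>h i j\<bar>) * (n2 d w)\<^sup>2" for h w
  proof -
    have "\<bar>bform d h w w\<bar> \<le> (\<Sum>i<d. \<Sum>j<d. \<bar>w i * h i j * w j\<bar>)"
      unfolding bform_def by (intro order_trans[OF sum_abs] sum_mono order_trans[OF sum_abs]) auto
    also have "\<dots> \<le> (\<Sum>i<d. \<Sum>j<d. n2 d w * \<bar>h i j\<bar> * n2 d w)"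
      unfolding abs_mult by (intro sum_mono mult_mono coord) auto
    finally show ?thesis by (simp add: sum_distrib_left sum_distrib_right power2_eq_square mult_ac)
  qed
  have bdd: "bdd_below S"
  proof (rule bdd_belowI)
    fix s assume "s \<in> S"
    then obtain w where "s = bform d g w w" "n2 d w = 1" unfolding S_def by auto
    then show "- b \<le> s" using bound[of g w] by (simp add: b_def)
  qed
  define \<mu> where "\<mu> = Inf S"
  have scal: "bform d h (c *\<^sub>R w) (c *\<^sub>R w) = c\<^sup>2 * bform d h w w" for h c w
    using bilinear_lmul[OF bilinear_bform] bilinear_rmul[OF bilinear_bform] by (simp add: power2_eq_square)
  have ray: "\<mu> * (n2 d w)\<^sup>2 \<le> bform d g w w" for w
  proof (cases "n2 d w = 0")
    case True
    then have "\<And>i. i < d \<Longrightarrow> w i = 0" using n2_sq[of d w] by (simp add: sum_nonneg_eq_0_iff)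
    then show ?thesis using True by (simp add: bform_def)
  next
    case False
    have "n2 d ((1 / n2 d w) *\<^sub>R w) = 1" using False by (simp add: n2.scale)
    then have "bform d g ((1 / n2 d w) *\<^sub>R w) ((1 / n2 d w) *\<^sub>R w) \<in> S" unfolding S_def by blast
    then have "\<mu> \<le> (1 / n2 d w)\<^sup>2 * bform d g w w" unfolding \<mu>_def scal[symmetric] using bdd by (rule cInf_lower)
    then show ?thesis using False by (simp add: field_simps)
  qed
  have ne: "S \<noteq> {}"
  proof -
    have "n2 d ((1 / n2 d u) *\<^sub>R u) = 1" using False by (simp add: n2.scale)
    then show ?thesis unfolding S_def by blast
  qed
  define q where "q i j = g i j - (if i = j then \<mu> else 0)" for i j
  have q: "bform d q w w = bform d g w w - \<mu> * (n2 d w)\<^sup>2" for w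
  proof -
    have "bform d (\<lambda>i j. if i = j then \<mu> else 0) w w = (\<Sum>i<d. \<Sum>j<d. if j = i then \<mu> * (w i)\<^sup>2 else 0)"
      unfolding bform_def by (intro sum.cong) (auto simp: power2_eq_square)
    also have "\<dots> = \<mu> * (n2 d w)\<^sup>2" by (simp add: n2_sq sum_distrib_left)
    finally show ?thesis unfolding q_def bform_diff by simp
  qed
  interpret psd_form "bform d q"
    by standard (use bilinear_bform ray q sym in \<open>auto intro!: bform_sym simp: q_def\<close>)
  define A where "A = Matrix.mat d d (\<lambda>(i, j). q i j)"
  have A: "A \<in> carrier_mat d d" by (simp add: A_def)
  have "det A = 0"
  proof (rule ccontr)
    assume "det A \<noteq> 0"
    note inv = mat_inv_inverse[OF A this]
    define B where "B i j = mat_inv A $$ (i, j)" for i j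
    \<comment> \<open>A bound for the form of the inverse on unit vectors, with 1 added to make it
      positive.\<close>
    define c where "c = 1 + (\<Sum>i<d. \<Sum>j<d. \<bar>B i j\<bar>)"
    have c: "c > 0" unfolding c_def by (simp add: add_pos_nonneg sum_nonneg)
    \<comment> \<open>With \<open>w\<close> the solution of A w = v, Cauchy-Schwarz bounds |v|^4,
      the square of the form at (v, w), by the product of the forms at (v, v) and (w, w); the latter
      is the form of the inverse at \<open>v\<close>, at most \<open>c\<close> times |v|^2.\<close>
    have key: "(n2 d v)\<^sup>2 \<le> c * bform d q v v" for v
    proof -
      define w where "w i = (\<Sum>j<d. B i j * v j)" for i
      have Aw: "(\<Sum>j<d. q i j * w j) = v i" if i: "i < d" for i
      proof -
        have "(\<Sum>j<d. q i j * w j) = (\<Sum>k<d. (\<Sum>j<d. q i j * B j k) * v k)"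
          unfolding w_def sum_distrib_left sum_distrib_right by (subst sum.swap) (simp add: mult.assoc)
        also have "\<dots> = (\<Sum>k<d. (if i = k then v k else 0))"
        proof (intro sum.cong refl)
          fix k assume k: "k \<in> {..<d}"
          have "(A * mat_inv A) $$ (i, k) = (\<Sum>j<d. q i j * B j k)"
            using i k by (subst mult_mat_index[OF A inv(3)]) (auto simp: A_def B_def)
          then show "(\<Sum>j<d. q i j * B j k) * v k = (if i = k then v k else 0)"
            unfolding inv(1) using i k by auto
        qed
        finally show ?thesis using i by simp
      qed
      have row: "bform d q x w = (\<Sum>i<d. x i * v i)" for x
        unfolding bform_def by (intro sum.cong) (auto simp: Aw[symmetric] sum_distrib_left mult.assoc)
      have vw: "bform d q v w = (n2 d v)\<^sup>2" unfolding row n2_sq by (simp add: power2_eq_square)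
      have "bform d q w w = bform d B v v"
        unfolding row unfolding bform_def w_def by (simp add: sum_distrib_left sum_distrib_right mult_ac)
      also have "\<dots> \<le> c * (n2 d v)\<^sup>2" using abs_le_D1[OF bound[of B v]] by (simp add: c_def distrib_right add_increasing)
      finally have ww: "bform d q w w \<le> c * (n2 d v)\<^sup>2" .
      have "(n2 d v)\<^sup>2 * (n2 d v)\<^sup>2 \<le> bform d q v v * bform d q w w"
        using cauchy_schwarz_sq[of v w] unfolding vw by (simp add: power2_eq_square)
      also have "\<dots> \<le> bform d q v v * (c * (n2 d v)\<^sup>2)" using ww psd by (intro mult_left_mono)
      finally have "(n2 d v)\<^sup>2 * (n2 d v)\<^sup>2 \<le> (c * bform d q v v) * (n2 d v)\<^sup>2" by (simp add: mult_ac)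
      then show ?thesis
      proof (cases "n2 d v = 0")
        case False
        then have "0 < (n2 d v)\<^sup>2" by simp
        with \<open>_ \<le> (c * bform d q v v) * (n2 d v)\<^sup>2\<close> show ?thesis by (rule mult_right_le_imp_le)
      qed (use psd[of v] c in auto)
    qed
    \<comment> \<open>\<open>key\<close> lifts every Rayleigh quotient to at least
      \<open>\<mu> + 1 / c\<close>, although \<open>\<mu>\<close> is their infimum.\<close>
    have "\<mu> + 1 / c \<le> Inf S"
    proof (rule cInf_greatest[OF ne])
      fix s assume "s \<in> S"
      then obtain w where w: "s = bform d g w w" "n2 d w = 1" unfolding S_def by auto
      have "1 \<le> c * (s - \<mu>)" using key[of w] q[of w] w by simp
      then show "\<mu> + 1 / c \<le> s" using c by (simp add: field_simps)
    qed
    then show False using c unfolding \<mu>_def by simp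
  qed
  then obtain v where v: "v \<in> carrier_vec d" "v \<noteq> 0\<^sub>v d" "A *\<^sub>v v = 0\<^sub>v d"
    using det_0_iff_vec_prod_zero[OF A] by auto
  have "eigenvector (Matrix.mat d d (\<lambda>(i, j). g i j)) v \<mu>"
    unfolding eigenvector_def
  proof (intro conjI)
    show "Matrix.mat d d (\<lambda>(i, j). g i j) *\<^sub>v v = \<mu> \<cdot>\<^sub>v v"
    proof (rule eq_vecI)
      fix i assume "i < dim_vec (\<mu> \<cdot>\<^sub>v v)"
      then have i: "i < d" using v(1) by simp
      have "(A *\<^sub>v v) $ i = (\<Sum>j<d. q i j * v $ j)"
        using i by (subst mult_mat_vec_index[OF A v(1)]) (auto simp: A_def)
      also have "\<dots> = (\<Sum>j<d. g i j * v $ j) - (\<Sum>j<d. if i = j then \<mu> * v $ j else 0)"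
        unfolding sum_subtractf[symmetric] by (intro sum.cong) (auto simp: q_def algebra_simps)
      finally have "(\<Sum>j<d. g i j * v $ j) = \<mu> * v $ i" using i unfolding v(3) by simp
      then show "(Matrix.mat d d (\<lambda>(i, j). g i j) *\<^sub>v v) $ i = (\<mu> \<cdot>\<^sub>v v) $ i"
        using i v(1) by (subst mult_mat_vec_index[of _ d d]) auto
    qed (use v in auto)
  qed (use v in auto)
  then have "l \<le> \<mu>" using ev unfolding eigenvalue_def by blast
  then have "l * (n2 d u)\<^sup>2 \<le> \<mu> * (n2 d u)\<^sup>2" by (intro mult_right_mono) auto
  then show ?thesis using ray[of u] by linarith
qed

text \<open>The lower bound for \<open>- g\<close>, whose eigenvalues are the negatives of those of
  \<open>g\<close>.\<close>

lemma eigenvalues_upper_bound: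
  fixes g :: "nat \<Rightarrow> nat \<Rightarrow> real"
  assumes sym: "\<And>i j. i < d \<Longrightarrow> j < d \<Longrightarrow> g i j = g j i"
    and ev: "\<And>k. eigenvalue (Matrix.mat d d (\<lambda>(i, j). g i j)) k \<Longrightarrow> k \<le> h"
  shows "bform d g u u \<le> h * (n2 d u)\<^sup>2"
proof -
  have "- h * (n2 d u)\<^sup>2 \<le> bform d (\<lambda>i j. - g i j) u u"
  proof (rule eigenvalues_lower_bound)
    fix k assume "eigenvalue (Matrix.mat d d (\<lambda>(i, j). - g i j)) k"
    then obtain v where v: "v \<in> carrier_vec d" "v \<noteq> 0\<^sub>v d" "Matrix.mat d d (\<lambda>(i, j). - g i j) *\<^sub>v v = k \<cdot>\<^sub>v v"
      by (auto simp: eigenvalue_def eigenvector_def)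
    have "Matrix.mat d d (\<lambda>(i, j). g i j) *\<^sub>v v = (- k) \<cdot>\<^sub>v v"
    proof (rule eq_vecI)
      fix i assume "i < dim_vec (- k \<cdot>\<^sub>v v)"
      then have i: "i < d" using v(1) by simp
      have "(Matrix.mat d d (\<lambda>(i, j). h i j) *\<^sub>v v) $ i = (\<Sum>j<d. h i j * v $ j)" for h :: "nat \<Rightarrow> nat \<Rightarrow> real"
        using i v(1) by (subst mult_mat_vec_index[of _ d d]) auto
      then have "(Matrix.mat d d (\<lambda>(i, j). - g i j) *\<^sub>v v) $ i = - (Matrix.mat d d (\<lambda>(i, j). g i j) *\<^sub>v v) $ i"
        by (simp only: sum_negf mult_minus_left)
      then show "(Matrix.mat d d (\<lambda>(i, j). g i j) *\<^sub>v v) $ i = (- k \<cdot>\<^sub>v v) $ i"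
        unfolding v(3) using i v(1) by simp
    qed (use v in auto)
    then have "eigenvalue (Matrix.mat d d (\<lambda>(i, j). g i j)) (- k)"
      using v by (auto simp: eigenvalue_def eigenvector_def)
    then show "- h \<le> k" using ev by fastforce
  qed (use sym in auto)
  then show ?thesis by (simp add: bform_def sum_negf)
qed

section \<open>Node problems and block matrices as bilinear forms\<close>

abbreviation entries :: "rmatrix \<Rightarrow> nat \<Rightarrow> nat \<Rightarrow> real" where
  "entries A \<equiv> \<lambda>i j. A $$ (i, j)"

text \<open>Undoes the deletion of the node with the value 0 there, so that the regressions at all
  nodes share one space and one bilinear form.\<close>

definition node_embed :: "nat \<Rightarrow> rvector \<Rightarrow> nat \<Rightarrow> real" where
  "node_embed j \<eta> = (\<lambda>i. if i = j then 0 else \<eta> $ delete_index j i)"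

lemma node_embed_node [simp]: "node_embed j \<eta> j = 0"
  by (simp add: node_embed_def)

lemma node_embed_insert [simp]: "node_embed j \<eta> (insert_index j i) = \<eta> $ i"
  by (simp add: node_embed_def)

lemma sum_insert_index:
  assumes "j < m"
  shows "(\<Sum>i<m - 1. f (insert_index j i)) = (\<Sum>i\<in>{..<m} - {j}. f i)"
proof -
  have "insert_index j ` {0..<m - 1} = {0..<Suc (m - 1)} - {j}"
    using assms by (intro insert_index_image) auto
  then have "insert_index j ` {..<m - 1} = {..<m} - {j}" using assms by (simp add: lessThan_atLeast0)
  then show ?thesis using sum.reindex[OF insert_index_inj_on, of f j "{..<m - 1}"] by simp
qed

lemma sum_except_node:
  fixes f :: "nat \<Rightarrow> real"
  assumes "j < m" "f j = 0"
  shows "(\<Sum>i<m. f i) = (\<Sum>i<m - 1. f (insert_index j i))"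
  unfolding sum_insert_index[OF assms(1)] using assms by (simp add: sum.remove[of "{..<m}" j])

lemma insert_index_less: "j < m \<Longrightarrow> i < m - 1 \<Longrightarrow> insert_index j i < m"
  by (auto simp: insert_index_def)

lemma n1_node_embed:
  assumes "j < m" "\<eta> \<in> carrier_vec (m - 1)"
  shows "n1 m (node_embed j \<eta>) = vec_l1 \<eta>"
  unfolding n1_def vec_l1_def using assms by (subst sum_except_node[of j]) auto

text \<open>Away from the node, the matrix applied to (1, -\<eta>) is the residual of the normal
  equations; the row of the node itself drops out because \<open>w j = 0\<close>.\<close>

lemma node_form:
  assumes A: "A \<in> carrier_mat m m" and sym: "\<And>i k. i < m \<Longrightarrow> k < m \<Longrightarrow> A $$ (i, k) = A $$ (k, i)"
    and j: "j < m" and \<eta>: "\<eta> \<in> carrier_vec (m - 1)" and w: "w j = 0"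
  shows "bform m (entries A) (unit j - node_embed j \<eta>) w =
    (\<Sum>i<m - 1. (col_delete A j $ i - (mat_delete A j j *\<^sub>v \<eta>) $ i) * w (insert_index j i))"
proof -
  let ?e = "unit j - node_embed j \<eta>"
  have D: "mat_delete A j j \<in> carrier_mat (m - 1) (m - 1)" using mat_delete_carrier[OF A] .
  have "bform m (entries A) ?e w = bform m (entries A) w ?e" by (rule bform_sym) (rule sym)
  also have "\<dots> = (\<Sum>i<m. w i * (\<Sum>k<m. A $$ (i, k) * ?e k))"
    unfolding bform_def by (simp add: sum_distrib_left mult.assoc)
  also have "\<dots> = (\<Sum>i<m - 1. w (insert_index j i) * (\<Sum>k<m. A $$ (insert_index j i, k) * ?e k))"
    by (rule sum_except_node) (use j w in auto)
  also have "\<dots> = (\<Sum>i<m - 1. (col_delete A j $ i - (mat_delete A j j *\<^sub>v \<eta>) $ i) * w (insert_index j i))"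
  proof (intro sum.cong refl)
    fix i assume "i \<in> {..<m - 1}"
    then have i: "i < m - 1" by simp
    have "(\<Sum>k<m. A $$ (insert_index j i, k) * ?e k)
      = (\<Sum>k<m. A $$ (insert_index j i, k) * unit j k) - (\<Sum>k<m. A $$ (insert_index j i, k) * node_embed j \<eta> k)"
      by (simp add: right_diff_distrib sum_subtractf)
    also have "(\<Sum>k<m. A $$ (insert_index j i, k) * unit j k) = A $$ (insert_index j i, j)"
    proof -
      have "(\<Sum>k<m. A $$ (insert_index j i, k) * unit j k) = (\<Sum>k<m. if k = j then A $$ (insert_index j i, k) else 0)"
        by (intro sum.cong) (auto simp: unit_def)
      then show ?thesis using j by simp
    qed
    also have "\<dots> = col_delete A j $ i" using A i by (simp add: col_delete_def)
    also have "(\<Sum>k<m. A $$ (insert_index j i, k) * node_embed j \<eta> k) = (mat_delete A j j *\<^sub>v \<eta>) $ i"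
    proof -
      have "(\<Sum>k<m. A $$ (insert_index j i, k) * node_embed j \<eta> k)
        = (\<Sum>k<m - 1. A $$ (insert_index j i, insert_index j k) * node_embed j \<eta> (insert_index j k))"
        by (rule sum_except_node) (use j in auto)
      also have "\<dots> = (mat_delete A j j *\<^sub>v \<eta>) $ i"
        unfolding mult_mat_vec_index[OF D \<eta> i] node_embed_insert
        using A i by (intro sum.cong) (auto simp: mat_delete_def insert_index_def)
      finally show ?thesis .
    qed
    finally show "w (insert_index j i) * (\<Sum>k<m. A $$ (insert_index j i, k) * ?e k)
      = (col_delete A j $ i - (mat_delete A j j *\<^sub>v \<eta>) $ i) * w (insert_index j i)" by simp
  qed
  finally show ?thesis .
qed

text \<open>By symmetry of the matrix, the gradient of the smooth part is -2 times the residual in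
  \<open>node_form\<close>. The subgradient inequality replaces the first-order term of the penalty
  by a difference of l1 norms.\<close>

lemma stationary_form:
  assumes A: "A \<in> carrier_mat m m" and sym: "\<And>i k. i < m \<Longrightarrow> k < m \<Longrightarrow> A $$ (i, k) = A $$ (k, i)"
    and j: "j < m" and l: "0 \<le> l"
    and st: "lasso_stationary (mat_delete A j j) (col_delete A j) l B \<eta>"
    and \<theta>: "\<theta> j = 0" "n1 m \<theta> \<le> B"
  shows "2 * bform m (entries A) (unit j - node_embed j \<eta>) (\<theta> - node_embed j \<eta>)
    \<le> l * (n1 m \<theta> - n1 m (node_embed j \<eta>))"
proof -
  let ?D = "mat_delete A j j" and ?a = "col_delete A j"
  have D: "?D \<in> carrier_mat (m - 1) (m - 1)" using mat_delete_carrier[OF A] .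
  have a: "?a \<in> carrier_vec (m - 1)" using A by (auto simp: col_delete_def)
  have da: "dim_vec ?a = m - 1" using a by simp
  have \<eta>: "\<eta> \<in> carrier_vec (m - 1)" using st unfolding lasso_stationary_def da by simp
  obtain z where z: "l1_subgradient \<eta> z" and ineq: "\<And>\<theta>. \<theta> \<in> carrier_vec (m - 1) \<Longrightarrow> vec_l1 \<theta> \<le> B \<Longrightarrow>
     ((?D + ?D\<^sup>T) *\<^sub>v \<eta> - 2 \<cdot>\<^sub>v ?a + l \<cdot>\<^sub>v z) \<bullet> (\<theta> - \<eta>) \<ge> 0"
    using st unfolding lasso_stationary_def da by blast
  have zc: "z \<in> carrier_vec (m - 1)" using z \<eta> by (simp add: l1_subgradient_def)
  define t where "t = Matrix.vec (m - 1) (\<lambda>i. \<theta> (insert_index j i))"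
  have t: "t \<in> carrier_vec (m - 1)" by (simp add: t_def)
  have t1: "vec_l1 t = n1 m \<theta>"
    unfolding n1_def vec_l1_def using \<theta> by (subst sum_except_node[OF j]) (auto simp: t_def)
  have \<eta>1: "n1 m (node_embed j \<eta>) = vec_l1 \<eta>" by (rule n1_node_embed[OF j \<eta>])
  have "vec_l1 \<eta> + z \<bullet> (t - \<eta>) \<le> vec_l1 t" using z t \<eta> unfolding l1_subgradient_def by auto
  then have "z \<bullet> (t - \<eta>) \<le> vec_l1 t - vec_l1 \<eta>" by linarith
  then have zl: "l * (z \<bullet> (t - \<eta>)) \<le> l * (vec_l1 t - vec_l1 \<eta>)" using l by (rule mult_left_mono)
  have Ds: "?D $$ (i, k) = ?D $$ (k, i)" if "i < m - 1" "k < m - 1" for i k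
    using that A sym[OF insert_index_less[OF j that(1)] insert_index_less[OF j that(2)]]
    by (auto simp: mat_delete_def insert_index_def)
  have DT: "((?D + ?D\<^sup>T) *\<^sub>v \<eta>) $ i = 2 * (?D *\<^sub>v \<eta>) $ i" if "i < m - 1" for i
  proof -
    have S: "?D + ?D\<^sup>T \<in> carrier_mat (m - 1) (m - 1)" using D by auto
    have ent: "(?D + ?D\<^sup>T) $$ (i, k) = 2 * ?D $$ (i, k)" if k: "k < m - 1" for k
      using Ds[OF \<open>i < m - 1\<close> k] carrier_matD[OF D] \<open>i < m - 1\<close> k by simp
    have "((?D + ?D\<^sup>T) *\<^sub>v \<eta>) $ i = (\<Sum>k<m - 1. 2 * (?D $$ (i, k) * \<eta> $ k))"
      unfolding mult_mat_vec_index[OF S \<eta> that] by (intro sum.cong) (simp_all add: ent)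
    then show ?thesis using that by (simp add: mult_mat_vec_index[OF D \<eta>] sum_distrib_left)
  qed
  have "0 \<le> ((?D + ?D\<^sup>T) *\<^sub>v \<eta> - 2 \<cdot>\<^sub>v ?a + l \<cdot>\<^sub>v z) \<bullet> (t - \<eta>)" using ineq[OF t] t1 \<theta> by simp
  also have "\<dots> = (\<Sum>i<m - 1. (2 * (?D *\<^sub>v \<eta>) $ i - 2 * ?a $ i + l * z $ i) * (t $ i - \<eta> $ i))"
    unfolding scalar_prod_def using t \<eta> zc a D
    by (auto simp: lessThan_atLeast0 DT intro!: sum.cong)
  also have "\<dots> = l * (z \<bullet> (t - \<eta>)) - 2 * (\<Sum>i<m - 1. (?a $ i - (?D *\<^sub>v \<eta>) $ i) * (t $ i - \<eta> $ i))"
    unfolding scalar_prod_def using t \<eta>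
    by (simp add: lessThan_atLeast0 sum_distrib_left sum_subtractf[symmetric] algebra_simps sum.distrib)
  also have "(\<Sum>i<m - 1. (?a $ i - (?D *\<^sub>v \<eta>) $ i) * (t $ i - \<eta> $ i))
      = bform m (entries A) (unit j - node_embed j \<eta>) (\<theta> - node_embed j \<eta>)"
    by (subst node_form[OF A sym j \<eta>]) (auto simp: \<theta> t_def)
  finally show ?thesis using zl t1 \<eta>1 by simp
qed

section \<open>Block matrices on the joint coordinate space\<close>

definition proj_x :: "nat \<Rightarrow> (nat \<Rightarrow> real) \<Rightarrow> nat \<Rightarrow> real" where
  "proj_x p u = (\<lambda>i. if i < p then u i else 0)"

text \<open>There is no upper end to the range, so that \<open>proj_x\<close> and
  \<open>proj_y\<close> add up to the identity on all functions.\<close>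

definition proj_y :: "nat \<Rightarrow> (nat \<Rightarrow> real) \<Rightarrow> nat \<Rightarrow> real" where
  "proj_y p u = (\<lambda>i. if i < p then 0 else u i)"

definition embed_x :: "rvector \<Rightarrow> nat \<Rightarrow> real" where
  "embed_x a = (\<lambda>i. if i < dim_vec a then a $ i else 0)"

definition embed_y :: "nat \<Rightarrow> rvector \<Rightarrow> nat \<Rightarrow> real" where
  "embed_y p b = (\<lambda>i. if p \<le> i \<and> i < p + dim_vec b then b $ (i - p) else 0)"

lemma sum_lessThan_plus:
  fixes f :: "nat \<Rightarrow> real"
  shows "(\<Sum>i<p + q. f i) = (\<Sum>i<p. f i) + (\<Sum>i<q. f (p + i))"
  by (induction q) auto

lemma split_space_proj: "split_space (n1 d) (n2 d) (proj_x p) (proj_y p)"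
proof (intro split_space.intro seminorm_n1 seminorm_n2 split_space_axioms.intro)
  show "linear (proj_x p)" "linear (proj_y p)"
    by (auto intro!: linearI simp: proj_x_def proj_y_def)
  show "proj_x p (proj_x p u) = proj_x p u" "proj_y p (proj_y p u) = proj_y p u"
    "proj_x p (proj_y p u) = 0" "proj_y p (proj_x p u) = 0" "proj_x p u + proj_y p u = u" for u
    by (auto simp: proj_x_def proj_y_def fun_eq_iff)
  show "n1 d (proj_x p u) \<le> n1 d u" "n1 d (proj_y p u) \<le> n1 d u" for u
    unfolding n1_def by (auto intro!: sum_mono simp: proj_x_def proj_y_def)
  show "(n2 d u)\<^sup>2 = (n2 d (proj_x p u))\<^sup>2 + (n2 d (proj_y p u))\<^sup>2" for u
    unfolding n2_sq sum.distrib[symmetric] by (intro sum.cong) (auto simp: proj_x_def proj_y_def)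
qed

definition joint :: "nat \<Rightarrow> rmatrix \<Rightarrow> rmatrix \<Rightarrow> rmatrix \<Rightarrow> nat \<Rightarrow> nat \<Rightarrow> real" where
  "joint p Sx Sxy Sy = (\<lambda>i j.
     if i < p then if j < p then Sx $$ (i, j) else Sxy $$ (i, j - p)
     else if j < p then Sxy $$ (j, i - p) else Sy $$ (i - p, j - p))"

lemma joint_apply: "joint p Sx Sxy Sy i j =
    (if i < p then if j < p then Sx $$ (i, j) else Sxy $$ (i, j - p)
     else if j < p then Sxy $$ (j, i - p) else Sy $$ (i - p, j - p))"
  by (simp add: joint_def)

lemma bform_joint_xx: "bform (p + q) (joint p Sx Sxy Sy) (proj_x p u) (proj_x p v) = bform p (entries Sx) u v"
  unfolding bform_def sum_lessThan_plus by (auto simp: proj_x_def joint_def intro!: sum.cong)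

lemma bform_joint_yy: "bform (p + q) (joint p Sx Sxy Sy) (proj_y p u) (proj_y p v)
    = bform q (entries Sy) (\<lambda>i. u (p + i)) (\<lambda>i. v (p + i))"
  unfolding bform_def sum_lessThan_plus by (auto simp: proj_y_def joint_def intro!: sum.cong)

lemma bform_joint_xy: "bform (p + q) (joint p Sx Sxy Sy) (proj_x p u) (proj_y p v)
    = (\<Sum>i<p. \<Sum>j<q. u i * Sxy $$ (i, j) * v (p + j))"
  unfolding bform_def sum_lessThan_plus by (auto simp: proj_x_def proj_y_def joint_def intro!: sum.cong)

lemma proj_embed:
  "a \<in> carrier_vec p \<Longrightarrow> proj_x p (embed_x a) = embed_x a" "proj_y p (embed_y p b) = embed_y p b"
  by (auto simp: proj_x_def proj_y_def embed_x_def embed_y_def fun_eq_iff)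

lemma outer_sandwich:
  assumes "Sx \<in> carrier_mat p p" "a \<in> carrier_vec p" "i < p" "j < p"
  shows "(Sx * outer_prod a a * Sx) $$ (i, j) = (\<Sum>k<p. Sx $$ (i, k) * a $ k) * (\<Sum>k<p. a $ k * Sx $$ (k, j))"
proof -
  have O: "outer_prod a a \<in> carrier_mat p p" using assms by (simp add: outer_prod_def)
  have "(Sx * outer_prod a a * Sx) $$ (i, j) = (\<Sum>h<p. (\<Sum>k<p. Sx $$ (i, k) * outer_prod a a $$ (k, h)) * Sx $$ (h, j))"
    using assms O by (subst mult_mat_index[of _ p p _ p]) (auto simp: mult_mat_index[of _ p p _ p] simp del: index_mult_mat)
  also have "\<dots> = (\<Sum>h<p. (\<Sum>k<p. Sx $$ (i, k) * a $ k) * (a $ h * Sx $$ (h, j)))"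
    using assms(2) by (intro sum.cong refl) (simp add: outer_prod_def sum_distrib_right sum_distrib_left mult_ac)
  finally show ?thesis by (simp add: sum_distrib_left)
qed

text \<open>The matrix sum sees the first \<open>m\<close> coordinates only, whereas a bilinear form
  on functions may see more; hence the truncated arguments on the right.\<close>

lemma bilinear_truncate:
  assumes B: "bilinear B"
  shows "bform m (\<lambda>i j. B (unit i) (unit j)) u v = B (\<Sum>i<m. u i *\<^sub>R unit i) (\<Sum>i<m. v i *\<^sub>R unit i)"
proof -
  have l: "linear (\<lambda>x. B x y)" "linear (B x)" for x y using B by (auto simp: bilinear_def)
  have e1: "B (\<Sum>i<m. u i *\<^sub>R unit i) y = (\<Sum>i<m. u i * B (unit i) y)" for y
    using linear_sum[OF l(1), of "\<lambda>i. u i *\<^sub>R unit i" "{..<m}" y] by (simp add: bilinear_lmul[OF B])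
  have e2: "B x (\<Sum>i<m. v i *\<^sub>R unit i) = (\<Sum>i<m. B x (unit i) * v i)" for x
    using linear_sum[OF l(2), of x "\<lambda>i. v i *\<^sub>R unit i" "{..<m}"] by (simp add: bilinear_rmul[OF B] mult.commute)
  show ?thesis unfolding e1 unfolding e2 by (simp add: bform_def sum_distrib_left mult.assoc)
qed

lemma truncate_apply: "(\<Sum>i<m. u i *\<^sub>R unit i) k = (if k < m then u k else 0)"
proof -
  have "(\<Sum>i<m. u i *\<^sub>R unit i) k = (\<Sum>i<m. if i = k then u i else 0)"
    unfolding sum_fun_apply by (intro sum.cong) (auto simp: unit_def)
  then show ?thesis by simp
qed

text \<open>Compare entries on unit vectors and extend by bilinearity. The three weights let one
  statement serve both the population Hessian, where all equal \<open>\<rho>\<close>, and the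
  plug-in estimate.\<close>

lemma block_matrix_form:
  fixes p q :: nat
  defines "m \<equiv> p + q"
  assumes Sx: "Sx \<in> carrier_mat p p" and Sy: "Sy \<in> carrier_mat q q" and Sxy: "Sxy \<in> carrier_mat p q"
    and a: "a \<in> carrier_vec p" and b: "b \<in> carrier_vec q"
    and entry: "\<And>i j. i < m \<Longrightarrow> j < m \<Longrightarrow> H i j = 2 *
      (if i < p then if j < p
         then \<rho>\<^sub>1 * Sx $$ (i, j) + 2 * \<rho>\<^sub>3 * (\<Sum>k<p. Sx $$ (i, k) * a $ k) * (\<Sum>k<p. a $ k * Sx $$ (k, j))
         else - Sxy $$ (i, j - p)
       else if j < p then - Sxy $$ (j, i - p)
         else \<rho>\<^sub>2 * Sy $$ (i - p, j - p)
           + 2 * \<rho>\<^sub>3 * (\<Sum>k<q. Sy $$ (i - p, k) * b $ k) * (\<Sum>k<q. b $ k * Sy $$ (k, j - p)))"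
  shows "bform m H = split_space.block_form (proj_x p) (proj_y p) \<rho>\<^sub>1 \<rho>\<^sub>2 \<rho>\<^sub>3
      (bform m (joint p Sx Sxy Sy)) (embed_x a) (embed_y p b)"
proof (intro ext)
  fix u v :: "nat \<Rightarrow> real"
  interpret split_space "n1 m" "n2 m" "proj_x p" "proj_y p" by (rule split_space_proj)
  let ?F = "bform m (joint p Sx Sxy Sy)"
  let ?B = "block_form \<rho>\<^sub>1 \<rho>\<^sub>2 \<rho>\<^sub>3 ?F (embed_x a) (embed_y p b)"
  have F0: "?F 0 w = 0" "?F w 0 = 0" for w by (simp_all add: bform_def)
  have px: "proj_x p (unit i) = (if i < p then unit i else 0)" "proj_y p (unit i) = (if i < p then 0 else unit i)" for i
    by (auto simp: proj_x_def proj_y_def unit_def fun_eq_iff)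
  have Fa: "?F (unit i) (embed_x a) = (\<Sum>k<p. Sx $$ (i, k) * a $ k)" "?F (embed_x a) (unit i) = (\<Sum>k<p. a $ k * Sx $$ (k, i))" if "i < p" for i
    using that a unfolding m_def
    by (simp_all add: bform_unit_left bform_unit_right sum_lessThan_plus embed_x_def joint_def)
  have Fb: "?F (unit i) (embed_y p b) = (\<Sum>k<q. Sy $$ (i - p, k) * b $ k)" "?F (embed_y p b) (unit i) = (\<Sum>k<q. b $ k * Sy $$ (k, i - p))"
    if "i < m" "\<not> i < p" for i
    using that b unfolding m_def
    by (simp_all add: bform_unit_left bform_unit_right sum_lessThan_plus embed_y_def joint_def)
  have HB: "H i j = ?B (unit i) (unit j)" if "i < m" "j < m" for i j
    unfolding entry[OF that] block_form_def px using that
    by (auto simp: F0 Fa Fb bform_unit_unit joint_apply)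
  have "bform m H u v = bform m (\<lambda>i j. ?B (unit i) (unit j)) u v"
    by (intro bform_cong HB) auto
  also have "\<dots> = ?B (\<Sum>i<m. u i *\<^sub>R unit i) (\<Sum>i<m. v i *\<^sub>R unit i)"
    by (rule bilinear_truncate[OF bilinear_block_form[OF bilinear_bform]])
  also have "\<dots> = ?B u v"
    unfolding block_form_def
    by (intro arg_cong2[of _ _ _ _ "(*)"] arg_cong2[of _ _ _ _ "(+)"] arg_cong2[of _ _ _ _ "(-)"] refl bform_cong)
       (auto simp: proj_x_def proj_y_def truncate_apply)
  finally show "bform m H u v = ?B u v" .
qed

lemma vec_l1_fun: "vec_l1 w = n1 (dim_vec w) (\<lambda>i. w $ i)"
  by (simp add: vec_l1_def n1_def)

lemma vec_l2_fun: "vec_l2 w = n2 (dim_vec w) (\<lambda>i. w $ i)"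
  unfolding vec_l2_def n2_def L2_set_def scalar_prod_def
  by (simp add: power2_eq_square lessThan_atLeast0)

lemma n1_cong: "(\<And>i. i < d \<Longrightarrow> u i = v i) \<Longrightarrow> n1 d u = n1 d v"
  by (simp add: n1_def)

lemma n2_cong: "(\<And>i. i < d \<Longrightarrow> u i = v i) \<Longrightarrow> n2 d u = n2 d v"
  unfolding n2_def by (intro L2_set_cong) auto

lemma embed_norms:
  assumes "w \<in> carrier_vec p"
  shows "n1 (p + q) (embed_x w) = vec_l1 w" "n2 (p + q) (embed_x w) = vec_l2 w"
    "n1 (q + p) (embed_y q w) = vec_l1 w" "n2 (q + p) (embed_y q w) = vec_l2 w"
proof -
  show "n1 (p + q) (embed_x w) = vec_l1 w" "n1 (q + p) (embed_y q w) = vec_l1 w"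
    using assms by (auto simp: n1_def vec_l1_def sum_lessThan_plus embed_x_def embed_y_def)
  have "(n2 (p + q) (embed_x w))\<^sup>2 = (vec_l2 w)\<^sup>2" "(n2 (q + p) (embed_y q w))\<^sup>2 = (vec_l2 w)\<^sup>2"
    unfolding vec_l2_fun n2_sq using assms by (auto simp: sum_lessThan_plus embed_x_def embed_y_def)
  then show "n2 (p + q) (embed_x w) = vec_l2 w" "n2 (q + p) (embed_y q w) = vec_l2 w"
    using seminorm.nonneg[OF seminorm_n2] unfolding vec_l2_fun by (auto simp: power2_eq_iff_nonneg)
qed

section \<open>The sparse CCA sample\<close>

text \<open>One member of the triangular array with the assumptions valid at every sample size;
  limits enter only when the members are put in sequence.\<close>

locale cca_sample =
  fixes S :: "'w cca" and K M \<epsilon> :: real and r n :: nat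
  assumes model: "cca_model K r n S" and n_pos: "n \<ge> 1" and r_pos: "r \<ge> 1" and K_pos: "K > 0" and M_pos: "M > 0"
    and \<epsilon>_bounds: "0 < \<epsilon>" "\<epsilon> < 1" and gap_assm: "eigengap \<epsilon> r S" and eig_assm: "bounded_eigenvalues M S"
begin

abbreviation "P \<equiv> pspace S"
abbreviation "p \<equiv> dimX S"
abbreviation "q \<equiv> dimY S"
abbreviation "m \<equiv> dimX S + dimY S"

lemma model_facts:
  shows prob: "prob_space P"
    and X: "random_vec P p (popX S)" and Y: "random_vec P q (popY S)"
    and Xi: "i < n \<Longrightarrow> random_vec P p (smpX S i)" and Yi: "i < n \<Longrightarrow> random_vec P q (smpY S i)"
    and iid: "iid_sample n S"
    and cX: "centered P p (popX S)" and cY: "centered P q (popY S)"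
    and psiX: "vec_psi2_norm P p (popX S) \<le> ennreal K" and psiY: "vec_psi2_norm P q (popY S) \<le> ennreal K"
    and U: "canU S \<in> carrier_mat p r" and V: "canV S \<in> carrier_mat q r"
    and Sxy_eq: "Sigma_xy S = Sigma_x S * canU S * mat_diag r (canL S) * (canV S)\<^sup>T * Sigma_y S"
    and UU_eq: "(canU S)\<^sup>T * Sigma_x S * canU S = 1\<^sub>m r" and VV_eq: "(canV S)\<^sup>T * Sigma_y S * canV S = 1\<^sub>m r"
    and L_mono: "i \<le> j \<Longrightarrow> j < r \<Longrightarrow> canL S j \<le> canL S i" and L_pos: "i < r \<Longrightarrow> canL S i > 0"
  using model unfolding cca_model_def Let_def by auto

definition "Z\<^sub>0 \<omega> = coords m (popX S \<omega> @\<^sub>v popY S \<omega>)"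
definition "Z i \<omega> = coords m (smpX S i \<omega> @\<^sub>v smpY S i \<omega>)"

text \<open>The norm is an infimum that may not be attained, so a bound \<open>K\<close> on it
  yields exponential moments at scales above \<open>K\<close>, such as \<open>2 * K\<close>.
  Shrinking the vector extends this from the unit sphere to the ball.\<close>

lemma subgauss_one:
  assumes psi: "vec_psi2_norm P d W \<le> ennreal K" and W: "random_vec P d W" and a: "a \<in> carrier_vec d" and a1: "vec_l2 a \<le> 1"
  shows "(\<integral>\<^sup>+\<omega>. ennreal (exp ((a \<bullet> W \<omega> / (2 * K))\<^sup>2)) \<partial>P) \<le> 2"
proof (cases "vec_l2 a = 0")
  case True
  interpret prob_space P by (rule prob)
  have "n2 d (\<lambda>i. a $ i) = 0" using True a by (simp add: vec_l2_fun)
  then have "(\<Sum>k<d. (a $ k)\<^sup>2) = 0" using n2_sq[of d "\<lambda>i. a $ i"] by simp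
  then have "a $ k = 0" if "k < d" for k using that by (simp add: sum_nonneg_eq_0_iff)
  then have "a \<bullet> W \<omega> = 0" if "\<omega> \<in> space P" for \<omega>
    using W that a unfolding random_vec_def scalar_prod_def by (intro sum.neutral) auto
  then have "(\<integral>\<^sup>+\<omega>. ennreal (exp ((a \<bullet> W \<omega> / (2 * K))\<^sup>2)) \<partial>P) = (\<integral>\<^sup>+\<omega>. 1 \<partial>P)"
    by (intro nn_integral_cong) simp
  also have "\<dots> \<le> 2" by (simp add: emeasure_space_1)
  finally show ?thesis .
next
  case False
  define s where "s = vec_l2 a"
  have s: "0 < s" "s \<le> 1" using False a1 seminorm.nonneg[OF seminorm_n2, of d "\<lambda>i. a $ i"] a
    unfolding s_def vec_l2_fun by auto
  define u where "u = (1 / s) \<cdot>\<^sub>v a"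
  have u: "u \<in> carrier_vec d" using a by (simp add: u_def)
  have au: "a = s \<cdot>\<^sub>v u" using s by (simp add: u_def smult_smult_assoc)
  have "vec_l2 u = 1"
  proof -
    have "vec_l2 u = n2 d ((1 / s) *\<^sub>R (\<lambda>i. a $ i))"
      using a unfolding vec_l2_fun u_def by (simp, intro n2_cong) simp
    also have "\<dots> = 1" using s a unfolding seminorm.scale[OF seminorm_n2] by (simp add: s_def vec_l2_fun)
    finally show ?thesis .
  qed
  then have "psi2_norm P (\<lambda>\<omega>. u \<bullet> W \<omega>) \<le> vec_psi2_norm P d W"
    unfolding vec_psi2_norm_def using u by (intro SUP_upper) auto
  also have "\<dots> < ennreal (2 * K)" by (rule le_less_trans[OF psi]) (use K_pos in \<open>simp add: ennreal_less_iff\<close>)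
  finally obtain t where t: "t > 0" "(\<integral>\<^sup>+\<omega>. ennreal (exp ((u \<bullet> W \<omega> / t)\<^sup>2)) \<partial>P) \<le> 2" "ennreal t < ennreal (2 * K)"
    unfolding psi2_norm_def Inf_less_iff by auto
  have tK: "t < 2 * K" using t by (simp add: ennreal_less_iff)
  have "(\<integral>\<^sup>+\<omega>. ennreal (exp ((a \<bullet> W \<omega> / (2 * K))\<^sup>2)) \<partial>P) \<le> (\<integral>\<^sup>+\<omega>. ennreal (exp ((u \<bullet> W \<omega> / t)\<^sup>2)) \<partial>P)"
  proof (intro nn_integral_mono ennreal_leI, subst exp_le_cancel_iff, rule abs_le_square_iff[THEN iffD1])
    fix \<omega> assume "\<omega> \<in> space P"
    then have "W \<omega> \<in> carrier_vec d" using W by (simp add: random_vec_def)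
    then have "a \<bullet> W \<omega> = s * (u \<bullet> W \<omega>)" using u by (simp add: au)
    moreover have "s * \<bar>u \<bullet> W \<omega>\<bar> / (2 * K) \<le> \<bar>u \<bullet> W \<omega>\<bar> / t"
    proof (rule frac_le)
      show "s * \<bar>u \<bullet> W \<omega>\<bar> \<le> \<bar>u \<bullet> W \<omega>\<bar>" using s by (simp add: mult_left_le_one_le)
    qed (use t tK in auto)
    ultimately show "\<bar>a \<bullet> W \<omega> / (2 * K)\<bar> \<le> \<bar>u \<bullet> W \<omega> / t\<bar>" using s t K_pos by (simp add: abs_mult)
  qed
  then show ?thesis using t(2) by simp
qed

lemma Z_coord:
  assumes "x \<in> carrier_vec p" "y \<in> carrier_vec q" "k < m"
  shows "coords m (x @\<^sub>v y) k = (if k < p then x $ k else y $ (k - p))"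
  using assms by (simp add: coords_def)

lemma lform_coords:
  assumes "x \<in> carrier_vec p" "y \<in> carrier_vec q"
  shows "lform m u (coords m (x @\<^sub>v y)) = Matrix.vec p u \<bullet> x + Matrix.vec q (\<lambda>i. u (p + i)) \<bullet> y"
proof -
  have "lform m u (coords m (x @\<^sub>v y)) = (\<Sum>k<m. u k * (if k < p then x $ k else y $ (k - p)))"
    unfolding lform_def by (intro sum.cong) (auto simp: Z_coord[OF assms])
  also have "\<dots> = Matrix.vec p u \<bullet> x + Matrix.vec q (\<lambda>i. u (p + i)) \<bullet> y"
    unfolding sum_lessThan_plus scalar_prod_def using assms by (simp add: lessThan_atLeast0)
  finally show ?thesis .
qed

lemma coords_measurable:
  assumes "random_vec P p A" "random_vec P q B"
  shows "(\<lambda>\<omega>. coords m (A \<omega> @\<^sub>v B \<omega>)) \<in> measurable P (coord_space m)"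
  unfolding coords_def coord_space_def
proof (rule measurable_restrict)
  fix k assume "k \<in> {..<m}"
  then have k: "k < m" by simp
  have "(A \<omega> @\<^sub>v B \<omega>) $ k = (if k < p then A \<omega> $ k else B \<omega> $ (k - p))" if "\<omega> \<in> space P" for \<omega>
  proof -
    have "A \<omega> \<in> carrier_vec p" "B \<omega> \<in> carrier_vec q" using assms that by (auto simp: random_vec_def)
    then show ?thesis using k by simp
  qed
  then have "(\<lambda>\<omega>. (A \<omega> @\<^sub>v B \<omega>) $ k) \<in> borel_measurable P \<longleftrightarrow>
      (\<lambda>\<omega>. if k < p then A \<omega> $ k else B \<omega> $ (k - p)) \<in> borel_measurable P"
    by (intro measurable_cong) auto
  also have "\<dots>" using assms k by (cases "k < p") (auto simp: random_vec_def)
  finally show "(\<lambda>\<omega>. (A \<omega> @\<^sub>v B \<omega>) $ k) \<in> borel_measurable P" .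
qed

text \<open>\<open>popX\<close> and \<open>popY\<close> are dependent and only their separate norms
  are bounded. For the normalised marginals x and y, the square of (x + y) / 2 is at most the mean
  of the squares, and the product of exp (x^2 / 2) and exp (y^2 / 2) is at most the mean of exp
  (x^2) and exp (y^2). The halving is the second factor 2 in \<open>4 * K\<close>.\<close>

lemma subgauss_joint:
  assumes u: "(\<Sum>k<m. (u k)\<^sup>2) \<le> 1"
  shows "(\<integral>\<^sup>+\<omega>. ennreal (exp ((lform m u (Z\<^sub>0 \<omega>) / (4 * K))\<^sup>2)) \<partial>P) \<le> 2"
proof -
  define a where "a = Matrix.vec p u"
  define b where "b = Matrix.vec q (\<lambda>i. u (p + i))"
  have s: "(\<Sum>k<p. (u k)\<^sup>2) + (\<Sum>k<q. (u (p + k))\<^sup>2) \<le> 1" using u by (simp add: sum_lessThan_plus)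
  have "vec_l2 a \<le> 1"
  proof (rule power2_le_imp_le)
    show "(vec_l2 a)\<^sup>2 \<le> 1\<^sup>2" using s unfolding vec_l2_fun n2_sq a_def
      by (simp add: order_trans[OF _ s] sum_nonneg)
  qed simp
  moreover have "vec_l2 b \<le> 1"
  proof (rule power2_le_imp_le)
    show "(vec_l2 b)\<^sup>2 \<le> 1\<^sup>2" using s unfolding vec_l2_fun n2_sq b_def
      by (simp add: order_trans[OF _ s] sum_nonneg)
  qed simp
  ultimately have ab: "(\<integral>\<^sup>+\<omega>. ennreal (exp ((a \<bullet> popX S \<omega> / (2 * K))\<^sup>2)) \<partial>P) \<le> 2"
    "(\<integral>\<^sup>+\<omega>. ennreal (exp ((b \<bullet> popY S \<omega> / (2 * K))\<^sup>2)) \<partial>P) \<le> 2"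
    using subgauss_one[OF psiX X, of a] subgauss_one[OF psiY Y, of b] by (auto simp: a_def b_def)
  have meas: "(\<lambda>\<omega>. a \<bullet> popX S \<omega>) \<in> borel_measurable P" "(\<lambda>\<omega>. b \<bullet> popY S \<omega>) \<in> borel_measurable P"
  proof -
    have "(\<lambda>\<omega>. a \<bullet> popX S \<omega>) \<in> borel_measurable P \<longleftrightarrow> (\<lambda>\<omega>. \<Sum>k<p. u k * popX S \<omega> $ k) \<in> borel_measurable P"
      using X by (intro measurable_cong) (auto simp: scalar_prod_def a_def random_vec_def lessThan_atLeast0)
    also have "\<dots>" using X by (intro borel_measurable_sum borel_measurable_times) (auto simp: random_vec_def)
    finally show "(\<lambda>\<omega>. a \<bullet> popX S \<omega>) \<in> borel_measurable P" .
    have "(\<lambda>\<omega>. b \<bullet> popY S \<omega>) \<in> borel_measurable P \<longleftrightarrow> (\<lambda>\<omega>. \<Sum>k<q. u (p + k) * popY S \<omega> $ k) \<in> borel_measurable P"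
      using Y by (intro measurable_cong) (auto simp: scalar_prod_def b_def random_vec_def lessThan_atLeast0)
    also have "\<dots>" using Y by (intro borel_measurable_sum borel_measurable_times) (auto simp: random_vec_def)
    finally show "(\<lambda>\<omega>. b \<bullet> popY S \<omega>) \<in> borel_measurable P" .
  qed
  note [measurable] = meas
  have "(\<integral>\<^sup>+\<omega>. ennreal (exp ((lform m u (Z\<^sub>0 \<omega>) / (4 * K))\<^sup>2)) \<partial>P)
     \<le> (\<integral>\<^sup>+\<omega>. ennreal (1 / 2) * (ennreal (exp ((a \<bullet> popX S \<omega> / (2 * K))\<^sup>2)) + ennreal (exp ((b \<bullet> popY S \<omega> / (2 * K))\<^sup>2))) \<partial>P)"
  proof (rule nn_integral_mono)
    fix \<omega> assume w: "\<omega> \<in> space P"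
    have l: "lform m u (Z\<^sub>0 \<omega>) = a \<bullet> popX S \<omega> + b \<bullet> popY S \<omega>"
      unfolding Z\<^sub>0_def a_def b_def using X Y w by (intro lform_coords) (auto simp: random_vec_def)
    define x where "x = (a \<bullet> popX S \<omega>) / (2 * K)"
    define y where "y = (b \<bullet> popY S \<omega>) / (2 * K)"
    have eq: "lform m u (Z\<^sub>0 \<omega>) / (4 * K) = (x + y) / 2" using K_pos by (simp add: l x_def y_def field_simps)
    have "((x + y) / 2)\<^sup>2 \<le> x\<^sup>2 / 2 + y\<^sup>2 / 2"
      using sum_squares_bound[of x y] by (simp add: power2_eq_square field_simps)
    then have "exp ((lform m u (Z\<^sub>0 \<omega>) / (4 * K))\<^sup>2) \<le> exp (x\<^sup>2 / 2 + y\<^sup>2 / 2)"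
      unfolding eq by (simp only: exp_le_cancel_iff)
    also have "\<dots> = exp (x\<^sup>2 / 2) * exp (y\<^sup>2 / 2)" by (rule exp_add)
    also have "\<dots> \<le> 1 / 2 * ((exp (x\<^sup>2 / 2))\<^sup>2 + (exp (y\<^sup>2 / 2))\<^sup>2)"
      using sum_squares_bound[of "exp (x\<^sup>2 / 2)" "exp (y\<^sup>2 / 2)"] by simp
    also have "\<dots> = 1 / 2 * (exp (x\<^sup>2) + exp (y\<^sup>2))" by (simp add: exp_double[symmetric])
    finally have "ennreal (exp ((lform m u (Z\<^sub>0 \<omega>) / (4 * K))\<^sup>2)) \<le> ennreal (1 / 2 * (exp (x\<^sup>2) + exp (y\<^sup>2)))"
      by (rule ennreal_leI)
    also have "\<dots> = ennreal (1 / 2) * (ennreal (exp (x\<^sup>2)) + ennreal (exp (y\<^sup>2)))"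
      by (subst ennreal_mult, simp, simp, subst ennreal_plus) auto
    finally show "ennreal (exp ((lform m u (Z\<^sub>0 \<omega>) / (4 * K))\<^sup>2))
      \<le> ennreal (1 / 2) * (ennreal (exp ((a \<bullet> popX S \<omega> / (2 * K))\<^sup>2)) + ennreal (exp ((b \<bullet> popY S \<omega> / (2 * K))\<^sup>2)))"
      unfolding x_def y_def .
  qed
  also have "\<dots> = ennreal (1 / 2) * ((\<integral>\<^sup>+\<omega>. ennreal (exp ((a \<bullet> popX S \<omega> / (2 * K))\<^sup>2)) \<partial>P)
      + (\<integral>\<^sup>+\<omega>. ennreal (exp ((b \<bullet> popY S \<omega> / (2 * K))\<^sup>2)) \<partial>P))"
    by (subst nn_integral_cmult, simp, subst nn_integral_add) auto
  also have "\<dots> \<le> ennreal (1 / 2) * (2 + 2)" by (intro mult_left_mono add_mono ab) auto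
  also have "\<dots> = 2"
  proof -
    have "ennreal (1 / 2) * (2 + 2) = ennreal (1 / 2) * ennreal 4" by simp
    also have "\<dots> = ennreal (1 / 2 * 4)" by (rule ennreal_mult[symmetric]) auto
    finally show ?thesis by simp
  qed
  finally show ?thesis .
qed

sublocale iid_vectors P m n Z\<^sub>0 Z "4 * K"
proof -
  interpret prob_space P by (rule prob)
  have i: "indep_vars (\<lambda>_. coord_space m) Z {..<n}"
    "\<And>i. i < n \<Longrightarrow> distr P (coord_space m) (Z i) = distr P (coord_space m) Z\<^sub>0"
    using iid unfolding iid_sample_def Let_def Z_def[abs_def] Z\<^sub>0_def[abs_def] by auto
  show "iid_vectors P m n Z\<^sub>0 Z (4 * K)"
  proof
    show "Z\<^sub>0 \<in> measurable P (coord_space m)"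
      unfolding Z\<^sub>0_def[abs_def] by (rule coords_measurable[OF X Y])
  qed (use n_pos K_pos i subgauss_joint in auto)
qed

section \<open>Population covariance and canonical vectors in joint coordinates\<close>

lemma carriers [simp]:
  "Sigma_x S \<in> carrier_mat p p" "Sigma_y S \<in> carrier_mat q q" "Sigma_xy S \<in> carrier_mat p q"
  "hat_Sigma_x n S \<omega> \<in> carrier_mat p p" "hat_Sigma_y n S \<omega> \<in> carrier_mat q q" "hat_Sigma_xy n S \<omega> \<in> carrier_mat p q"
  by (simp_all add: Sigma_x_def Sigma_y_def Sigma_xy_def cov_mat_def hat_Sigma_x_def hat_Sigma_y_def hat_Sigma_xy_def emp_cov_def)

abbreviation "\<Sigma> \<equiv> joint p (Sigma_x S) (Sigma_xy S) (Sigma_y S)"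

lemma cov_joint:
  assumes "i < m" "j < m"
  shows "cov i j = \<Sigma> i j"
proof -
  have Zc: "Z\<^sub>0 \<omega> k = (if k < p then popX S \<omega> $ k else popY S \<omega> $ (k - p))" if "\<omega> \<in> space P" "k < m" for \<omega> k
    unfolding Z\<^sub>0_def using X Y that by (intro Z_coord) (auto simp: random_vec_def)
  have c: "cov i j = expectation (\<lambda>\<omega>. (if i < p then popX S \<omega> $ i else popY S \<omega> $ (i - p)) *
      (if j < p then popX S \<omega> $ j else popY S \<omega> $ (j - p)))"
    unfolding cov_def by (intro Bochner_Integration.integral_cong) (auto simp: Zc assms)
  have eX: "expectation (\<lambda>\<omega>. popX S \<omega> $ k) = 0" if "k < p" for k using cX that by (simp add: centered_def)
  have eY: "expectation (\<lambda>\<omega>. popY S \<omega> $ k) = 0" if "k < q" for k using cY that by (simp add: centered_def)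
  show ?thesis unfolding c joint_apply using assms
    by (auto simp: Sigma_x_def Sigma_y_def Sigma_xy_def cov_mat_def eX eY mult.commute)
qed

lemma emp_joint:
  assumes w: "\<omega> \<in> space P" and "i < m" "j < m"
  shows "cov i j + dev \<omega> i j = joint p (hat_Sigma_x n S \<omega>) (hat_Sigma_xy n S \<omega>) (hat_Sigma_y n S \<omega>) i j"
proof -
  have Zc: "Z l \<omega> k = (if k < p then smpX S l \<omega> $ k else smpY S l \<omega> $ (k - p))" if "l < n" "k < m" for l k
    unfolding Z_def using Xi[of l] Yi[of l] that w by (intro Z_coord) (auto simp: random_vec_def)
  have "cov i j + dev \<omega> i j = (\<Sum>l<n. (if i < p then smpX S l \<omega> $ i else smpY S l \<omega> $ (i - p)) *
      (if j < p then smpX S l \<omega> $ j else smpY S l \<omega> $ (j - p))) / n"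
    unfolding dev_def using assms by (auto simp: Zc intro!: sum.cong)
  then show ?thesis unfolding joint_apply using assms
    by (auto simp: hat_Sigma_x_def hat_Sigma_y_def hat_Sigma_xy_def emp_cov_def mult.commute)
qed

lemma cov_sym: "cov i j = cov j i"
  unfolding cov_def by (simp add: mult.commute)

lemma Sigma_x_sym: "i < p \<Longrightarrow> j < p \<Longrightarrow> Sigma_x S $$ (i, j) = Sigma_x S $$ (j, i)"
  using cov_joint[of i j] cov_joint[of j i] cov_sym[of i j] by (simp add: joint_apply)

lemma Sigma_y_sym: "i < q \<Longrightarrow> j < q \<Longrightarrow> Sigma_y S $$ (i, j) = Sigma_y S $$ (j, i)"
  using cov_joint[of "p + i" "p + j"] cov_joint[of "p + j" "p + i"] cov_sym[of "p + i" "p + j"] by (simp add: joint_apply)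

lemma bform_cov_joint: "bform m cov = bform m \<Sigma>"
  by (intro ext bform_cong) (auto simp: cov_joint)

definition "uvec k = embed_x (Matrix.col (canU S) k)"
definition "vvec k = embed_y p (Matrix.col (canV S) k)"

lemma gram_x:
  assumes "k < r" "l < r"
  shows "bform p (entries (Sigma_x S)) (\<lambda>i. canU S $$ (i, k)) (\<lambda>i. canU S $$ (i, l)) = (if k = l then 1 else 0)"
proof -
  have "((canU S)\<^sup>T * Sigma_x S * canU S) $$ (k, l) = (\<Sum>j<p. (\<Sum>i<p. canU S $$ (i, k) * Sigma_x S $$ (i, j)) * canU S $$ (j, l))"
    using U assms by (subst mult_mat_index[of _ r p _ r]) (auto simp: mult_mat_index[of _ r p _ p] simp del: index_mult_mat)
  also have "\<dots> = bform p (entries (Sigma_x S)) (\<lambda>i. canU S $$ (i, k)) (\<lambda>i. canU S $$ (i, l))"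
    unfolding bform_def sum_distrib_right by (subst sum.swap) simp
  finally show ?thesis using assms by (simp add: UU_eq)
qed

lemma gram_y:
  assumes "k < r" "l < r"
  shows "bform q (entries (Sigma_y S)) (\<lambda>i. canV S $$ (i, k)) (\<lambda>i. canV S $$ (i, l)) = (if k = l then 1 else 0)"
proof -
  have "((canV S)\<^sup>T * Sigma_y S * canV S) $$ (k, l) = (\<Sum>j<q. (\<Sum>i<q. canV S $$ (i, k) * Sigma_y S $$ (i, j)) * canV S $$ (j, l))"
    using V assms by (subst mult_mat_index[of _ r q _ r]) (auto simp: mult_mat_index[of _ r q _ q] simp del: index_mult_mat)
  also have "\<dots> = bform q (entries (Sigma_y S)) (\<lambda>i. canV S $$ (i, k)) (\<lambda>i. canV S $$ (i, l))"
    unfolding bform_def sum_distrib_right by (subst sum.swap) simp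
  finally show ?thesis using assms by (simp add: VV_eq)
qed

lemma Sigma_xy_entry:
  assumes "i < p" "j < q"
  shows "Sigma_xy S $$ (i, j) = (\<Sum>k<r. canL S k * (\<Sum>h<p. Sigma_x S $$ (i, h) * canU S $$ (h, k)) *
    (\<Sum>h<q. canV S $$ (h, k) * Sigma_y S $$ (h, j)))"
proof -
  define A where "A = Sigma_x S * canU S * mat_diag r (canL S)"
  have A: "A \<in> carrier_mat p r" unfolding A_def using U
    by (intro mult_carrier_mat[of _ p r] mult_carrier_mat[of _ p p]) auto
  have Ae: "A $$ (i, k) = (\<Sum>h<p. Sigma_x S $$ (i, h) * canU S $$ (h, k)) * canL S k" if "k < r" for k
    unfolding A_def using assms that U mult_carrier_mat[OF carriers(1) U]
    by (subst mat_diag_mult_right[of _ p r]) (auto simp: mult_mat_index[of _ p p _ r] simp del: index_mult_mat)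
  have "Sigma_xy S $$ (i, j) = (\<Sum>h<q. (\<Sum>k<r. A $$ (i, k) * canV S $$ (h, k)) * Sigma_y S $$ (h, j))"
    unfolding Sxy_eq A_def[symmetric] using assms V A
    by (subst mult_mat_index[of _ p q _ q]) (auto simp: mult_mat_index[of _ p r _ q] simp del: index_mult_mat)
  also have "\<dots> = (\<Sum>k<r. \<Sum>h<q. A $$ (i, k) * canV S $$ (h, k) * Sigma_y S $$ (h, j))"
    unfolding sum_distrib_right by (rule sum.swap)
  also have "\<dots> = (\<Sum>k<r. canL S k * (\<Sum>h<p. Sigma_x S $$ (i, h) * canU S $$ (h, k)) *
    (\<Sum>h<q. canV S $$ (h, k) * Sigma_y S $$ (h, j)))"
  proof (intro sum.cong refl)
    fix k assume "k \<in> {..<r}"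
    moreover have "(\<Sum>h<q. A $$ (i, k) * canV S $$ (h, k) * Sigma_y S $$ (h, j)) =
        A $$ (i, k) * (\<Sum>h<q. canV S $$ (h, k) * Sigma_y S $$ (h, j))"
      by (simp add: sum_distrib_left mult.assoc)
    ultimately show "(\<Sum>h<q. A $$ (i, k) * canV S $$ (h, k) * Sigma_y S $$ (h, j)) =
        canL S k * (\<Sum>h<p. Sigma_x S $$ (i, h) * canU S $$ (h, k)) * (\<Sum>h<q. canV S $$ (h, k) * Sigma_y S $$ (h, j))"
      by (simp add: Ae mult.commute)
  qed
  finally show ?thesis .
qed

lemma uvec_proj [simp]: "k < r \<Longrightarrow> proj_x p (uvec k) = uvec k" and vvec_proj [simp]: "proj_y p (vvec k) = vvec k"
  using U unfolding uvec_def vvec_def by (auto intro!: proj_embed)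

lemma form_uvec: "k < r \<Longrightarrow> bform m cov (proj_x p u) (uvec k) = (\<Sum>i<p. u i * (\<Sum>h<p. Sigma_x S $$ (i, h) * canU S $$ (h, k)))"
  unfolding bform_cov_joint
  by (subst uvec_proj[symmetric], assumption, subst bform_joint_xx)
     (use U in \<open>auto simp: bform_def uvec_def embed_x_def sum_distrib_left mult.assoc intro!: sum.cong\<close>)

lemma form_vvec: "k < r \<Longrightarrow> bform m cov (vvec k) (proj_y p u) = (\<Sum>j<q. (\<Sum>h<q. canV S $$ (h, k) * Sigma_y S $$ (h, j)) * u (p + j))"
proof -
  assume k: "k < r"
  have "bform m cov (vvec k) (proj_y p u) = bform m cov (proj_y p (vvec k)) (proj_y p u)" by simp
  also have "\<dots> = bform q (entries (Sigma_y S)) (\<lambda>i. vvec k (p + i)) (\<lambda>i. u (p + i))"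
    unfolding bform_cov_joint by (rule bform_joint_yy)
  also have "\<dots> = (\<Sum>j<q. \<Sum>h<q. vvec k (p + h) * Sigma_y S $$ (h, j) * u (p + j))"
    unfolding bform_def by (rule sum.swap)
  also have "\<dots> = (\<Sum>j<q. (\<Sum>h<q. canV S $$ (h, k) * Sigma_y S $$ (h, j)) * u (p + j))"
    unfolding sum_distrib_right using V k by (intro sum.cong refl) (auto simp: vvec_def embed_y_def)
  finally show ?thesis .
qed

lemma row_zero_card:
  assumes "A \<in> carrier_mat d r"
  shows "\<And>i k. i < d \<Longrightarrow> k < r \<Longrightarrow> i \<notin> {i. i < d \<and> Matrix.row A i \<noteq> 0\<^sub>v r} \<Longrightarrow> A $$ (i, k) = 0"
    and "card {i. i < d \<and> Matrix.row A i \<noteq> 0\<^sub>v r} = nonzero_rows A"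
proof -
  fix i k assume "i < d" "k < r" "i \<notin> {i. i < d \<and> Matrix.row A i \<noteq> 0\<^sub>v r}"
  then have "Matrix.row A i $ k = 0" by simp
  then show "A $$ (i, k) = 0" using assms \<open>i < d\<close> \<open>k < r\<close> by simp
qed (use assms in \<open>auto simp: nonzero_rows_def\<close>)

lemma uvec_sparse: "k < r \<Longrightarrow> n1 m (uvec k) \<le> sqrt (nonzero_rows (canU S)) * n2 m (uvec k)"
proof (rule n1_le_n2[of "{i. i < p \<and> Matrix.row (canU S) i \<noteq> 0\<^sub>v r}"])
  fix i assume "k < r" "i < m" "i \<notin> {i. i < p \<and> Matrix.row (canU S) i \<noteq> 0\<^sub>v r}"
  then show "uvec k i = 0" using row_zero_card(1)[OF U, of i k] U by (auto simp: uvec_def embed_x_def)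
qed (auto simp: row_zero_card(2)[OF U])

lemma vvec_sparse: "k < r \<Longrightarrow> n1 m (vvec k) \<le> sqrt (nonzero_rows (canV S)) * n2 m (vvec k)"
proof (rule n1_le_n2[of "(+) p ` {i. i < q \<and> Matrix.row (canV S) i \<noteq> 0\<^sub>v r}"])
  show "card ((+) p ` {i. i < q \<and> Matrix.row (canV S) i \<noteq> 0\<^sub>v r}) \<le> nonzero_rows (canV S)"
    by (rule order_trans[OF card_image_le]) (auto simp: row_zero_card(2)[OF V])
  fix i assume k: "k < r" and i: "i < m" "i \<notin> (+) p ` {i. i < q \<and> Matrix.row (canV S) i \<noteq> 0\<^sub>v r}"
  show "vvec k i = 0"
  proof (cases "p \<le> i")
    case True
    then have "i - p \<notin> {i. i < q \<and> Matrix.row (canV S) i \<noteq> 0\<^sub>v r}" "i - p < q" using i by (auto simp: image_iff)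
    then show ?thesis using row_zero_card(1)[OF V, of "i - p" k] V k True by (auto simp: vvec_def embed_y_def)
  qed (simp add: vvec_def embed_y_def)
qed auto

lemma bform_Sigma_x: "bform m cov (proj_x p u) (proj_x p v) = bform p (entries (Sigma_x S)) u v"
  unfolding bform_cov_joint by (rule bform_joint_xx)

lemma bform_Sigma_y: "bform m cov (proj_y p u) (proj_y p v) = bform q (entries (Sigma_y S)) (\<lambda>i. u (p + i)) (\<lambda>i. v (p + i))"
  unfolding bform_cov_joint by (rule bform_joint_yy)

lemma uu: "k < r \<Longrightarrow> l < r \<Longrightarrow> bform m cov (uvec k) (uvec l) = (if k = l then 1 else 0)"
proof -
  assume kl: "k < r" "l < r"
  have "bform m cov (uvec k) (uvec l) = bform p (entries (Sigma_x S)) (uvec k) (uvec l)"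
    using bform_Sigma_x[of "uvec k" "uvec l"] kl by simp
  also have "\<dots> = bform p (entries (Sigma_x S)) (\<lambda>i. canU S $$ (i, k)) (\<lambda>i. canU S $$ (i, l))"
    by (intro bform_cong) (use U kl in \<open>auto simp: uvec_def embed_x_def\<close>)
  finally show ?thesis using gram_x[OF kl] by simp
qed

lemma vv: "k < r \<Longrightarrow> l < r \<Longrightarrow> bform m cov (vvec k) (vvec l) = (if k = l then 1 else 0)"
proof -
  assume kl: "k < r" "l < r"
  have "bform m cov (vvec k) (vvec l) = bform q (entries (Sigma_y S)) (\<lambda>i. vvec k (p + i)) (\<lambda>i. vvec l (p + i))"
    using bform_Sigma_y[of "vvec k" "vvec l"] by simp
  also have "\<dots> = bform q (entries (Sigma_y S)) (\<lambda>i. canV S $$ (i, k)) (\<lambda>i. canV S $$ (i, l))"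
    by (intro bform_cong) (use V kl in \<open>auto simp: vvec_def embed_y_def\<close>)
  finally show ?thesis using gram_y[OF kl] by simp
qed

text \<open>A canonical vector has unit variance, hence is not 0, and the l1 bound by the number of
  nonzero rows makes that number positive. This yields \<open>\<sigma> \<ge> 1\<close> and, in the
  limit, dimensions tending to infinity.\<close>

lemma sparsity_pos: "nonzero_rows (canU S) \<ge> 1" "nonzero_rows (canV S) \<ge> 1"
proof -
  have 0: "0 < r" using r_pos by simp
  have *: "n2 m w \<noteq> 0" if "bform m cov w w = 1" for w
  proof
    assume "n2 m w = 0"
    then have "\<And>i. i < m \<Longrightarrow> w i = 0" using n2_sq[of m w] by (simp add: sum_nonneg_eq_0_iff)
    then show False using that by (simp add: bform_def)
  qed
  have **: "n2 m w = 0" if "n1 m w = 0" for w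
    using that n2_sq[of m w] by (simp add: n1_def sum_nonneg_eq_0_iff)
  show "nonzero_rows (canU S) \<ge> 1"
  proof (rule ccontr)
    assume "\<not> ?thesis"
    then have "nonzero_rows (canU S) = 0" by simp
    then have "n1 m (uvec 0) \<le> 0" using uvec_sparse[OF 0] by simp
    then have "n1 m (uvec 0) = 0" using seminorm.nonneg[OF seminorm_n1, of m "uvec 0"] by linarith
    then show False using *[of "uvec 0"] **[of "uvec 0"] uu[OF 0 0] by simp
  qed
  show "nonzero_rows (canV S) \<ge> 1"
  proof (rule ccontr)
    assume "\<not> ?thesis"
    then have "nonzero_rows (canV S) = 0" by simp
    then have "n1 m (vvec 0) \<le> 0" using vvec_sparse[OF 0] by simp
    then have "n1 m (vvec 0) = 0" using seminorm.nonneg[OF seminorm_n1, of m "vvec 0"] by linarith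
    then show False using *[of "vvec 0"] **[of "vvec 0"] vv[OF 0 0] by simp
  qed
qed

abbreviation "\<sigma> \<equiv> sqrt (real (sparsity S))"

text \<open>\<open>max 1 M\<close> in place of \<open>M\<close> meets the requirement of a bound of
  at least 1; enlarging the bound preserves all four eigenvalue inequalities.\<close>

sublocale canonical_form "n1 m" "n2 m" "proj_x p" "proj_y p" "bform m cov" "max 1 M" \<epsilon> \<sigma> r uvec vvec "canL S"
proof -
  interpret split_space "n1 m" "n2 m" "proj_x p" "proj_y p" by (rule split_space_proj)
  have psd: "psd_form (bform m cov)"
  proof
    show "bform m cov u u \<ge> 0" for u unfolding bform_cov by (intro integral_nonneg_AE) auto
  qed (use bilinear_bform bform_sym cov_sym in blast)+
  have ex: "Matrix.mat p p (\<lambda>(i, j). Sigma_x S $$ (i, j)) = Sigma_x S" and ey: "Matrix.mat q q (\<lambda>(i, j). Sigma_y S $$ (i, j)) = Sigma_y S"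
    by (auto intro!: eq_matI simp: carrier_matD[OF carriers(1)] carrier_matD[OF carriers(2)])
  have ex': "Matrix.mat p p (($$) (Sigma_x S)) = Sigma_x S" and ey': "Matrix.mat q q (($$) (Sigma_y S)) = Sigma_y S"
    using ex ey by simp_all
  have N: "(n2 m (proj_x p u))\<^sup>2 = (n2 p u)\<^sup>2" "(n2 m (proj_y p u))\<^sup>2 = (n2 q (\<lambda>i. u (p + i)))\<^sup>2" for u
    unfolding n2_sq sum_lessThan_plus by (auto simp: proj_x_def proj_y_def)
  have ev: "inverse M \<le> k" "k \<le> M" if "eigenvalue (Sigma_x S) k \<or> eigenvalue (Sigma_y S) k" for k
    using eig_assm that unfolding bounded_eigenvalues_def by auto
  have lo: "z \<le> max 1 M * y" if "inverse M * z \<le> y" "0 \<le> z" for z y :: real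
  proof -
    have "z \<le> M * y" using that M_pos by (simp add: field_simps)
    moreover have "0 \<le> y" by (rule order_trans[OF _ that(1)]) (use that M_pos in simp)
    then have "M * y \<le> max 1 M * y" by (intro mult_right_mono) auto
    ultimately show ?thesis by linarith
  qed
  have up: "y \<le> max 1 M * z" if "y \<le> M * z" "0 \<le> z" for z y :: real
    using that mult_right_mono[of M "max 1 M" z] by simp
  have sp: "sqrt (real k) * n2 m w \<le> \<sigma> * n2 m w" if "k \<le> sparsity S" for k w
    using that seminorm.nonneg[OF seminorm_n2] by (intro mult_right_mono) auto
  show "canonical_form (n1 m) (n2 m) (proj_x p) (proj_y p) (bform m cov) (max 1 M) \<epsilon> \<sigma> r uvec vvec (canL S)"
  proof (intro canonical_form.intro canonical_form_axioms.intro psd split_space_proj)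
    show "1 \<le> max 1 M" "0 < \<epsilon>" "\<epsilon> < 1" "1 \<le> r" "1 \<le> \<sigma>"
      using \<epsilon>_bounds r_pos sparsity_pos by (auto simp: sparsity_def)
    show "(n2 m (proj_x p u))\<^sup>2 \<le> max 1 M * bform m cov (proj_x p u) (proj_x p u)" for u
      unfolding bform_Sigma_x N
      by (intro lo eigenvalues_lower_bound) (use Sigma_x_sym ev in \<open>auto simp: ex'\<close>)
    show "(n2 m (proj_y p u))\<^sup>2 \<le> max 1 M * bform m cov (proj_y p u) (proj_y p u)" for u
      unfolding bform_Sigma_y N
      by (intro lo eigenvalues_lower_bound) (use Sigma_y_sym ev in \<open>auto simp: ey'\<close>)
    show "bform m cov (proj_x p u) (proj_x p u) \<le> max 1 M * (n2 m (proj_x p u))\<^sup>2" for u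
      unfolding bform_Sigma_x N
      by (intro up eigenvalues_upper_bound) (use Sigma_x_sym ev in \<open>auto simp: ex'\<close>)
    show "bform m cov (proj_y p u) (proj_y p u) \<le> max 1 M * (n2 m (proj_y p u))\<^sup>2" for u
      unfolding bform_Sigma_y N
      by (intro up eigenvalues_upper_bound) (use Sigma_y_sym ev in \<open>auto simp: ey'\<close>)
    show "proj_x p (uvec k) = uvec k" if "k < r" for k using that by simp
    show "proj_y p (vvec k) = vvec k" for k by simp
    show "bform m cov (uvec k) (uvec l) = (if k = l then 1 else 0)" if "k < r" "l < r" for k l using uu that by simp
    show "bform m cov (vvec k) (vvec l) = (if k = l then 1 else 0)" if "k < r" "l < r" for k l using vv that by simp
    show "bform m cov (proj_x p u) (proj_y p v) = (\<Sum>k<r. canL S k * bform m cov (proj_x p u) (uvec k) * bform m cov (vvec k) (proj_y p v))" for u v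
    proof -
      define A where "A i k = (\<Sum>h<p. Sigma_x S $$ (i, h) * canU S $$ (h, k))" for i k
      define B where "B k j = (\<Sum>h<q. canV S $$ (h, k) * Sigma_y S $$ (h, j))" for k j
      have "bform m cov (proj_x p u) (proj_y p v) = (\<Sum>i<p. \<Sum>j<q. u i * (\<Sum>k<r. canL S k * A i k * B k j) * v (p + j))"
        unfolding bform_cov_joint bform_joint_xy by (intro sum.cong refl) (auto simp: Sigma_xy_entry A_def B_def)
      also have "\<dots> = (\<Sum>i<p. \<Sum>j<q. \<Sum>k<r. canL S k * (u i * A i k) * (B k j * v (p + j)))"
        by (simp add: sum_distrib_left sum_distrib_right mult_ac)
      also have "\<dots> = (\<Sum>i<p. \<Sum>k<r. \<Sum>j<q. canL S k * (u i * A i k) * (B k j * v (p + j)))"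
        by (intro sum.cong refl sum.swap)
      also have "\<dots> = (\<Sum>k<r. \<Sum>i<p. \<Sum>j<q. canL S k * (u i * A i k) * (B k j * v (p + j)))"
        by (rule sum.swap)
      also have "\<dots> = (\<Sum>k<r. canL S k * (\<Sum>i<p. u i * A i k) * (\<Sum>j<q. B k j * v (p + j)))"
        by (simp add: sum_distrib_left sum_distrib_right mult_ac)
      also have "\<dots> = (\<Sum>k<r. canL S k * bform m cov (proj_x p u) (uvec k) * bform m cov (vvec k) (proj_y p v))"
        by (intro sum.cong refl) (auto simp: form_uvec form_vvec A_def B_def)
      finally show ?thesis .
    qed
    have L0: "0 < canL S 0" using L_pos r_pos by simp
    show "0 \<le> canL S k \<and> canL S k \<le> canL S 0 - \<epsilon>" if "1 \<le> k" "k < r" for k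
      using that L_pos[of k] L_mono[of 1 k] gap_assm unfolding eigengap_def rho0_def Lambda2_def by auto
    show "\<epsilon> \<le> canL S 0"
      using gap_assm L_pos[of 1] r_pos unfolding eigengap_def rho0_def Lambda2_def by (auto split: if_splits)
    show "n1 m (uvec k) \<le> \<sigma> * n2 m (uvec k)" if "k < r" for k
      using uvec_sparse[OF that] sp[of "nonzero_rows (canU S)" "uvec k"] by (simp add: sparsity_def)
    show "n1 m (vvec k) \<le> \<sigma> * n2 m (vvec k)" if "k < r" for k
      using vvec_sparse[OF that] sp[of "nonzero_rows (canV S)" "vvec k"] by (simp add: sparsity_def)
  qed
qed

end

context cca_sample
begin

section \<open>The Hessian, its inverse, and its estimate\<close>

lemma alpha0_carrier: "alpha0 S \<in> carrier_vec p" and beta0_carrier: "beta0 S \<in> carrier_vec q"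
  unfolding alpha0_def beta0_def using col_carrier_vec[OF r0 U] col_carrier_vec[OF r0 V] by auto

lemma H0_entry:
  assumes "i < m" "j < m"
  shows "H0 S $$ (i, j) = 2 *
      (if i < p then if j < p
         then \<rho> * Sigma_x S $$ (i, j) + 2 * \<rho> * (\<Sum>k<p. Sigma_x S $$ (i, k) * alpha0 S $ k) * (\<Sum>k<p. alpha0 S $ k * Sigma_x S $$ (k, j))
         else - Sigma_xy S $$ (i, j - p)
       else if j < p then - Sigma_xy S $$ (j, i - p)
         else \<rho> * Sigma_y S $$ (i - p, j - p)
           + 2 * \<rho> * (\<Sum>k<q. Sigma_y S $$ (i - p, k) * beta0 S $ k) * (\<Sum>k<q. beta0 S $ k * Sigma_y S $$ (k, j - p)))"
proof -
  note a = alpha0_carrier and b = beta0_carrier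
  note d = carrier_matD[OF carriers(1)] carrier_matD[OF carriers(2)] carrier_matD[OF carriers(3)]
  have dS: "dim_row (outer_prod x y) = dim_vec x" "dim_col (outer_prod x y) = dim_vec y" for x y
    by (simp_all add: outer_prod_def)
  have ent: "H0 S $$ (i, j) = (2 * \<rho>) *
      (if i < p then if j < p
         then Sigma_x S $$ (i, j) + 2 * ((\<Sum>k<p. Sigma_x S $$ (i, k) * alpha0 S $ k) * (\<Sum>k<p. alpha0 S $ k * Sigma_x S $$ (k, j)))
         else - (inverse \<rho> * Sigma_xy S $$ (i, j - p))
       else if j < p then - (inverse \<rho> * Sigma_xy S $$ (j, i - p))
         else Sigma_y S $$ (i - p, j - p)
           + 2 * ((\<Sum>k<q. Sigma_y S $$ (i - p, k) * beta0 S $ k) * (\<Sum>k<q. beta0 S $ k * Sigma_y S $$ (k, j - p))))"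
    unfolding H0_def Let_def rho0_def using assms
    by (simp add: d outer_sandwich[OF carriers(1) a] outer_sandwich[OF carriers(2) b] del: index_mult_mat(1))
  have inv: "2 * \<rho> * - (inverse \<rho> * x) = 2 * - x" for x using rho_pos by simp
  have dist: "2 * \<rho> * (x + 2 * (y * z)) = 2 * (\<rho> * x + 2 * \<rho> * y * z)" for x y z :: real by (simp add: algebra_simps)
  show ?thesis unfolding ent by (simp only: inv dist split: if_split) simp
qed

lemma H0_carrier: "H0 S \<in> carrier_mat m m"
  unfolding H0_def Let_def
  using carrier_matD[OF carriers(1)] carrier_matD[OF carriers(2)] carrier_matD[OF carriers(3)] by auto

lemma H0_form: "bform m (entries (H0 S)) = H"
proof -
  note a = alpha0_carrier and b = beta0_carrier
  have "bform m (entries (H0 S)) = block_form \<rho> \<rho> \<rho> (bform m \<Sigma>) (embed_x (alpha0 S)) (embed_y p (beta0 S))"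
    by (rule block_matrix_form[OF carriers(1,2,3) a b]) (rule H0_entry)
  then show ?thesis
    unfolding H_def unfolding bform_cov_joint uvec_def vvec_def alpha0_def beta0_def .
qed

lemma H0_sym: "i < m \<Longrightarrow> j < m \<Longrightarrow> H0 S $$ (i, j) = H0 S $$ (j, i)"
  using sym_H[of "unit i" "unit j"] unfolding H0_form[symmetric] by (simp add: bform_unit_unit)

lemma H_pd: "n2 m u \<noteq> 0 \<Longrightarrow> H u u > 0"
proof -
  assume "n2 m u \<noteq> 0"
  then have "0 < 2 * \<epsilon> / max 1 M * (n2 m u)\<^sup>2" using \<epsilon>_bounds by simp
  then show ?thesis using H_lower[of u] by linarith
qed

text \<open>A principal submatrix is the form restricted to functions vanishing at the node and so
  inherits definiteness. This gives the inverse in \<open>eta0\<close> its meaning.\<close>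

lemma node_lift:
  assumes j: "j < m"
  defines "lift u \<equiv> \<lambda>i. if i = j then 0 else u (delete_index j i)"
  shows "bform (m - 1) (entries (mat_delete (H0 S) j j)) u v = H (lift u) (lift v)"
    and "n2 (m - 1) u = n2 m (lift u)"
proof -
  have l: "lift u (insert_index j i) = u i" for u i by (simp add: lift_def)
  have l0: "lift u j = 0" for u by (simp add: lift_def)
  have "H (lift u) (lift v) = (\<Sum>i<m. lift u i * (\<Sum>k<m. H0 S $$ (i, k) * lift v k))"
    unfolding H0_form[symmetric] bform_def by (simp add: sum_distrib_left mult.assoc)
  also have "\<dots> = (\<Sum>i<m - 1. u i * (\<Sum>k<m. H0 S $$ (insert_index j i, k) * lift v k))"
    by (subst sum_except_node[OF j]) (auto simp: l l0)
  also have "\<dots> = (\<Sum>i<m - 1. u i * (\<Sum>k<m - 1. H0 S $$ (insert_index j i, insert_index j k) * v k))"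
  proof (intro sum.cong refl)
    fix i
    have "(\<Sum>k<m. H0 S $$ (insert_index j i, k) * lift v k)
      = (\<Sum>k<m - 1. H0 S $$ (insert_index j i, insert_index j k) * v k)"
      by (subst sum_except_node[OF j]) (auto simp: l l0)
    then show "u i * (\<Sum>k<m. H0 S $$ (insert_index j i, k) * lift v k)
      = u i * (\<Sum>k<m - 1. H0 S $$ (insert_index j i, insert_index j k) * v k)" by simp
  qed
  also have "\<dots> = bform (m - 1) (entries (mat_delete (H0 S) j j)) u v"
    unfolding bform_def sum_distrib_left using carrier_matD[OF H0_carrier]
    by (intro sum.cong refl) (auto simp: mat_delete_def insert_index_def)
  finally show "bform (m - 1) (entries (mat_delete (H0 S) j j)) u v = H (lift u) (lift v)" by simp
  have "(n2 (m - 1) u)\<^sup>2 = (n2 m (lift u))\<^sup>2"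
    unfolding n2_sq using sum_except_node[OF j, of "\<lambda>i. (lift u i)\<^sup>2"] by (simp add: l l0)
  then show "n2 (m - 1) u = n2 m (lift u)"
    using seminorm.nonneg[OF seminorm_n2] by (simp add: power2_eq_iff_nonneg)
qed

lemma eta0_eq:
  assumes j: "j < m"
  shows "eta0 S j \<in> carrier_vec (m - 1)" "mat_delete (H0 S) j j *\<^sub>v eta0 S j = col_delete (H0 S) j"
proof -
  let ?D = "mat_delete (H0 S) j j"
  have D: "?D \<in> carrier_mat (m - 1) (m - 1)" by (rule mat_delete_carrier[OF H0_carrier])
  have c: "col_delete (H0 S) j \<in> carrier_vec (m - 1)" using H0_carrier by (auto simp: col_delete_def)
  have "det ?D \<noteq> 0"
  proof (rule pd_det_nonzero[OF D])
    fix u assume "n2 (m - 1) u \<noteq> 0"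
    then show "bform (m - 1) (entries ?D) u u \<noteq> 0"
      unfolding node_lift[OF j] using H_pd by fastforce
  qed
  note inv = mat_inv_inverse[OF D this]
  show "eta0 S j \<in> carrier_vec (m - 1)" unfolding eta0_def using inv c by auto
  have "?D *\<^sub>v eta0 S j = (?D * mat_inv ?D) *\<^sub>v col_delete (H0 S) j"
    unfolding eta0_def by (rule assoc_mult_mat_vec[symmetric, OF D inv(3) c])
  also have "\<dots> = col_delete (H0 S) j" unfolding inv(1) using c by simp
  finally show "?D *\<^sub>v eta0 S j = col_delete (H0 S) j" .
qed

text \<open>By the normal equations \<open>H0\<close> maps this vector to a multiple of
  \<open>unit j\<close>, so it is column \<open>j\<close> of \<open>Phi0\<close> up to
  scale.\<close>

definition "\<Gamma> j = unit j - node_embed j (eta0 S j)"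

lemma \<Gamma>_orth:
  assumes "j < m" "w j = 0"
  shows "H (\<Gamma> j) w = 0"
  unfolding H0_form[symmetric] \<Gamma>_def
  by (subst node_form[where w = w, OF H0_carrier H0_sym assms(1) eta0_eq(1)[OF assms(1)] assms(2)]) (simp_all add: eta0_eq(2)[OF assms(1)])

lemma unit_apply: "unit j i = (if i = j then 1 else 0)"
  by (simp add: unit_def)

lemma \<Gamma>_node: "\<Gamma> j j = 1"
  by (simp add: \<Gamma>_def unit_apply)

lemma abs_coord_le_n2: "i < d \<Longrightarrow> \<bar>w i\<bar> \<le> n2 d w"
  unfolding n2_def using member_le_L2_set[of "{..<d}" i "\<lambda>i. \<bar>w i\<bar>"] by (simp add: L2_set_def)

lemma n2_unit: "i < d \<Longrightarrow> n2 d (unit i) = 1"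
proof -
  assume "i < d"
  then have "(n2 d (unit i))\<^sup>2 = 1"
    unfolding n2_sq by (simp add: unit_apply if_distrib[of "\<lambda>x. x\<^sup>2"] cong: if_cong)
  then show ?thesis using seminorm.nonneg[OF seminorm_n2, of d "unit i"] by (simp add: power2_eq_1_iff)
qed

lemma n1_unit: "i < d \<Longrightarrow> n1 d (unit i) = 1"
  by (simp add: n1_def unit_apply if_distrib[of abs] cong: if_cong)

lemma H_unit_\<Gamma>:
  assumes "i < m" "j < m"
  shows "H (unit i) (\<Gamma> j) = (if i = j then H (\<Gamma> j) (\<Gamma> j) else 0)"
proof (cases "i = j")
  case True
  have "unit j = \<Gamma> j + node_embed j (eta0 S j)" by (simp add: \<Gamma>_def)
  then have "H (unit j) (\<Gamma> j) = H (\<Gamma> j) (\<Gamma> j) + H (node_embed j (eta0 S j)) (\<Gamma> j)" by (simp only: hsimps)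
  also have "H (node_embed j (eta0 S j)) (\<Gamma> j) = 0" by (subst sym_H) (rule \<Gamma>_orth[OF assms(2)], simp)
  finally show ?thesis using True by simp
next
  case False
  then show ?thesis by (subst sym_H) (simp add: \<Gamma>_orth[OF assms(2)] unit_apply)
qed

text \<open>\<open>unit j\<close> is the \<open>H\<close>-orthogonal sum of
  \<open>\<Gamma> j\<close> and a vector vanishing at the node, so by Pythagoras the form at
  \<open>\<Gamma> j\<close> is at most its value at \<open>unit j\<close>; \<open>H_lower\<close>
  turns this into a norm bound, rounded up to a perfect square.\<close>

lemma \<Gamma>_bounds:
  assumes j: "j < m"
  shows "1 \<le> n2 m (\<Gamma> j)" "n2 m (\<Gamma> j) \<le> 3 * (max 1 M)\<^sup>2 / \<epsilon>"
proof -
  show one: "1 \<le> n2 m (\<Gamma> j)" using abs_coord_le_n2[OF j, of "\<Gamma> j"] by (simp add: \<Gamma>_node)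
  define M' where "M' = max 1 M"
  have M': "M' \<ge> 1" by (simp add: M'_def)
  define w where "w = node_embed j (eta0 S j)"
  have u: "unit j = \<Gamma> j + w" by (simp add: \<Gamma>_def w_def)
  have o: "H (\<Gamma> j) w = 0" "H w (\<Gamma> j) = 0" using \<Gamma>_orth[OF j, of w] sym_H[of w "\<Gamma> j"] by (auto simp: w_def)
  have "H (unit j) (unit j) = H (\<Gamma> j) (\<Gamma> j) + H w w" unfolding u hsimps o by simp
  moreover have "\<bar>H (unit j) (unit j)\<bar> \<le> 16 * M'\<^sup>2" using H_upper[of "unit j" "unit j"] n2_unit[OF j] by (simp add: M'_def)
  ultimately have "H (\<Gamma> j) (\<Gamma> j) \<le> 16 * M'\<^sup>2" using H_psd[of w] by linarith
  then have "2 * \<epsilon> / M' * (n2 m (\<Gamma> j))\<^sup>2 \<le> 16 * M'\<^sup>2" using H_lower[of "\<Gamma> j"] by (simp add: M'_def)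
  then have "(n2 m (\<Gamma> j))\<^sup>2 \<le> 8 * M' ^ 3 / \<epsilon>" using M' \<epsilon>_bounds by (simp add: field_simps power2_eq_square power3_eq_cube)
  also have "\<dots> \<le> 9 * M' ^ 4 / \<epsilon>\<^sup>2"
  proof (rule frac_le)
    have "8 * M' ^ 3 \<le> 9 * M' ^ 3" using M' by simp
    also have "\<dots> \<le> 9 * M' ^ 4" using M' by (intro mult_left_mono power_increasing) auto
    finally show "8 * M' ^ 3 \<le> 9 * M' ^ 4" .
    show "\<epsilon>\<^sup>2 \<le> \<epsilon>" using \<epsilon>_bounds mult_left_mono[of \<epsilon> 1 \<epsilon>] by (simp add: power2_eq_square)
  qed (use M' \<epsilon>_bounds in auto)
  also have "\<dots> = (3 * M'\<^sup>2 / \<epsilon>)\<^sup>2" by (simp add: power_divide power_mult_distrib flip: power_mult)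
  finally show "n2 m (\<Gamma> j) \<le> 3 * (max 1 M)\<^sup>2 / \<epsilon>"
    unfolding M'_def by (rule power2_le_imp_le) (use \<epsilon>_bounds in simp)
qed

text \<open>Apply the inverse to the identity that \<open>H0\<close> maps \<open>\<Gamma> j\<close>
  to \<open>H (\<Gamma> j) (\<Gamma> j)\<close> times the unit vector.\<close>

lemma Phi0_col:
  assumes "i < m" "j < m"
  shows "Phi0 S \<in> carrier_mat m m" "Phi0 S $$ (i, j) = 1 / H (\<Gamma> j) (\<Gamma> j) * \<Gamma> j i"
proof -
  have "det (H0 S) \<noteq> 0"
  proof (rule pd_det_nonzero[OF H0_carrier])
    show "n2 m u \<noteq> 0 \<Longrightarrow> bform m (entries (H0 S)) u u \<noteq> 0" for u
      unfolding H0_form using H_pd[of u] by simp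
  qed
  note inv = mat_inv_inverse[OF H0_carrier this, folded Phi0_def]
  show "Phi0 S \<in> carrier_mat m m" by (rule inv)
  have row: "(\<Sum>k<m. H0 S $$ (l, k) * \<Gamma> j k) = (if l = j then H (\<Gamma> j) (\<Gamma> j) else 0)" if "l < m" for l
    using H_unit_\<Gamma>[OF that assms(2)] that unfolding H0_form[symmetric] by (simp add: bform_unit_left)
  have "\<Gamma> j i = (\<Sum>k<m. (if i = k then 1 else 0) * \<Gamma> j k)" using assms by (simp add: if_distrib[of "\<lambda>x. x * _"] cong: if_cong)
  also have "\<dots> = (\<Sum>k<m. (Phi0 S * H0 S) $$ (i, k) * \<Gamma> j k)" using assms by (simp add: inv(2))
  also have "\<dots> = (\<Sum>k<m. \<Sum>l<m. Phi0 S $$ (i, l) * (H0 S $$ (l, k) * \<Gamma> j k))"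
    using assms by (simp add: mult_mat_index[OF inv(3) H0_carrier] sum_distrib_right mult.assoc del: index_mult_mat)
  also have "\<dots> = (\<Sum>l<m. Phi0 S $$ (i, l) * (\<Sum>k<m. H0 S $$ (l, k) * \<Gamma> j k))"
    unfolding sum_distrib_left by (rule sum.swap)
  also have "\<dots> = (\<Sum>l<m. if l = j then Phi0 S $$ (i, l) * H (\<Gamma> j) (\<Gamma> j) else 0)"
    by (intro sum.cong) (auto simp: row)
  also have "\<dots> = Phi0 S $$ (i, j) * H (\<Gamma> j) (\<Gamma> j)" using assms by simp
  finally have "\<Gamma> j i = Phi0 S $$ (i, j) * H (\<Gamma> j) (\<Gamma> j)" .
  moreover have "H (\<Gamma> j) (\<Gamma> j) > 0" using \<Gamma>_bounds(1)[OF assms(2)] by (intro H_pd) auto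
  ultimately show "Phi0 S $$ (i, j) = 1 / H (\<Gamma> j) (\<Gamma> j) * \<Gamma> j i" by (simp add: field_simps)
qed

section \<open>The plug-in Hessian as a block form\<close>

abbreviation "Gh \<omega> \<equiv> \<lambda>u v. bform m cov u v + bform m (dev \<omega>) u v"

lemma Gh_form:
  assumes "\<omega> \<in> space P"
  shows "Gh \<omega> = bform m (joint p (hat_Sigma_x n S \<omega>) (hat_Sigma_xy n S \<omega>) (hat_Sigma_y n S \<omega>))"
proof (intro ext)
  fix u v
  have "Gh \<omega> u v = bform m (\<lambda>i j. cov i j + dev \<omega> i j) u v"
    by (simp add: bform_def algebra_simps sum.distrib)
  also have "\<dots> = bform m (joint p (hat_Sigma_x n S \<omega>) (hat_Sigma_xy n S \<omega>) (hat_Sigma_y n S \<omega>)) u v"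
    by (intro bform_cong) (auto simp: emp_joint[OF assms])
  finally show "Gh \<omega> u v = bform m (joint p (hat_Sigma_x n S \<omega>) (hat_Sigma_xy n S \<omega>) (hat_Sigma_y n S \<omega>)) u v" .
qed

lemma Gh_apply:
  assumes "\<omega> \<in> space P"
  shows "Gh \<omega> u v = bform m (joint p (hat_Sigma_x n S \<omega>) (hat_Sigma_xy n S \<omega>) (hat_Sigma_y n S \<omega>)) u v"
  using Gh_form[OF assms] by (rule fun_cong[THEN fun_cong])

lemma quad_form_sum:
  assumes "A \<in> carrier_mat d d" "x \<in> carrier_vec d"
  shows "quad_form A x = bform d (entries A) (\<lambda>i. x $ i) (\<lambda>i. x $ i)"
  unfolding quad_form_def scalar_prod_def bform_def using assms
  by (auto simp: mult_mat_vec_index[OF assms] sum_distrib_left mult.assoc lessThan_atLeast0 simp del: index_mult_mat_vec)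

lemma hat_forms:
  assumes w: "\<omega> \<in> space P" and a: "a \<in> carrier_vec p" and b: "b \<in> carrier_vec q"
  shows "quad_form (hat_Sigma_x n S \<omega>) a = Gh \<omega> (embed_x a) (embed_x a)"
    "quad_form (hat_Sigma_y n S \<omega>) b = Gh \<omega> (embed_y p b) (embed_y p b)"
    "a \<bullet> (hat_Sigma_xy n S \<omega> *\<^sub>v b) = Gh \<omega> (embed_x a) (embed_y p b)"
proof -
  note e = proj_embed(1)[OF a] proj_embed(2)[of p b]
  have 1: "Gh \<omega> (embed_x a) (embed_x a) = bform p (entries (hat_Sigma_x n S \<omega>)) (embed_x a) (embed_x a)"
    unfolding Gh_apply[OF w] using bform_joint_xx[of p q _ _ _ "embed_x a" "embed_x a"] by (simp add: e)
  also have "\<dots> = quad_form (hat_Sigma_x n S \<omega>) a"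
    unfolding quad_form_sum[OF carriers(4) a] by (intro bform_cong) (use a in \<open>auto simp: embed_x_def\<close>)
  finally show "quad_form (hat_Sigma_x n S \<omega>) a = Gh \<omega> (embed_x a) (embed_x a)" ..
  have 2: "Gh \<omega> (embed_y p b) (embed_y p b) = bform q (entries (hat_Sigma_y n S \<omega>)) (\<lambda>i. embed_y p b (p + i)) (\<lambda>i. embed_y p b (p + i))"
    unfolding Gh_apply[OF w] using bform_joint_yy[of p q _ _ _ "embed_y p b" "embed_y p b"] by (simp add: e)
  also have "\<dots> = quad_form (hat_Sigma_y n S \<omega>) b"
    unfolding quad_form_sum[OF carriers(5) b] by (intro bform_cong) (use b in \<open>auto simp: embed_y_def\<close>)
  finally show "quad_form (hat_Sigma_y n S \<omega>) b = Gh \<omega> (embed_y p b) (embed_y p b)" ..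
  have "Gh \<omega> (embed_x a) (embed_y p b) = (\<Sum>i<p. \<Sum>j<q. embed_x a i * hat_Sigma_xy n S \<omega> $$ (i, j) * embed_y p b (p + j))"
    unfolding Gh_apply[OF w] using bform_joint_xy[of p q _ _ _ "embed_x a" "embed_y p b"] by (simp add: e)
  also have "\<dots> = a \<bullet> (hat_Sigma_xy n S \<omega> *\<^sub>v b)"
    unfolding scalar_prod_def using a b
    by (auto simp: mult_mat_vec_index[OF carriers(6) b] sum_distrib_left mult.assoc lessThan_atLeast0 embed_x_def embed_y_def
        carrier_matD[OF carriers(6)] intro!: sum.cong simp del: index_mult_mat_vec)
  finally show "a \<bullet> (hat_Sigma_xy n S \<omega> *\<^sub>v b) = Gh \<omega> (embed_x a) (embed_y p b)" ..
qed

lemma plugin_carrier: "plugin_H n S \<omega> a b \<in> carrier_mat m m"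
  unfolding plugin_H_def hat_H_def Let_def
  using carrier_matD[OF carriers(4), of \<omega>] carrier_matD[OF carriers(5), of \<omega>] carrier_matD[OF carriers(6), of \<omega>] by auto

lemma quad_form_scale:
  assumes "A \<in> carrier_mat d d" "x \<in> carrier_vec d"
  shows "quad_form A (c \<cdot>\<^sub>v x) = c\<^sup>2 * quad_form A x"
  using assms by (simp add: quad_form_sum bform_def sum_distrib_left power2_eq_square mult_ac)

text \<open>Scaling both estimators by the root \<open>c\<close> of \<open>\<rho>\<^sub>h\<close>
  multiplies quadratic forms and rank-one terms by \<open>\<rho>\<^sub>h\<close>. The estimators
  have no exact unit variance in the sample, hence three separate weights in the block form.\<close>

lemma plugin_form:
  assumes w: "\<omega> \<in> space P" and a: "a \<in> carrier_vec p" and b: "b \<in> carrier_vec q"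
  defines "\<rho>\<^sub>h \<equiv> \<bar>hat_rho n S \<omega> a b\<bar>"
  shows "bform m (entries (plugin_H n S \<omega> a b)) =
    block_form (\<rho>\<^sub>h * Gh \<omega> (embed_x a) (embed_x a)) (\<rho>\<^sub>h * Gh \<omega> (embed_y p b) (embed_y p b)) \<rho>\<^sub>h (Gh \<omega>) (embed_x a) (embed_y p b)"
  unfolding Gh_form[OF w] Gh_apply[OF w]
proof (rule block_matrix_form[OF carriers(4,5,6) a b])
  fix i j assume ij: "i < m" "j < m"
  define c where "c = sqrt \<rho>\<^sub>h"
  have cc: "c\<^sup>2 = \<rho>\<^sub>h" "c * c = \<rho>\<^sub>h" unfolding c_def \<rho>\<^sub>h_def by simp_all
  have ca: "c \<cdot>\<^sub>v a \<in> carrier_vec p" and cb: "c \<cdot>\<^sub>v b \<in> carrier_vec q" using a b by auto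
  note d = carrier_matD[OF carriers(4), of \<omega>] carrier_matD[OF carriers(5), of \<omega>] carrier_matD[OF carriers(6), of \<omega>]
  have sx: "(\<Sum>k<p. A k * (c \<cdot>\<^sub>v a) $ k) = c * (\<Sum>k<p. A k * a $ k)" "(\<Sum>k<p. (c \<cdot>\<^sub>v a) $ k * A k) = c * (\<Sum>k<p. a $ k * A k)" for A
    using a by (simp_all add: sum_distrib_left mult_ac)
  have sy: "(\<Sum>k<q. A k * (c \<cdot>\<^sub>v b) $ k) = c * (\<Sum>k<q. A k * b $ k)" "(\<Sum>k<q. (c \<cdot>\<^sub>v b) $ k * A k) = c * (\<Sum>k<q. b $ k * A k)" for A
    using b by (simp_all add: sum_distrib_left mult_ac)
  have ccx: "c * x * (c * y) = \<rho>\<^sub>h * x * y" for x y using cc by (simp add: mult_ac)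
  have ent: "plugin_H n S \<omega> a b $$ (i, j) = 2 *
      (if i < p then if j < p
         then quad_form (hat_Sigma_x n S \<omega>) (c \<cdot>\<^sub>v a) * hat_Sigma_x n S \<omega> $$ (i, j)
           + 2 * ((\<Sum>k<p. hat_Sigma_x n S \<omega> $$ (i, k) * (c \<cdot>\<^sub>v a) $ k) * (\<Sum>k<p. (c \<cdot>\<^sub>v a) $ k * hat_Sigma_x n S \<omega> $$ (k, j)))
         else - hat_Sigma_xy n S \<omega> $$ (i, j - p)
       else if j < p then - hat_Sigma_xy n S \<omega> $$ (j, i - p)
         else quad_form (hat_Sigma_y n S \<omega>) (c \<cdot>\<^sub>v b) * hat_Sigma_y n S \<omega> $$ (i - p, j - p)
           + 2 * ((\<Sum>k<q. hat_Sigma_y n S \<omega> $$ (i - p, k) * (c \<cdot>\<^sub>v b) $ k) * (\<Sum>k<q. (c \<cdot>\<^sub>v b) $ k * hat_Sigma_y n S \<omega> $$ (k, j - p))))"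
    unfolding plugin_H_def hat_H_def Let_def \<rho>\<^sub>h_def[symmetric] c_def[symmetric] using ij
    by (simp add: d outer_sandwich[OF carriers(4) ca] outer_sandwich[OF carriers(5) cb] del: index_mult_mat(1) index_smult_vec)
  show "plugin_H n S \<omega> a b $$ (i, j) = 2 *
      (if i < p then if j < p
         then \<rho>\<^sub>h * bform m (joint p (hat_Sigma_x n S \<omega>) (hat_Sigma_xy n S \<omega>) (hat_Sigma_y n S \<omega>)) (embed_x a) (embed_x a) * hat_Sigma_x n S \<omega> $$ (i, j)
           + 2 * \<rho>\<^sub>h * (\<Sum>k<p. hat_Sigma_x n S \<omega> $$ (i, k) * a $ k) * (\<Sum>k<p. a $ k * hat_Sigma_x n S \<omega> $$ (k, j))
         else - hat_Sigma_xy n S \<omega> $$ (i, j - p)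
       else if j < p then - hat_Sigma_xy n S \<omega> $$ (j, i - p)
         else \<rho>\<^sub>h * bform m (joint p (hat_Sigma_x n S \<omega>) (hat_Sigma_xy n S \<omega>) (hat_Sigma_y n S \<omega>)) (embed_y p b) (embed_y p b) * hat_Sigma_y n S \<omega> $$ (i - p, j - p)
           + 2 * \<rho>\<^sub>h * (\<Sum>k<q. hat_Sigma_y n S \<omega> $$ (i - p, k) * b $ k) * (\<Sum>k<q. b $ k * hat_Sigma_y n S \<omega> $$ (k, j - p)))"
    unfolding ent sx sy ccx quad_form_scale[OF carriers(4) a] quad_form_scale[OF carriers(5) b] cc(1)
      hat_forms(1,2)[OF w a b] Gh_apply[OF w] by (simp only: mult.assoc)
qed

text \<open>The preliminary estimators are close to the canonical pair only up to sign. The signs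
  are invisible because each estimator enters its rank-one term twice.\<close>

lemma block_form_sign:
  assumes F: "bilinear F" and s: "s\<^sup>2 = 1" "t\<^sup>2 = (1::real)"
  shows "block_form \<rho>\<^sub>1 \<rho>\<^sub>2 \<rho>\<^sub>3 F (s *\<^sub>R x) (t *\<^sub>R y) u v = block_form \<rho>\<^sub>1 \<rho>\<^sub>2 \<rho>\<^sub>3 F x y u v"
proof -
  have "2 * \<rho>\<^sub>3 * (s * A) * (s * B) = 2 * \<rho>\<^sub>3 * A * B * s\<^sup>2" "2 * \<rho>\<^sub>3 * (t * A) * (t * B) = 2 * \<rho>\<^sub>3 * A * B * t\<^sup>2" for A B
    by (simp_all add: power2_eq_square mult_ac)
  then have e: "2 * \<rho>\<^sub>3 * (s * A) * (s * B) = 2 * \<rho>\<^sub>3 * A * B" "2 * \<rho>\<^sub>3 * (t * A) * (t * B) = 2 * \<rho>\<^sub>3 * A * B" for A B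
    unfolding s by simp_all
  show ?thesis
    unfolding block_form_def bilinear_lmul[OF F] bilinear_rmul[OF F] real_scaleR_def e ..
qed

end

section \<open>The plug-in scale\<close>

text \<open>\<open>x\<close> and \<open>y\<close> are the empirical variances and \<open>z\<close>
  the empirical covariance along the estimated pair. The normalisation is the geometric mean of
  \<open>x\<close> and \<open>y\<close>, so it is again within \<open>d\<close> of 1.\<close>

lemma correlation_perturbation:
  fixes x y z \<rho> d :: real
  assumes x: "\<bar>x - 1\<bar> \<le> d" and y: "\<bar>y - 1\<bar> \<le> d" and z: "\<bar>z - \<rho>\<bar> \<le> d"
    and \<rho>: "0 < \<rho>" "\<rho> \<le> 1" and d: "d \<le> 1 / 8"
  defines "h \<equiv> \<bar>z / (sqrt x * sqrt y)\<bar>"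
  shows "\<bar>h - \<rho>\<bar> \<le> 6 * d" "\<bar>h * x - \<rho>\<bar> \<le> 6 * d" "\<bar>h * y - \<rho>\<bar> \<le> 6 * d"
proof -
  have d0: "0 \<le> d" using x by linarith
  define s where "s = sqrt x * sqrt y"
  have x': "1 - d \<le> x" "x \<le> 1 + d" and y': "1 - d \<le> y" "y \<le> 1 + d" using x y by linarith+
  have s: "s = sqrt (x * y)" by (simp add: s_def real_sqrt_mult)
  have "(1 - d) * (1 - d) \<le> x * y" using x' y' d by (intro mult_mono) auto
  then have s1: "1 - d \<le> s" unfolding s by (intro real_le_rsqrt) (simp add: power2_eq_square)
  have "x * y \<le> (1 + d) * (1 + d)" using x' y' d d0 by (intro mult_mono) auto
  then have s2: "s \<le> 1 + d" unfolding s using d0 by (intro real_le_lsqrt) (auto simp: power2_eq_square)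
  have s0: "0 < s" using s1 d by linarith
  have rd: "\<rho> * d \<le> 1 * d" "0 \<le> \<rho> * d" by (rule mult_right_mono) (use \<rho> d0 in auto)
  have dd: "d * d \<le> 1 / 8 * d" using d d0 by (intro mult_right_mono) auto
  have up: "\<bar>z\<bar> \<le> (\<rho> + 4 * d) * s"
  proof -
    have "\<bar>z\<bar> \<le> \<rho> + d" using z \<rho> by linarith
    also have "\<dots> \<le> (\<rho> + 4 * d) * (1 - d)" using rd dd d0 by (simp add: algebra_simps)
    also have "\<dots> \<le> (\<rho> + 4 * d) * s" using s1 \<rho> d0 by (intro mult_left_mono) auto
    finally show ?thesis .
  qed
  have lo: "(\<rho> - 4 * d) * s \<le> \<bar>z\<bar>"
  proof (cases "0 \<le> \<rho> - 4 * d")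
    case True
    then have "(\<rho> - 4 * d) * s \<le> (\<rho> - 4 * d) * (1 + d)" using s2 by (intro mult_left_mono)
    also have "\<dots> \<le> \<rho> - d"
    proof -
      have "(\<rho> - 4 * d) * (1 + d) = \<rho> + \<rho> * d - 4 * d - 4 * (d * d)" by (simp add: algebra_simps)
      moreover have "0 \<le> d * d" by simp
      ultimately show ?thesis using rd d0 by linarith
    qed
    also have "\<dots> \<le> \<bar>z\<bar>" using z by linarith
    finally show ?thesis .
  next
    case False
    then have "(\<rho> - 4 * d) * s \<le> 0" using s0 by (simp add: mult_le_0_iff)
    then show ?thesis by (rule order_trans) simp
  qed
  have h: "\<bar>h - \<rho>\<bar> \<le> 4 * d"
  proof -
    have "h = \<bar>z\<bar> / s" using s0 by (simp add: h_def s_def[symmetric])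
    moreover have "\<bar>z\<bar> / s \<le> \<rho> + 4 * d" "\<rho> - 4 * d \<le> \<bar>z\<bar> / s"
      using up lo s0 by (simp_all add: pos_divide_le_eq pos_le_divide_eq)
    ultimately show ?thesis by linarith
  qed
  then show "\<bar>h - \<rho>\<bar> \<le> 6 * d" using d0 by linarith
  have *: "\<bar>h * w - \<rho>\<bar> \<le> 6 * d" if w: "\<bar>w - 1\<bar> \<le> d" for w
  proof -
    have "h * w - \<rho> = (h - \<rho>) * w + \<rho> * (w - 1)" by (simp add: algebra_simps)
    also have "\<bar>\<dots>\<bar> \<le> (4 * d) * (9 / 8) + 1 * d"
      using w d \<rho> by (intro abs_add_bound abs_mult_bound h) auto
    finally show ?thesis using d0 by linarith
  qed
  show "\<bar>h * x - \<rho>\<bar> \<le> 6 * d" "\<bar>h * y - \<rho>\<bar> \<le> 6 * d" using x y by (auto intro!: *)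
qed

context canonical_form
begin

text \<open>Each of the three empirical quantities differs from its limit by three terms through
  \<open>G\<close>, of order \<open>D * e\<close>, and four through \<open>E\<close>, of order
  \<open>\<delta>\<close>; \<open>k\<close> provides for four of each kind.\<close>

lemma scale_perturbation:
  assumes bE: "bilinear E" and sE: "\<And>u v. E u v = E v u"
    and A: "1 \<le> A" and D: "1 \<le> D" and \<delta>: "0 < \<delta>" "\<delta> \<le> e"
    and E_inf: "\<And>u v. \<bar>E u v\<bar> \<le> A * \<delta> * (N\<^sub>1 u * N\<^sub>1 v)"
    and E\<alpha>: "\<And>v. \<bar>E \<alpha> v\<bar> \<le> A * \<delta> * N\<^sub>1 v" and E\<beta>: "\<And>v. \<bar>E \<beta> v\<bar> \<le> A * \<delta> * N\<^sub>1 v"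
    and E0: "\<bar>E \<alpha> \<alpha>\<bar> \<le> A * \<delta>" "\<bar>E \<alpha> \<beta>\<bar> \<le> A * \<delta>" "\<bar>E \<beta> \<beta>\<bar> \<le> A * \<delta>"
    and a: "PX a = a" and b: "PY b = b"
    and a2: "N\<^sub>2 (a - \<alpha>) \<le> D * e" and a1: "N\<^sub>1 (a - \<alpha>) \<le> 1"
    and b2: "N\<^sub>2 (b - \<beta>) \<le> D * e" and b1: "N\<^sub>1 (b - \<beta>) \<le> 1"
    and De: "D * e \<le> 1" and k: "k = 4 * M\<^sup>2 * D + 4 * A" and small: "k * e \<le> 1 / 8"
  defines "h \<equiv> \<bar>(G a b + E a b) / (sqrt (G a a + E a a) * sqrt (G b b + E b b))\<bar>"
  shows "\<bar>h - \<rho>\<bar> \<le> 6 * k * e" "\<bar>h * (G a a + E a a) - \<rho>\<bar> \<le> 6 * k * e" "\<bar>h * (G b b + E b b) - \<rho>\<bar> \<le> 6 * k * e"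
proof -
  define x where "x = a - \<alpha>"
  define y where "y = b - \<beta>"
  note es = bilinear_ladd[OF bE] bilinear_radd[OF bE]
  have ax: "a = \<alpha> + x" and byy: "b = \<beta> + y" by (simp_all add: x_def y_def)
  have PXx: "PX x = x" "PY y = y" by (simp_all add: x_def y_def psimps a b)
  have e: "0 < e" using \<delta> by linarith
  have M2: "M \<le> M\<^sup>2" using M1 by (simp add: power2_eq_square)
  have De0: "0 \<le> D * e" using D e by simp
  have lin: "M * N\<^sub>2 w \<le> M\<^sup>2 * (D * e)" if "N\<^sub>2 w \<le> D * e" for w
    using that M2 M1 by (intro mult_mono) auto
  have quad: "M * (N\<^sub>2 w * N\<^sub>2 w') \<le> M\<^sup>2 * (D * e)" if "N\<^sub>2 w \<le> D * e" "N\<^sub>2 w' \<le> D * e" for w w'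
  proof -
    have "N\<^sub>2 w' \<le> 1" using that De by linarith
    then have "N\<^sub>2 w * N\<^sub>2 w' \<le> (D * e) * 1" by (rule mult_mono[OF that(1)]) (use De0 in auto)
    then have "N\<^sub>2 w * N\<^sub>2 w' \<le> D * e" by simp
    then show ?thesis by (rule mult_mono[OF M2]) auto
  qed
  have AE: "A * \<delta> \<le> A * e" using A \<delta> by (intro mult_left_mono) auto
  have Ad: "0 \<le> A * \<delta>" using A \<delta> by simp
  have El: "\<bar>E \<alpha> w\<bar> \<le> A * e" "\<bar>E \<beta> w\<bar> \<le> A * e" if "N\<^sub>1 w \<le> 1" for w
    using E\<alpha>[of w] E\<beta>[of w] mult_left_mono[OF that Ad] AE by linarith+
  have Eq: "\<bar>E w w'\<bar> \<le> A * e" if "N\<^sub>1 w \<le> 1" "N\<^sub>1 w' \<le> 1" for w w'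
  proof -
    have "N\<^sub>1 w * N\<^sub>1 w' \<le> 1 * 1" using that by (intro mult_mono) auto
    then show ?thesis using E_inf[of w w'] mult_left_mono[OF _ Ad, of "N\<^sub>1 w * N\<^sub>1 w'" 1] AE by linarith
  qed
  have E0': "\<bar>E \<alpha> \<alpha>\<bar> \<le> A * e" "\<bar>E \<alpha> \<beta>\<bar> \<le> A * e" "\<bar>E \<beta> \<beta>\<bar> \<le> A * e" using E0 AE by linarith+
  note x2 = a2[folded x_def] and x1 = a1[folded x_def] and y2 = b2[folded y_def] and y1 = b1[folded y_def]
  have kk: "M\<^sup>2 * (D * e) + M\<^sup>2 * (D * e) + M\<^sup>2 * (D * e) + (A * e + A * e + A * e + A * e) \<le> k * e"
  proof -
    have "k * e = 4 * (M\<^sup>2 * (D * e)) + 4 * (A * e)" by (simp add: k algebra_simps)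
    moreover have "0 \<le> M\<^sup>2 * (D * e)" using De0 by simp
    ultimately show ?thesis by linarith
  qed
  have G1: "\<bar>G \<alpha> x\<bar> \<le> M\<^sup>2 * (D * e)" "\<bar>G x \<alpha>\<bar> \<le> M\<^sup>2 * (D * e)"
    using G_XU[of 0 x] lin[OF x2] sym[of \<alpha> x] PXx by auto
  have G2: "\<bar>G \<beta> y\<bar> \<le> M\<^sup>2 * (D * e)" "\<bar>G y \<beta>\<bar> \<le> M\<^sup>2 * (D * e)"
    using G_YV[of 0 y] lin[OF y2] sym[of \<beta> y] PXx by auto
  have G3: "\<bar>G x x\<bar> \<le> M\<^sup>2 * (D * e)" using G_XX[of x x] quad[OF x2 x2] PXx by auto
  have G4: "\<bar>G y y\<bar> \<le> M\<^sup>2 * (D * e)" using G_YY[of y y] quad[OF y2 y2] PXx by auto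
  have G5: "\<bar>G x y\<bar> \<le> M\<^sup>2 * (D * e)" using G_XY[of x y] quad[OF x2 y2] PXx by auto
  have G6: "\<bar>G \<alpha> y\<bar> \<le> M\<^sup>2 * (D * e)"
  proof -
    have "M * (N\<^sub>2 \<alpha> * N\<^sub>2 y) \<le> M * (M * (D * e))" using n2_U[OF r0] y2 M1 by (intro mult_left_mono mult_mono) auto
    then show ?thesis using G_XY[of \<alpha> y] PXx by (simp add: power2_eq_square mult.assoc)
  qed
  have G7: "\<bar>G x \<beta>\<bar> \<le> M\<^sup>2 * (D * e)"
  proof -
    have "M * (N\<^sub>2 x * N\<^sub>2 \<beta>) \<le> M * ((D * e) * M)" using n2_V[OF r0] x2 M1 De0 by (intro mult_left_mono mult_mono) auto
    then show ?thesis using G_XY[of x \<beta>] PXx by (simp add: power2_eq_square mult_ac)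
  qed
  have Gaa: "G a a + E a a - 1 = G \<alpha> x + G x \<alpha> + G x x + (E \<alpha> \<alpha> + E \<alpha> x + E x \<alpha> + E x x)"
    unfolding ax by (simp add: bsimps es UU)
  have Gbb: "G b b + E b b - 1 = G \<beta> y + G y \<beta> + G y y + (E \<beta> \<beta> + E \<beta> y + E y \<beta> + E y y)"
    unfolding byy by (simp add: bsimps es VV)
  have Gab: "G a b + E a b - \<rho> = G \<alpha> y + G x \<beta> + G x y + (E \<alpha> \<beta> + E \<alpha> y + E x \<beta> + E x y)"
    unfolding ax byy by (simp add: bsimps es G_ab)
  have Es: "\<bar>E x \<alpha>\<bar> \<le> A * e" "\<bar>E y \<beta>\<bar> \<le> A * e" "\<bar>E x \<beta>\<bar> \<le> A * e"
    unfolding sE[of x] sE[of y] using El x1 y1 by auto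
  have 1: "\<bar>G a a + E a a - 1\<bar> \<le> k * e" unfolding Gaa
    by (rule order_trans[OF _ kk]) (intro abs_bounds G1 G3 E0' El Es Eq x1)
  have 2: "\<bar>G b b + E b b - 1\<bar> \<le> k * e" unfolding Gbb
    by (rule order_trans[OF _ kk]) (intro abs_bounds G2 G4 E0' El Es Eq y1)
  have 3: "\<bar>G a b + E a b - \<rho>\<bar> \<le> k * e" unfolding Gab
    by (rule order_trans[OF _ kk]) (intro abs_bounds G5 G6 G7 E0' El Es Eq x1 y1)
  show "\<bar>h - \<rho>\<bar> \<le> 6 * k * e" "\<bar>h * (G a a + E a a) - \<rho>\<bar> \<le> 6 * k * e" "\<bar>h * (G b b + E b b) - \<rho>\<bar> \<le> 6 * k * e"
    using correlation_perturbation[OF 1 2 3 rho_pos rho_le1 small] unfolding h_def by (simp_all add: mult.assoc)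
qed

end

context cca_sample
begin

section \<open>The event on which all empirical forms are accurate\<close>

text \<open>The nonrandom vectors along which the deviation must be small without the loss of an l1
  norm. Their number is linear in the dimension, so a union bound over pairs costs only a power of
  it.\<close>

definition "anchors = unit ` {..<m} \<union> (\<lambda>j. proj_x p (\<Gamma> j)) ` {..<m} \<union> (\<lambda>j. proj_y p (\<Gamma> j)) ` {..<m} \<union> {uvec 0, vvec 0}"

definition "L\<^sub>0 = 3 * (max 1 M)\<^sup>2 / \<epsilon> + max 1 M"

lemma anchors_n2: "w \<in> anchors \<Longrightarrow> n2 m w \<le> L\<^sub>0"
proof -
  assume w: "w \<in> anchors"
  have g: "n2 m (\<Gamma> j) \<le> L\<^sub>0" if "j < m" for j
    using \<Gamma>_bounds(2)[OF that] by (simp add: L\<^sub>0_def)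
  have nn: "0 \<le> 3 * (max 1 M)\<^sup>2 / \<epsilon>" using \<epsilon>_bounds by simp
  consider i where "i < m" "w = unit i" | j where "j < m" "w = proj_x p (\<Gamma> j)" | j where "j < m" "w = proj_y p (\<Gamma> j)"
    | "w = uvec 0" | "w = vvec 0"
    using w by (auto simp: anchors_def)
  then show ?thesis
  proof cases
    case 1
    then show ?thesis using nn by (simp add: n2_unit L\<^sub>0_def add_increasing)
  next
    case 2
    then show ?thesis using n2_X[of "\<Gamma> j"] g by fastforce
  next
    case 3
    then show ?thesis using n2_Y[of "\<Gamma> j"] g by fastforce
  next
    case 4
    then show ?thesis using n2_U[OF r0] nn by (simp add: L\<^sub>0_def)
  next
    case 5
    then show ?thesis using n2_V[OF r0] nn by (simp add: L\<^sub>0_def)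
  qed
qed

lemma finite_anchors: "finite anchors" by (simp add: anchors_def)

lemma card_anchors: "card anchors \<le> 3 * m + 2"
proof -
  have im: "card (f ` {..<m}) \<le> m" for f :: "nat \<Rightarrow> nat \<Rightarrow> real" using card_image_le[of "{..<m}" f] by simp
  have un: "card (A \<union> B) \<le> a + b" if "card A \<le> a" "card B \<le> b" for A B :: "(nat \<Rightarrow> real) set" and a b
    using card_Un_le[of A B] that by linarith
  have two: "card {x, y} \<le> 2" for x y :: "nat \<Rightarrow> real" by (simp add: card_insert_if)
  have "card anchors \<le> m + m + m + 2"
    unfolding anchors_def by (intro un im two)
  then show ?thesis by simp
qed

lemma dev_sym: "dev \<omega> i j = dev \<omega> j i"
  unfolding dev_def by (simp add: cov_sym[of i j] mult.commute)

abbreviation "E \<omega> \<equiv> bform m (dev \<omega>)"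

lemma E_sym: "E \<omega> u v = E \<omega> v u"
  by (rule bform_sym) (rule dev_sym)

text \<open>Tail bounds are available for quadratic forms only. Sum and difference have norm at most
  \<open>2 * L\<close>, whence the factor 2 * 4 / 4.\<close>

lemma polarize:
  assumes "\<bar>E \<omega> (x + y) (x + y)\<bar> \<le> c * (n2 m (x + y))\<^sup>2" "\<bar>E \<omega> (x - y) (x - y)\<bar> \<le> c * (n2 m (x - y))\<^sup>2"
    and "n2 m x \<le> L" "n2 m y \<le> L" and c: "0 \<le> c"
  shows "\<bar>E \<omega> x y\<bar> \<le> 2 * c * L\<^sup>2"
proof -
  note b = bilinear_ladd[OF bilinear_bform] bilinear_radd[OF bilinear_bform] bilinear_lsub[OF bilinear_bform] bilinear_rsub[OF bilinear_bform]
  have "E \<omega> (x + y) (x + y) - E \<omega> (x - y) (x - y) = 4 * E \<omega> x y"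
    by (simp add: b E_sym[of \<omega> y x])
  moreover have "n2 m (x + y) \<le> 2 * L" "n2 m (x - y) \<le> 2 * L"
    using n2.triangle[of x y] n2.triangle_diff[of x y] assms by linarith+
  then have "(n2 m (x + y))\<^sup>2 \<le> (2 * L)\<^sup>2" "(n2 m (x - y))\<^sup>2 \<le> (2 * L)\<^sup>2"
    by (intro power_mono; simp)+
  then have "c * (n2 m (x + y))\<^sup>2 \<le> c * (2 * L)\<^sup>2" "c * (n2 m (x - y))\<^sup>2 \<le> c * (2 * L)\<^sup>2"
    using c by (intro mult_left_mono; simp)+
  ultimately have "4 * \<bar>E \<omega> x y\<bar> \<le> 2 * (c * (2 * L)\<^sup>2)" using assms(1,2) by linarith
  then show ?thesis by (simp add: power2_eq_square mult_ac)
qed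

text \<open>\<open>Q s\<close> is \<open>c\<close> times the identity minus \<open>s\<close> times
  the deviation form. For both signs \<open>s\<close> it is nonnegative on the unit sums and its
  diagonal is at most \<open>2 * c\<close>, so \<open>unit_sums_extend\<close> bounds it below
  everywhere.\<close>

lemma restricted_deviation:
  assumes k: "k \<ge> 2" and c: "0 \<le> c"
    and sums: "\<And>u. u \<in> unit_sums m k \<Longrightarrow> \<bar>E \<omega> u u\<bar> \<le> c * (n2 m u)\<^sup>2"
  shows "\<bar>E \<omega> v v\<bar> \<le> c * (n2 m v)\<^sup>2 + 2 * c / (real k - 1) * (n1 m v)\<^sup>2"
proof -
  define w where "w i = (if i < m then v i else 0)" for i
  have w: "E \<omega> v v = E \<omega> w w" "n1 m v = n1 m w" "n2 m v = n2 m w"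
    by (auto intro!: bform_cong n1_cong n2_cong simp: w_def)
  define Q where "Q s = bform m (\<lambda>i j. (if i = j then c else 0) - s * dev \<omega> i j)" for s :: real
  have Quu: "Q s u u = c * (n2 m u)\<^sup>2 - s * E \<omega> u u" for s u
  proof -
    have "bform m (\<lambda>i j. if i = j then c else 0) u u = (\<Sum>i<m. \<Sum>j<m. if j = i then c * (u i)\<^sup>2 else 0)"
      unfolding bform_def by (intro sum.cong) (auto simp: power2_eq_square)
    also have "\<dots> = c * (n2 m u)\<^sup>2" by (simp add: n2_sq sum_distrib_left)
    finally have 1: "bform m (\<lambda>i j. if i = j then c else 0) u u = c * (n2 m u)\<^sup>2" .
    have 2: "bform m (\<lambda>i j. s * dev \<omega> i j) u u = s * E \<omega> u u"
      by (simp add: bform_def sum_distrib_left mult_ac)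
    show ?thesis unfolding Q_def bform_diff 1 2 ..
  qed
  \<comment> \<open>A single unit vector is reached through its \<open>k\<close>-fold
    repetition.\<close>
  have Ejj: "\<bar>E \<omega> (unit i) (unit i)\<bar> \<le> c" if i: "i < m" for i
  proof -
    have sl: "sum_list (map signed_unit (replicate k (i, True))) = real k *\<^sub>R unit i" for k
      by (induction k) (auto simp: signed_unit_def algebra_simps)
    have "real k *\<^sub>R unit i \<in> unit_sums m k"
      unfolding unit_sums_def sl[symmetric] by (rule imageI) (use i in auto)
    from sums[OF this] have "(real k)\<^sup>2 * \<bar>E \<omega> (unit i) (unit i)\<bar> \<le> (real k)\<^sup>2 * c"
      using n2_unit[OF i]
      by (simp add: bilinear_lmul[OF bilinear_bform] bilinear_rmul[OF bilinear_bform] n2.scale abs_mult power2_eq_square mult_ac)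
    then show ?thesis using k by simp
  qed
  have main: "- (2 * c / (real k - 1) * (n1 m w)\<^sup>2) \<le> Q s w w" if s: "\<bar>s\<bar> = 1" for s
  proof (rule unit_sums_extend[where Q="Q s" and d=m and k=k and q="2 * c" and v=w, OF _ _ k])
    show "bilinear (Q s)" unfolding Q_def by (rule bilinear_bform)
    show "Q s u v = Q s v u" for u v unfolding Q_def by (rule bform_sym) (simp add: dev_sym[of \<omega>])
    show "0 \<le> Q s u u" if "u \<in> unit_sums m k" for u
    proof -
      have "\<bar>s * E \<omega> u u\<bar> \<le> c * (n2 m u)\<^sup>2" using sums[OF that] s by (simp add: abs_mult)
      then show ?thesis unfolding Quu by linarith
    qed
    show "Q s (unit i) (unit i) \<le> 2 * c" if "i < m" for i
    proof -
      have "\<bar>s * E \<omega> (unit i) (unit i)\<bar> \<le> c" using Ejj[OF that] s by (simp add: abs_mult)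
      then show ?thesis unfolding Quu n2_unit[OF that] by simp
    qed
  qed (simp add: w_def)
  show ?thesis using main[of 1] main[of "-1"] unfolding Quu w by simp
qed

lemma base_rate_facts:
  assumes "2 \<le> max p q"
  shows "0 < base_rate n S" "real n * (base_rate n S)\<^sup>2 = ln (real (max p q))" "0 < ln (real (max p q))"
proof -
  show l: "0 < ln (real (max p q))" using assms by (intro ln_gt_zero) linarith
  then show "0 < base_rate n S" "real n * (base_rate n S)\<^sup>2 = ln (real (max p q))"
    unfolding base_rate_def using n_pos by simp_all
qed

text \<open>Two union bounds at different thresholds: one of order \<open>base_rate\<close> over
  polynomially many sums and differences of anchors, and the constant \<open>t\<close> over the unit
  sums, whose number is affordable because the length \<open>k\<close> is proportional to the
  squared ratio of \<open>t\<close> and the base rate.\<close>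

lemma good_event:
  assumes d: "2 \<le> max p q" and t: "0 < t" "t \<le> 8"
    and small: "10 * base_rate n S \<le> 8" "768 * (base_rate n S)\<^sup>2 \<le> t\<^sup>2"
  obtains X where "X \<in> events" "prob X \<le> 400 / max p q + 2 * exp (- real n * t\<^sup>2 / 64)"
    "\<And>\<omega> x y. \<omega> \<in> space P - X \<Longrightarrow> x \<in> anchors \<Longrightarrow> y \<in> anchors \<Longrightarrow>
        \<bar>E \<omega> x y\<bar> \<le> 20 * (4 * K)\<^sup>2 * L\<^sub>0\<^sup>2 * base_rate n S"
    "\<And>\<omega> v. \<omega> \<in> space P - X \<Longrightarrow>
        \<bar>E \<omega> v v\<bar> \<le> t * (4 * K)\<^sup>2 * (n2 m v)\<^sup>2 + 768 * (4 * K)\<^sup>2 / t * (base_rate n S)\<^sup>2 * (n1 m v)\<^sup>2"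
proof -
  define dd where "dd = real (max p q)"
  define \<delta> where "\<delta> = base_rate n S"
  define T where "T = 4 * K"
  have dd: "2 \<le> dd" using d by (simp add: dd_def)
  have md: "real m \<le> 2 * dd" by (simp add: dd_def)
  have m1: "1 \<le> m" using d by auto
  note br = base_rate_facts[OF d, folded \<delta>_def dd_def]
  define F where "F = (\<lambda>(x, y). x + y) ` (anchors \<times> anchors) \<union> (\<lambda>(x, y). x - y) ` (anchors \<times> anchors)"
  have F: "finite F" unfolding F_def using finite_anchors by auto
  have cF: "real (card F) \<le> 2 * (5 * real m)\<^sup>2"
  proof -
    have "card F \<le> card (anchors \<times> anchors) + card (anchors \<times> anchors)"
      unfolding F_def by (rule order_trans[OF card_Un_le], rule add_mono; rule card_image_le) (auto simp: finite_anchors)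
    also have "\<dots> = 2 * (card anchors)\<^sup>2" by (simp add: card_cartesian_product power2_eq_square)
    also have "\<dots> \<le> 2 * (5 * m)\<^sup>2" using card_anchors m1 by (intro mult_left_mono power_mono) auto
    finally have "real (card F) \<le> real (2 * (5 * m)\<^sup>2)" by (rule of_nat_mono)
    then show ?thesis by simp
  qed
  obtain X1 where X1: "X1 \<in> events" "prob X1 \<le> card F * (2 * exp (- real n * (10 * \<delta>)\<^sup>2 / 32))"
    "\<And>\<omega> u. \<omega> \<in> space P - X1 \<Longrightarrow> u \<in> F \<Longrightarrow> \<bar>E \<omega> u u\<bar> \<le> 10 * \<delta> * T\<^sup>2 * (\<Sum>k<m. (u k)\<^sup>2)"
  proof -
    have "0 < 10 * \<delta>" "10 * \<delta> \<le> 8" using br(1) small(1) by (simp_all add: \<delta>_def)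
    from quadratic_deviation[OF F this] show ?thesis using that unfolding T_def by blast
  qed
  have p1: "prob X1 \<le> 400 / dd"
  proof -
    \<comment> \<open>The factor 10 is chosen for 100 / 32 > 3: a tail of order dd^(-3) against a
      number of vectors of order dd^2 leaves 1 / dd.\<close>
    have "- real n * (10 * \<delta>)\<^sup>2 / 32 = - (100 / 32) * (real n * \<delta>\<^sup>2)" by (simp add: power2_eq_square)
    also have "\<dots> = - (100 / 32) * ln dd" unfolding br(2) ..
    also have "\<dots> \<le> - 3 * ln dd" using br(3) by (intro mult_right_mono) auto
    finally have "exp (- real n * (10 * \<delta>)\<^sup>2 / 32) \<le> exp (- 3 * ln dd)" by simp
    also have "exp (- 3 * ln dd) = 1 / dd ^ 3"
    proof -
      have "exp (3 * ln dd) = dd ^ 3" using exp_of_nat_mult[of 3 "ln dd"] dd by simp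
      then show ?thesis using exp_minus[of "3 * ln dd"] by (simp add: inverse_eq_divide)
    qed
    finally have e: "exp (- real n * (10 * \<delta>)\<^sup>2 / 32) \<le> 1 / dd ^ 3" .
    have "prob X1 \<le> (2 * (5 * real m)\<^sup>2) * (2 * (1 / dd ^ 3))"
      by (rule order_trans[OF X1(2)], intro mult_mono cF mult_left_mono e) auto
    also have "\<dots> \<le> (2 * (5 * (2 * dd))\<^sup>2) * (2 * (1 / dd ^ 3))"
      using md dd by (intro mult_right_mono mult_left_mono power_mono) auto
    also have "\<dots> = 400 / dd" using dd by (simp add: power2_eq_square power3_eq_cube field_simps)
    finally show ?thesis .
  qed
  \<comment> \<open>There are at most dd^(3 k) unit sums. With 192 = 3 * 64 the logarithm of this
    number is at most n t^2 / 64, half of the exponent n t^2 / 32 of the tail bound.\<close>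
  define x where "x = t\<^sup>2 / (192 * \<delta>\<^sup>2)"
  define k where "k = nat \<lfloor>x\<rfloor>"
  have x4: "4 \<le> x" using small(2) br(1) unfolding x_def \<delta>_def[symmetric] by (simp add: field_simps)
  have kx: "real k \<le> x" "x - 1 < real k" unfolding k_def using x4 by linarith+
  have k2: "2 \<le> k" using kx x4 by linarith
  have nx: "real n * t\<^sup>2 = 192 * x * ln dd" unfolding x_def br(2)[symmetric] using br(1) by simp
  obtain X2 where X2: "X2 \<in> events" "prob X2 \<le> card (unit_sums m k) * (2 * exp (- real n * t\<^sup>2 / 32))"
    "\<And>\<omega> u. \<omega> \<in> space P - X2 \<Longrightarrow> u \<in> unit_sums m k \<Longrightarrow> \<bar>E \<omega> u u\<bar> \<le> t * T\<^sup>2 * (\<Sum>k<m. (u k)\<^sup>2)"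
    using quadratic_deviation[OF finite_unit_sums t] unfolding T_def by blast
  have p2: "prob X2 \<le> 2 * exp (- real n * t\<^sup>2 / 64)"
  proof -
    have "real (card (unit_sums m k)) \<le> real ((2 * m) ^ k)" using card_unit_sums by (rule of_nat_mono)
    also have "\<dots> \<le> (dd ^ 3) ^ k"
    proof -
      have "4 * dd \<le> dd ^ 3"
        using mult_mono[of 2 dd 2 dd] dd mult_right_mono[of 4 "dd * dd" dd] by (simp add: power3_eq_cube)
      then have "real (2 * m) \<le> dd ^ 3" using md by simp
      then have "real (2 * m) ^ k \<le> (dd ^ 3) ^ k" by (intro power_mono) auto
      then show ?thesis by simp
    qed
    also have "\<dots> = exp (real k * (3 * ln dd))"
    proof -
      have "exp (3 * ln dd) = dd ^ 3" using exp_of_nat_mult[of 3 "ln dd"] dd by simp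
      then show ?thesis by (simp add: exp_of_nat_mult)
    qed
    also have "\<dots> \<le> exp (x * (3 * ln dd))" using kx br(3) by simp
    also have "x * (3 * ln dd) = real n * t\<^sup>2 / 64" unfolding nx by simp
    finally have c: "real (card (unit_sums m k)) \<le> exp (real n * t\<^sup>2 / 64)" .
    have "prob X2 \<le> exp (real n * t\<^sup>2 / 64) * (2 * exp (- real n * t\<^sup>2 / 32))"
      by (rule order_trans[OF X2(2)], intro mult_right_mono c) auto
    also have "\<dots> = 2 * exp (- real n * t\<^sup>2 / 64)" by (simp flip: exp_add)
    finally show ?thesis .
  qed
  show ?thesis
  proof (rule that)
    show "X1 \<union> X2 \<in> events" using X1 X2 by auto
    have "prob (X1 \<union> X2) \<le> prob X1 + prob X2" using X1 X2 by (intro measure_Un_le)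
    then show "prob (X1 \<union> X2) \<le> 400 / max p q + 2 * exp (- real n * t\<^sup>2 / 64)" using p1 p2 by (simp add: dd_def)
  next
    fix \<omega> x y assume "\<omega> \<in> space P - (X1 \<union> X2)" and xy: "x \<in> anchors" "y \<in> anchors"
    then have w: "\<omega> \<in> space P - X1" by auto
    have "x + y \<in> F" "x - y \<in> F" unfolding F_def using xy by (auto intro!: image_eqI[of _ _ "(x, y)"])
    then have "\<bar>E \<omega> x y\<bar> \<le> 2 * (10 * \<delta> * T\<^sup>2) * L\<^sub>0\<^sup>2"
      using X1(3)[OF w, folded n2_sq] br(1) by (intro polarize anchors_n2 xy) auto
    then show "\<bar>E \<omega> x y\<bar> \<le> 20 * (4 * K)\<^sup>2 * L\<^sub>0\<^sup>2 * base_rate n S"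
      by (simp add: T_def \<delta>_def mult_ac)
  next
    fix \<omega> v assume "\<omega> \<in> space P - (X1 \<union> X2)"
    then have w: "\<omega> \<in> space P - X2" by auto
    have "\<bar>E \<omega> v v\<bar> \<le> t * T\<^sup>2 * (n2 m v)\<^sup>2 + 2 * (t * T\<^sup>2) / (real k - 1) * (n1 m v)\<^sup>2"
      using X2(3)[OF w, folded n2_sq] t by (intro restricted_deviation[OF k2]) auto
    also have "2 * (t * T\<^sup>2) / (real k - 1) * (n1 m v)\<^sup>2 \<le> 768 * T\<^sup>2 / t * \<delta>\<^sup>2 * (n1 m v)\<^sup>2"
    proof (rule mult_right_mono)
      \<comment> \<open>Rounding down loses less than 1 and the variance term of Maurey's method
        another 1; \<open>x \<ge> 4\<close> covers both.\<close>
      have "x / 2 \<le> real k - 1" using kx x4 by linarith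
      then have "2 * (t * T\<^sup>2) / (real k - 1) \<le> 2 * (t * T\<^sup>2) / (x / 2)"
        using t x4 by (intro divide_left_mono mult_pos_pos) auto
      also have "\<dots> = 768 * T\<^sup>2 / t * \<delta>\<^sup>2"
        unfolding x_def using t br(1) by (simp add: field_simps power2_eq_square)
      finally show "2 * (t * T\<^sup>2) / (real k - 1) \<le> 768 * T\<^sup>2 / t * \<delta>\<^sup>2" .
    qed simp
    finally show "\<bar>E \<omega> v v\<bar> \<le> t * (4 * K)\<^sup>2 * (n2 m v)\<^sup>2 + 768 * (4 * K)\<^sup>2 / t * (base_rate n S)\<^sup>2 * (n1 m v)\<^sup>2"
      by (simp add: T_def \<delta>_def)
  qed
qed

end

section \<open>The columns of the nodewise Lasso output\<close>

lemma node_Gamma_apply: "i < m \<Longrightarrow> node_Gamma m j \<eta> $ i = (unit j - node_embed j \<eta>) i"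
  by (auto simp: node_Gamma_def unit_def node_embed_def)

text \<open>Off the support of \<open>g\<close> the difference is \<open>f\<close> itself. On the
  support, where \<open>w\<close> lives, the triangle inequality loses twice the difference, and
  Cauchy-Schwarz turns that loss into an l2 norm.\<close>

lemma sparse_difference:
  assumes "card {i. i < d \<and> g i \<noteq> 0} \<le> c" "sqrt c \<le> x"
  shows "n1 d (f - g) \<le> n1 d f - n1 d g + 2 * x * n2 d (f - g)"
proof -
  let ?T = "{i. i < d \<and> g i \<noteq> 0}"
  define w where "w i = (if g i = 0 then 0 else f i - g i)" for i
  have "n1 d (f - g) \<le> (\<Sum>i<d. \<bar>f i\<bar> - \<bar>g i\<bar> + 2 * \<bar>w i\<bar>)"
    unfolding n1_def w_def by (intro sum_mono) auto
  also have "\<dots> = n1 d f - n1 d g + 2 * n1 d w"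
    by (simp add: n1_def sum.distrib sum_subtractf sum_distrib_left)
  finally have 1: "n1 d (f - g) \<le> n1 d f - n1 d g + 2 * n1 d w" .
  have "n1 d w \<le> sqrt c * n2 d w"
    by (rule n1_le_n2[of ?T]) (use assms in \<open>auto simp: w_def\<close>)
  also have "n2 d w \<le> n2 d (f - g)"
    unfolding n2_def L2_set_def by (intro real_sqrt_le_mono sum_mono) (auto simp: w_def)
  then have "sqrt c * n2 d w \<le> x * n2 d (f - g)"
    by (rule mult_mono[OF assms(2)]) (use assms(2) order_trans[OF real_sqrt_ge_zero[of "real c"]] in \<open>auto intro: seminorm.nonneg[OF seminorm_n2]\<close>)
  finally show ?thesis using 1 by simp
qed

lemma card_node_embed:
  assumes j: "j < m" and \<eta>: "\<eta> \<in> carrier_vec (m - 1)"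
  shows "card {i. i < m \<and> node_embed j \<eta> i \<noteq> 0} \<le> vec_l0 \<eta>"
proof -
  have "{i. i < m \<and> node_embed j \<eta> i \<noteq> 0} \<subseteq> insert_index j ` {i. i < dim_vec \<eta> \<and> \<eta> $ i \<noteq> 0}"
  proof
    fix i assume i: "i \<in> {i. i < m \<and> node_embed j \<eta> i \<noteq> 0}"
    then have "i \<noteq> j" "i < m" by auto
    then have "i = insert_index j (delete_index j i)" "delete_index j i < m - 1"
      using j by (auto simp: insert_index_def delete_index_def)
    then show "i \<in> insert_index j ` {i. i < dim_vec \<eta> \<and> \<eta> $ i \<noteq> 0}"
      using i \<eta> \<open>i \<noteq> j\<close> unfolding node_embed_def by (intro image_eqI[of _ _ "delete_index j i"]) simp_all
  qed
  then have "card {i. i < m \<and> node_embed j \<eta> i \<noteq> 0} \<le> card (insert_index j ` {i. i < dim_vec \<eta> \<and> \<eta> $ i \<noteq> 0})"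
    by (intro card_mono) auto
  also have "\<dots> \<le> vec_l0 \<eta>" unfolding vec_l0_def by (rule card_image_le) auto
  finally show ?thesis .
qed

context cca_sample
begin

abbreviation "M\<^sub>1 \<equiv> max 1 M"

lemma uvec_alpha0: "uvec 0 = embed_x (alpha0 S)" and vvec_beta0: "vvec 0 = embed_y p (beta0 S)"
  by (simp_all add: uvec_def vvec_def alpha0_def beta0_def)

lemma embed_differences:
  assumes a: "a \<in> carrier_vec p" and b: "b \<in> carrier_vec q"
  shows "n1 m (s *\<^sub>R embed_x a - uvec 0) = vec_l1 (s \<cdot>\<^sub>v a - alpha0 S)"
    "n2 m (s *\<^sub>R embed_x a - uvec 0) = vec_l2 (s \<cdot>\<^sub>v a - alpha0 S)"
    "n1 m (s *\<^sub>R embed_y p b - vvec 0) = vec_l1 (s \<cdot>\<^sub>v b - beta0 S)"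
    "n2 m (s *\<^sub>R embed_y p b - vvec 0) = vec_l2 (s \<cdot>\<^sub>v b - beta0 S)"
proof -
  have x: "s *\<^sub>R embed_x a - uvec 0 = embed_x (s \<cdot>\<^sub>v a - alpha0 S)"
    using a alpha0_carrier by (auto simp: uvec_alpha0 embed_x_def fun_eq_iff)
  have y: "s *\<^sub>R embed_y p b - vvec 0 = embed_y p (s \<cdot>\<^sub>v b - beta0 S)"
    using b beta0_carrier by (auto simp: vvec_beta0 embed_y_def fun_eq_iff)
  have c: "s \<cdot>\<^sub>v a - alpha0 S \<in> carrier_vec p" "s \<cdot>\<^sub>v b - beta0 S \<in> carrier_vec q"
    using a b alpha0_carrier beta0_carrier by auto
  show "n1 m (s *\<^sub>R embed_x a - uvec 0) = vec_l1 (s \<cdot>\<^sub>v a - alpha0 S)"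
    "n2 m (s *\<^sub>R embed_x a - uvec 0) = vec_l2 (s \<cdot>\<^sub>v a - alpha0 S)"
    unfolding x by (simp_all add: embed_norms[OF c(1)])
  show "n1 m (s *\<^sub>R embed_y p b - vvec 0) = vec_l1 (s \<cdot>\<^sub>v b - beta0 S)"
    "n2 m (s *\<^sub>R embed_y p b - vvec 0) = vec_l2 (s \<cdot>\<^sub>v b - beta0 S)"
    unfolding y using embed_norms(3,4)[OF c(2), of p] by (simp_all add: add.commute)
qed

text \<open>The abstract argument applied at one fixed outcome. Randomness enters only through the
  two deviation bounds, the closeness of the estimators with signs \<open>s\<close> and
  \<open>t\<close>, and the output itself; the constants do not depend on the outcome.\<close>

lemma output_columns:
  fixes A D e \<delta> L C\<^sub>T \<chi> :: real
  assumes w: "\<omega> \<in> space P" and a: "a \<in> carrier_vec p" and b: "b \<in> carrier_vec q"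
    and dev_anchors: "\<And>x y. x \<in> anchors \<Longrightarrow> y \<in> anchors \<Longrightarrow> \<bar>E \<omega> x y\<bar> \<le> A * \<delta>"
    and dev_all: "\<And>v. \<bar>E \<omega> v v\<bar> \<le> \<epsilon> / (20 * M\<^sub>1) * (n2 m v)\<^sup>2 + A * \<delta>\<^sup>2 * (n1 m v)\<^sup>2"
    and A: "1 \<le> A" and D: "1 \<le> D" and \<delta>: "0 < \<delta>" and sl: "\<sigma> * \<delta> \<le> e" and e2: "e\<^sup>2 \<le> \<delta>"
    and st: "s\<^sup>2 = 1" "t\<^sup>2 = 1"
    and a2: "vec_l2 (s \<cdot>\<^sub>v a - alpha0 S) \<le> D * e" and a1: "vec_l1 (s \<cdot>\<^sub>v a - alpha0 S) \<le> D * (\<sigma> * e)"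
    and b2: "vec_l2 (t \<cdot>\<^sub>v b - beta0 S) \<le> D * e" and b1: "vec_l1 (t \<cdot>\<^sub>v b - beta0 S) \<le> D * (\<sigma> * e)"
    and k: "k = 6 * (4 * M\<^sub>1\<^sup>2 * D + 4 * A)"
    and kc: "k\<^sub>c = k * M\<^sub>1 + 2 * M\<^sub>1 * D + 4" and kg: "k\<^sub>g = 2 * (k + 2 * M\<^sub>1 * k\<^sub>c + 2 * M\<^sub>1 * D + 2)"
    and A2: "A\<^sub>2 = 2 * (7 * A + 5120 * A\<^sup>2 * M\<^sub>1 ^ 3 / \<epsilon>)"
    and L: "3 * M\<^sub>1\<^sup>2 / \<epsilon> + 1 + C\<^sub>T \<le> L" and CT: "0 < C\<^sub>T" and \<chi>: "0 \<le> \<chi>"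
    and \<nu>: "\<nu> = 28 * A\<^sup>2 + 32 * A * M\<^sub>1 * L" and C: "C = 8 + 4 * \<nu>"
    and hc: "h\<^sub>c = 2 * ((1 + 4 * real r * M\<^sub>1\<^sup>2 / \<epsilon>) / \<epsilon>) * k\<^sub>g * (L + A) * (1 + L)"
    and k3: "k\<^sub>3 = 4 * M\<^sub>1 * k\<^sub>g * h\<^sub>c * (1 + A)" and k4: "k\<^sub>4 = k\<^sub>3\<^sup>2 * M\<^sub>1 / (2 * \<epsilon>)" and k5: "k\<^sub>5 = 3 * h\<^sub>c + 2 * k\<^sub>4"
    and k6: "k\<^sub>6 = 1 + M\<^sub>1 / \<epsilon> * (16 * M\<^sub>1\<^sup>2 * h\<^sub>c + 4 * C * \<chi> + C * k\<^sub>5)" and k7: "k\<^sub>7 = 4 * \<chi> * k\<^sub>6 + k\<^sub>5"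
    and k8: "k\<^sub>8 = 4 * M\<^sub>1 * k\<^sub>g * (L + A) * L + \<nu> * L + 2 * (16 * M\<^sub>1\<^sup>2 * h\<^sub>c * k\<^sub>6 + \<nu> * k\<^sub>7)
       + (16 * M\<^sub>1\<^sup>2 * h\<^sub>c * k\<^sub>6 + C * k\<^sub>7) + C * C\<^sub>T"
    and small: "2 * k * (\<sigma> * e) \<le> 1" "k\<^sub>c * D * (\<sigma> * e) \<le> 1" "(6 * k * M\<^sub>1\<^sup>2 + 16 * M\<^sub>1\<^sup>2 * D) * (4 * M\<^sub>1 / \<epsilon>) * (\<sigma> * e) \<le> 1"
      "(28 * A\<^sup>2 * h\<^sub>c + 32 * A * M\<^sub>1 * h\<^sub>c) * (\<sigma> * e) \<le> 1" "h\<^sub>c * (\<sigma> * e) \<le> 1"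
      "A\<^sub>2 * (2 * C\<^sub>T + 1) * (\<sigma> * e) \<le> 1" "k\<^sub>8 * M\<^sub>1 / \<epsilon> * (\<sigma> * e) \<le> 1"
    and out: "nodewise_lasso_output (plugin_H n S \<omega> a b) (\<lambda>_. C * \<delta>) B \<Phi>"
    and j: "j < m" and B: "vec_l1 (eta0 S j) \<le> B j" "B j \<le> C\<^sub>T * \<sigma>"
    and l0: "sqrt (vec_l0 (eta0 S j)) \<le> \<chi> * \<sigma>"
  shows "vec_l2 (Matrix.col \<Phi> j - Matrix.col (Phi0 S) j) \<le> (M\<^sub>1 / \<epsilon> * k\<^sub>6 + (M\<^sub>1 / \<epsilon>)\<^sup>2 * k\<^sub>8 * L) * e"
    "vec_l1 (Matrix.col \<Phi> j - Matrix.col (Phi0 S) j) \<le> (M\<^sub>1 / \<epsilon> * k\<^sub>7 + (M\<^sub>1 / \<epsilon>)\<^sup>2 * k\<^sub>8 * L) * (\<sigma> * e)"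
proof -
  define \<rho>\<^sub>h where "\<rho>\<^sub>h = \<bar>hat_rho n S \<omega> a b\<bar>"
  \<comment> \<open>\<open>x\<close> and \<open>y\<close> are the sign-corrected estimators, close
    to the canonical pair; \<open>x0\<close> and \<open>y0\<close> are the ones that the algorithm
    uses. Both yield the same plug-in form.\<close>
  define x where "x = s *\<^sub>R embed_x a"
  define y where "y = t *\<^sub>R embed_y p b"
  define x0 where "x0 = embed_x a"
  define y0 where "y0 = embed_y p b"
  define H' where "H' = plugin_H n S \<omega> a b"
  note dim = plugin_carrier[of \<omega> a b, folded H'_def]
  have px: "proj_x p x = x" "proj_y p y = y"
    using proj_embed(1)[OF a] proj_embed(2)[of p b] lin_X lin_Y by (simp_all add: x_def y_def linear_cmul)
  have st': "s * s = 1" "t * t = 1" using st by (simp_all add: power2_eq_square)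
  have abs1: "\<bar>s\<bar> = 1" "\<bar>t\<bar> = 1" using st unfolding power2_eq_1_iff by auto
  note bE = bilinear_bform[of m "dev \<omega>"]
  note sc = bilinear_lmul[OF bE] bilinear_rmul[OF bE] bilinear_lmul[OF bil] bilinear_rmul[OF bil]
  have ss: "s * (s * c) = c" "t * (t * c) = c" for c using st' by (simp_all flip: mult.assoc)
  have sxx: "Gh \<omega> x x = Gh \<omega> x0 x0" and syy: "Gh \<omega> y y = Gh \<omega> y0 y0" and sxy: "Gh \<omega> x y = s * t * Gh \<omega> x0 y0"
    unfolding x_def y_def x0_def y0_def sc real_scaleR_def ss by (simp_all only: distrib_left mult_ac)
  have rh: "\<rho>\<^sub>h = \<bar>Gh \<omega> x y / (sqrt (Gh \<omega> x x) * sqrt (Gh \<omega> y y))\<bar>"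
    unfolding \<rho>\<^sub>h_def hat_rho_def hat_forms[OF w a b] sxx syy sxy using abs1 by (simp add: abs_mult x0_def y0_def)
  have se: "0 < e" "e \<le> \<sigma> * e" "\<delta> \<le> e"
  proof -
    have "1 * \<delta> \<le> \<sigma> * \<delta>" using sig \<delta> by (intro mult_right_mono) auto
    then show "\<delta> \<le> e" using sl by simp
    then show "0 < e" using \<delta> by simp
    then have "1 * e \<le> \<sigma> * e" using sig by (intro mult_right_mono) auto
    then show "e \<le> \<sigma> * e" by simp
  qed
  have M1': "1 \<le> M\<^sub>1\<^sup>2" by (simp add: one_le_power)
  define X where "X = M\<^sub>1\<^sup>2 * D"
  have MD: "D \<le> X" using M1' D by (simp add: X_def)
  have kX: "k = 24 * X + 24 * A" by (simp add: k X_def)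
  have kD: "24 * D \<le> k" "1 \<le> k" "0 \<le> k" using MD A D unfolding kX by linarith+
  have ks: "k * (\<sigma> * e) \<le> 1 / 2" using small(1) by simp
  have Dse: "D * (\<sigma> * e) \<le> 1" 
  proof -
    have "24 * D * (\<sigma> * e) \<le> k * (\<sigma> * e)" using kD se by (intro mult_right_mono) auto
    then have "24 * (D * (\<sigma> * e)) \<le> 1 / 2" using ks by simp
    moreover have "0 \<le> D * (\<sigma> * e)" using D se by simp
    ultimately show ?thesis by linarith
  qed
  have De: "D * e \<le> 1" using mult_left_mono[OF se(2), of D] D Dse by linarith
  have ke: "k * e \<le> 1 / 2" using mult_left_mono[OF se(2), of k] kD ks by linarith
  note norms = embed_differences[OF a b, of s] embed_differences[OF a b, of t]
  have x2: "n2 m (x - uvec 0) \<le> D * e" and x1: "n1 m (x - uvec 0) \<le> D * (\<sigma> * e)"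
    and y2: "n2 m (y - vvec 0) \<le> D * e" and y1: "n1 m (y - vvec 0) \<le> D * (\<sigma> * e)"
    unfolding x_def y_def norms by (fact a2 a1 b2 b1)+
  have anch: "unit i \<in> anchors" "proj_x p (\<Gamma> i) \<in> anchors" "proj_y p (\<Gamma> i) \<in> anchors" "uvec 0 \<in> anchors" "vvec 0 \<in> anchors"
    if "i < m" for i using that by (auto simp: anchors_def)
  have E_left: "\<bar>E \<omega> u v\<bar> \<le> A * \<delta> * n1 m v" if "u \<in> anchors" for u v
    by (rule bform_abs_le_left) (rule dev_anchors[OF that anch(1)])
  have E_inf: "\<bar>E \<omega> u v\<bar> \<le> A * \<delta> * (n1 m u * n1 m v)" for u v
  proof (rule bform_abs_le)
    fix i l assume "i < m" "l < m"
    then show "\<bar>dev \<omega> i l\<bar> \<le> A * \<delta>" using dev_anchors[OF anch(1)[of i] anch(1)[of l]] by (simp add: bform_unit_unit)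
  qed
  have sixk: "6 * (4 * M\<^sub>1\<^sup>2 * D + 4 * A) * e = k * e" by (simp add: k)
  have k8e: "(4 * M\<^sub>1\<^sup>2 * D + 4 * A) * e \<le> 1 / 8"
  proof -
    define Y where "Y = (4 * M\<^sub>1\<^sup>2 * D + 4 * A) * e"
    have "6 * Y = k * e" unfolding sixk[symmetric] Y_def by (rule mult.assoc[symmetric])
    then have "6 * Y \<le> 1 / 2" using ke by simp
    then show ?thesis unfolding Y_def[symmetric] by linarith
  qed
  have rho: "\<bar>\<rho>\<^sub>h - canL S 0\<bar> \<le> k * e" "\<bar>\<rho>\<^sub>h * Gh \<omega> x0 x0 - canL S 0\<bar> \<le> k * e" "\<bar>\<rho>\<^sub>h * Gh \<omega> y0 y0 - canL S 0\<bar> \<le> k * e"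
    using scale_perturbation[OF bE E_sym A D \<delta> se(3) E_inf E_left E_left dev_anchors dev_anchors dev_anchors
        px x2 order_trans[OF x1 Dse] y2 order_trans[OF y1 Dse] De refl, OF anch(4,5)[OF j] anch(4)[OF j] anch(4)[OF j] anch(4)[OF j] anch(5)[OF j] anch(5)[OF j] anch(5)[OF j] k8e]
    unfolding rh[symmetric] sxx[symmetric] syy[symmetric] sixk by simp_all
  interpret pf: perturbed_form "n1 m" "n2 m" "proj_x p" "proj_y p" "bform m cov" M\<^sub>1 \<epsilon> \<sigma> r uvec vvec "canL S"
    "E \<omega>" x y "\<rho>\<^sub>h * Gh \<omega> x0 x0" "\<rho>\<^sub>h * Gh \<omega> y0 y0" \<rho>\<^sub>h A D k e \<delta> k\<^sub>c k\<^sub>g A\<^sub>2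
    by unfold_locales (fact bE E_sym A D kD(2) \<delta> sl e2 E_inf E_left[OF anch(4)[OF j]] E_left[OF anch(5)[OF j]] dev_all px x2 x1 y2 y1 rho kc kg A2 small(2,3) | simp add: \<rho>\<^sub>h_def)+
  have Hh: "pf.Hh = bform m (entries H')"
    unfolding pf.Hh_def H'_def plugin_form[OF w a b] \<rho>\<^sub>h_def[symmetric] x0_def[symmetric] y0_def[symmetric]
    unfolding x_def y_def x0_def y0_def
    by (intro ext block_form_sign st) (rule pf.bil_Gh)
  from out obtain \<eta>h where st1: "lasso_stationary (mat_delete H' j j) (col_delete H' j) (C * \<delta>) (B j) (\<eta>h j)"
    and \<Phi>: "\<Phi> = mat_of_cols m (map (\<lambda>j. inverse (node_tau2 H' (C * \<delta>) j (\<eta>h j)) \<cdot>\<^sub>v node_Gamma m j (\<eta>h j)) [0..<m])"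
    unfolding nodewise_lasso_output_def H'_def[symmetric] using dim j by auto
  define \<eta>1 where "\<eta>1 = \<eta>h j"
  define \<eta> where "\<eta> = node_embed j \<eta>1"
  define \<eta>0 where "\<eta>0 = node_embed j (eta0 S j)"
  have c1: "\<eta>1 \<in> carrier_vec (m - 1)" and B1: "vec_l1 \<eta>1 \<le> B j"
    using st1 dim unfolding lasso_stationary_def \<eta>1_def by (auto simp: col_delete_def)
  note c0 = eta0_eq(1)[OF j]
  have n\<eta>: "n1 m \<eta> = vec_l1 \<eta>1" "n1 m \<eta>0 = vec_l1 (eta0 S j)"
    unfolding \<eta>_def \<eta>0_def using n1_node_embed[OF j c1] n1_node_embed[OF j c0] by auto
  have Gv: "\<Gamma> j - (\<eta> - \<eta>0) = unit j - \<eta>" by (simp add: \<Gamma>_def \<eta>0_def)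
  have A0: "0 \<le> \<nu>" "0 \<le> C" 
  proof -
    have "0 \<le> 3 * M\<^sub>1\<^sup>2 / \<epsilon>" using \<epsilon>_bounds by simp
    then have "0 \<le> L" using L CT by linarith
    then show "0 \<le> \<nu>" using A unfolding \<nu> by simp
    then show "0 \<le> C" unfolding C by simp
  qed
  have symH': "H' $$ (i, l) = H' $$ (l, i)" if "i < m" "l < m" for i l
    using pf.sym_Hh[of "unit i" "unit l"] that unfolding Hh by (simp add: bform_unit_unit)
  have L3: "1 \<le> L" "3 * M\<^sub>1\<^sup>2 / \<epsilon> \<le> L" "1 + C\<^sub>T \<le> L"
  proof -
    have "0 \<le> 3 * M\<^sub>1\<^sup>2 / \<epsilon>" using \<epsilon>_bounds by simp
    then show "1 \<le> L" "3 * M\<^sub>1\<^sup>2 / \<epsilon> \<le> L" "1 + C\<^sub>T \<le> L" using L CT by linarith+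
  qed
  have \<Gamma>2: "n2 m (\<Gamma> j) \<le> L" using \<Gamma>_bounds(2)[OF j] L3(2) by linarith
  \<comment> \<open>The source of the summand \<open>1 + C\<^sub>T\<close> of \<open>L\<close>: the
    node coordinate contributes 1 and \<open>eta0\<close> at most
    \<open>C\<^sub>T * \<sigma>\<close>, where \<open>\<sigma> \<ge> 1\<close>.\<close>
  have \<Gamma>1: "n1 m (\<Gamma> j) \<le> \<sigma> * L"
  proof -
    have "n1 m (\<Gamma> j) \<le> n1 m (unit j) + n1 m \<eta>0" unfolding \<Gamma>_def \<eta>0_def by (rule n1.triangle_diff)
    also have "\<dots> \<le> 1 + C\<^sub>T * \<sigma>" using n1_unit[OF j] n\<eta> B by simp
    also have "\<dots> \<le> \<sigma> * (1 + C\<^sub>T)" using sig by (simp add: algebra_simps)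
    also have "\<dots> \<le> \<sigma> * L" using sig L3 by (intro mult_left_mono) auto
    finally show ?thesis .
  qed
  interpret nw: nodewise "n1 m" "n2 m" "proj_x p" "proj_y p" "bform m cov" M\<^sub>1 \<epsilon> \<sigma> r uvec vvec "canL S"
    "E \<omega>" x y "\<rho>\<^sub>h * Gh \<omega> x0 x0" "\<rho>\<^sub>h * Gh \<omega> y0 y0" \<rho>\<^sub>h A D k e \<delta> k\<^sub>c k\<^sub>g A\<^sub>2
    "\<lambda>u. u j" "\<Gamma> j" \<eta> \<eta>0 L "B j" C\<^sub>T \<nu> C \<chi> h\<^sub>c k\<^sub>3 k\<^sub>4 k\<^sub>5 k\<^sub>6 k\<^sub>7 k\<^sub>8
  proof (rule nodewise.intro, rule pf.perturbed_form_axioms, rule nodewise_axioms.intro)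
    show "linear (\<lambda>u. u j :: real)" by (rule linearI) auto
    show "\<bar>u j\<bar> \<le> n2 m u" for u by (rule abs_coord_le_n2[OF j])
    show "2 * pf.Hh (\<Gamma> j - (\<eta> - \<eta>0)) (\<theta> - \<eta>) \<le> C * \<delta> * (n1 m \<theta> - n1 m \<eta>)"
      if "\<theta> j = 0" "n1 m \<theta> \<le> B j" for \<theta>
      unfolding Hh Gv unfolding \<eta>_def \<eta>1_def using stationary_form[OF dim symH' j _ st1 that] A0 \<delta> by simp
    show "n1 m (\<eta> - \<eta>0) \<le> n1 m \<eta> - n1 m \<eta>0 + 2 * \<chi> * \<sigma> * n2 m (\<eta> - \<eta>0)"
      using sparse_difference[OF card_node_embed[OF j c0] l0, of \<eta>] by (simp add: \<eta>0_def mult.assoc)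
    show "H (\<Gamma> j) w = 0" if "w j = 0" for w by (rule \<Gamma>_orth[where w = w, OF j that])
    show "\<Gamma> j j = 1" by (rule \<Gamma>_node)
    show "\<eta> j = 0" "\<eta>0 j = 0" by (simp_all add: \<eta>_def \<eta>0_def)
    show "n1 m \<eta>0 \<le> B j" "n1 m \<eta> \<le> B j" using n\<eta> B B1 by auto
    show "\<bar>E \<omega> (proj_x p (\<Gamma> j)) v\<bar> \<le> A * \<delta> * n1 m v" "\<bar>E \<omega> (proj_y p (\<Gamma> j)) v\<bar> \<le> A * \<delta> * n1 m v" for v
      by (rule E_left, rule anch[OF j])+
    show "\<bar>E \<omega> (proj_x p (\<Gamma> j)) (uvec 0)\<bar> \<le> A * \<delta>" "\<bar>E \<omega> (proj_y p (\<Gamma> j)) (vvec 0)\<bar> \<le> A * \<delta>"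
      by (rule dev_anchors; rule anch[OF j])+
  qed (fact L3 \<Gamma>2 \<Gamma>1 CT B(2) \<chi> \<nu> C hc k3 k4 k5 k6 k7 k8 small)+
  define \<tau> where "\<tau> = pf.Hh (\<Gamma> j - (\<eta> - \<eta>0)) (\<Gamma> j - (\<eta> - \<eta>0)) + C * \<delta> / 2 * n1 m \<eta>"
  have g: "node_Gamma m j \<eta>1 \<in> carrier_vec m" by (simp add: node_Gamma_def)
  have tau: "node_tau2 H' (C * \<delta>) j \<eta>1 = \<tau>"
  proof -
    have "node_tau2 H' (C * \<delta>) j \<eta>1 = bform m (entries H') (\<lambda>i. node_Gamma m j \<eta>1 $ i) (\<lambda>i. node_Gamma m j \<eta>1 $ i) + C * \<delta> / 2 * n1 m \<eta>"
      unfolding node_tau2_def n\<eta> using quad_form_sum[OF dim g] dim by simp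
    also have "bform m (entries H') (\<lambda>i. node_Gamma m j \<eta>1 $ i) (\<lambda>i. node_Gamma m j \<eta>1 $ i) = pf.Hh (unit j - \<eta>) (unit j - \<eta>)"
      unfolding Hh \<eta>_def by (intro bform_cong) (simp_all add: node_Gamma_apply)
    finally show ?thesis unfolding \<tau>_def Gv .
  qed
  have col\<Phi>: "Matrix.col \<Phi> j = inverse \<tau> \<cdot>\<^sub>v node_Gamma m j \<eta>1"
    unfolding \<Phi> using j g by (subst col_mat_of_cols) (auto simp: \<eta>1_def[symmetric] tau)
  define R where "R = (1 / \<tau>) *\<^sub>R (\<Gamma> j - (\<eta> - \<eta>0)) - (1 / H (\<Gamma> j) (\<Gamma> j)) *\<^sub>R \<Gamma> j"
  have dP: "Phi0 S \<in> carrier_mat m m" by (rule Phi0_col(1)[OF j j])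
  have cd: "dim_vec (Matrix.col \<Phi> j - Matrix.col (Phi0 S) j) = m" using dP by auto
  have Ri: "(Matrix.col \<Phi> j - Matrix.col (Phi0 S) j) $ i = R i" if i: "i < m" for i
    using i j g dP Phi0_col(2)[OF i j] unfolding col\<Phi> R_def Gv by (simp add: node_Gamma_apply \<eta>_def inverse_eq_divide)
  have e1: "vec_l1 (Matrix.col \<Phi> j - Matrix.col (Phi0 S) j) = n1 m R" "vec_l2 (Matrix.col \<Phi> j - Matrix.col (Phi0 S) j) = n2 m R"
    unfolding vec_l1_fun vec_l2_fun cd by (intro n1_cong n2_cong Ri; assumption)+
  have kk: "0 \<le> k\<^sub>6" "0 \<le> k\<^sub>7" using nw.k_nonneg by auto
  show "vec_l2 (Matrix.col \<Phi> j - Matrix.col (Phi0 S) j) \<le> (M\<^sub>1 / \<epsilon> * k\<^sub>6 + (M\<^sub>1 / \<epsilon>)\<^sup>2 * k\<^sub>8 * L) * e"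
    unfolding e1 R_def \<tau>_def
    by (rule nw.column_error[unfolded nw.v_def, OF seminorm_n2 \<Gamma>_bounds(1)[OF j] nw.n2_error[unfolded nw.v_def] \<Gamma>2 kk(1)]) (use L3 in linarith)
  \<comment> \<open>The factor \<open>\<sigma>\<close> is moved into the constants, so that
    \<open>column_error\<close>, stated at rate \<open>e\<close>, also gives the l1 rate.\<close>
  have n1e: "n1 m (\<eta> - \<eta>0) \<le> (k\<^sub>7 * \<sigma>) * e" using nw.n1_error unfolding nw.v_def by (simp only: mult.assoc)
  have "n1 m R \<le> (M\<^sub>1 / \<epsilon> * (k\<^sub>7 * \<sigma>) + (M\<^sub>1 / \<epsilon>)\<^sup>2 * k\<^sub>8 * (\<sigma> * L)) * e"
    unfolding R_def \<tau>_def
    by (rule nw.column_error[unfolded nw.v_def, OF seminorm_n1 \<Gamma>_bounds(1)[OF j] n1e \<Gamma>1]) (use L3 kk sig in auto)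
  then show "vec_l1 (Matrix.col \<Phi> j - Matrix.col (Phi0 S) j) \<le> (M\<^sub>1 / \<epsilon> * k\<^sub>7 + (M\<^sub>1 / \<epsilon>)\<^sup>2 * k\<^sub>8 * L) * (\<sigma> * e)"
    unfolding e1 by (simp add: algebra_simps)
qed

end

section \<open>Signs of the preliminary estimators\<close>

context cca_sample
begin

text \<open>Unit variance and the upper eigenvalue bound keep the leading canonical vectors away
  from 0, so an estimator and its negative cannot both be close to one of them.\<close>

lemma anchor_norm: "1 \<le> M\<^sub>1 * n2 m (uvec 0)" "1 \<le> M\<^sub>1 * n2 m (vvec 0)"
proof -
  have *: "1 \<le> M\<^sub>1 * x" if "1 \<le> M\<^sub>1 * x\<^sup>2" "0 \<le> x" for x
  proof -
    have "1 \<le> M\<^sub>1 * (M\<^sub>1 * x\<^sup>2)" using mult_mono[of 1 M\<^sub>1 1 "M\<^sub>1 * x\<^sup>2"] that by simp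
    then have "1\<^sup>2 \<le> (M\<^sub>1 * x)\<^sup>2" by (simp add: power2_eq_square mult_ac)
    then show ?thesis by (rule power2_le_imp_le) (use that in simp)
  qed
  have 1: "bform m cov (uvec 0) (uvec 0) = 1" "bform m cov (vvec 0) (vvec 0) = 1"
    unfolding UU[OF r0 r0] VV[OF r0 r0] by (rule if_P[OF refl])+
  show "1 \<le> M\<^sub>1 * n2 m (uvec 0)" using upper_X[of "uvec 0"] unfolding UX[OF r0] 1 by (rule *[OF _ n2.nonneg])
  show "1 \<le> M\<^sub>1 * n2 m (vvec 0)" using upper_Y[of "vvec 0"] unfolding VY[OF r0] 1 by (rule *[OF _ n2.nonneg])
qed

text \<open>The signs minimizing the two norms agree: otherwise the triangle inequality would bound
  \<open>2 n2 g\<close> by the sum of the two errors.\<close>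

lemma common_sign:
  assumes "(INF w\<in>{1, - 1}. n2 m (w *\<^sub>R f - g)) \<le> x" "(INF w\<in>{1, - 1}. n1 m (w *\<^sub>R f - g)) \<le> y"
    and "x + y < 2 * n2 m g"
  obtains s :: real where "s\<^sup>2 = 1" "n2 m (s *\<^sub>R f - g) \<le> x" "n1 m (s *\<^sub>R f - g) \<le> y"
proof -
  have inf: "\<exists>s. (s = 1 \<or> s = - 1) \<and> F s \<le> z" if "(INF w\<in>{1, - 1 :: real}. F w) \<le> z" for F :: "real \<Rightarrow> real" and z
  proof -
    have "(INF w\<in>{1, - 1 :: real}. F w) \<in> F ` {1, - 1}"
      using Min_in[of "F ` {1, - 1}"] by (subst cInf_eq_Min) auto
    then show ?thesis using that by auto
  qed
  obtain s where s: "s = 1 \<or> s = - 1" "n2 m (s *\<^sub>R f - g) \<le> x" using inf[OF assms(1)] by blast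
  obtain t where t: "t = 1 \<or> t = - 1" "n1 m (t *\<^sub>R f - g) \<le> y" using inf[OF assms(2)] by blast
  have "t = s"
  proof (rule ccontr)
    assume "t \<noteq> s"
    then have "2 *\<^sub>R g = - ((s *\<^sub>R f - g) + (t *\<^sub>R f - g))"
      using s(1) t(1) by (auto simp: scaleR_2)
    then have "n2 m (2 *\<^sub>R g) = n2 m ((s *\<^sub>R f - g) + (t *\<^sub>R f - g))" by (simp only: n2.minus)
    then have "2 * n2 m g \<le> n2 m (s *\<^sub>R f - g) + n2 m (t *\<^sub>R f - g)"
      using n2.scale[of 2 g] n2.triangle[of "s *\<^sub>R f - g" "t *\<^sub>R f - g"] by simp
    moreover have "n2 m (t *\<^sub>R f - g) \<le> n1 m (t *\<^sub>R f - g)"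
      unfolding n2_def n1_def by (rule L2_set_le_sum_abs)
    ultimately show False using s t assms(3) by linarith
  qed
  then show thesis using s t by (intro that[of s]) auto
qed

text \<open>The condition bounds sums of infima, taken separately in l2 and l1 norm. The infima are
  nonnegative, so each is bounded on its own, and \<open>common_sign\<close> finds one sign for both
  norms. The signs of the two estimators may differ.\<close>

lemma preliminary_signs:
  assumes a: "a \<in> carrier_vec p" and b: "b \<in> carrier_vec q"
    and l2: "\<bar>(INF w\<in>{1, - 1}. vec_l2 (w \<cdot>\<^sub>v a - alpha0 S)) + (INF w\<in>{1, - 1}. vec_l2 (w \<cdot>\<^sub>v b - beta0 S))\<bar> \<le> D * e"
    and l1: "\<bar>(INF w\<in>{1, - 1}. vec_l1 (w \<cdot>\<^sub>v a - alpha0 S)) + (INF w\<in>{1, - 1}. vec_l1 (w \<cdot>\<^sub>v b - beta0 S))\<bar> \<le> D * (\<sigma> * e)"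
    and D: "0 \<le> D" and e: "0 \<le> e" and small: "M\<^sub>1 * D * (\<sigma> * e) \<le> 1 / 2"
  obtains s t :: real where "s\<^sup>2 = 1" "t\<^sup>2 = 1"
    "vec_l2 (s \<cdot>\<^sub>v a - alpha0 S) \<le> D * e" "vec_l1 (s \<cdot>\<^sub>v a - alpha0 S) \<le> D * (\<sigma> * e)"
    "vec_l2 (t \<cdot>\<^sub>v b - beta0 S) \<le> D * e" "vec_l1 (t \<cdot>\<^sub>v b - beta0 S) \<le> D * (\<sigma> * e)"
proof -
  let ?I = "\<lambda>N f g. (INF w\<in>{1, - 1 :: real}. N m (w *\<^sub>R f - g) :: real)"
  have n0: "0 \<le> ?I N f g" if "\<And>u. 0 \<le> N m u" for N :: "nat \<Rightarrow> (nat \<Rightarrow> real) \<Rightarrow> real" and f g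
    by (rule cINF_greatest) (use that in auto)
  note ed = embed_differences[OF a b, symmetric]
  have "?I n2 (embed_x a) (uvec 0) + ?I n2 (embed_y p b) (vvec 0) \<le> D * e"
    "?I n1 (embed_x a) (uvec 0) + ?I n1 (embed_y p b) (vvec 0) \<le> D * (\<sigma> * e)"
    using l2 l1 unfolding ed by linarith+
  moreover have "0 \<le> ?I n2 (embed_x a) (uvec 0)" "0 \<le> ?I n2 (embed_y p b) (vvec 0)"
    "0 \<le> ?I n1 (embed_x a) (uvec 0)" "0 \<le> ?I n1 (embed_y p b) (vvec 0)" by (rule n0[of n2, OF n2.nonneg] n0[of n1, OF n1.nonneg])+
  ultimately have I: "?I n2 (embed_x a) (uvec 0) \<le> D * e" "?I n2 (embed_y p b) (vvec 0) \<le> D * e"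
    "?I n1 (embed_x a) (uvec 0) \<le> D * (\<sigma> * e)" "?I n1 (embed_y p b) (vvec 0) \<le> D * (\<sigma> * e)"
    by linarith+
  have "1 * (D * e) \<le> \<sigma> * (D * e)" using sig D e by (intro mult_right_mono) auto
  then have De: "D * e \<le> D * (\<sigma> * e)" by (simp add: mult_ac)
  have lt: "D * e + D * (\<sigma> * e) < 2 * z" if z: "1 \<le> M\<^sub>1 * z" for z
  proof -
    have "M\<^sub>1 * (D * (\<sigma> * e)) \<le> 1 / 2" using small by (simp add: mult.assoc)
    then have "M\<^sub>1 * (D * (\<sigma> * e)) < M\<^sub>1 * z" using z by linarith
    then have "D * (\<sigma> * e) < z" by (rule mult_less_cancel_left_pos[THEN iffD1, rotated]) simp
    then show ?thesis using De by linarith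
  qed
  obtain s where s: "s\<^sup>2 = 1" "n2 m (s *\<^sub>R embed_x a - uvec 0) \<le> D * e" "n1 m (s *\<^sub>R embed_x a - uvec 0) \<le> D * (\<sigma> * e)"
    using common_sign[OF I(1,3) lt[OF anchor_norm(1)]] by blast
  obtain t where t: "t\<^sup>2 = 1" "n2 m (t *\<^sub>R embed_y p b - vvec 0) \<le> D * e" "n1 m (t *\<^sub>R embed_y p b - vvec 0) \<le> D * (\<sigma> * e)"
    using common_sign[OF I(2,4) lt[OF anchor_norm(2)]] by blast
  show thesis using that[OF s(1) t(1)] s t unfolding ed[symmetric] by blast
qed

end

section \<open>Asymptotics\<close>

text \<open>At least one row of \<open>canU\<close> is nonzero, so s_U = o(p) forces p to infinity.
  Then the logarithm in the base rate exceeds 1 and \<open>\<delta>\<close> dominates n^(-1/2),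
  which turns the sparsity assumption into e^2 = o(\<delta>).\<close>

lemma rates:
  fixes S :: "nat \<Rightarrow> 'w cca"
  assumes pos: "\<forall>n\<ge>1. nonzero_rows (canU (S n)) \<ge> 1" and sp: "sparsity_assumption \<kappa> S" and \<kappa>: "1 / 2 \<le> \<kappa>"
  defines "\<delta> \<equiv> \<lambda>n. base_rate n (S n)" and "e \<equiv> \<lambda>n. real (sparsity (S n)) powr \<kappa> * base_rate n (S n)"
    and "\<sigma> \<equiv> \<lambda>n. sqrt (real (sparsity (S n)))" and "d \<equiv> \<lambda>n. max (dimX (S n)) (dimY (S n))"
  shows "eventually (\<lambda>n. N \<le> d n) sequentially"
    "eventually (\<lambda>n. 0 < \<delta> n \<and> \<sigma> n * \<delta> n \<le> e n \<and> (e n)\<^sup>2 \<le> \<delta> n) sequentially"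
    "eventually (\<lambda>n. c * (\<sigma> n * e n) \<le> 1) sequentially"
proof -
  have dN: "eventually (\<lambda>n. N \<le> d n) sequentially" for N :: nat
  proof -
    have "(\<lambda>n. real (nonzero_rows (canU (S n)))) \<in> o(\<lambda>n. real (dimX (S n)))"
      using sp by (simp add: sparsity_assumption_def)
    from landau_o.smallD[OF this, of "1 / (real N + 1)"]
    have "eventually (\<lambda>n. real (nonzero_rows (canU (S n))) \<le> 1 / (real N + 1) * real (dimX (S n))) sequentially" by simp
    then show ?thesis
    proof (rule eventually_elim2[OF _ eventually_ge_at_top[of 1]])
      fix n :: nat assume n: "1 \<le> n" and le: "real (nonzero_rows (canU (S n))) \<le> 1 / (real N + 1) * real (dimX (S n))"
      have "1 \<le> 1 / (real N + 1) * real (dimX (S n))" using le pos[rule_format, OF n] by linarith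
      then have "real N + 1 \<le> real (dimX (S n))" by (simp add: field_simps)
      then show "N \<le> d n" by (simp add: d_def)
    qed
  qed
  show "eventually (\<lambda>n. N \<le> d n) sequentially" by (rule dN)
  have small: "eventually (\<lambda>n. 0 < \<delta> n \<and> \<sigma> n * \<delta> n \<le> e n \<and> (e n)\<^sup>2 \<le> z * \<delta> n \<and> \<sigma> n * e n \<le> z) sequentially" if z: "0 < z" for z
  proof -
    have "(\<lambda>n. real (sparsity (S n)) powr (2 * \<kappa>) * (base_rate n (S n))\<^sup>2) \<in> o(\<lambda>n. real n powr (- 1 / 2))"
      using sp by (simp add: sparsity_assumption_def)
    from landau_o.smallD[OF this z]
    have "eventually (\<lambda>n. real (sparsity (S n)) powr (2 * \<kappa>) * (base_rate n (S n))\<^sup>2 \<le> z * real n powr (- 1 / 2)) sequentially"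
      by simp
    with dN[of 3] eventually_ge_at_top[of 1] show ?thesis
    proof eventually_elim
      case (elim n)
      have s1: "1 \<le> real (sparsity (S n))" using pos[rule_format, OF elim(2)] by (simp add: sparsity_def)
      have "exp 1 \<le> real (d n)" using exp_le elim(1) by linarith
      then have ln1: "1 \<le> ln (real (d n))" using ln_mono[of "exp 1" "real (d n)"] by simp
      have n0: "0 < real n" using elim by simp
      have "real n powr (- 1 / 2) = sqrt (1 / real n)"
        using n0 by (simp add: powr_minus powr_half_sqrt real_sqrt_divide inverse_eq_divide)
      also have "\<dots> \<le> \<delta> n" unfolding \<delta>_def base_rate_def using ln1[unfolded d_def] n0 by (intro real_sqrt_le_mono divide_right_mono) auto
      finally have nd: "real n powr (- 1 / 2) \<le> \<delta> n" .
      have \<delta>0: "0 < \<delta> n" using n0 by (intro less_le_trans[OF _ nd]) simp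
      have "(real (sparsity (S n)) powr \<kappa>)\<^sup>2 = real (sparsity (S n)) powr (2 * \<kappa>)"
        by (simp add: power2_eq_square flip: powr_add)
      then have "(e n)\<^sup>2 \<le> z * real n powr (- 1 / 2)" using elim(3) by (simp add: e_def power_mult_distrib)
      also have "\<dots> \<le> z * \<delta> n" using nd z by (intro mult_left_mono) auto
      finally have e2: "(e n)\<^sup>2 \<le> z * \<delta> n" .
      have "\<sigma> n = real (sparsity (S n)) powr (1 / 2)" using s1 by (simp add: \<sigma>_def powr_half_sqrt)
      also have "\<dots> \<le> real (sparsity (S n)) powr \<kappa>" using s1 \<kappa> by (intro powr_mono) auto
      finally have se: "\<sigma> n * \<delta> n \<le> e n" using \<delta>0 unfolding e_def \<delta>_def by (intro mult_right_mono) auto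
      have e0: "0 \<le> e n" using \<delta>0 by (simp add: e_def \<delta>_def)
      \<comment> \<open>Multiplying \<open>\<sigma> n * \<delta> n \<le> e n\<close> by
        \<open>e n\<close> and dividing by \<open>\<delta> n\<close> bounds
        \<open>\<sigma> n * e n\<close> by e^2 / \<delta>, which is at most
        \<open>z\<close>.\<close>
      have "\<delta> n * (\<sigma> n * e n) \<le> e n * e n" using mult_right_mono[OF se e0] by (simp add: mult_ac)
      also have "\<dots> \<le> \<delta> n * z" using e2 by (simp add: power2_eq_square mult_ac)
      finally have "\<sigma> n * e n \<le> z" using \<delta>0 by simp
      then show ?case using \<delta>0 se e2 by simp
    qed
  qed
  show "eventually (\<lambda>n. 0 < \<delta> n \<and> \<sigma> n * \<delta> n \<le> e n \<and> (e n)\<^sup>2 \<le> \<delta> n) sequentially"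
    using small[of 1] by simp (auto elim: eventually_mono)
  have c0: "0 < 1 / (\<bar>c\<bar> + 1)" by simp
  from small[OF this] show "eventually (\<lambda>n. c * (\<sigma> n * e n) \<le> 1) sequentially"
  proof eventually_elim
    case (elim n)
    have se: "0 \<le> \<sigma> n * e n" using elim by (simp add: \<sigma>_def e_def \<delta>_def)
    have "c * (\<sigma> n * e n) \<le> (\<bar>c\<bar> + 1) * (\<sigma> n * e n)" using se by (intro mult_right_mono) auto
    also have "\<dots> \<le> 1" using elim by (simp add: field_simps)
    finally show ?case .
  qed
qed

text \<open>The order of choices matters: \<open>t\<close>, \<open>A\<close>, \<open>L\<close> and
  \<open>C\<close> come from the model constants. Only then is the level \<open>x\<close> fixed; it
  determines \<open>D\<close> through the preliminary rates, and \<open>D\<close> enters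
  \<open>k\<close> and what is built from it, but not \<open>C\<close>. One exceptional event serves
  all columns and both norms.\<close>

lemma uniform_column_bound:
  fixes S :: "nat \<Rightarrow> 'w cca" and r :: nat and K M \<epsilon> \<kappa> C\<^sub>T A L C t :: real
  assumes par: "r \<ge> 1" "K > 0" "M > 0" "0 < \<epsilon>" "\<epsilon> < 1" "1 / 2 \<le> \<kappa>" "C\<^sub>T > 0"
    and t_def: "t = min 8 (\<epsilon> / (20 * max 1 M * (4 * K)\<^sup>2))"
    and A_def: "A = max 1 (max (20 * (4 * K)\<^sup>2 * (3 * (max 1 M)\<^sup>2 / \<epsilon> + max 1 M)\<^sup>2) (768 * (4 * K)\<^sup>2 / t))"
    and L_def: "L = 3 * (max 1 M)\<^sup>2 / \<epsilon> + 1 + C\<^sub>T"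
    and C_def: "C = 8 + 4 * (28 * A\<^sup>2 + 32 * A * max 1 M * L)"
    and model: "\<And>n. n \<ge> 1 \<Longrightarrow> cca_model K r n (S n)" "\<And>n. n \<ge> 1 \<Longrightarrow> eigengap \<epsilon> r (S n)" "\<And>n. n \<ge> 1 \<Longrightarrow> bounded_eigenvalues M (S n)"
    and sp: "sparsity_assumption \<kappa> S"
    and l0: "(\<lambda>n. real (MAX j\<in>{..<dimX (S n) + dimY (S n)}. vec_l0 (eta0 (S n) j))) \<in> O(\<lambda>n. real (sparsity (S n)))"
    and prelim: "preliminary_estimators \<kappa> S \<alpha>h \<beta>h"
    and B: "\<And>n j. n \<ge> 1 \<Longrightarrow> j < dimX (S n) + dimY (S n) \<Longrightarrow>
      vec_l1 (eta0 (S n) j) \<le> B n j \<and> B n j \<le> C\<^sub>T * sqrt (real (sparsity (S n)))"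
    and out: "\<And>n \<omega>. n \<ge> 1 \<Longrightarrow> \<omega> \<in> space (pspace (S n)) \<Longrightarrow>
      nodewise_lasso_output (plugin_H n (S n) \<omega> (\<alpha>h n \<omega>) (\<beta>h n \<omega>)) (\<lambda>j. C * base_rate n (S n)) (B n) (\<Phi>h n \<omega>)"
    and x: "0 < x"
  obtains c where "0 < c" "\<forall>\<^sub>F n in sequentially. 1 \<le> n \<and> dimX (S n) > 0 \<and> (\<exists>X\<in>sets (pspace (S n)). measure (pspace (S n)) X < x \<and>
      (\<forall>\<omega>\<in>space (pspace (S n)) - X. \<forall>j<dimX (S n) + dimY (S n).
        vec_l2 (Matrix.col (\<Phi>h n \<omega>) j - Matrix.col (Phi0 (S n)) j) \<le> c * (real (sparsity (S n)) powr \<kappa> * base_rate n (S n)) \<and>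
        vec_l1 (Matrix.col (\<Phi>h n \<omega>) j - Matrix.col (Phi0 (S n)) j) \<le> c * (real (sparsity (S n)) powr (\<kappa> + 1 / 2) * base_rate n (S n))))"
proof -
  let ?M = "max 1 M"
  define \<delta> where "\<delta> n = base_rate n (S n)" for n
  define e where "e n = real (sparsity (S n)) powr \<kappa> * base_rate n (S n)" for n
  define \<sigma> where "\<sigma> n = sqrt (real (sparsity (S n)))" for n
  define d where "d n = max (dimX (S n)) (dimY (S n))" for n
  have rate1: "real (sparsity (S n)) powr (\<kappa> + 1 / 2) * base_rate n (S n) = \<sigma> n * e n" for n
    by (simp add: \<sigma>_def e_def powr_add powr_half_sqrt)
  have cs: "cca_sample (S n) K M \<epsilon> r n" if "n \<ge> 1" for n
    by unfold_locales (use model[OF that] par that in auto)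
  have pos: "\<forall>n\<ge>1. nonzero_rows (canU (S n)) \<ge> 1" using cca_sample.sparsity_pos(1)[OF cs] by blast
  note rt = rates[OF pos sp par(6), folded \<delta>_def e_def \<sigma>_def d_def]
  have T0: "0 < (4 * K)\<^sup>2" using par by simp
  have t: "0 < t" "t \<le> 8" "t * (4 * K)\<^sup>2 \<le> \<epsilon> / (20 * ?M)"
  proof -
    show "0 < t" "t \<le> 8" using par T0 by (simp_all add: t_def)
    have "t * (4 * K)\<^sup>2 \<le> \<epsilon> / (20 * ?M * (4 * K)\<^sup>2) * (4 * K)\<^sup>2"
      by (rule mult_right_mono) (simp_all add: t_def)
    also have "\<dots> = \<epsilon> / (20 * ?M)" using T0 by simp
    finally show "t * (4 * K)\<^sup>2 \<le> \<epsilon> / (20 * ?M)" .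
  qed
  have A: "1 \<le> A" "20 * (4 * K)\<^sup>2 * (3 * ?M\<^sup>2 / \<epsilon> + ?M)\<^sup>2 \<le> A" "768 * (4 * K)\<^sup>2 / t \<le> A"
    unfolding A_def by (simp_all only: max.cobounded1 max.coboundedI2[OF max.cobounded1] max.coboundedI2[OF max.cobounded2])
  from prelim have pr:
    "\<And>n \<omega>. n \<ge> 1 \<Longrightarrow> \<omega> \<in> space (pspace (S n)) \<Longrightarrow> \<alpha>h n \<omega> \<in> carrier_vec (dimX (S n))"
    "\<And>n \<omega>. n \<ge> 1 \<Longrightarrow> \<omega> \<in> space (pspace (S n)) \<Longrightarrow> \<beta>h n \<omega> \<in> carrier_vec (dimY (S n))"
    by (auto simp: preliminary_estimators_def random_vec_def)
  let ?Z = "\<lambda>N n \<omega>. (INF w\<in>{1, - 1}. N (w \<cdot>\<^sub>v \<alpha>h n \<omega> - alpha0 (S n))) + (INF w\<in>{1, - 1}. N (w \<cdot>\<^sub>v \<beta>h n \<omega> - beta0 (S n))) :: real"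
  have x3: "0 < x / 3" using x by simp
  have "\<exists>c>0. \<forall>\<^sub>F n in sequentially. \<exists>E\<in>sets (pspace (S n)).
      {\<omega> \<in> space (pspace (S n)). \<bar>?Z vec_l2 n \<omega>\<bar> > c * e n} \<subseteq> E \<and> measure (pspace (S n)) E < x / 3"
    using prelim x3 unfolding preliminary_estimators_def bounded_in_prob_def e_def by blast
  then obtain C1 where C1: "\<forall>\<^sub>F n in sequentially. \<exists>E\<in>sets (pspace (S n)).
      {\<omega> \<in> space (pspace (S n)). \<bar>?Z vec_l2 n \<omega>\<bar> > C1 * e n} \<subseteq> E \<and> measure (pspace (S n)) E < x / 3" by blast
  have "\<exists>c>0. \<forall>\<^sub>F n in sequentially. \<exists>E\<in>sets (pspace (S n)).
      {\<omega> \<in> space (pspace (S n)). \<bar>?Z vec_l1 n \<omega>\<bar> > c * (\<sigma> n * e n)} \<subseteq> E \<and> measure (pspace (S n)) E < x / 3"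
    using prelim x3 unfolding preliminary_estimators_def bounded_in_prob_def rate1 by blast
  then obtain C2 where C2: "\<forall>\<^sub>F n in sequentially. \<exists>E\<in>sets (pspace (S n)).
      {\<omega> \<in> space (pspace (S n)). \<bar>?Z vec_l1 n \<omega>\<bar> > C2 * (\<sigma> n * e n)} \<subseteq> E \<and> measure (pspace (S n)) E < x / 3" by blast
  define D where "D = max 1 (max C1 C2)"
  have D: "1 \<le> D" "C1 \<le> D" "C2 \<le> D" by (simp_all add: D_def)
  obtain b where b: "0 < b" "\<forall>\<^sub>F n in sequentially. norm (real (MAX j\<in>{..<dimX (S n) + dimY (S n)}. vec_l0 (eta0 (S n) j))) \<le> b * norm (real (sparsity (S n)))"
    using landau_o.bigE[OF l0] by blast
  define \<chi> where "\<chi> = sqrt b"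
  define k where "k = 6 * (4 * ?M\<^sup>2 * D + 4 * A)"
  define k\<^sub>c where "k\<^sub>c = k * ?M + 2 * ?M * D + 4"
  define k\<^sub>g where "k\<^sub>g = 2 * (k + 2 * ?M * k\<^sub>c + 2 * ?M * D + 2)"
  define A\<^sub>2 where "A\<^sub>2 = 2 * (7 * A + 5120 * A\<^sup>2 * ?M ^ 3 / \<epsilon>)"
  define \<nu> where "\<nu> = 28 * A\<^sup>2 + 32 * A * ?M * L"
  define h\<^sub>c where "h\<^sub>c = 2 * ((1 + 4 * real r * ?M\<^sup>2 / \<epsilon>) / \<epsilon>) * k\<^sub>g * (L + A) * (1 + L)"
  define k\<^sub>3 where "k\<^sub>3 = 4 * ?M * k\<^sub>g * h\<^sub>c * (1 + A)"
  define k\<^sub>4 where "k\<^sub>4 = k\<^sub>3\<^sup>2 * ?M / (2 * \<epsilon>)"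
  define k\<^sub>5 where "k\<^sub>5 = 3 * h\<^sub>c + 2 * k\<^sub>4"
  define k\<^sub>6 where "k\<^sub>6 = 1 + ?M / \<epsilon> * (16 * ?M\<^sup>2 * h\<^sub>c + 4 * C * \<chi> + C * k\<^sub>5)"
  define k\<^sub>7 where "k\<^sub>7 = 4 * \<chi> * k\<^sub>6 + k\<^sub>5"
  define k\<^sub>8 where "k\<^sub>8 = 4 * ?M * k\<^sub>g * (L + A) * L + \<nu> * L + 2 * (16 * ?M\<^sup>2 * h\<^sub>c * k\<^sub>6 + \<nu> * k\<^sub>7)
       + (16 * ?M\<^sup>2 * h\<^sub>c * k\<^sub>6 + C * k\<^sub>7) + C * C\<^sub>T"
  have C\<nu>: "C = 8 + 4 * \<nu>" by (simp add: C_def \<nu>_def)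
  have Lle: "3 * ?M\<^sup>2 / \<epsilon> + 1 + C\<^sub>T \<le> L" by (simp add: L_def)
  have \<chi>0: "0 \<le> \<chi>" using b by (simp add: \<chi>_def)
  define c where "c = max 1 (max (?M / \<epsilon> * k\<^sub>6 + (?M / \<epsilon>)\<^sup>2 * k\<^sub>8 * L) (?M / \<epsilon> * k\<^sub>7 + (?M / \<epsilon>)\<^sup>2 * k\<^sub>8 * L))"
  have "1 \<le> c" unfolding c_def by (rule max.cobounded1)
  then have c0: "0 < c" by simp
  have c: "?M / \<epsilon> * k\<^sub>6 + (?M / \<epsilon>)\<^sup>2 * k\<^sub>8 * L \<le> c" "?M / \<epsilon> * k\<^sub>7 + (?M / \<epsilon>)\<^sup>2 * k\<^sub>8 * L \<le> c"
    unfolding c_def by (simp_all only: max.coboundedI2[OF max.cobounded1] max.coboundedI2[OF max.cobounded2])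
  have expo: "\<forall>\<^sub>F n in sequentially. 2 * exp (- real n * t\<^sup>2 / 64) < x / 6"
  proof -
    have "(\<lambda>n. 2 * exp (- (t\<^sup>2 / 64)) ^ n) \<longlonglongrightarrow> 2 * 0"
      using t by (intro tendsto_mult_left LIMSEQ_realpow_zero) auto
    then have "\<forall>\<^sub>F n in sequentially. 2 * exp (- (t\<^sup>2 / 64)) ^ n < x / 6"
      using x by (intro order_tendstoD(2)[of _ "2 * 0"]) auto
    then show ?thesis by (simp flip: exp_of_nat_mult)
  qed
  \<comment> \<open>The level \<open>x\<close> is split into x / 3 for each preliminary event and x
    / 6 for each part of the deviation event. Hence 2400 = 6 * 400 for the dimension; 28 serves
    because 28^2 = 784 exceeds 768.\<close>
  have "\<forall>\<^sub>F n in sequentially. 1 \<le> n \<and> dimX (S n) > 0 \<and> (\<exists>X\<in>sets (pspace (S n)). measure (pspace (S n)) X < x \<and>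
      (\<forall>\<omega>\<in>space (pspace (S n)) - X. \<forall>j<dimX (S n) + dimY (S n).
        vec_l2 (Matrix.col (\<Phi>h n \<omega>) j - Matrix.col (Phi0 (S n)) j) \<le> c * e n \<and>
        vec_l1 (Matrix.col (\<Phi>h n \<omega>) j - Matrix.col (Phi0 (S n)) j) \<le> c * (\<sigma> n * e n)))"
    using eventually_ge_at_top[of 1] rt(1)[of "nat \<lceil>2400 / x\<rceil> + 2"] rt(2) C1 C2 b(2) expo
      rt(3)[of "2 * k"] rt(3)[of "k\<^sub>c * D"] rt(3)[of "(6 * k * ?M\<^sup>2 + 16 * ?M\<^sup>2 * D) * (4 * ?M / \<epsilon>)"]
      rt(3)[of "28 * A\<^sup>2 * h\<^sub>c + 32 * A * ?M * h\<^sub>c"] rt(3)[of "h\<^sub>c"] rt(3)[of "A\<^sub>2 * (2 * C\<^sub>T + 1)"]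
      rt(3)[of "k\<^sub>8 * ?M / \<epsilon>"] rt(3)[of "2 * (?M * D)"] rt(3)[of "28 / t"] rt(3)[of 2]
  proof eventually_elim
    case (elim n)
    interpret c: cca_sample "S n" K M \<epsilon> r n by (rule cs[OF elim(1)])
    note n1 = elim(1) and small = elim(8-14)
    have \<delta>0: "0 < \<delta> n" and sl: "\<sigma> n * \<delta> n \<le> e n" and e2: "(e n)\<^sup>2 \<le> \<delta> n" using elim(3) by auto
    have s1: "1 \<le> \<sigma> n" unfolding \<sigma>_def by (rule c.sig)
    have \<delta>e: "\<delta> n \<le> e n" using mult_right_mono[OF s1, of "\<delta> n"] \<delta>0 sl by linarith
    then have e0: "0 < e n" using \<delta>0 by simp
    have ese: "e n \<le> \<sigma> n * e n" using mult_right_mono[OF s1, of "e n"] e0 by linarith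
    have se0: "0 \<le> \<sigma> n * e n" using e0 ese by linarith
    have dn: "2400 / x \<le> real (d n)" "2 \<le> d n"
    proof -
      show "2 \<le> d n" using elim(2) by simp
      have "2400 / x \<le> real (nat \<lceil>2400 / x\<rceil>)" by (rule real_nat_ceiling_ge)
      also have "\<dots> \<le> real (d n)" by (rule of_nat_mono) (use elim(2) in linarith)
      finally show "2400 / x \<le> real (d n)" .
    qed
    have d400: "400 / real (d n) \<le> x / 6" using dn x by (simp add: field_simps)
    have sm1: "10 * \<delta> n \<le> 8" using elim(17) \<delta>e ese by linarith
    have sm2: "768 * (\<delta> n)\<^sup>2 \<le> t\<^sup>2"
    proof -
      have "28 * (\<sigma> n * e n) \<le> t" using elim(16) t by (simp add: field_simps)
      then have "28 * \<delta> n \<le> t" using \<delta>e ese by linarith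
      then have "(28 * \<delta> n)\<^sup>2 \<le> t\<^sup>2" using \<delta>0 by (intro power_mono) auto
      then have "784 * (\<delta> n)\<^sup>2 \<le> t\<^sup>2" by (simp add: power_mult_distrib)
      then show ?thesis using zero_le_power2[of "\<delta> n"] by linarith
    qed
    obtain X0 where X0: "X0 \<in> c.events" "c.prob X0 \<le> 400 / real (d n) + 2 * exp (- real n * t\<^sup>2 / 64)"
      "\<And>\<omega> u v. \<omega> \<in> space c.P - X0 \<Longrightarrow> u \<in> c.anchors \<Longrightarrow> v \<in> c.anchors \<Longrightarrow> \<bar>c.E \<omega> u v\<bar> \<le> 20 * (4 * K)\<^sup>2 * c.L\<^sub>0\<^sup>2 * \<delta> n"
      "\<And>\<omega> v. \<omega> \<in> space c.P - X0 \<Longrightarrow>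
        \<bar>c.E \<omega> v v\<bar> \<le> t * (4 * K)\<^sup>2 * (n2 c.m v)\<^sup>2 + 768 * (4 * K)\<^sup>2 / t * (\<delta> n)\<^sup>2 * (n1 c.m v)\<^sup>2"
      using c.good_event[OF dn(2)[unfolded d_def] t(1,2) sm1[unfolded \<delta>_def] sm2[unfolded \<delta>_def]]
      unfolding d_def[symmetric] \<delta>_def[symmetric] by blast
    obtain X1 where X1: "X1 \<in> c.events" "{\<omega> \<in> space c.P. \<bar>?Z vec_l2 n \<omega>\<bar> > C1 * e n} \<subseteq> X1" "c.prob X1 < x / 3"
      using elim(4) by blast
    obtain X2 where X2: "X2 \<in> c.events" "{\<omega> \<in> space c.P. \<bar>?Z vec_l1 n \<omega>\<bar> > C2 * (\<sigma> n * e n)} \<subseteq> X2" "c.prob X2 < x / 3"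
      using elim(5) by blast
    define X where "X = X0 \<union> X1 \<union> X2"
    have "c.prob X \<le> c.prob X0 + c.prob X1 + c.prob X2"
      using measure_Un_le[of X0 c.P X1] measure_Un_le[of "X0 \<union> X1" c.P X2] X0(1) X1(1) X2(1) unfolding X_def by simp
    then have probX: "c.prob X < x" using X0(2) X1(3) X2(3) d400 elim(7) by linarith
    have "vec_l2 (Matrix.col (\<Phi>h n \<omega>) j - Matrix.col (Phi0 (S n)) j) \<le> c * e n \<and>
        vec_l1 (Matrix.col (\<Phi>h n \<omega>) j - Matrix.col (Phi0 (S n)) j) \<le> c * (\<sigma> n * e n)"
      if w': "\<omega> \<in> space c.P - X" and j: "j < c.m" for \<omega> j
    proof -
      have w: "\<omega> \<in> space c.P" and w0: "\<omega> \<in> space c.P - X0" using w' by (auto simp: X_def)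
      note ca = pr(1)[OF n1 w] and cb = pr(2)[OF n1 w]
      have "\<bar>?Z vec_l2 n \<omega>\<bar> \<le> C1 * e n" using X1(2) w' by (auto simp: X_def not_less)
      also have "\<dots> \<le> D * e n" by (rule mult_right_mono[OF D(2) less_imp_le[OF e0]])
      finally have z2: "\<bar>?Z vec_l2 n \<omega>\<bar> \<le> D * e n" .
      have "\<bar>?Z vec_l1 n \<omega>\<bar> \<le> C2 * (\<sigma> n * e n)" using X2(2) w' by (auto simp: X_def not_less)
      also have "\<dots> \<le> D * (\<sigma> n * e n)" by (rule mult_right_mono[OF D(3) se0])
      finally have z1: "\<bar>?Z vec_l1 n \<omega>\<bar> \<le> D * (\<sigma> n * e n)" .
      have MD: "?M * D * (\<sigma> n * e n) \<le> 1 / 2" using elim(15) by (simp add: mult.assoc)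
      obtain s u where su: "s\<^sup>2 = 1" "u\<^sup>2 = 1"
        "vec_l2 (s \<cdot>\<^sub>v \<alpha>h n \<omega> - alpha0 (S n)) \<le> D * e n" "vec_l1 (s \<cdot>\<^sub>v \<alpha>h n \<omega> - alpha0 (S n)) \<le> D * (\<sigma> n * e n)"
        "vec_l2 (u \<cdot>\<^sub>v \<beta>h n \<omega> - beta0 (S n)) \<le> D * e n" "vec_l1 (u \<cdot>\<^sub>v \<beta>h n \<omega> - beta0 (S n)) \<le> D * (\<sigma> n * e n)"
        using c.preliminary_signs[OF ca cb z2 z1[unfolded \<sigma>_def] _ _ MD[unfolded \<sigma>_def], folded \<sigma>_def] D e0 by auto
      have dev1: "\<bar>c.E \<omega> y z\<bar> \<le> A * \<delta> n" if "y \<in> c.anchors" "z \<in> c.anchors" for y z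
        by (rule order_trans[OF X0(3)[OF w0 that, unfolded c.L\<^sub>0_def] mult_right_mono[OF A(2)]]) (use \<delta>0 in simp)
      have dev2: "\<bar>c.E \<omega> v v\<bar> \<le> \<epsilon> / (20 * ?M) * (n2 c.m v)\<^sup>2 + A * (\<delta> n)\<^sup>2 * (n1 c.m v)\<^sup>2" for v
        by (rule order_trans[OF X0(4)[OF w0]]) (intro add_mono mult_right_mono t(3) A(3); simp)
      have l0j: "sqrt (vec_l0 (eta0 (S n) j)) \<le> \<chi> * \<sigma> n"
      proof -
        have "vec_l0 (eta0 (S n) j) \<le> (MAX j\<in>{..<c.m}. vec_l0 (eta0 (S n) j))" using j by (intro Max_ge) auto
        then have "real (vec_l0 (eta0 (S n) j)) \<le> b * real (sparsity (S n))" using elim(6) by simp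
        then show ?thesis unfolding \<chi>_def \<sigma>_def real_sqrt_mult[symmetric] by (rule real_sqrt_le_mono)
      qed
      note bounds = c.output_columns[OF w ca cb, where A = A and D = D and e = "e n" and \<delta> = "\<delta> n" and s = s and t = u and k = k and k\<^sub>c = k\<^sub>c
          and k\<^sub>g = k\<^sub>g and A\<^sub>2 = A\<^sub>2 and L = L and C\<^sub>T = C\<^sub>T and \<chi> = \<chi> and \<nu> = \<nu> and C = C and h\<^sub>c = h\<^sub>c and k\<^sub>3 = k\<^sub>3 and k\<^sub>4 = k\<^sub>4 and k\<^sub>5 = k\<^sub>5
          and k\<^sub>6 = k\<^sub>6 and k\<^sub>7 = k\<^sub>7 and k\<^sub>8 = k\<^sub>8 and B = "B n" and \<Phi> = "\<Phi>h n \<omega>" and j = j, folded \<sigma>_def,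
          OF dev1 dev2 A(1) D(1) \<delta>0 sl e2 su(1,2,3,4,5,6) k_def k\<^sub>c_def k\<^sub>g_def A\<^sub>2_def Lle par(7) \<chi>0 \<nu>_def C\<nu> h\<^sub>c_def
            k\<^sub>3_def k\<^sub>4_def k\<^sub>5_def k\<^sub>6_def k\<^sub>7_def k\<^sub>8_def small out[OF n1 w, folded \<delta>_def] j _ _ l0j]
      have Bj: "vec_l1 (eta0 (S n) j) \<le> B n j" "B n j \<le> C\<^sub>T * \<sigma> n" using B[OF n1 j] by (simp_all add: \<sigma>_def)
      have "vec_l2 (Matrix.col (\<Phi>h n \<omega>) j - Matrix.col (Phi0 (S n)) j) \<le> (?M / \<epsilon> * k\<^sub>6 + (?M / \<epsilon>)\<^sup>2 * k\<^sub>8 * L) * e n"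
        by (rule bounds(1)[OF _ _ Bj])
      moreover have "vec_l1 (Matrix.col (\<Phi>h n \<omega>) j - Matrix.col (Phi0 (S n)) j) \<le> (?M / \<epsilon> * k\<^sub>7 + (?M / \<epsilon>)\<^sup>2 * k\<^sub>8 * L) * (\<sigma> n * e n)"
        by (rule bounds(2)[OF _ _ Bj])
      ultimately show ?thesis
        using order_trans[OF _ mult_right_mono[OF c(1) less_imp_le[OF e0]]] order_trans[OF _ mult_right_mono[OF c(2) se0]] by blast
    qed
    moreover have "0 < dimX (S n)"
    proof (rule ccontr)
      assume "\<not> 0 < dimX (S n)"
      then have "nonzero_rows (canU (S n)) = 0" using c.U by (auto simp: nonzero_rows_def)
      then show False using c.sparsity_pos(1) by simp
    qed
    moreover have "X \<in> c.events" using X0(1) X1(1) X2(1) by (simp add: X_def)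
    ultimately show ?case using n1 probX by blast
  qed
  then show thesis using c0 unfolding rate1[symmetric] unfolding e_def by (intro that[of c])
qed

text \<open>The exceptional event is common to all indices, so there is no union over columns.
  \<open>0 < d n\<close> avoids the maximum of the empty set, which has no specified value.\<close>

lemma bounded_in_prob_Max:
  fixes Z :: "nat \<Rightarrow> nat \<Rightarrow> 'w \<Rightarrow> real"
  assumes "\<And>x. 0 < x \<Longrightarrow> \<exists>c>0. \<forall>\<^sub>F n in sequentially. 0 < d n \<and> (\<exists>X\<in>sets (P n). measure (P n) X < x \<and>
      (\<forall>\<omega>\<in>space (P n) - X. \<forall>j<d n. 0 \<le> Z n j \<omega> \<and> Z n j \<omega> \<le> c * a n))"
  shows "bounded_in_prob P (\<lambda>n \<omega>. MAX j\<in>{..<d n}. Z n j \<omega>) a"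
  unfolding bounded_in_prob_def
proof (intro allI impI)
  fix x :: real assume "0 < x"
  from assms[OF this] obtain c where c: "c > 0" and ev: "\<forall>\<^sub>F n in sequentially. 0 < d n \<and> (\<exists>X\<in>sets (P n). measure (P n) X < x \<and>
      (\<forall>\<omega>\<in>space (P n) - X. \<forall>j<d n. 0 \<le> Z n j \<omega> \<and> Z n j \<omega> \<le> c * a n))" by blast
  have "\<forall>\<^sub>F n in sequentially. \<exists>E\<in>sets (P n).
        {\<omega> \<in> space (P n). c * a n < \<bar>MAX j\<in>{..<d n}. Z n j \<omega>\<bar>} \<subseteq> E \<and> measure (P n) E < x"
    using ev
  proof eventually_elim
    case (elim n)
    then obtain X where X: "X \<in> sets (P n)" "measure (P n) X < x" "0 < d n"
      "\<And>\<omega> j. \<omega> \<in> space (P n) - X \<Longrightarrow> j < d n \<Longrightarrow> 0 \<le> Z n j \<omega> \<and> Z n j \<omega> \<le> c * a n" by blast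
    have "\<bar>MAX j\<in>{..<d n}. Z n j \<omega>\<bar> \<le> c * a n" if "\<omega> \<in> space (P n) - X" for \<omega>
    proof -
      have "(MAX j\<in>{..<d n}. Z n j \<omega>) \<in> (\<lambda>j. Z n j \<omega>) ` {..<d n}" using X(3) by (intro Max_in) auto
      then show ?thesis using X(4)[OF that] by auto
    qed
    then have "{\<omega> \<in> space (P n). c * a n < \<bar>MAX j\<in>{..<d n}. Z n j \<omega>\<bar>} \<subseteq> X" by fastforce
    then show ?case using X by blast
  qed
  then show "\<exists>C>0. \<forall>\<^sub>F n in sequentially. \<exists>E\<in>sets (P n).
        {\<omega> \<in> space (P n). C * a n < \<bar>MAX j\<in>{..<d n}. Z n j \<omega>\<bar>} \<subseteq> E \<and> measure (P n) E < x"
    using c by blast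
qed

theorem theorem4:
  fixes r :: nat and K M \<epsilon>\<^sub>0 \<kappa> C\<^sub>T :: real
  assumes "r \<ge> 1" and "K > 0" and "M > 0" and "0 < \<epsilon>\<^sub>0" and "\<epsilon>\<^sub>0 < 1"
    and "1 / 2 \<le> \<kappa>" and "\<kappa> \<le> 1" and "C\<^sub>T > 0"
  shows "\<exists>C>0. \<forall>(S :: nat \<Rightarrow> 'w cca) hat_\<alpha> hat_\<beta> (B :: nat \<Rightarrow> nat \<Rightarrow> real) hat_\<Phi>.
      (\<forall>n\<ge>1. cca_model K r n (S n)) \<longrightarrow>
      (\<forall>n\<ge>1. eigengap \<epsilon>\<^sub>0 r (S n)) \<longrightarrow>
      (\<forall>n\<ge>1. bounded_eigenvalues M (S n)) \<longrightarrow>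
      sparsity_assumption \<kappa> S \<longrightarrow>
      (\<lambda>n. real (MAX j\<in>{..<dimX (S n) + dimY (S n)}. vec_l0 (eta0 (S n) j)))
        \<in> O(\<lambda>n. real (sparsity (S n))) \<longrightarrow>
      preliminary_estimators \<kappa> S hat_\<alpha> hat_\<beta> \<longrightarrow>
      (\<forall>n\<ge>1. \<forall>j<dimX (S n) + dimY (S n). B n j > 0 \<and>
         vec_l1 (eta0 (S n) j) \<le> B n j \<and> B n j \<le> C\<^sub>T * sqrt (real (sparsity (S n)))) \<longrightarrow>
      (\<forall>n\<ge>1. \<forall>\<omega>\<in>space (pspace (S n)).
         nodewise_lasso_output (plugin_H n (S n) \<omega> (hat_\<alpha> n \<omega>) (hat_\<beta> n \<omega>))
           (\<lambda>j. C * base_rate n (S n)) (B n) (hat_\<Phi> n \<omega>)) \<longrightarrow>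
      bounded_in_prob (\<lambda>n. pspace (S n))
        (\<lambda>n \<omega>. MAX j\<in>{..<dimX (S n) + dimY (S n)}.
           vec_l1 (Matrix.col (hat_\<Phi> n \<omega>) j - Matrix.col (Phi0 (S n)) j))
        (\<lambda>n. real (sparsity (S n)) powr (\<kappa> + 1 / 2) * base_rate n (S n)) \<and>
      bounded_in_prob (\<lambda>n. pspace (S n))
        (\<lambda>n \<omega>. MAX j\<in>{..<dimX (S n) + dimY (S n)}.
           vec_l2 (Matrix.col (hat_\<Phi> n \<omega>) j - Matrix.col (Phi0 (S n)) j))
        (\<lambda>n. real (sparsity (S n)) powr \<kappa> * base_rate n (S n))"
proof -
  define t where "t = min 8 (\<epsilon>\<^sub>0 / (20 * max 1 M * (4 * K)\<^sup>2))"
  define A where "A = max 1 (max (20 * (4 * K)\<^sup>2 * (3 * (max 1 M)\<^sup>2 / \<epsilon>\<^sub>0 + max 1 M)\<^sup>2) (768 * (4 * K)\<^sup>2 / t))"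
  define L where "L = 3 * (max 1 M)\<^sup>2 / \<epsilon>\<^sub>0 + 1 + C\<^sub>T"
  \<comment> \<open>Built from \<open>K\<close>, \<open>M\<close>, \<open>\<epsilon>\<^sub>0\<close>
    and \<open>C\<^sub>T\<close> before the array, the estimators and the probability level are
    introduced.\<close>
  define C where "C = 8 + 4 * (28 * A\<^sup>2 + 32 * A * max 1 M * L)"
  have "0 \<le> A" "0 \<le> max 1 M" "0 \<le> L" unfolding A_def L_def using assms by auto
  then have C0: "0 < C" unfolding C_def by (intro add_pos_nonneg mult_nonneg_nonneg add_nonneg_nonneg) (simp_all add: mult.assoc)
  show ?thesis
  proof (intro exI[of _ C] conjI C0 allI impI)
    fix S :: "nat \<Rightarrow> 'w cca" and hat_\<alpha> hat_\<beta> and B :: "nat \<Rightarrow> nat \<Rightarrow> real" and hat_\<Phi>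
    assume h: "\<forall>n\<ge>1. cca_model K r n (S n)" "\<forall>n\<ge>1. eigengap \<epsilon>\<^sub>0 r (S n)" "\<forall>n\<ge>1. bounded_eigenvalues M (S n)"
      "sparsity_assumption \<kappa> S"
      "(\<lambda>n. real (MAX j\<in>{..<dimX (S n) + dimY (S n)}. vec_l0 (eta0 (S n) j))) \<in> O(\<lambda>n. real (sparsity (S n)))"
      "preliminary_estimators \<kappa> S hat_\<alpha> hat_\<beta>"
      "\<forall>n\<ge>1. \<forall>j<dimX (S n) + dimY (S n). B n j > 0 \<and> vec_l1 (eta0 (S n) j) \<le> B n j \<and> B n j \<le> C\<^sub>T * sqrt (real (sparsity (S n)))"
      "\<forall>n\<ge>1. \<forall>\<omega>\<in>space (pspace (S n)). nodewise_lasso_output (plugin_H n (S n) \<omega> (hat_\<alpha> n \<omega>) (hat_\<beta> n \<omega>))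
           (\<lambda>j. C * base_rate n (S n)) (B n) (hat_\<Phi> n \<omega>)"
    have key: "\<exists>c>0. \<forall>\<^sub>F n in sequentially. 1 \<le> n \<and> dimX (S n) > 0 \<and> (\<exists>X\<in>sets (pspace (S n)). measure (pspace (S n)) X < x \<and>
      (\<forall>\<omega>\<in>space (pspace (S n)) - X. \<forall>j<dimX (S n) + dimY (S n).
        vec_l2 (Matrix.col (hat_\<Phi> n \<omega>) j - Matrix.col (Phi0 (S n)) j) \<le> c * (real (sparsity (S n)) powr \<kappa> * base_rate n (S n)) \<and>
        vec_l1 (Matrix.col (hat_\<Phi> n \<omega>) j - Matrix.col (Phi0 (S n)) j) \<le> c * (real (sparsity (S n)) powr (\<kappa> + 1 / 2) * base_rate n (S n))))"
      if "0 < x" for x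
      using uniform_column_bound[OF assms(1-6,8) t_def A_def L_def C_def h(1-3)[rule_format] h(4,5,6) conjunct2[OF h(7)[rule_format]] h(8)[rule_format] that]
      by blast
    have nn: "0 \<le> vec_l1 v" "0 \<le> vec_l2 v" for v
      unfolding vec_l1_fun vec_l2_fun by (rule seminorm.nonneg[OF seminorm_n1] seminorm.nonneg[OF seminorm_n2])+
    show "bounded_in_prob (\<lambda>n. pspace (S n))
        (\<lambda>n \<omega>. MAX j\<in>{..<dimX (S n) + dimY (S n)}. vec_l1 (Matrix.col (hat_\<Phi> n \<omega>) j - Matrix.col (Phi0 (S n)) j))
        (\<lambda>n. real (sparsity (S n)) powr (\<kappa> + 1 / 2) * base_rate n (S n))"
    proof (rule bounded_in_prob_Max)
      fix x :: real assume "0 < x"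
      show "\<exists>c>0. \<forall>\<^sub>F n in sequentially. 0 < dimX (S n) + dimY (S n) \<and> (\<exists>X\<in>sets (pspace (S n)). measure (pspace (S n)) X < x \<and>
        (\<forall>\<omega>\<in>space (pspace (S n)) - X. \<forall>j<dimX (S n) + dimY (S n).
          0 \<le> vec_l1 (Matrix.col (hat_\<Phi> n \<omega>) j - Matrix.col (Phi0 (S n)) j) \<and>
          vec_l1 (Matrix.col (hat_\<Phi> n \<omega>) j - Matrix.col (Phi0 (S n)) j) \<le> c * (real (sparsity (S n)) powr (\<kappa> + 1 / 2) * base_rate n (S n))))"
        by (rule ex_forward[OF key[OF \<open>0 < x\<close>]], erule conj_forward, assumption, erule eventually_mono) (fastforce simp: nn)
    qed
    show "bounded_in_prob (\<lambda>n. pspace (S n))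
        (\<lambda>n \<omega>. MAX j\<in>{..<dimX (S n) + dimY (S n)}. vec_l2 (Matrix.col (hat_\<Phi> n \<omega>) j - Matrix.col (Phi0 (S n)) j))
        (\<lambda>n. real (sparsity (S n)) powr \<kappa> * base_rate n (S n))"
    proof (rule bounded_in_prob_Max)
      fix x :: real assume "0 < x"
      show "\<exists>c>0. \<forall>\<^sub>F n in sequentially. 0 < dimX (S n) + dimY (S n) \<and> (\<exists>X\<in>sets (pspace (S n)). measure (pspace (S n)) X < x \<and>
        (\<forall>\<omega>\<in>space (pspace (S n)) - X. \<forall>j<dimX (S n) + dimY (S n).
          0 \<le> vec_l2 (Matrix.col (hat_\<Phi> n \<omega>) j - Matrix.col (Phi0 (S n)) j) \<and>
          vec_l2 (Matrix.col (hat_\<Phi> n \<omega>) j - Matrix.col (Phi0 (S n)) j) \<le> c * (real (sparsity (S n)) powr \<kappa> * base_rate n (S n))))"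
        by (rule ex_forward[OF key[OF \<open>0 < x\<close>]], erule conj_forward, assumption, erule eventually_mono) (fastforce simp: nn)
    qed
  qed
qed

end
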